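(* For every integer $d\ge1$ and every $\mathcal{C}_1,\dots,\mathcal{C}_d\in\mathscr{C}$, as $E\to\infty$, $$\big(\widetilde\phi_E(\mathcal{C}_1),\dots,\widetilde\phi_E(\mathcal{C}_d)\big)\xrightarrow{d}\mathcal{N}_d(0,\Sigma),$$ where $\Sigma=\{\Sigma(i,j):i,j=1,\dots,d\}$ is the $d\times d$ matrix defined by $\Sigma(i,j):=\lambda(\mathcal{C}_i,\mathcal{C}_j)$.
   Context: For $E>0$, $B_E=\{B_E(x):x\in\mathbb{R}^2\}$ (Berry's random plane wave) is the centered smooth Gaussian field on $\mathbb{R}^2$ with covariance $\mathbb{E}[B_E(x)B_E(y)]=J_0(2\pi\sqrt E\,\|x-y\|)$, $J_0$ being the Bessel function of the first kind of order $0$. An oriented segment $S$ is the image of a map $\gamma:[0,L]\to\mathbb{R}^2$, $\gamma(t)=p+t(\cos\theta,\sin\theta)$, with $L>0$ (its length), $p\in\mathbb{R}^2$, $\theta\in[0,2\pi)$; its unit normal is $\mathrm{n}_S=(-\sin\theta,\cos\theta)$. A (simple) polygonal chain is an ordered collection $\mathcal{C}=(S_1,\dots,S_m)$ of oriented segments, with parametrizations $\gamma_k$ on $[0,L_k]$, such that $\gamma_k(L_k)=\gamma_{k+1}(0)$ for $k=1,\dots,m-1$ and $\bigcup_k S_k$ defines a simple curve in $\mathbb{R}^2$ (closed if $\gamma_m(L_m)=\gamma_1(0)$). $\mathscr{C}$ is the class of all polygonal chains. For $x$ in the relative interior of $S_k$, $\mathrm{n}_{\mathcal{C}}(x):=\mathrm{n}_{S_k}$,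 and $\mathrm{n}_{\mathcal{C}}(x):=0$ at the remaining finitely many points. The signed length for two oriented segments is $\lambda(S_1,S_2):=\mathrm{length}(S_1\cap S_2)\,\langle \mathrm{n}_{S_1},\mathrm{n}_{S_2}\rangle$, and for chains $\mathcal{A}=(T_1,\dots,T_n)$, $\mathcal{C}=(S_1,\dots,S_m)$, $\lambda(\mathcal{A},\mathcal{C}):=\sum_{i=1}^n\sum_{k=1}^m\lambda(T_i,S_k)$. For $\mathcal{C}\in\mathscr{C}$ and $E>0$, $$\phi_E(\mathcal{C}):=\frac{1}{8\pi\sqrt{2E}}\int_{\mathcal{C}}B_E(x)\langle\nabla B_E(x),\mathrm{n}_{\mathcal{C}}(x)\rangle\,\mathcal{H}^1(dx),\qquad \widetilde\phi_E(\mathcal{C}):=4\pi E^{1/4}\phi_E(\mathcal{C}),$$ with $\mathcal{H}^1$ the one-dimensional Hausdorff measure. $\xrightarrow{d}$ denotes convergence in distribution and $\mathcal{N}_d(0,\Sigma)$ the centered $d$-dimensional Gaussian law with covariance $\Sigma$. *)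

theory Defs
  imports "HOL-Probability.Probability"
begin

section \<open>One-dimensional Hausdorff measure\<close>

text \<open>
  The library's \<^const>\<open>diameter\<close> is a supremum of real numbers and carries no information
  for unbounded sets, so covering sets are required to be bounded.
\<close>

definition hausdorff1_pre :: "real \<Rightarrow> 'a::metric_space set \<Rightarrow> ennreal" where
  "hausdorff1_pre \<delta> A =
     (INF U \<in> {U :: nat \<Rightarrow> 'a set.
                A \<subseteq> (\<Union>i. U i) \<and> (\<forall>i. bounded (U i) \<and> diameter (U i) \<le> \<delta>)}.
        \<Sum>i. ennreal (diameter (U i)))"

definition hausdorff1_outer :: "'a::metric_space set \<Rightarrow> ennreal" where
  "hausdorff1_outer A = (SUP \<delta> \<in> {0<..}. hausdorff1_pre \<delta> A)"

text \<open>
  \<^const>\<open>measure_of\<close> yields the null measure for set functions that are not countably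
  additive. That does not happen here: \<^const>\<open>hausdorff1_outer\<close> is a metric outer
  measure, hence countably additive on Borel sets by Caratheodory's criterion. No normalising
  factor is needed in dimension one: a segment has measure equal to its length.
\<close>

definition hausdorff1 :: "'a::metric_space measure" where
  "hausdorff1 = measure_of UNIV (sets borel) hausdorff1_outer"


section \<open>Smooth functions and gradients\<close>

primrec Ck :: "nat \<Rightarrow> ('a::euclidean_space \<Rightarrow> real) \<Rightarrow> bool" where
  "Ck 0 f \<longleftrightarrow> continuous_on UNIV f"
| "Ck (Suc k) f \<longleftrightarrow>
     (\<forall>x. f differentiable (at x)) \<and> (\<forall>v. Ck k (\<lambda>x. frechet_derivative f (at x) v))"

definition smooth :: "('a::euclidean_space \<Rightarrow> real) \<Rightarrow> bool" where
  "smooth f \<longleftrightarrow> (\<forall>k. Ck k f)"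

definition gradient :: "('a::euclidean_space \<Rightarrow> real) \<Rightarrow> 'a \<Rightarrow> 'a" where
  "gradient f x = (THE D. GDERIV f x :> D)"


section \<open>Oriented segments and polygonal chains\<close>

text \<open>
  A segment is represented by the data of its parametrization
  \<open>\<gamma>(t) = p + t (cos \<theta>, sin \<theta>)\<close>, \<open>0 \<le> t \<le> L\<close>.
\<close>

record oriented_segment =
  seg_start :: "real^2"
  seg_length :: real
  seg_angle :: real

definition oriented_segment :: "oriented_segment \<Rightarrow> bool" where
  "oriented_segment S \<longleftrightarrow> seg_length S > 0 \<and> 0 \<le> seg_angle S \<and> seg_angle S < 2 * pi"

definition seg_param :: "oriented_segment \<Rightarrow> real \<Rightarrow> real^2" where
  "seg_param S t = seg_start S + t *\<^sub>R vector [cos (seg_angle S), sin (seg_angle S)]"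

definition seg_image :: "oriented_segment \<Rightarrow> (real^2) set" where
  "seg_image S = seg_param S ` {0..seg_length S}"

definition seg_normal :: "oriented_segment \<Rightarrow> real^2" where
  "seg_normal S = vector [- sin (seg_angle S), cos (seg_angle S)]"

type_synonym chain = "oriented_segment list"

definition chain_image :: "chain \<Rightarrow> (real^2) set" where
  "chain_image C = (\<Union>S\<in>set C. seg_image S)"

text \<open>
  The concatenation of the segments, each rescaled to the unit interval, as a library path.
  The value for the empty list is irrelevant.
\<close>

fun chain_path :: "chain \<Rightarrow> real \<Rightarrow> real^2" where
  "chain_path [] = (\<lambda>_. 0)"
| "chain_path [S] = (\<lambda>t. seg_param S (t * seg_length S))"
| "chain_path (S # T # C) = (\<lambda>t. seg_param S (t * seg_length S)) +++ chain_path (T # C)"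

text \<open>
  \<^const>\<open>simple_path\<close> requires injectivity on the unit interval, except that the
  two endpoints may coincide; thus both open and closed chains are included.
\<close>

definition polygonal_chain :: "chain \<Rightarrow> bool" where
  "polygonal_chain C \<longleftrightarrow>
     C \<noteq> [] \<and> (\<forall>S\<in>set C. oriented_segment S) \<and>
     (\<forall>k. Suc k < length C \<longrightarrow>
        seg_param (C ! k) (seg_length (C ! k)) = seg_param (C ! Suc k) 0) \<and>
     simple_path (chain_path C)"

text \<open>
  The relative interiors of distinct segments of a polygonal chain are disjoint, so the
  segment chosen by the description operator is unique.
\<close>

definition chain_normal :: "chain \<Rightarrow> real^2 \<Rightarrow> real^2" where
  "chain_normal C x =
     (if \<exists>S\<in>set C. x \<in> rel_interior (seg_image S)
      then seg_normal (THE S. S \<in> set C \<and> x \<in> rel_interior (seg_image S))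
      else 0)"

definition seg_signed_length :: "oriented_segment \<Rightarrow> oriented_segment \<Rightarrow> real" where
  "seg_signed_length S T =
     measure hausdorff1 (seg_image S \<inter> seg_image T) * (seg_normal S \<bullet> seg_normal T)"

definition signed_length :: "chain \<Rightarrow> chain \<Rightarrow> real" where
  "signed_length A C = (\<Sum>T\<leftarrow>A. \<Sum>S\<leftarrow>C. seg_signed_length T S)"


section \<open>Gaussian families and convergence in distribution\<close>

text \<open>Normal laws on the line, point masses included.\<close>

definition normal_law :: "real measure \<Rightarrow> bool" where
  "normal_law N \<longleftrightarrow>
     (\<exists>m. N = return borel m) \<or>
     (\<exists>m \<sigma>. \<sigma> > 0 \<and> N = density lborel (\<lambda>x. ennreal (normal_density m \<sigma> x)))"

definition gaussian_family :: "'w measure \<Rightarrow> ('i \<Rightarrow> 'w \<Rightarrow> real) \<Rightarrow> bool" where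
  "gaussian_family M X \<longleftrightarrow>
     prob_space M \<and> (\<forall>i. X i \<in> borel_measurable M) \<and>
     (\<forall>I c. finite I \<longrightarrow> normal_law (distr M borel (\<lambda>\<omega>. \<Sum>i\<in>I. c i * X i \<omega>)))"

definition centered_gaussian_family ::
    "'w measure \<Rightarrow> ('i \<Rightarrow> 'w \<Rightarrow> real) \<Rightarrow> ('i \<Rightarrow> 'i \<Rightarrow> real) \<Rightarrow> bool" where
  "centered_gaussian_family M X K \<longleftrightarrow>
     gaussian_family M X \<and>
     (\<forall>i. (\<integral>\<omega>. X i \<omega> \<partial>M) = 0) \<and>
     (\<forall>i j. (\<integral>\<omega>. X i \<omega> * X j \<omega> \<partial>M) = K i j)"

text \<open>
  \<open>N\<close> is the centered Gaussian law with covariance matrix \<open>\<Sigma>\<close> (which may be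
  singular): under \<open>N\<close> the coordinates form a centered Gaussian family with covariance
  \<open>\<Sigma>\<close>.
\<close>

definition centered_gaussian_law :: "real^'d^'d \<Rightarrow> (real^'d) measure \<Rightarrow> bool" where
  "centered_gaussian_law \<Sigma> N \<longleftrightarrow>
     sets N = sets borel \<and>
     centered_gaussian_family N (\<lambda>i x. x $ i) (\<lambda>i j. \<Sigma> $ i $ j)"

text \<open>The random elements \<open>X e\<close> may live on different probability spaces \<open>M e\<close>.\<close>

definition converges_in_distribution ::
    "('e \<Rightarrow> 'w measure) \<Rightarrow> ('e \<Rightarrow> 'w \<Rightarrow> 'b::metric_space) \<Rightarrow> 'b measure \<Rightarrow> 'e filter \<Rightarrow> bool" where
  "converges_in_distribution M X N F \<longleftrightarrow>
     (\<forall>\<^sub>F e in F. prob_space (M e) \<and> X e \<in> borel_measurable (M e)) \<and>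
     prob_space N \<and> sets N = sets borel \<and>
     (\<forall>f :: 'b \<Rightarrow> real. continuous_on UNIV f \<longrightarrow> bounded (range f) \<longrightarrow>
        ((\<lambda>e. \<integral>\<omega>. f (X e \<omega>) \<partial>M e) \<longlongrightarrow> (\<integral>x. f x \<partial>N)) F)"


section \<open>Berry's random plane wave\<close>

definition bessel_J0 :: "real \<Rightarrow> real" where
  "bessel_J0 z = (\<Sum>k. (- 1) ^ k / (fact k)\<^sup>2 * (z / 2) ^ (2 * k))"

definition berry_random_wave :: "real \<Rightarrow> 'w measure \<Rightarrow> (real^2 \<Rightarrow> 'w \<Rightarrow> real) \<Rightarrow> bool" where
  "berry_random_wave E M B \<longleftrightarrow>
     centered_gaussian_family M B (\<lambda>x y. bessel_J0 (2 * pi * sqrt E * norm (x - y))) \<and>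
     (\<forall>\<omega>\<in>space M. smooth (\<lambda>x. B x \<omega>))"

text \<open>The functionals of the random wave, as functions of a sample path \<open>b\<close>.\<close>

definition phi :: "real \<Rightarrow> (real^2 \<Rightarrow> real) \<Rightarrow> chain \<Rightarrow> real" where
  "phi E b C = 1 / (8 * pi * sqrt (2 * E)) *
     (LINT x:chain_image C|hausdorff1. b x * (gradient b x \<bullet> chain_normal C x))"

definition phi_tilde :: "real \<Rightarrow> (real^2 \<Rightarrow> real) \<Rightarrow> chain \<Rightarrow> real" where
  "phi_tilde E b C = 4 * pi * E powr (1/4) * phi E b C"

end

theory Submission
  imports Defs "HOL-Complex_Analysis.Complex_Analysis"
begin

text \<open>
  A linear combination of the functionals is a limit of Riemann sums, and each Riemann sum is a
  quadratic form \<open>\<Sum>\<^sub>p w\<^sub>p X\<^sub>p\<^sup>2\<close> in Gaussian variables with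
  \<open>\<Sum>\<^sub>p w\<^sub>p E X\<^sub>p\<^sup>2 = 0\<close>, because
  \<open>4 b g = (b + g)\<^sup>2 - (b - g)\<^sup>2\<close> for a value \<open>b\<close> and a normal derivative \<open>g\<close> of the wave.
  Gaussian integration by parts turns the derivative of the characteristic function of such a form
  into a quadratic expectation whose variance is the trace of the fourth power of the weighted
  covariance; hence the characteristic function is Gaussian up to the square root of that trace.

  The variance is a double integral of \<open>- (1/2) \<partial>\<^sub>n \<partial>\<^sub>n\<^sub>' J\<^sub>0(k |z|)\<^sup>2\<close>. Tangential derivatives
  integrate to boundary terms of lower order, so transversal segments decorrelate, and on parallel
  segments the normal derivatives may be completed to the Laplacian, which is a multiple of
  \<open>J\<^sub>0\<^sup>2 - J\<^sub>1\<^sup>2\<close>, the derivative of \<open>P(u) = u (J\<^sub>0\<^sup>2 + J\<^sub>1\<^sup>2)\<close>. As \<open>P(u)\<close> tends to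
  \<open>2 / \<pi>\<close>, the limit is the length of the overlap. The fourth trace is bounded segment by segment, where
  the value and the normal derivative of the wave are uncorrelated, and it vanishes in the limit
  because \<open>J\<^sub>0\<close> does. Convergence of characteristic functions gives convergence in distribution.
\<close>

section \<open>Quadratic forms in Gaussian variables\<close>

text \<open>The functionals belong to the second Wiener chaos, but all Gaussian analysis takes place
  on finite quadratic forms: the error bound for the characteristic function survives the limit of
  vanishing mesh at fixed energy, and only afterwards does the energy grow. What has to be
  controlled is thus one trace, in the limit of vanishing mesh.

  The trace is a quartic form in the weights that obeys a Cauchy-Schwarz inequality, so up to a
  constant it splits into the contributions of single segments; correlations between different
  segments never enter the bound. On one segment, with wave number k, the kernel of the normal
  derivatives has row mass of order k, since J1(u)/u is integrable. It occurs twice among the four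
  factors, and the fourth power of the normalisation, of order 1/k^2, compensates it exactly. Of the
  two remaining factors J0, one is bounded by 1 and the other has mean absolute value tending to 0.

  The constant 2/pi must be exact, for it makes the limit the length of the overlap and not a
  multiple of it. It is read off from Gaussian averages of P, which are also integrals over a
  quarter circle.\<close>

lemma has_derivative_quadratic_remainder:
  assumes "bounded_linear f'"
    and "\<And>y. y \<in> S \<Longrightarrow> norm (f y - f x - f' (y - x)) \<le> C * norm (y - x) ^ 2"
  shows "(f has_derivative f') (at x within S)"
  unfolding has_derivative_iff_norm
proof (intro conjI assms)
  have "((\<lambda>y. C * norm (y - x)) \<longlongrightarrow> C * norm (x - x)) (at x within S)"
    by (intro tendsto_intros)
  then have lim: "((\<lambda>y. C * norm (y - x)) \<longlongrightarrow> 0) (at x within S)" by simp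
  show "((\<lambda>y. norm (f y - f x - f' (y - x)) / norm (y - x)) \<longlongrightarrow> 0) (at x within S)"
  proof (rule tendsto_sandwich[OF _ _ tendsto_const lim])
    show "\<forall>\<^sub>F y in at x within S. norm (f y - f x - f' (y - x)) / norm (y - x) \<le> C * norm (y - x)"
      unfolding eventually_at_filter
    proof (intro always_eventually allI impI)
      fix y assume "y \<noteq> x" "y \<in> S"
      then show "norm (f y - f x - f' (y - x)) / norm (y - x) \<le> C * norm (y - x)"
        using assms(2)[of y] by (simp add: divide_simps power2_eq_square mult.assoc)
    qed
  qed auto
qed

text \<open>On \<open>U\<close> all the exponentials have modulus at most 1, so Taylor's formula
  along the segment from \<open>s\<close> to \<open>s'\<close> leaves only the square of
  \<open>A\<close> in the remainder. The set \<open>U\<close> is a parameter because of its two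
  uses: the real line with imaginary \<open>A\<close>, and the closed right half plane with
  nonpositive real \<open>A\<close>.\<close>

lemma exp_linear_remainder:
  fixes A :: complex
  assumes "convex U" "\<And>s. s \<in> U \<Longrightarrow> Re (s * A) \<le> 0" "s \<in> U" "s' \<in> U"
  shows "norm (exp (s' * A) - exp (s * A) - (s' - s) * (A * exp (s * A))) \<le> norm A ^ 2 * norm (s' - s) ^ 2"
proof -
  have "cmod ((\<lambda>i z. A ^ i * exp (z * A)) 0 s' - (\<Sum>i\<le>1. (\<lambda>i z. A ^ i * exp (z * A)) i s * (s' - s) ^ i / fact i))
    \<le> norm A ^ 2 * norm (s' - s) ^ Suc 1 / fact 1"
  proof (rule complex_Taylor[OF assms(1)])
    fix i x assume "x \<in> U"
    show "((\<lambda>z. A ^ i * exp (z * A)) has_field_derivative A ^ Suc i * exp (x * A)) (at x within U)"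
      by (auto intro!: derivative_eq_intros)
  next
    fix x assume "x \<in> U"
    then have "norm (exp (x * A)) \<le> 1" using assms(2)[of x] by (simp del: times_complex.sel)
    then show "norm (A ^ Suc 1 * exp (x * A)) \<le> (norm A)\<^sup>2"
      by (simp add: norm_mult power2_eq_square mult_left_le)
  qed (use assms in auto)
  then show ?thesis by (simp add: algebra_simps power2_eq_square numeral_2_eq_2)
qed

text \<open>The remainder is quadratic in \<open>s' - s\<close> with a second moment as constant.
  Exponential moments do not occur, because the exponentials are bounded on
  \<open>U\<close>.\<close>

lemma expectation_exp_remainder:
  fixes A W :: "'w \<Rightarrow> complex"
  assumes U: "convex U" "\<And>s \<omega>. s \<in> U \<Longrightarrow> Re (s * A \<omega>) \<le> 0" "s \<in> U" "s' \<in> U"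
    and [measurable]: "A \<in> borel_measurable M" "W \<in> borel_measurable M"
    and int: "integrable M W" "integrable M (\<lambda>\<omega>. A \<omega> * W \<omega>)" "integrable M (\<lambda>\<omega>. (A \<omega>)^2 * W \<omega>)"
  defines "f \<equiv> \<lambda>s. \<integral>\<omega>. W \<omega> * exp (s * A \<omega>) \<partial>M"
  shows "norm (f s' - f s - (s' - s) * (\<integral>\<omega>. A \<omega> * W \<omega> * exp (s * A \<omega>) \<partial>M))
     \<le> (\<integral>\<omega>. norm ((A \<omega>)^2 * W \<omega>) \<partial>M) * norm (s' - s) ^ 2"
proof -
  have bd: "norm (exp (s * A \<omega>)) \<le> 1" if "s \<in> U" for s \<omega>
    using U(2)[OF that, of \<omega>] by (simp del: times_complex.sel)
  have i1: "integrable M (\<lambda>\<omega>. V \<omega> * exp (s * A \<omega>))" if "s \<in> U" "integrable M V" for s V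
    by (rule Bochner_Integration.integrable_bound[OF that(2)])
       (use that bd[OF that(1)] in \<open>auto simp: norm_mult mult_left_le\<close>)
  have eq: "f s' - f s - (s' - s) * (\<integral>\<omega>. A \<omega> * W \<omega> * exp (s * A \<omega>) \<partial>M)
     = (\<integral>\<omega>. W \<omega> * (exp (s' * A \<omega>) - exp (s * A \<omega>) - (s' - s) * (A \<omega> * exp (s * A \<omega>))) \<partial>M)"
    unfolding f_def
    using i1[OF U(3) int(1)] i1[OF U(4) int(1)] i1[OF U(3) int(2)]
    by (simp add: algebra_simps)
  have "norm \<dots> \<le> (\<integral>\<omega>. norm ((A \<omega>)^2 * W \<omega>) * norm (s' - s) ^ 2 \<partial>M)"
  proof (rule order_trans[OF integral_norm_bound integral_mono'])
    show "integrable M (\<lambda>\<omega>. norm ((A \<omega>)^2 * W \<omega>) * norm (s' - s) ^ 2)"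
      using int(3) by (intro integrable_mult_left integrable_norm)
    fix \<omega>
    have "norm (exp (s' * A \<omega>) - exp (s * A \<omega>) - (s' - s) * (A \<omega> * exp (s * A \<omega>))) \<le> norm (A \<omega>) ^ 2 * norm (s' - s) ^ 2"
      by (rule exp_linear_remainder[OF U(1) _ U(3,4)]) (use U(2) in auto)
    from mult_left_mono[OF this norm_ge_zero[of "W \<omega>"]]
    show "norm (W \<omega> * (exp (s' * A \<omega>) - exp (s * A \<omega>) - (s' - s) * (A \<omega> * exp (s * A \<omega>)))) \<le> norm ((A \<omega>)^2 * W \<omega>) * norm (s' - s) ^ 2"
      by (simp only: norm_mult norm_power) (simp add: mult_ac)
    show "0 \<le> norm ((A \<omega>)^2 * W \<omega>) * norm (s' - s) ^ 2" by simp
  qed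
  then show ?thesis unfolding eq by simp
qed

lemma expectation_exp_has_field_derivative:
  fixes A W :: "'w \<Rightarrow> complex"
  assumes "convex U" "\<And>s \<omega>. s \<in> U \<Longrightarrow> Re (s * A \<omega>) \<le> 0" "s \<in> U"
    and "A \<in> borel_measurable M" "W \<in> borel_measurable M"
    and "integrable M W" "integrable M (\<lambda>\<omega>. A \<omega> * W \<omega>)" "integrable M (\<lambda>\<omega>. (A \<omega>)^2 * W \<omega>)"
  shows "((\<lambda>s. \<integral>\<omega>. W \<omega> * exp (s * A \<omega>) \<partial>M) has_field_derivative
     (\<integral>\<omega>. A \<omega> * W \<omega> * exp (s * A \<omega>) \<partial>M)) (at s within U)"
  unfolding has_field_derivative_def
  apply (rule has_derivative_quadratic_remainder[where C = "\<integral>\<omega>. norm ((A \<omega>)^2 * W \<omega>) \<partial>M"])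
   apply (rule bounded_linear_mult_right)
  using expectation_exp_remainder[OF assms(1-3) _ assms(4-)] by (auto simp: mult.commute)

lemma expectation_iexp_has_vector_derivative:
  fixes Y :: "'w \<Rightarrow> real" and W :: "'w \<Rightarrow> complex"
  assumes "Y \<in> borel_measurable M" "W \<in> borel_measurable M"
    and "integrable M W" "integrable M (\<lambda>\<omega>. Y \<omega> * W \<omega>)" "integrable M (\<lambda>\<omega>. (Y \<omega>)^2 * W \<omega>)"
  shows "((\<lambda>t. \<integral>\<omega>. W \<omega> * iexp (t * Y \<omega>) \<partial>M) has_vector_derivative
     \<i> * (\<integral>\<omega>. Y \<omega> * W \<omega> * iexp (t * Y \<omega>) \<partial>M)) (at t)"
proof -
  let ?A = "\<lambda>\<omega>. \<i> * Y \<omega>"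
  have *: "exp (complex_of_real t * (\<i> * complex_of_real (Y \<omega>))) = iexp (t * Y \<omega>)" for t \<omega>
    by (simp add: mult_ac)
  have i2: "integrable M (\<lambda>\<omega>. ?A \<omega> * W \<omega>)"
    using integrable_mult_right[OF assms(4), of \<i>] by (simp add: mult_ac)
  have i3: "integrable M (\<lambda>\<omega>. (?A \<omega>)^2 * W \<omega>)"
    using integrable_mult_right[OF assms(5), of "-1"] by (simp add: mult_ac power_mult_distrib)
  \<comment> \<open>The real line is regarded as a convex subset of the complex plane; the complex
    estimate restricted to it gives the derivative in a real variable.\<close>
  have R: "convex (\<real> :: complex set)"
    by (rule convexI) (auto simp: scaleR_conv_of_real intro!: Reals_add Reals_mult)
  have A: "?A \<in> borel_measurable M" using assms(1) by measurable
  have "((\<lambda>t. \<integral>\<omega>. W \<omega> * iexp (t * Y \<omega>) \<partial>M) has_derivative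
     (\<lambda>h. h *\<^sub>R (\<i> * (\<integral>\<omega>. Y \<omega> * W \<omega> * iexp (t * Y \<omega>) \<partial>M)))) (at t within UNIV)"
  proof (rule has_derivative_quadratic_remainder[where C = "\<integral>\<omega>. norm ((?A \<omega>)^2 * W \<omega>) \<partial>M"])
    fix t'
    have "norm ((\<integral>\<omega>. W \<omega> * exp (complex_of_real t' * ?A \<omega>) \<partial>M) - (\<integral>\<omega>. W \<omega> * exp (complex_of_real t * ?A \<omega>) \<partial>M)
       - (complex_of_real t' - t) * (\<integral>\<omega>. ?A \<omega> * W \<omega> * exp (t * ?A \<omega>) \<partial>M))
     \<le> (\<integral>\<omega>. norm ((?A \<omega>)^2 * W \<omega>) \<partial>M) * norm (complex_of_real t' - t) ^ 2"
      by (rule expectation_exp_remainder[OF R _ _ _ A assms(2,3) i2 i3]) (auto elim!: Reals_cases)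
    moreover have "(\<integral>\<omega>. ?A \<omega> * W \<omega> * exp (t * ?A \<omega>) \<partial>M) = \<i> * (\<integral>\<omega>. Y \<omega> * W \<omega> * iexp (t * Y \<omega>) \<partial>M)"
      unfolding * by (simp add: mult.assoc flip: integral_mult_right_zero)
    moreover have "norm (complex_of_real t' - t) = norm (t' - t)"
      by (metis norm_of_real of_real_diff real_norm_def)
    ultimately show "norm ((\<integral>\<omega>. W \<omega> * iexp (t' * Y \<omega>) \<partial>M) - (\<integral>\<omega>. W \<omega> * iexp (t * Y \<omega>) \<partial>M)
       - (t' - t) *\<^sub>R (\<i> * (\<integral>\<omega>. Y \<omega> * W \<omega> * iexp (t * Y \<omega>) \<partial>M)))
       \<le> (\<integral>\<omega>. norm ((?A \<omega>)^2 * W \<omega>) \<partial>M) * norm (t' - t) ^ 2"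
      unfolding * by (simp add: scaleR_conv_of_real)
  qed (rule bounded_linear_scaleR_left)
  then show ?thesis by (simp add: has_vector_derivative_def)
qed

text \<open>All absolute moments are demanded because this class is closed under products, unlike
  integrability to a fixed power. Integrability of polynomials in Gaussian variables then reduces to
  introduction rules.\<close>

definition (in prob_space) has_moments :: "('a \<Rightarrow> real) \<Rightarrow> bool" where
  "has_moments Y \<longleftrightarrow> Y \<in> borel_measurable M \<and> (\<forall>k. integrable M (\<lambda>\<omega>. \<bar>Y \<omega>\<bar> ^ k))"

context prob_space begin

lemma has_moments_measurable: "has_moments Y \<Longrightarrow> Y \<in> borel_measurable M"
  by (simp add: has_moments_def)

lemma has_moments_const: "has_moments (\<lambda>_. c)"
  by (simp add: has_moments_def)

lemma has_moments_mult:
  assumes "has_moments X" "has_moments Y" shows "has_moments (\<lambda>\<omega>. X \<omega> * Y \<omega>)"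
  unfolding has_moments_def
proof (intro conjI allI)
  have [measurable]: "X \<in> borel_measurable M" "Y \<in> borel_measurable M"
    using assms by (auto simp: has_moments_def)
  show "(\<lambda>\<omega>. X \<omega> * Y \<omega>) \<in> borel_measurable M" by measurable
  fix k
  have "integrable M (\<lambda>\<omega>. \<bar>X \<omega>\<bar> ^ (2*k) + \<bar>Y \<omega>\<bar> ^ (2*k))"
    using assms by (auto simp: has_moments_def)
  then show "integrable M (\<lambda>\<omega>. \<bar>X \<omega> * Y \<omega>\<bar> ^ k)"
  proof (rule Bochner_Integration.integrable_bound)
    show "AE \<omega> in M. norm (\<bar>X \<omega> * Y \<omega>\<bar> ^ k) \<le> norm (\<bar>X \<omega>\<bar> ^ (2*k) + \<bar>Y \<omega>\<bar> ^ (2*k))"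
    proof (rule AE_I2)
      fix \<omega>
      let ?a = "\<bar>X \<omega>\<bar> ^ k" and ?b = "\<bar>Y \<omega>\<bar> ^ k"
      have "0 \<le> (?a - ?b)^2" "0 \<le> ?a * ?b" by auto
      then have "?a * ?b \<le> ?a^2 + ?b^2" unfolding power2_diff by linarith
      then show "norm (\<bar>X \<omega> * Y \<omega>\<bar> ^ k) \<le> norm (\<bar>X \<omega>\<bar> ^ (2*k) + \<bar>Y \<omega>\<bar> ^ (2*k))"
        by (simp add: abs_mult power_mult_distrib power_mult mult.commute[of 2])
    qed
  qed measurable
qed

lemma has_moments_add:
  assumes "has_moments X" "has_moments Y" shows "has_moments (\<lambda>\<omega>. X \<omega> + Y \<omega>)"
  unfolding has_moments_def
proof (intro conjI allI)
  have [measurable]: "X \<in> borel_measurable M" "Y \<in> borel_measurable M"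
    using assms by (auto simp: has_moments_def)
  show "(\<lambda>\<omega>. X \<omega> + Y \<omega>) \<in> borel_measurable M" by measurable
  fix k
  have "integrable M (\<lambda>\<omega>. 2^k * (\<bar>X \<omega>\<bar> ^ k + \<bar>Y \<omega>\<bar> ^ k))"
    using assms by (auto simp: has_moments_def)
  then show "integrable M (\<lambda>\<omega>. \<bar>X \<omega> + Y \<omega>\<bar> ^ k)"
  proof (rule Bochner_Integration.integrable_bound)
    show "AE \<omega> in M. norm (\<bar>X \<omega> + Y \<omega>\<bar> ^ k) \<le> norm (2^k * (\<bar>X \<omega>\<bar> ^ k + \<bar>Y \<omega>\<bar> ^ k))"
    proof (rule AE_I2)
      fix \<omega>
      have "\<bar>X \<omega> + Y \<omega>\<bar> \<le> 2 * max \<bar>X \<omega>\<bar> \<bar>Y \<omega>\<bar>" by auto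
      then have "\<bar>X \<omega> + Y \<omega>\<bar> ^ k \<le> (2 * max \<bar>X \<omega>\<bar> \<bar>Y \<omega>\<bar>)^k" by (intro power_mono) auto
      also have "\<dots> \<le> 2^k * (\<bar>X \<omega>\<bar> ^ k + \<bar>Y \<omega>\<bar> ^ k)"
        by (auto simp: power_mult_distrib max_def)
      finally show "norm (\<bar>X \<omega> + Y \<omega>\<bar> ^ k) \<le> norm (2^k * (\<bar>X \<omega>\<bar> ^ k + \<bar>Y \<omega>\<bar> ^ k))" by simp
    qed
  qed measurable
qed

lemma has_moments_power: "has_moments X \<Longrightarrow> has_moments (\<lambda>\<omega>. X \<omega> ^ n)"
  by (induction n) (simp_all add: has_moments_const has_moments_mult)

lemma has_moments_sum: "(\<And>i. i \<in> I \<Longrightarrow> has_moments (X i)) \<Longrightarrow> has_moments (\<lambda>\<omega>. \<Sum>i\<in>I. X i \<omega>)"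
  by (induction I rule: infinite_finite_induct) (simp_all add: has_moments_const has_moments_add)

lemma has_moments_integrable: "has_moments X \<Longrightarrow> integrable M X"
  using integrable_abs_iff[of X M] unfolding has_moments_def by (auto dest: spec[of _ "1::nat"])

lemmas has_moments_intros = has_moments_const has_moments_add has_moments_mult has_moments_power has_moments_sum

lemma has_moments_integrable_of_real: "has_moments X \<Longrightarrow> integrable M (\<lambda>\<omega>. complex_of_real (X \<omega>))"
  using has_moments_integrable by (rule integrable_of_real)

end

text \<open>Gaussianity is encoded by the characteristic functions of finite linear combinations.
  This covers degenerate laws without a case distinction, passes to pointwise limits of the
  variables, and is the form that is differentiated below. That \<open>K\<close> is positive
  semidefinite is a consequence, because a characteristic function is bounded by 1.\<close>

locale gauss_field = prob_space M for M :: "'w measure" +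
  fixes X :: "'i \<Rightarrow> 'w \<Rightarrow> real" and K :: "'i \<Rightarrow> 'i \<Rightarrow> real"
  assumes rv [measurable]: "X i \<in> borel_measurable M"
    and sym: "K i j = K j i"
    and chf: "finite I \<Longrightarrow> (\<integral>\<omega>. iexp (\<Sum>i\<in>I. c i * X i \<omega>) \<partial>M)
       = complex_of_real (exp (- (\<Sum>i\<in>I. \<Sum>j\<in>I. c i * c j * K i j) / 2))"
begin

lemma quadratic_form_nonneg:
  assumes "finite I" shows "0 \<le> (\<Sum>i\<in>I. \<Sum>j\<in>I. c i * c j * K i j)"
proof -
  have "norm (\<integral>\<omega>. iexp (\<Sum>i\<in>I. c i * X i \<omega>) \<partial>M) \<le> (\<integral>\<omega>. norm (iexp (\<Sum>i\<in>I. c i * X i \<omega>)) \<partial>M)"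
    by (rule integral_norm_bound)
  also have "\<dots> = 1" by (simp add: prob_space)
  finally show ?thesis unfolding chf[OF assms] norm_of_real by simp
qed

lemma law:
  assumes "finite I"
  shows "distr M borel (\<lambda>\<omega>. \<Sum>i\<in>I. c i * X i \<omega>) =
    distr std_normal_distribution borel (\<lambda>x. sqrt (\<Sum>i\<in>I. \<Sum>j\<in>I. c i * c j * K i j) * x)"
    (is "?L = ?R")
proof (rule Levy_uniqueness)
  interpret N: real_distribution std_normal_distribution by (rule real_dist_normal_dist)
  let ?q = "\<Sum>i\<in>I. \<Sum>j\<in>I. c i * c j * K i j"
  show "real_distribution ?L" by (rule real_distribution_distr) measurable
  show "real_distribution ?R" by (rule N.real_distribution_distr) measurable
  show "char ?L = char ?R"
  proof
    fix t
    have "char ?L t = (\<integral>\<omega>. iexp (\<Sum>i\<in>I. (t * c i) * X i \<omega>) \<partial>M)"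
      unfolding char_def by (subst integral_distr) (auto simp: sum_distrib_left mult.assoc)
    also have "\<dots> = exp (- (t\<^sup>2 * ?q) / 2)"
      unfolding chf[OF assms] by (simp add: sum_distrib_left power2_eq_square mult_ac)
    also have "t\<^sup>2 * ?q = (t * sqrt ?q)\<^sup>2"
      using quadratic_form_nonneg[OF assms, of c] by (simp add: power_mult_distrib)
    also have "complex_of_real (exp (- (t * sqrt ?q)\<^sup>2 / 2)) = char std_normal_distribution (t * sqrt ?q)"
      by (simp add: char_std_normal_distribution)
    also have "\<dots> = char ?R t"
      unfolding char_def by (subst integral_distr) (auto simp: mult_ac)
    finally show "char ?L t = char ?R t" .
  qed
qed

lemma expectation_linear:
  fixes f :: "real \<Rightarrow> real"
  assumes "finite I" and [measurable]: "f \<in> borel_measurable borel"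
  shows "(\<integral>\<omega>. f (\<Sum>i\<in>I. c i * X i \<omega>) \<partial>M) =
    (\<integral>x. f (sqrt (\<Sum>i\<in>I. \<Sum>j\<in>I. c i * c j * K i j) * x) \<partial>std_normal_distribution)"
proof -
  have "(\<integral>\<omega>. f (\<Sum>i\<in>I. c i * X i \<omega>) \<partial>M) = (\<integral>x. f x \<partial>distr M borel (\<lambda>\<omega>. \<Sum>i\<in>I. c i * X i \<omega>))"
    by (subst integral_distr) auto
  then show ?thesis unfolding law[OF assms(1)] by (subst (asm) integral_distr) auto
qed

lemma has_moments_X: "has_moments (X i)"
  unfolding has_moments_def
proof (intro conjI allI)
  fix k
  have "integrable std_normal_distribution (\<lambda>x. \<bar>sqrt (K i i) * x\<bar> ^ k)"
    using integrable_norm[OF integrable_std_normal_distribution_moment[of k]]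
    by (auto simp: abs_mult power_mult_distrib power_abs)
  then have "integrable (distr std_normal_distribution borel (\<lambda>x. sqrt (K i i) * x)) (\<lambda>x. \<bar>x\<bar> ^ k)"
    by (subst integrable_distr_eq) auto
  also have "distr std_normal_distribution borel (\<lambda>x. sqrt (K i i) * x) = distr M borel (X i)"
    using law[of "{i}" "\<lambda>_. 1"] by simp
  finally show "integrable M (\<lambda>\<omega>. \<bar>X i \<omega>\<bar> ^ k)"
    by (subst (asm) integrable_distr_eq) auto
qed (rule rv)

lemma fourth_moment_linear:
  assumes "finite I"
  shows "(\<integral>\<omega>. (\<Sum>i\<in>I. c i * X i \<omega>) ^ 4 \<partial>M) = 3 * (\<Sum>i\<in>I. \<Sum>j\<in>I. c i * c j * K i j)\<^sup>2"
proof -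
  let ?q = "\<Sum>i\<in>I. \<Sum>j\<in>I. c i * c j * K i j"
  have "(\<integral>\<omega>. (\<Sum>i\<in>I. c i * X i \<omega>) ^ 4 \<partial>M) = (\<integral>x. (sqrt ?q * x) ^ 4 \<partial>std_normal_distribution)"
    by (rule expectation_linear[OF assms]) measurable
  also have "\<dots> = (sqrt ?q ^ 2)^2 * (\<integral>x. x ^ (2 * 2) \<partial>std_normal_distribution)"
    by (simp add: power_mult_distrib flip: power_mult)
  also have "(\<integral>x. x ^ (2 * 2) \<partial>std_normal_distribution) = 3"
    using std_normal_distribution_even_moments[of 2] by (simp add: has_bochner_integral_integral_eq fact_numeral)
  finally show ?thesis using quadratic_form_nonneg[OF assms, of c] by simp
qed

text \<open>Adding \<open>t\<close> to the coefficient at \<open>a\<close> multiplies the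
  exponential by \<open>iexp (t * X a)\<close>. The expansion in \<open>t\<close> is what a
  derivative of the characteristic function at \<open>t = 0\<close> reads off.\<close>

lemma quadratic_form_perturb:
  assumes "finite I" "a \<in> I"
  shows "(\<Sum>i\<in>I. \<Sum>j\<in>I. (c i + t * indicator {a} i) * (c j + t * indicator {a} j) * K i j)
     = (\<Sum>i\<in>I. \<Sum>j\<in>I. c i * c j * K i j) + 2 * t * (\<Sum>j\<in>I. K a j * c j) + t\<^sup>2 * K a a"
proof -
  have ind: "(\<Sum>i\<in>I. indicator {a} i * f i) = f a" for f :: "'i \<Rightarrow> real"
    using assms by (simp add: indicator_def if_distrib if_distribR sum.delta cong: if_cong)
  have "(\<Sum>i\<in>I. \<Sum>j\<in>I. (c i + t * indicator {a} i) * (c j + t * indicator {a} j) * K i j)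
     = (\<Sum>i\<in>I. \<Sum>j\<in>I. c i * c j * K i j) + t * (\<Sum>i\<in>I. c i * (\<Sum>j\<in>I. indicator {a} j * K i j))
       + t * (\<Sum>i\<in>I. indicator {a} i * (\<Sum>j\<in>I. c j * K i j))
       + t\<^sup>2 * (\<Sum>i\<in>I. indicator {a} i * (\<Sum>j\<in>I. indicator {a} j * K i j))"
    by (simp add: algebra_simps sum.distrib sum_distrib_left power2_eq_square)
  also have "(\<Sum>i\<in>I. c i * (\<Sum>j\<in>I. indicator {a} j * K i j)) = (\<Sum>j\<in>I. K a j * c j)"
    unfolding ind by (simp add: sym[of _ a] mult.commute)
  finally show ?thesis unfolding ind by (simp add: mult.commute algebra_simps)
qed

lemma linear_perturb:
  assumes "finite I" "a \<in> I"
  shows "(\<Sum>i\<in>I. (c i + t * indicator {a} i) * x i) = (\<Sum>i\<in>I. c i * x i) + t * (x a :: real)"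
proof -
  have "(\<Sum>i\<in>I. indicator {a} i * x i) = x a"
    using assms by (simp add: indicator_def if_distrib if_distribR sum.delta cong: if_cong)
  then show ?thesis
    by (simp add: algebra_simps sum.distrib flip: sum_distrib_left)
qed

lemma integrable_mult_bounded:
  assumes "integrable M f" "g \<in> borel_measurable M" "\<And>\<omega>. norm (g \<omega>) \<le> 1"
  shows "integrable M (\<lambda>\<omega>. f \<omega> * g \<omega> :: complex)"
  by (rule Bochner_Integration.integrable_bound[OF assms(1)])
     (use assms in \<open>auto simp: norm_mult mult_left_le\<close>)

text \<open>Two expressions for one derivative at \<open>t = 0\<close> are compared: differentiation
  under the expectation, and differentiation of the explicit Gaussian formula after a shift of the
  coefficient at \<open>a\<close>. The next lemma repeats this in a second direction.\<close>

lemma expectation_X_iexp: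
  assumes I: "finite I" "a \<in> I"
  shows "(\<integral>\<omega>. X a \<omega> * iexp (\<Sum>i\<in>I. c i * X i \<omega>) \<partial>M) =
    \<i> * (\<Sum>j\<in>I. K a j * c j) * exp (- (\<Sum>i\<in>I. \<Sum>j\<in>I. c i * c j * K i j) / 2)"
proof -
  let ?q = "\<Sum>i\<in>I. \<Sum>j\<in>I. c i * c j * K i j" and ?l = "\<Sum>j\<in>I. K a j * c j"
  let ?W = "\<lambda>\<omega>. iexp (\<Sum>i\<in>I. c i * X i \<omega>)"
  have A: "((\<lambda>t. \<integral>\<omega>. ?W \<omega> * iexp (t * X a \<omega>) \<partial>M) has_vector_derivative
     \<i> * (\<integral>\<omega>. X a \<omega> * ?W \<omega> * iexp (0 * X a \<omega>) \<partial>M)) (at 0)"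
  proof (rule expectation_iexp_has_vector_derivative)
    show "integrable M ?W" by (rule integrable_iexp) auto
    show "integrable M (\<lambda>\<omega>. X a \<omega> * ?W \<omega>)"
      by (intro integrable_mult_bounded has_moments_integrable_of_real has_moments_X) auto
    have "integrable M (\<lambda>\<omega>. complex_of_real (X a \<omega> ^ 2) * ?W \<omega>)"
      by (intro integrable_mult_bounded has_moments_integrable_of_real has_moments_power has_moments_X) auto
    then show "integrable M (\<lambda>\<omega>. (X a \<omega>)^2 * ?W \<omega>)" by simp
  qed measurable
  have B: "(\<integral>\<omega>. ?W \<omega> * iexp (t * X a \<omega>) \<partial>M) = complex_of_real (exp (- (?q + 2 * t * ?l + t\<^sup>2 * K a a) / 2))" for t
    using chf[OF I(1), of "\<lambda>i. c i + t * indicator {a} i"]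
    unfolding quadratic_form_perturb[OF I] linear_perturb[OF I]
    by (simp add: distrib_left exp_add)
  have C: "((\<lambda>t. complex_of_real (exp (- (?q + 2 * t * ?l + t\<^sup>2 * K a a) / 2))) has_vector_derivative
      complex_of_real (- ?l * exp (- ?q / 2))) (at 0)"
    by (rule has_vector_derivative_of_real) (auto intro!: derivative_eq_intros)
  have "\<i> * (\<integral>\<omega>. X a \<omega> * ?W \<omega> * iexp (0 * X a \<omega>) \<partial>M) = complex_of_real (- ?l * exp (- ?q / 2))"
    by (rule vector_derivative_unique_at[OF A[unfolded B] C])
  then have E: "\<i> * (\<integral>\<omega>. X a \<omega> * ?W \<omega> \<partial>M) = complex_of_real (- ?l * exp (- ?q / 2))"
    by simp
  have "(\<integral>\<omega>. X a \<omega> * ?W \<omega> \<partial>M) = - (\<i> * (\<i> * (\<integral>\<omega>. X a \<omega> * ?W \<omega> \<partial>M)))"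
    by (simp only: complex_i_mult_minus minus_minus)
  then show ?thesis unfolding E by (simp only: of_real_mult of_real_minus mult_minus_left mult_minus_right minus_minus mult.assoc)
qed

lemma expectation_XX_iexp:
  assumes I: "finite I" "a \<in> I" "b \<in> I"
  shows "(\<integral>\<omega>. X a \<omega> * X b \<omega> * iexp (\<Sum>i\<in>I. c i * X i \<omega>) \<partial>M) =
    (K a b - (\<Sum>j\<in>I. K a j * c j) * (\<Sum>j\<in>I. K b j * c j)) * exp (- (\<Sum>i\<in>I. \<Sum>j\<in>I. c i * c j * K i j) / 2)"
proof -
  let ?q = "\<Sum>i\<in>I. \<Sum>j\<in>I. c i * c j * K i j" and ?l = "\<lambda>a. \<Sum>j\<in>I. K a j * c j"
  let ?W = "\<lambda>\<omega>. X a \<omega> * iexp (\<Sum>i\<in>I. c i * X i \<omega>)"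
  have m: "integrable M (\<lambda>\<omega>. complex_of_real (X b \<omega> ^ n * X a \<omega>) * iexp (\<Sum>i\<in>I. c i * X i \<omega>))" for n
    by (intro integrable_mult_bounded has_moments_integrable_of_real has_moments_power has_moments_mult has_moments_X) auto
  have A: "((\<lambda>t. \<integral>\<omega>. ?W \<omega> * iexp (t * X b \<omega>) \<partial>M) has_vector_derivative
     \<i> * (\<integral>\<omega>. X b \<omega> * ?W \<omega> * iexp (0 * X b \<omega>) \<partial>M)) (at 0)"
    by (rule expectation_iexp_has_vector_derivative) (use m[of 0] m[of 1] m[of 2] in \<open>auto simp: mult.assoc\<close>)
  have B: "(\<integral>\<omega>. ?W \<omega> * iexp (t * X b \<omega>) \<partial>M) =
    \<i> * complex_of_real ((?l a + t * K a b) * exp (- (?q + 2 * t * ?l b + t\<^sup>2 * K b b) / 2))" for t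
  proof -
    have "(\<Sum>i\<in>I. K a i * (c i + t * indicator {b} i)) = ?l a + t * K a b"
      using linear_perturb[OF I(1,3), of c t "K a"] by (simp add: mult.commute)
    then show ?thesis
      using expectation_X_iexp[OF I(1,2), of "\<lambda>i. c i + t * indicator {b} i"]
      unfolding quadratic_form_perturb[OF I(1,3)] linear_perturb[OF I(1,3)]
      by (simp add: distrib_left exp_add mult.assoc)
  qed
  have C: "((\<lambda>t. \<i> * complex_of_real ((?l a + t * K a b) * exp (- (?q + 2 * t * ?l b + t\<^sup>2 * K b b) / 2))) has_vector_derivative
      \<i> * complex_of_real ((K a b - ?l a * ?l b) * exp (- ?q / 2))) (at 0)"
    apply (rule has_vector_derivative_mult_right)
    apply (rule has_vector_derivative_of_real)
    apply (auto intro!: derivative_eq_intros simp: algebra_simps)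
    done
  have "\<i> * (\<integral>\<omega>. X b \<omega> * ?W \<omega> * iexp (0 * X b \<omega>) \<partial>M) = \<i> * complex_of_real ((K a b - ?l a * ?l b) * exp (- ?q / 2))"
    by (rule vector_derivative_unique_at[OF A[unfolded B] C])
  then have *: "(\<integral>\<omega>. X b \<omega> * ?W \<omega> * iexp (0 * X b \<omega>) \<partial>M) = complex_of_real ((K a b - ?l a * ?l b) * exp (- ?q / 2))"
    by (simp only: mult_left_cancel[OF complex_i_not_zero])
  have "(\<lambda>\<omega>. X b \<omega> * ?W \<omega> * iexp (0 * X b \<omega>)) = (\<lambda>\<omega>. complex_of_real (X a \<omega> * X b \<omega>) * iexp (\<Sum>i\<in>I. c i * X i \<omega>))"
    by (intro ext) (simp add: mult.assoc mult.left_commute[of "complex_of_real (X b _)"])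
  with * show ?thesis by simp
qed

end

definition (in prob_space) complex_moments :: "('a \<Rightarrow> complex) \<Rightarrow> bool" where
  "complex_moments Z \<longleftrightarrow> has_moments (\<lambda>\<omega>. Re (Z \<omega>)) \<and> has_moments (\<lambda>\<omega>. Im (Z \<omega>))"

context prob_space begin

lemma complex_moments_of_real: "has_moments X \<Longrightarrow> complex_moments (\<lambda>\<omega>. complex_of_real (X \<omega>))"
  by (simp add: complex_moments_def has_moments_const)

lemma complex_moments_const: "complex_moments (\<lambda>_. c)"
  by (simp add: complex_moments_def has_moments_const)

lemma complex_moments_add:
  "complex_moments X \<Longrightarrow> complex_moments Y \<Longrightarrow> complex_moments (\<lambda>\<omega>. X \<omega> + Y \<omega>)"
  by (simp add: complex_moments_def has_moments_add)

lemma has_moments_diff: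
  "has_moments X \<Longrightarrow> has_moments Y \<Longrightarrow> has_moments (\<lambda>\<omega>. X \<omega> - Y \<omega>)"
  using has_moments_add[OF _ has_moments_mult[OF has_moments_const[of "-1"]], of X Y] by simp

lemma complex_moments_diff:
  "complex_moments X \<Longrightarrow> complex_moments Y \<Longrightarrow> complex_moments (\<lambda>\<omega>. X \<omega> - Y \<omega>)"
  by (simp add: complex_moments_def has_moments_diff)

lemma complex_moments_mult:
  "complex_moments X \<Longrightarrow> complex_moments Y \<Longrightarrow> complex_moments (\<lambda>\<omega>. X \<omega> * Y \<omega>)"
  by (simp add: complex_moments_def has_moments_diff has_moments_add has_moments_mult)

lemma complex_moments_sum:
  "(\<And>i. i \<in> I \<Longrightarrow> complex_moments (X i)) \<Longrightarrow> complex_moments (\<lambda>\<omega>. \<Sum>i\<in>I. X i \<omega>)"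
  by (simp add: complex_moments_def has_moments_sum)

lemma complex_moments_integrable:
  assumes "complex_moments Z" shows "integrable M Z"
proof -
  have "integrable M (\<lambda>\<omega>. complex_of_real (Re (Z \<omega>)) + \<i> * complex_of_real (Im (Z \<omega>)))"
    using assms unfolding complex_moments_def
    by (intro Bochner_Integration.integrable_add integrable_mult_right has_moments_integrable_of_real) auto
  then show ?thesis using complex_eq by (simp flip: complex_eq)
qed

end

text \<open>Over a one-point index set the formulas above become the integrals over the standard
  normal variable that mixes characters into Gaussian weights.\<close>

lemma std_normal_gauss_field:
  "gauss_field std_normal_distribution (\<lambda>_::unit. \<lambda>x. x) (\<lambda>_ _. 1)"
proof -
  interpret N: real_distribution std_normal_distribution by (rule real_dist_normal_dist)
  show ?thesis
  proof
    fix I :: "unit set" and c :: "unit \<Rightarrow> real" assume "finite I"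
    have "I = {} \<or> I = {()}" by auto
    then show "(\<integral>\<omega>. iexp (\<Sum>i\<in>I. c i * \<omega>) \<partial>std_normal_distribution)
      = complex_of_real (exp (- (\<Sum>i\<in>I. \<Sum>j\<in>I. c i * c j * 1) / 2))"
      using fun_cong[OF char_std_normal_distribution, of "c ()"] N.prob_space
      by (auto simp: char_def power2_eq_square)
  qed auto
qed

lemma std_normal_expectation_iexp:
  "(\<integral>x. iexp (t * x) \<partial>std_normal_distribution) = complex_of_real (exp (- t\<^sup>2 / 2))"
  using fun_cong[OF char_std_normal_distribution, of t] by (simp add: char_def)

lemma std_normal_expectation_id_iexp:
  "(\<integral>x. x * iexp (t * x) \<partial>std_normal_distribution) = \<i> * t * complex_of_real (exp (- t\<^sup>2 / 2))"
  using gauss_field.expectation_X_iexp[OF std_normal_gauss_field, of "{()}" "()" "\<lambda>_. t"]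
  by (simp add: power2_eq_square)

section \<open>Gaussian integration by parts under exponentials of squares\<close>

context gauss_field begin

text \<open>Gaussian weights \<open>exp (- s x\<^sup>2 / 2)\<close> with \<open>s > 0\<close> are mixtures of characters, for which
  integration by parts amounts to differentiating the characteristic function; complex \<open>s\<close> follow
  by analytic continuation.\<close>

lemma integration_by_parts_mixture:
  fixes Y V \<Psi> :: "'w \<Rightarrow> complex"
  assumes Y: "complex_moments Y" and V: "complex_moments V"
    and \<Psi>[measurable]: "\<Psi> \<in> borel_measurable M" "\<And>\<omega>. norm (\<Psi> \<omega>) \<le> 1"
    and IH: "\<And>g. (\<integral>\<omega>. (Y \<omega> + g * V \<omega>) * \<Psi> \<omega> * iexp (r * g * X m \<omega>) \<partial>M) = 0"
  shows "(\<integral>\<omega>. (Y \<omega> + \<i> * r * X m \<omega> * V \<omega>) * \<Psi> \<omega> * complex_of_real (exp (- (r * X m \<omega>)\<^sup>2 / 2)) \<partial>M) = 0"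
proof -
  let ?N = "std_normal_distribution"
  interpret N: real_distribution ?N by (rule real_dist_normal_dist)
  interpret P: pair_prob_space M ?N by standard
  have [measurable]: "Y \<in> borel_measurable M" "V \<in> borel_measurable M"
    using Y V complex_moments_integrable by auto
  let ?f = "\<lambda>\<omega> g. (Y \<omega> + complex_of_real g * V \<omega>) * \<Psi> \<omega> * iexp (r * g * X m \<omega>)"
  have gi: "integrable ?N (\<lambda>g. complex_of_real g)" "integrable ?N (\<lambda>g. \<bar>g\<bar>)"
    using integrable_std_normal_distribution_moment[of 1] by (auto intro: integrable_of_real)
  have N1: "integrable ?N (\<lambda>g. iexp (r * g * X m \<omega>))" for \<omega>
    by (rule N.integrable_iexp) auto
  have N2: "integrable ?N (\<lambda>g. complex_of_real g * iexp (r * g * X m \<omega>))" for \<omega>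
    by (rule Bochner_Integration.integrable_bound[OF gi(1)]) (auto simp: norm_mult)
  have int: "integrable (M \<Otimes>\<^sub>M ?N) (\<lambda>(\<omega>, g). ?f \<omega> g)"
  proof (rule Bochner_Integration.integrable_bound)
    show "integrable (M \<Otimes>\<^sub>M ?N) (\<lambda>(\<omega>, g). norm (Y \<omega>) + \<bar>g\<bar> * norm (V \<omega>))"
    proof (rule P.Fubini_integrable)
      show "integrable M (\<lambda>\<omega>. \<integral>g. norm (case (\<omega>, g) of (\<omega>, g) \<Rightarrow> norm (Y \<omega>) + \<bar>g\<bar> * norm (V \<omega>)) \<partial>?N)"
        using gi complex_moments_integrable[OF Y] complex_moments_integrable[OF V]
        by (simp add: N.prob_space[simplified])
      show "AE \<omega> in M. integrable ?N (\<lambda>g. case (\<omega>, g) of (\<omega>, g) \<Rightarrow> norm (Y \<omega>) + \<bar>g\<bar> * norm (V \<omega>))"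
        using gi by (intro AE_I2) auto
    qed measurable
    have *: "norm (Y \<omega> + complex_of_real g * V \<omega>) * (norm (\<Psi> \<omega>) * 1) \<le> (norm (Y \<omega>) + \<bar>g\<bar> * norm (V \<omega>)) * 1" for \<omega> g
      by (rule mult_mono, rule norm_triangle_le) (use \<Psi>(2)[of \<omega>] in \<open>auto simp: norm_mult\<close>)
    show "AE x in M \<Otimes>\<^sub>M ?N. norm (case x of (\<omega>, g) \<Rightarrow> ?f \<omega> g) \<le> norm (case x of (\<omega>, g) \<Rightarrow> norm (Y \<omega>) + \<bar>g\<bar> * norm (V \<omega>))"
      using * by (intro AE_I2) (auto simp: norm_mult split: prod.splits)
  qed measurable
  have "(\<integral>\<omega>. \<integral>g. ?f \<omega> g \<partial>?N \<partial>M) = (\<integral>g. \<integral>\<omega>. ?f \<omega> g \<partial>M \<partial>?N)"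
    using P.Fubini_integral[OF int] by simp
  also have "\<dots> = 0" using IH by simp
  \<comment> \<open>Averaging over \<open>g\<close> replaces the character by the Gaussian weight
    and the factor \<open>g\<close> by i r X(m); so the term of the hypothesis that is linear in
    \<open>g\<close> turns into a term containing \<open>X m\<close>.\<close>
  also have "(\<lambda>\<omega>. \<integral>g. ?f \<omega> g \<partial>?N) = (\<lambda>\<omega>. (Y \<omega> + \<i> * r * X m \<omega> * V \<omega>) * \<Psi> \<omega> * complex_of_real (exp (- (r * X m \<omega>)\<^sup>2 / 2)))"
  proof
    fix \<omega>
    have "(\<integral>g. ?f \<omega> g \<partial>?N) = (\<integral>g. (Y \<omega> * \<Psi> \<omega>) * iexp (r * g * X m \<omega>) + (V \<omega> * \<Psi> \<omega>) * (g * iexp (r * g * X m \<omega>)) \<partial>?N)"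
      by (simp add: algebra_simps)
    also have "\<dots> = (Y \<omega> * \<Psi> \<omega>) * (\<integral>g. iexp (r * g * X m \<omega>) \<partial>?N) + (V \<omega> * \<Psi> \<omega>) * (\<integral>g. g * iexp (r * g * X m \<omega>) \<partial>?N)"
      by (subst Bochner_Integration.integral_add) (use N1 N2 in auto)
    also have "(\<integral>g. iexp (r * g * X m \<omega>) \<partial>?N) = complex_of_real (exp (- (r * X m \<omega>)\<^sup>2 / 2))"
      using std_normal_expectation_iexp[of "r * X m \<omega>"] by (simp add: mult_ac)
    also have "(\<integral>g. g * iexp (r * g * X m \<omega>) \<partial>?N) = \<i> * (r * X m \<omega>) * complex_of_real (exp (- (r * X m \<omega>)\<^sup>2 / 2))"
      using std_normal_expectation_id_iexp[of "r * X m \<omega>"] by (simp add: mult_ac)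
    finally show "(\<integral>g. ?f \<omega> g \<partial>?N) = (Y \<omega> + \<i> * r * X m \<omega> * V \<omega>) * \<Psi> \<omega> * complex_of_real (exp (- (r * X m \<omega>)\<^sup>2 / 2))"
      by (simp add: algebra_simps)
  qed
  finally show ?thesis .
qed

text \<open>The case of interest is \<open>Re z = 0\<close>, where the weight is a character of the
  square of \<open>X m\<close>. Analytic continuation from the positive reals reaches only the open
  half plane. Therefore derivatives are taken within the closed half plane: they give holomorphy
  inside and continuity up to the boundary, which is then approached from the right.\<close>

lemma gaussian_weight_continuation:
  fixes Y V \<Psi> :: "'w \<Rightarrow> complex" and z :: complex
  assumes Y: "complex_moments Y" and V: "complex_moments V"
    and \<Psi>[measurable]: "\<Psi> \<in> borel_measurable M" "\<And>\<omega>. norm (\<Psi> \<omega>) \<le> 1"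
    and real: "\<And>r. r > 0 \<Longrightarrow> (\<integral>\<omega>. (Y \<omega> + r\<^sup>2 * V \<omega>) * \<Psi> \<omega> * complex_of_real (exp (- (r * X m \<omega>)\<^sup>2 / 2)) \<partial>M) = 0"
    and z: "Re z \<ge> 0"
  shows "(\<integral>\<omega>. (Y \<omega> + z * V \<omega>) * \<Psi> \<omega> * exp (- (z * (X m \<omega>)\<^sup>2) / 2) \<partial>M) = 0"
proof -
  let ?A = "\<lambda>\<omega>. complex_of_real (- (X m \<omega>)\<^sup>2 / 2)"
  let ?U = "{z. Re z \<ge> 0}"
  define F where "F W = (\<lambda>s. \<integral>\<omega>. W \<omega> * \<Psi> \<omega> * exp (s * ?A \<omega>) \<partial>M)" for W
  define D where "D = (\<lambda>s. F Y s + s * F V s)"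
  have cA: "complex_moments ?A"
    unfolding divide_inverse mult_minus_left
    by (intro complex_moments_of_real has_moments_diff[where X = "\<lambda>_. 0", simplified] has_moments_mult has_moments_const has_moments_power has_moments_X)
  have [measurable]: "Y \<in> borel_measurable M" "V \<in> borel_measurable M"
    using Y V complex_moments_integrable by auto
  have re: "Re (s * ?A \<omega>) \<le> 0" if "s \<in> ?U" for s \<omega>
    using that by (simp add: mult_nonneg_nonneg)
  have iW: "integrable M (\<lambda>\<omega>. Z \<omega> * \<Psi> \<omega>)" if "complex_moments Z" for Z
    by (intro integrable_mult_bounded complex_moments_integrable that \<Psi>)
  have der: "\<exists>F'. (F W has_field_derivative F') (at s within ?U)" if "complex_moments W" "s \<in> ?U" for W s
  proof -
    have [measurable]: "W \<in> borel_measurable M"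
      using that complex_moments_integrable by auto
    have "((\<lambda>s. \<integral>\<omega>. (W \<omega> * \<Psi> \<omega>) * exp (s * ?A \<omega>) \<partial>M) has_field_derivative
       (\<integral>\<omega>. ?A \<omega> * (W \<omega> * \<Psi> \<omega>) * exp (s * ?A \<omega>) \<partial>M)) (at s within ?U)"
    proof (rule expectation_exp_has_field_derivative)
      show "convex ?U" using convex_halfspace_Re_ge[of 0] by simp
      show "integrable M (\<lambda>\<omega>. ?A \<omega> * (W \<omega> * \<Psi> \<omega>))"
        using iW[OF complex_moments_mult[OF cA that(1)]] by (simp add: mult.assoc)
      show "integrable M (\<lambda>\<omega>. (?A \<omega>)\<^sup>2 * (W \<omega> * \<Psi> \<omega>))"
        using iW[OF complex_moments_mult[OF cA complex_moments_mult[OF cA that(1)]]] by (simp add: mult.assoc power2_eq_square)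
    qed (use that re iW[OF that(1)] in auto)
    then show ?thesis unfolding F_def by blast
  qed
  have "continuous_on ?U (F W)" if "complex_moments W" for W
    unfolding continuous_on_eq_continuous_within
  proof
    fix s assume "s \<in> ?U"
    then obtain F' where "(F W has_field_derivative F') (at s within ?U)" using der[OF \<open>complex_moments W\<close>] by auto
    then show "continuous (at s within ?U) (F W)" by (rule DERIV_continuous)
  qed
  then have cont: "continuous_on ?U D"
    unfolding D_def using Y V by (intro continuous_intros) auto
  have hol: "D holomorphic_on {z. Re z > 0}"
    unfolding D_def
  proof (intro holomorphic_intros)
    have *: "F W holomorphic_on {z. Re z > 0}" if W: "complex_moments W" for W
      unfolding holomorphic_on_def field_differentiable_def
    proof
      fix s assume "s \<in> {z. Re z > 0}"
      then obtain F' where "(F W has_field_derivative F') (at s within ?U)" using der[OF W, of s] by auto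
      then show "\<exists>f'. (F W has_field_derivative f') (at s within {z. 0 < Re z})"
        by (intro exI[of _ F']) (erule DERIV_subset, auto)
    qed
    show "F Y holomorphic_on {z. Re z > 0}" "F V holomorphic_on {z. Re z > 0}" using * Y V by auto
  qed
  have D_eq: "D s = (\<integral>\<omega>. (Y \<omega> + s * V \<omega>) * \<Psi> \<omega> * exp (s * ?A \<omega>) \<partial>M)" if "s \<in> ?U" for s
  proof -
    have ii: "integrable M (\<lambda>\<omega>. Z \<omega> * \<Psi> \<omega> * exp (s * ?A \<omega>))" if "complex_moments Z" for Z
      by (intro integrable_mult_bounded iW that) (use re[OF \<open>s \<in> ?U\<close>] in \<open>auto simp del: times_complex.sel\<close>)
    have "D s = (\<integral>\<omega>. Y \<omega> * \<Psi> \<omega> * exp (s * ?A \<omega>) + s * (V \<omega> * \<Psi> \<omega> * exp (s * ?A \<omega>)) \<partial>M)"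
      unfolding D_def F_def using ii[OF Y] ii[OF V] by simp
    then show ?thesis by (simp add: algebra_simps)
  qed
  have Dreal: "D (complex_of_real x) = 0" if "x > 0" for x
  proof -
    have "exp (complex_of_real x * ?A \<omega>) = complex_of_real (exp (- (sqrt x * X m \<omega>)\<^sup>2 / 2))" for \<omega>
      using that by (simp add: power_mult_distrib exp_of_real[symmetric])
    moreover have "(complex_of_real (sqrt x))\<^sup>2 = complex_of_real x"
      using that by (simp flip: of_real_power)
    ultimately show ?thesis using real[of "sqrt x"] that by (simp add: D_eq)
  qed
  have "D s = 0" if "Re s > 0" for s
  proof (rule analytic_continuation[OF hol])
    show "open {z. 0 < Re z}" by (rule open_halfspace_Re_gt)
    show "connected {z. 0 < Re z}" by (intro convex_connected convex_halfspace_Re_gt)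
    show "complex_of_real ` {0<..} \<subseteq> {z. 0 < Re z}" by auto
    show "1 \<in> {z. 0 < Re z}" by simp
    show "1 islimpt complex_of_real ` {0<..}"
      unfolding islimpt_approachable
    proof (intro allI impI)
      fix e :: real assume "e > 0"
      then have "complex_of_real (1 + e / 2) \<noteq> 1" "dist (complex_of_real (1 + e / 2)) 1 < e"
        by (auto simp: dist_norm norm_divide)
      moreover have "complex_of_real (1 + e / 2) \<in> complex_of_real ` {0<..}"
        by (intro imageI) (use \<open>e > 0\<close> in auto)
      ultimately show "\<exists>x'\<in>complex_of_real ` {0<..}. x' \<noteq> 1 \<and> dist x' 1 < e" by blast
    qed
  qed (use Dreal that in auto)
  have lim: "(\<lambda>n. D (z + of_real (1 / Suc n))) \<longlonglongrightarrow> D z"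
  proof (rule continuous_on_tendsto_compose[OF cont])
    have "(\<lambda>n. z + of_real (1 / Suc n)) \<longlonglongrightarrow> z + of_real 0"
      by (intro tendsto_intros LIMSEQ_Suc[OF lim_1_over_n])
    then show "(\<lambda>n. z + of_real (1 / Suc n)) \<longlonglongrightarrow> z" by simp
  qed (use z in auto)
  have "D (z + of_real (1 / Suc n)) = 0" for n
    using z \<open>\<And>s. Re s > 0 \<Longrightarrow> D s = 0\<close>[of "z + of_real (1 / Suc n)"] by (simp add: add_nonneg_pos)
  with lim have "D z = 0" by (simp only: LIMSEQ_const_iff)
  moreover have "exp (- (z * (X m \<omega>)\<^sup>2) / 2) = exp (z * ?A \<omega>)" for \<omega> by simp
  ultimately show ?thesis using D_eq[of z] z by simp
qed

end

context gauss_field begin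

lemma complex_moments_X: "complex_moments (\<lambda>\<omega>. complex_of_real (X i \<omega>))"
  by (intro complex_moments_of_real has_moments_X)

lemma gaussian_weight_norm_le_1:
  assumes "\<And>k. k \<in> J \<Longrightarrow> Re (s k) \<ge> 0"
  shows "norm (exp (- (\<Sum>k\<in>J. s k * (complex_of_real (x k))\<^sup>2) / 2)) \<le> 1"
  using assms by (auto intro!: sum_nonneg simp flip: of_real_power)

text \<open>This is Stein's identity, E[X(i) G] as the sum over l of K(i,l) E[dG/dX(l)], for
  \<open>G\<close> the product of \<open>X j\<close>, a character and a Gaussian weight. The weights
  are inserted one variable at a time. The coefficients \<open>c\<close> have to stay general in the
  induction, because a new weight at \<open>m\<close> is a mixture over shifts of
  \<open>c m\<close>.\<close>

lemma integration_by_parts: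
  fixes s :: "'i \<Rightarrow> complex"
  assumes I: "finite I" "J \<subseteq> I" "i \<in> I" "\<And>k. k \<in> J \<Longrightarrow> Re (s k) \<ge> 0"
  shows "(\<integral>\<omega>. (X i \<omega> * X j \<omega> - K i j - \<i> * (\<Sum>l\<in>I. K i l * c l) * X j \<omega> + (\<Sum>k\<in>J. s k * K i k * X k \<omega> * X j \<omega>))
      * (iexp (\<Sum>l\<in>I. c l * X l \<omega>) * exp (- (\<Sum>k\<in>J. s k * (X k \<omega>)\<^sup>2) / 2)) \<partial>M) = 0"
    (is "?E J c = 0")
proof -
  have "finite J" using I finite_subset by auto
  then show ?thesis using I(2,4)
  proof (induction J arbitrary: c rule: finite_induct)
    case empty
    \<comment> \<open>The index \<open>j\<close> may lie outside \<open>I\<close>, whereas the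
      formulas for characters need it inside; the index set is enlarged and \<open>c\<close>
      extended by 0.\<close>
    let ?I = "insert j I"
    define c' where "c' = (\<lambda>l. if l \<in> I then c l else 0)"
    have lin: "(\<Sum>l\<in>?I. c' l * x l) = (\<Sum>l\<in>I. c l * x l)" for x :: "'i \<Rightarrow> real"
      using I(1) unfolding c'_def by (cases "j \<in> I") (auto simp: insert_absorb intro!: sum.cong)
    have lin': "(\<Sum>l\<in>?I. K i l * c' l) = (\<Sum>l\<in>I. K i l * c l)"
      using lin[of "K i"] by (simp add: mult.commute)
    have *: "(\<integral>\<omega>. X i \<omega> * X j \<omega> * iexp (\<Sum>l\<in>I. c l * X l \<omega>) \<partial>M) =
      K i j * (\<integral>\<omega>. iexp (\<Sum>l\<in>I. c l * X l \<omega>) \<partial>M) + \<i> * (\<Sum>l\<in>I. K i l * c l) * (\<integral>\<omega>. X j \<omega> * iexp (\<Sum>l\<in>I. c l * X l \<omega>) \<partial>M)"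
      using expectation_XX_iexp[of ?I i j c'] expectation_X_iexp[of ?I j c'] chf[of ?I c'] I
      unfolding lin lin' by (simp add: algebra_simps)
    have int: "integrable M (\<lambda>\<omega>. W \<omega> * iexp (\<Sum>l\<in>I. c l * X l \<omega>))" if "complex_moments W" for W
      by (intro integrable_mult_bounded complex_moments_integrable that) auto
    show ?case
      using * int[of "\<lambda>\<omega>. X i \<omega> * X j \<omega>"] int[of "\<lambda>_. 1"] int[of "\<lambda>\<omega>. X j \<omega>"]
      by (simp add: complex_moments_mult complex_moments_X complex_moments_const ring_distribs mult.assoc)
  next
    case (insert m J)
    let ?\<Psi> = "\<lambda>\<omega>. iexp (\<Sum>l\<in>I. c l * X l \<omega>) * exp (- (\<Sum>k\<in>J. s k * (X k \<omega>)\<^sup>2) / 2)"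
    let ?Y = "\<lambda>c \<omega>. X i \<omega> * X j \<omega> - K i j - \<i> * (\<Sum>l\<in>I. K i l * c l) * X j \<omega> + (\<Sum>k\<in>J. s k * K i k * X k \<omega> * X j \<omega>)"
    have m: "m \<in> I" using insert by auto
    have Y: "complex_moments (?Y c)"
      by (intro complex_moments_add complex_moments_diff complex_moments_mult complex_moments_sum complex_moments_const complex_moments_X
        complex_moments_of_real has_moments_diff has_moments_mult has_moments_const has_moments_X)
    have V: "complex_moments (\<lambda>\<omega>. - \<i> * r * K i m * X j \<omega>)" for r :: real
      by (intro complex_moments_mult complex_moments_const complex_moments_X)
    have V': "complex_moments (\<lambda>\<omega>. complex_of_real (K i m) * X m \<omega> * X j \<omega>)"
      by (intro complex_moments_mult complex_moments_const complex_moments_X)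
    have \<Psi>: "?\<Psi> \<in> borel_measurable M" "norm (?\<Psi> \<omega>) \<le> 1" for \<omega>
    proof -
      have "norm (?\<Psi> \<omega>) = norm (exp (- (\<Sum>k\<in>J. s k * (complex_of_real (X k \<omega>))\<^sup>2) / 2))"
        by (simp add: norm_mult)
      also have "\<dots> \<le> 1" by (rule gaussian_weight_norm_le_1) (use insert in auto)
      finally show "norm (?\<Psi> \<omega>) \<le> 1" .
    qed measurable
    have "(\<integral>\<omega>. (?Y c \<omega> + (complex_of_real r)\<^sup>2 * (complex_of_real (K i m) * complex_of_real (X m \<omega>) * complex_of_real (X j \<omega>))) * ?\<Psi> \<omega> * complex_of_real (exp (- (r * X m \<omega>)\<^sup>2 / 2)) \<partial>M) = 0" for r
    proof -
      have "(\<integral>\<omega>. (?Y c \<omega> + g * (- \<i> * r * K i m * X j \<omega>)) * ?\<Psi> \<omega> * iexp (r * g * X m \<omega>) \<partial>M) = 0" for g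
      proof -
        \<comment> \<open>Shifting \<open>c m\<close> by \<open>r * g\<close> changes the linear
          term by \<open>r * g * K i m\<close>. This is the term multiplied by \<open>g\<close> in
          the mixture; after averaging it carries the factor \<open>r\<close> squared, hence the
          parameter of the new weight.\<close>
        let ?c = "\<lambda>l. c l + (r * g) * indicator {m} l"
        have "(\<Sum>l\<in>I. K i l * ?c l) = (\<Sum>l\<in>I. K i l * c l) + r * g * K i m"
          using linear_perturb[OF I(1) m, of c "r * g" "K i"] by (simp add: mult.commute)
        moreover have "(\<integral>\<omega>. ?Y ?c \<omega> * (iexp (\<Sum>l\<in>I. ?c l * X l \<omega>) * exp (- (\<Sum>k\<in>J. s k * (X k \<omega>)\<^sup>2) / 2)) \<partial>M) = 0"
          using insert.IH[of ?c] insert.prems by simp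
        ultimately show ?thesis
          unfolding linear_perturb[OF I(1) m]
          by (simp add: distrib_left exp_add algebra_simps del: of_real_sum)
      qed
      from integration_by_parts_mixture[OF Y V \<Psi> this] show ?thesis
        by (simp add: power2_eq_square algebra_simps)
    qed
    from gaussian_weight_continuation[OF Y V' \<Psi> this, of "s m"]
    have "(\<integral>\<omega>. (?Y c \<omega> + s m * (complex_of_real (K i m) * complex_of_real (X m \<omega>) * complex_of_real (X j \<omega>))) * ?\<Psi> \<omega> * exp (- (s m * (X m \<omega>)\<^sup>2) / 2) \<partial>M) = 0"
      using insert.prems by auto
    moreover have "exp (- (\<Sum>k\<in>insert m J. s k * (X k \<omega>)\<^sup>2) / 2) =
        exp (- (\<Sum>k\<in>J. s k * (X k \<omega>)\<^sup>2) / 2) * exp (- (s m * (X m \<omega>)\<^sup>2) / 2)" for \<omega>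
      using insert.hyps by (simp add: add_divide_distrib diff_divide_distrib algebra_simps flip: exp_add)
    moreover have "?Y c \<omega> + s m * (complex_of_real (K i m) * complex_of_real (X m \<omega>) * complex_of_real (X j \<omega>)) = X i \<omega> * X j \<omega> - K i j - \<i> * (\<Sum>l\<in>I. K i l * c l) * X j \<omega>
        + (\<Sum>k\<in>insert m J. s k * K i k * X k \<omega> * X j \<omega>)" for \<omega>
      using insert.hyps by (simp add: mult.assoc)
    ultimately show ?case by (simp only: mult.assoc)
  qed
qed

text \<open>With the imaginary parameters -2 i t w(k) the Gaussian weight is the character of
  \<open>t * Q\<close>. Integration by parts with \<open>j = i\<close>, weighted by
  \<open>w i\<close> and summed, produces the constant \<open>\<Sum>i\<in>I. w i * K i i\<close>,
  which vanishes by assumption, and gives E[Q e] = 2 i t E[R e] for e the character.\<close>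

lemma quadratic_chf_derivative:
  assumes I: "finite I" and tr: "(\<Sum>i\<in>I. w i * K i i) = 0"
  defines "Q \<equiv> \<lambda>\<omega>. \<Sum>i\<in>I. w i * (X i \<omega>)\<^sup>2"
    and "R \<equiv> \<lambda>\<omega>. \<Sum>i\<in>I. \<Sum>k\<in>I. w i * w k * K i k * X i \<omega> * X k \<omega>"
  shows "((\<lambda>t. \<integral>\<omega>. iexp (t * Q \<omega>) \<partial>M) has_vector_derivative
    - 2 * t * (\<integral>\<omega>. R \<omega> * iexp (t * Q \<omega>) \<partial>M)) (at t)"
proof -
  have Qm: "has_moments Q" unfolding Q_def
    by (intro has_moments_sum has_moments_mult has_moments_const has_moments_power has_moments_X)
  have Rm: "has_moments R" unfolding R_def
    by (intro has_moments_sum has_moments_mult has_moments_const has_moments_X)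
  have [measurable]: "Q \<in> borel_measurable M" "R \<in> borel_measurable M"
    using Qm Rm has_moments_measurable by auto
  define e where "e = (\<lambda>\<omega>. iexp (t * Q \<omega>))"
  have [measurable]: "e \<in> borel_measurable M" and e1: "norm (e \<omega>) \<le> 1" for \<omega>
    unfolding e_def by auto
  have int: "integrable M (\<lambda>\<omega>. W \<omega> * e \<omega>)" if "complex_moments W" for W
    by (intro integrable_mult_bounded complex_moments_integrable that e1) auto
  define s where "s = (\<lambda>k. - 2 * \<i> * complex_of_real (t * w k))"
  let ?Z = "\<lambda>i \<omega>. complex_of_real (X i \<omega> * X i \<omega> - K i i) + (\<Sum>k\<in>I. s k * K i k * X k \<omega> * X i \<omega>)"
  have Z: "(\<integral>\<omega>. ?Z i \<omega> * e \<omega> \<partial>M) = 0" if "i \<in> I" for i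
  proof -
    have "(\<Sum>k\<in>I. s k * (complex_of_real (X k \<omega>))\<^sup>2) = - 2 * \<i> * t * Q \<omega>" for \<omega>
      unfolding Q_def s_def by (simp add: sum_distrib_left mult_ac flip: sum_negf)
    then have "exp (- (\<Sum>k\<in>I. s k * (complex_of_real (X k \<omega>))\<^sup>2) / 2) = e \<omega>" for \<omega>
      unfolding e_def by (simp add: mult_ac)
    with integration_by_parts[OF I order_refl that, of s i "\<lambda>_. 0"] show ?thesis
      by (simp add: s_def)
  qed
  have Zm: "complex_moments (\<lambda>\<omega>. w i * ?Z i \<omega>)" for i
    by (intro complex_moments_add complex_moments_mult complex_moments_sum complex_moments_const complex_moments_X
       complex_moments_of_real has_moments_diff has_moments_mult has_moments_const has_moments_X)
  have "0 = (\<Sum>i\<in>I. w i * (\<integral>\<omega>. ?Z i \<omega> * e \<omega> \<partial>M))" using Z by simp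
  also have "\<dots> = (\<integral>\<omega>. (\<Sum>i\<in>I. w i * ?Z i \<omega> * e \<omega>) \<partial>M)"
    using int[OF Zm] by (subst Bochner_Integration.integral_sum) (auto simp: mult.assoc)
  also have "\<dots> = (\<integral>\<omega>. (Q \<omega> - 2 * \<i> * t * R \<omega>) * e \<omega> \<partial>M)"
  proof (intro Bochner_Integration.integral_cong refl)
    fix \<omega>
    have "(\<Sum>i\<in>I. w i * ?Z i \<omega>) = complex_of_real (\<Sum>i\<in>I. w i * (X i \<omega>)\<^sup>2) - complex_of_real (\<Sum>i\<in>I. w i * K i i) - 2 * \<i> * t * R \<omega>"
      unfolding R_def s_def
      by (simp add: algebra_simps power2_eq_square sum.distrib sum_subtractf sum_distrib_left sum_negf)
    then have "(\<Sum>i\<in>I. w i * ?Z i \<omega>) = Q \<omega> - 2 * \<i> * t * R \<omega>" unfolding tr Q_def by simp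
    then show "(\<Sum>i\<in>I. w i * ?Z i \<omega> * e \<omega>) = (Q \<omega> - 2 * \<i> * t * R \<omega>) * e \<omega>"
      by (simp flip: sum_distrib_right)
  qed
  also have "\<dots> = (\<integral>\<omega>. Q \<omega> * e \<omega> \<partial>M) - 2 * \<i> * t * (\<integral>\<omega>. R \<omega> * e \<omega> \<partial>M)"
    using int[OF complex_moments_of_real[OF Qm]] int[OF complex_moments_of_real[OF Rm]]
    by (simp add: ring_distribs mult.assoc)
  finally have "(\<integral>\<omega>. Q \<omega> * e \<omega> \<partial>M) = 2 * \<i> * t * (\<integral>\<omega>. R \<omega> * e \<omega> \<partial>M)"
    by simp
  moreover have "\<i> * (2 * \<i> * t * B) = - 2 * t * B" for B :: complex
    by (simp add: complex_eq_iff)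
  ultimately have "\<i> * (\<integral>\<omega>. Q \<omega> * e \<omega> \<partial>M) = - 2 * t * (\<integral>\<omega>. R \<omega> * e \<omega> \<partial>M)"
    by (simp only:)
  moreover have "((\<lambda>t. \<integral>\<omega>. 1 * iexp (t * Q \<omega>) \<partial>M) has_vector_derivative
     \<i> * (\<integral>\<omega>. complex_of_real (Q \<omega>) * 1 * iexp (t * Q \<omega>) \<partial>M)) (at t)"
  proof (rule expectation_iexp_has_vector_derivative)
    show "integrable M (\<lambda>\<omega>. complex_of_real (Q \<omega>) * 1)"
      using has_moments_integrable_of_real[OF Qm] by simp
    show "integrable M (\<lambda>\<omega>. complex_of_real ((Q \<omega>)\<^sup>2) * 1)"
      using has_moments_integrable_of_real[OF has_moments_power[OF Qm, of 2]] by simp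
  qed simp_all
  ultimately show ?thesis unfolding e_def by simp
qed

end

text \<open>The signed sum over all choices of three signs cancels every monomial of degree 4 except
  \<open>a * b * c * d\<close>. That one has coefficient 24 in each of the 8 powers, hence
  192.\<close>

lemma fourth_power_polarization:
  fixes a b c d :: real
  shows "(a + b + c + d)^4 - (a - b + c + d)^4 - (a + b - c + d)^4 - (a + b + c - d)^4
     + (a - b - c + d)^4 + (a - b + c - d)^4 + (a + b - c - d)^4 - (a - b - c - d)^4 = 192 * (a * b * c * d)"
proof -
  have q: "(p + d)^4 - (p - d)^4 = 8 * d * p^3 + 8 * d^3 * p" for p :: real
    by (simp add: power4_eq_xxxx power3_eq_cube algebra_simps)
  have c: "(p + c)^3 - (p - c)^3 = 6 * c * p^2 + 2 * c^3" for p :: real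
    by (simp add: power2_eq_square power3_eq_cube algebra_simps)
  have s: "(a + b)^2 - (a - b)^2 = 4 * a * b"
    by (simp add: power2_eq_square algebra_simps)
  have e: "8 * d * (a + b + c)^3 - 8 * d * (a + b - c)^3 - (8 * d * (a - b + c)^3 - 8 * d * (a - b - c)^3)
     = 8 * d * ((6 * c * (a + b)^2 + 2 * c^3) - (6 * c * (a - b)^2 + 2 * c^3))"
    unfolding c[symmetric] by (simp add: algebra_simps)
  also have "\<dots> = 48 * c * d * ((a + b)^2 - (a - b)^2)" by (simp add: algebra_simps)
  finally have e': "8 * d * (a + b + c)^3 - 8 * d * (a + b - c)^3 - (8 * d * (a - b + c)^3 - 8 * d * (a - b - c)^3) = 192 * (a * b * c * d)"
    unfolding s by simp
  have l: "8 * d^3 * (a + b + c) - 8 * d^3 * (a + b - c) - (8 * d^3 * (a - b + c) - 8 * d^3 * (a - b - c)) = 0"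
    by (simp add: algebra_simps)
  show ?thesis using q[of "a + b + c"] q[of "a + b - c"] q[of "a - b + c"] q[of "a - b - c"] e' l by linarith
qed

text \<open>The same signed sum, applied to the squares of the variances. If x, y, z go with the
  signs e1, e2, e3 and u, v, w with the products e1 e2, e1 e3, e2 e3, only products carrying e1 e2
  e3 survive, each with the factor 2 * 8.\<close>

lemma square_polarization:
  fixes A x y z u v w :: real
  shows "(A + x + y + z + u + v + w)\<^sup>2 - (A - x + y + z - u - v + w)\<^sup>2 - (A + x - y + z - u + v - w)\<^sup>2 - (A + x + y - z + u - v - w)\<^sup>2
    + (A - x - y + z + u - v - w)\<^sup>2 + (A - x + y - z - u + v - w)\<^sup>2 + (A + x - y - z - u - v + w)\<^sup>2 - (A - x - y - z + u + v + w)\<^sup>2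
    = 16 * (x * w + y * v + z * u)" (is "?l = _")
proof -
  have d: "p\<^sup>2 - q\<^sup>2 = (p - q) * (p + q)" for p q :: real
    by (simp add: power2_eq_square algebra_simps)
  have "?l = 4 * (x + u + v) * (A + y + z + w) - 4 * (x - u + v) * (A - y + z - w)
      - 4 * (x + u - v) * (A + y - z - w) + 4 * (x - u - v) * (A - y - z + w)"
    using d[of "A + x + y + z + u + v + w" "A - x + y + z - u - v + w"]
      d[of "A + x - y + z - u + v - w" "A - x - y + z + u - v - w"]
      d[of "A + x + y - z + u - v - w" "A - x + y - z - u + v - w"]
      d[of "A + x - y - z - u - v + w" "A - x - y - z + u + v + w"]
    by (simp add: algebra_simps)
  also have "\<dots> = 16 * (x * w + y * v + z * u)" by (simp add: algebra_simps)
  finally show ?thesis .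
qed

context gauss_field begin

text \<open>Isserlis' formula, obtained by polarization from the fourth moment of a single Gaussian
  variable, three times the squared variance.\<close>

lemma fourth_moment:
  shows "(\<integral>\<omega>. X a \<omega> * X b \<omega> * X c \<omega> * X d \<omega> \<partial>M) = K a b * K c d + K a c * K b d + K a d * K b c"
proof -
  let ?I = "{a,b,c,d}"
  let ?ind = "\<lambda>a i. indicator {a} i :: real"
  \<comment> \<open>The four indices may coincide, so the coefficients of the linear combination are
    sums of indicators, which add up at repeated indices.\<close>
  define C where "C e1 e2 e3 = (\<lambda>i. ?ind a i + e1 * ?ind b i + e2 * ?ind c i + e3 * ?ind d i)" for e1 e2 e3 :: real
  have ind: "(\<Sum>i\<in>?I. ?ind l i * f i) = f l" if "l \<in> ?I" for f :: "'i \<Rightarrow> real" and l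
    using linear_perturb[of ?I l "\<lambda>_. 0" 1 f] that by (simp del: sum.insert)
  have lin: "(\<Sum>i\<in>?I. C e1 e2 e3 i * f i) = f a + e1 * f b + e2 * f c + e3 * f d" for e1 e2 e3 f
    unfolding C_def distrib_right sum.distrib mult.assoc sum_distrib_left[symmetric]
    by (simp only: ind insertI1 insertI2)
  have quad: "(\<Sum>i\<in>?I. \<Sum>j\<in>?I. C e1 e2 e3 i * C e1 e2 e3 j * K i j) =
     (K a a + e1 * K a b + e2 * K a c + e3 * K a d) + e1 * (K b a + e1 * K b b + e2 * K b c + e3 * K b d)
     + e2 * (K c a + e1 * K c b + e2 * K c c + e3 * K c d) + e3 * (K d a + e1 * K d b + e2 * K d c + e3 * K d d)" for e1 e2 e3
    unfolding mult.assoc sum_distrib_left[symmetric] lin by (simp del: sum.insert)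
  define S where "S e1 e2 e3 \<omega> = X a \<omega> + e1 * X b \<omega> + e2 * X c \<omega> + e3 * X d \<omega>" for e1 e2 e3 \<omega>
  define A x y z u v w where "A = K a a + K b b + K c c + K d d" and "x = 2 * K a b" and "y = 2 * K a c"
    and "z = 2 * K a d" and "u = 2 * K b c" and "v = 2 * K b d" and "w = 2 * K c d"
  note defs = this
  have f: "(\<integral>\<omega>. (S e1 e2 e3 \<omega>) ^ 4 \<partial>M) = 3 * (A + e1 * x + e2 * y + e3 * z + (e1 * e2) * u + (e1 * e3) * v + (e2 * e3) * w)\<^sup>2"
    if "e1 * e1 = 1" "e2 * e2 = 1" "e3 * e3 = 1" for e1 e2 e3
  proof -
    have "(K a a + e1 * K a b + e2 * K a c + e3 * K a d) + e1 * (K b a + e1 * K b b + e2 * K b c + e3 * K b d)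
      + e2 * (K c a + e1 * K c b + e2 * K c c + e3 * K c d) + e3 * (K d a + e1 * K d b + e2 * K d c + e3 * K d d)
      = K a a + (e1 * e1) * K b b + (e2 * e2) * K c c + (e3 * e3) * K d d + e1 * x + e2 * y + e3 * z + (e1 * e2) * u + (e1 * e3) * v + (e2 * e3) * w"
      unfolding defs sym[of b a] sym[of c a] sym[of d a] sym[of c b] sym[of d b] sym[of d c] by (simp add: algebra_simps)
    also have "\<dots> = A + e1 * x + e2 * y + e3 * z + (e1 * e2) * u + (e1 * e3) * v + (e2 * e3) * w"
      unfolding that A_def by simp
    finally show ?thesis
      unfolding S_def using fourth_moment_linear[of ?I "C e1 e2 e3"] unfolding quad lin by simp
  qed
  have m: "integrable M (\<lambda>\<omega>. (S e1 e2 e3 \<omega>) ^ 4)" for e1 e2 e3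
    unfolding S_def
    by (intro has_moments_integrable has_moments_power has_moments_add has_moments_mult has_moments_const has_moments_X)
  have "192 * (X a \<omega> * X b \<omega> * X c \<omega> * X d \<omega>) =
     (S 1 1 1 \<omega>)^4 - (S (-1) 1 1 \<omega>)^4 - (S 1 (-1) 1 \<omega>)^4 - (S 1 1 (-1) \<omega>)^4
     + (S (-1) (-1) 1 \<omega>)^4 + (S (-1) 1 (-1) \<omega>)^4 + (S 1 (-1) (-1) \<omega>)^4 - (S (-1) (-1) (-1) \<omega>)^4" for \<omega>
    unfolding S_def using fourth_power_polarization[of "X a \<omega>" "X b \<omega>" "X c \<omega>" "X d \<omega>"] by simp
  then have "(\<integral>\<omega>. 192 * (X a \<omega> * X b \<omega> * X c \<omega> * X d \<omega>) \<partial>M) = (\<integral>\<omega>.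
     (S 1 1 1 \<omega>)^4 - (S (-1) 1 1 \<omega>)^4 - (S 1 (-1) 1 \<omega>)^4 - (S 1 1 (-1) \<omega>)^4
     + (S (-1) (-1) 1 \<omega>)^4 + (S (-1) 1 (-1) \<omega>)^4 + (S 1 (-1) (-1) \<omega>)^4 - (S (-1) (-1) (-1) \<omega>)^4 \<partial>M)" by simp
  also have "\<dots> = (\<integral>\<omega>. (S 1 1 1 \<omega>)^4 \<partial>M) - (\<integral>\<omega>. (S (-1) 1 1 \<omega>)^4 \<partial>M) - (\<integral>\<omega>. (S 1 (-1) 1 \<omega>)^4 \<partial>M) - (\<integral>\<omega>. (S 1 1 (-1) \<omega>)^4 \<partial>M)
     + (\<integral>\<omega>. (S (-1) (-1) 1 \<omega>)^4 \<partial>M) + (\<integral>\<omega>. (S (-1) 1 (-1) \<omega>)^4 \<partial>M) + (\<integral>\<omega>. (S 1 (-1) (-1) \<omega>)^4 \<partial>M) - (\<integral>\<omega>. (S (-1) (-1) (-1) \<omega>)^4 \<partial>M)"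
    by (simp add: m)
  also have "\<dots> = 192 * (K a b * K c d + K a c * K b d + K a d * K b c)"
    using square_polarization[of A x y z u v w] f[of 1 1 1] f[of "-1" 1 1] f[of 1 "-1" 1] f[of 1 1 "-1"]
      f[of "-1" "-1" 1] f[of "-1" 1 "-1"] f[of 1 "-1" "-1"] f[of "-1" "-1" "-1"]
    by (simp add: defs(2-7))
  finally show ?thesis by simp
qed

lemma second_moment: "(\<integral>\<omega>. X a \<omega> * X b \<omega> \<partial>M) = K a b"
proof -
  have "(\<integral>\<omega>. complex_of_real (X a \<omega> * X b \<omega>) \<partial>M) = complex_of_real (K a b)"
    using expectation_XX_iexp[of "{a,b}" a b "\<lambda>_. 0"] by simp
  then show ?thesis by (simp only: integral_complex_of_real of_real_eq_iff)
qed

end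

section \<open>The characteristic function of a quadratic form\<close>

context gauss_field begin

definition trace4 :: "'i set \<Rightarrow> ('i \<Rightarrow> real) \<Rightarrow> real" where
  "trace4 I w = (\<Sum>p\<in>I. \<Sum>q\<in>I. \<Sum>r\<in>I. \<Sum>s\<in>I. w p * w q * w r * w s * (K p q * K q r * K r s * K s p))"

text \<open>Of the three pairings in the fourth moment one reproduces the square of the mean, and
  each of the other two closes up to a cycle of length four. So the variance of \<open>R\<close> is
  twice the fourth trace.\<close>

lemma quadratic_form_moments:
  fixes w :: "'i \<Rightarrow> real"
  assumes I: "finite I"
  defines "R \<equiv> \<lambda>\<omega>. \<Sum>i\<in>I. \<Sum>k\<in>I. w i * w k * K i k * X i \<omega> * X k \<omega>"
  shows "(\<integral>\<omega>. R \<omega> \<partial>M) = (\<Sum>i\<in>I. \<Sum>k\<in>I. w i * w k * (K i k)\<^sup>2)"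
    and "(\<integral>\<omega>. (R \<omega>)\<^sup>2 \<partial>M) = (\<Sum>i\<in>I. \<Sum>k\<in>I. w i * w k * (K i k)\<^sup>2)\<^sup>2 + 2 * trace4 I w"
proof -
  have i2: "integrable M (\<lambda>\<omega>. c * (X i \<omega> * X k \<omega>))" for c i k
    by (intro has_moments_integrable has_moments_mult has_moments_const has_moments_X)
  have i4: "integrable M (\<lambda>\<omega>. c * (X i \<omega> * X k \<omega> * X j \<omega> * X l \<omega>))" for c i k j l
    by (intro has_moments_integrable has_moments_mult has_moments_const has_moments_X)
  have "(\<integral>\<omega>. R \<omega> \<partial>M) = (\<Sum>i\<in>I. \<Sum>k\<in>I. w i * w k * K i k * (\<integral>\<omega>. X i \<omega> * X k \<omega> \<partial>M))"
    unfolding R_def mult.assoc[of _ "X _ _"]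
    by (simp only: Bochner_Integration.integral_sum Bochner_Integration.integrable_sum i2 integral_mult_right_zero)
  then show "(\<integral>\<omega>. R \<omega> \<partial>M) = (\<Sum>i\<in>I. \<Sum>k\<in>I. w i * w k * (K i k)\<^sup>2)"
    by (simp add: second_moment power2_eq_square mult.assoc)
  let ?a = "\<lambda>i k. w i * w k * K i k"
  have "(R \<omega>)\<^sup>2 = (\<Sum>i\<in>I. \<Sum>k\<in>I. \<Sum>j\<in>I. \<Sum>l\<in>I. ?a i k * ?a j l * (X i \<omega> * X k \<omega> * X j \<omega> * X l \<omega>))" for \<omega>
    unfolding R_def power2_eq_square sum_distrib_right unfolding sum_distrib_left
    by (intro sum.cong refl) (simp only: mult_ac)
  then have "(\<integral>\<omega>. (R \<omega>)\<^sup>2 \<partial>M) = (\<Sum>i\<in>I. \<Sum>k\<in>I. \<Sum>j\<in>I. \<Sum>l\<in>I. ?a i k * ?a j l * (\<integral>\<omega>. X i \<omega> * X k \<omega> * X j \<omega> * X l \<omega> \<partial>M))"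
    by (simp only: Bochner_Integration.integral_sum Bochner_Integration.integrable_sum i4 integral_mult_right_zero)
  also have "\<dots> = (\<Sum>i\<in>I. \<Sum>k\<in>I. \<Sum>j\<in>I. \<Sum>l\<in>I. ?a i k * K i k * (?a j l * K j l))
      + (\<Sum>i\<in>I. \<Sum>k\<in>I. \<Sum>j\<in>I. \<Sum>l\<in>I. ?a i k * ?a j l * (K i j * K k l))
      + (\<Sum>i\<in>I. \<Sum>k\<in>I. \<Sum>j\<in>I. \<Sum>l\<in>I. ?a i k * ?a j l * (K i l * K k j))"
    unfolding fourth_moment by (simp add: sum.distrib[symmetric] algebra_simps)
  also have "(\<Sum>i\<in>I. \<Sum>k\<in>I. \<Sum>j\<in>I. \<Sum>l\<in>I. ?a i k * K i k * (?a j l * K j l)) = (\<Sum>i\<in>I. \<Sum>k\<in>I. w i * w k * (K i k)\<^sup>2)\<^sup>2"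
    unfolding power2_eq_square sum_distrib_right unfolding sum_distrib_left
    by (intro sum.cong refl) (simp only: mult_ac)
  also have "(\<Sum>i\<in>I. \<Sum>k\<in>I. \<Sum>j\<in>I. \<Sum>l\<in>I. ?a i k * ?a j l * (K i j * K k l)) = trace4 I w"
    unfolding trace4_def
  proof (rule sum.cong[OF refl], rule sum.cong[OF refl])
    fix i k
    have "(\<Sum>j\<in>I. \<Sum>l\<in>I. ?a i k * ?a j l * (K i j * K k l)) = (\<Sum>l\<in>I. \<Sum>j\<in>I. ?a i k * ?a j l * (K i j * K k l))"
      by (rule sum.swap)
    also have "\<dots> = (\<Sum>r\<in>I. \<Sum>s\<in>I. w i * w k * w r * w s * (K i k * K k r * K r s * K s i))"
    proof (intro sum.cong refl)
      fix r s
      show "?a i k * ?a s r * (K i s * K k r) = w i * w k * w r * w s * (K i k * K k r * K r s * K s i)"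
        by (simp add: sym[of s r] sym[of i s])
    qed
    finally show "(\<Sum>j\<in>I. \<Sum>l\<in>I. ?a i k * ?a j l * (K i j * K k l)) = (\<Sum>r\<in>I. \<Sum>s\<in>I. w i * w k * w r * w s * (K i k * K k r * K r s * K s i))" .
  qed
  also have "(\<Sum>i\<in>I. \<Sum>k\<in>I. \<Sum>j\<in>I. \<Sum>l\<in>I. ?a i k * ?a j l * (K i l * K k j)) = trace4 I w"
    unfolding trace4_def
  proof (intro sum.cong refl)
    fix i k j l
    show "?a i k * ?a j l * (K i l * K k j) = w i * w k * w j * w l * (K i k * K k j * K j l * K l i)"
      by (simp add: sym[of i l])
  qed
  finally show "(\<integral>\<omega>. (R \<omega>)\<^sup>2 \<partial>M) = (\<Sum>i\<in>I. \<Sum>k\<in>I. w i * w k * (K i k)\<^sup>2)\<^sup>2 + 2 * trace4 I w"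
    by simp
qed

text \<open>If \<open>R\<close> were constant equal to its mean \<open>m\<close>, the derivative
  formula would be the differential equation of the Gaussian characteristic function with variance
  \<open>2 * m\<close>. Multiplication by the integrating factor \<open>exp (m * t^2)\<close> leaves
  only the deviation of \<open>R\<close> from \<open>m\<close>, whose first absolute moment is at
  most its standard deviation; the mean value inequality does the rest.\<close>

lemma chf_quadratic_bound:
  assumes I: "finite I" and tr: "(\<Sum>i\<in>I. w i * K i i) = 0"
  shows "norm ((\<integral>\<omega>. iexp (t * (\<Sum>i\<in>I. w i * (X i \<omega>)\<^sup>2)) \<partial>M)
      - exp (- (2 * (\<Sum>i\<in>I. \<Sum>k\<in>I. w i * w k * (K i k)\<^sup>2)) * t\<^sup>2 / 2)) \<le> 2 * t\<^sup>2 * sqrt (2 * trace4 I w)"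
proof -
  define R where "R = (\<lambda>\<omega>. \<Sum>i\<in>I. \<Sum>k\<in>I. w i * w k * K i k * X i \<omega> * X k \<omega>)"
  define m where "m = (\<Sum>i\<in>I. \<Sum>k\<in>I. w i * w k * (K i k)\<^sup>2)"
  define Q where "Q = (\<lambda>\<omega>. \<Sum>i\<in>I. w i * (X i \<omega>)\<^sup>2)"
  define V where "V = sqrt (2 * trace4 I w)"
  define \<phi> where "\<phi> = (\<lambda>t. \<integral>\<omega>. iexp (t * Q \<omega>) \<partial>M)"
  have R: "has_moments R" unfolding R_def
    by (intro has_moments_sum has_moments_mult has_moments_const has_moments_X)
  have Q: "has_moments Q" unfolding Q_def
    by (intro has_moments_sum has_moments_mult has_moments_const has_moments_power has_moments_X)
  have [measurable]: "Q \<in> borel_measurable M" "R \<in> borel_measurable M"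
    using Q R has_moments_measurable by auto
  have ER: "(\<integral>\<omega>. R \<omega> \<partial>M) = m" "(\<integral>\<omega>. (R \<omega>)\<^sup>2 \<partial>M) = m\<^sup>2 + 2 * trace4 I w"
    using quadratic_form_moments[OF I, of w] by (auto simp: R_def m_def)
  have Ri: "integrable M R" "integrable M (\<lambda>\<omega>. (R \<omega>)\<^sup>2)"
    using R has_moments_power[OF R] has_moments_integrable by auto
  have var: "(\<integral>\<omega>. (R \<omega> - m)\<^sup>2 \<partial>M) = 2 * trace4 I w"
    using variance_eq[OF Ri] ER by simp
  then have T4: "0 \<le> trace4 I w"
    using Bochner_Integration.integral_nonneg[of M "\<lambda>\<omega>. (R \<omega> - m)\<^sup>2"] by simp
  have Z: "has_moments (\<lambda>\<omega>. R \<omega> - m)" by (intro has_moments_diff R has_moments_const)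
  have abs: "(\<integral>\<omega>. \<bar>R \<omega> - m\<bar> \<partial>M) \<le> V"
  proof -
    have i: "integrable M (\<lambda>\<omega>. \<bar>R \<omega> - m\<bar>)" "integrable M (\<lambda>\<omega>. \<bar>R \<omega> - m\<bar>\<^sup>2)"
      using has_moments_integrable[OF Z] has_moments_integrable[OF has_moments_power[OF Z, of 2]] by auto
    have "(\<integral>\<omega>. \<bar>R \<omega> - m\<bar> \<partial>M)\<^sup>2 \<le> (\<integral>\<omega>. \<bar>R \<omega> - m\<bar>\<^sup>2 \<partial>M)"
      using variance_eq[OF i] variance_positive[of "\<lambda>\<omega>. \<bar>R \<omega> - m\<bar>"] by simp
    also have "\<dots> = V\<^sup>2" unfolding V_def using var T4 by simp
    finally show ?thesis by (rule power2_le_imp_le) (simp add: V_def T4)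
  qed
  have bound: "norm (\<integral>\<omega>. complex_of_real (R \<omega> - m) * iexp (t * Q \<omega>) \<partial>M) \<le> V" for t
  proof -
    have "norm (\<integral>\<omega>. complex_of_real (R \<omega> - m) * iexp (t * Q \<omega>) \<partial>M) \<le> (\<integral>\<omega>. norm (complex_of_real (R \<omega> - m) * iexp (t * Q \<omega>)) \<partial>M)"
      by (rule integral_norm_bound)
    also have "\<dots> = (\<integral>\<omega>. \<bar>R \<omega> - m\<bar> \<partial>M)"
      by (simp only: norm_mult norm_exp_i_times mult_1_right norm_of_real)
    finally show ?thesis using abs by simp
  qed
  define D where "D = (\<lambda>t. \<phi> t * complex_of_real (exp (m * t\<^sup>2)))"
  define D' where "D' = (\<lambda>t. - 2 * t * (\<integral>\<omega>. complex_of_real (R \<omega> - m) * iexp (t * Q \<omega>) \<partial>M) * complex_of_real (exp (m * t\<^sup>2)))"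
  \<comment> \<open>\<open>R\<close> is the quadratic form of \<open>K\<close> at the random vector
    \<open>w i * X i\<close>, so its mean is nonnegative. This makes the integrating factor on the
    interval largest at its end points.\<close>
  have m0: "0 \<le> m"
  proof -
    have "0 \<le> (\<integral>\<omega>. R \<omega> \<partial>M)" unfolding R_def
    proof (intro Bochner_Integration.integral_nonneg)
      fix \<omega>
      show "0 \<le> (\<Sum>i\<in>I. \<Sum>k\<in>I. w i * w k * K i k * X i \<omega> * X k \<omega>)"
        using quadratic_form_nonneg[OF I, of "\<lambda>i. w i * X i \<omega>"] by (simp add: mult_ac)
    qed
    then show ?thesis using ER by simp
  qed
  have D: "(D has_vector_derivative D' t) (at t)" for t
  proof -
    have 1: "(\<phi> has_vector_derivative (- 2 * t * (\<integral>\<omega>. R \<omega> * iexp (t * Q \<omega>) \<partial>M))) (at t)"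
      using quadratic_chf_derivative[OF I tr, of t] unfolding \<phi>_def Q_def R_def by simp
    have 2: "((\<lambda>t. complex_of_real (exp (m * t\<^sup>2))) has_vector_derivative complex_of_real (exp (m * t\<^sup>2) * (m * (2 * t)))) (at t)"
      by (rule has_vector_derivative_of_real) (auto intro!: derivative_eq_intros)
    have i: "integrable M (\<lambda>\<omega>. complex_of_real (R \<omega>) * iexp (t * Q \<omega>))" "integrable M (\<lambda>\<omega>. complex_of_real m * iexp (t * Q \<omega>))"
      by (intro integrable_mult_bounded has_moments_integrable_of_real R has_moments_const; simp)+
    have eq: "(\<integral>\<omega>. complex_of_real (R \<omega> - m) * iexp (t * Q \<omega>) \<partial>M) = (\<integral>\<omega>. R \<omega> * iexp (t * Q \<omega>) \<partial>M) - m * \<phi> t"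
      using i by (simp add: \<phi>_def left_diff_distrib)
    have "D' t = \<phi> t * complex_of_real (exp (m * t\<^sup>2) * (m * (2 * t))) + (- 2 * t * (\<integral>\<omega>. R \<omega> * iexp (t * Q \<omega>) \<partial>M)) * complex_of_real (exp (m * t\<^sup>2))"
      unfolding D'_def eq by (simp add: algebra_simps)
    with has_vector_derivative_mult[OF 1 2] show ?thesis unfolding D_def by simp
  qed
  have "norm (D t - D 0) \<le> (2 * \<bar>t\<bar> * V * exp (m * t\<^sup>2)) * norm (t - 0)"
  proof (rule differentiable_bound[where f' = "\<lambda>t h. h *\<^sub>R D' t" and S = "{-\<bar>t\<bar>..\<bar>t\<bar>}"])
    fix s assume s: "s \<in> {-\<bar>t\<bar>..\<bar>t\<bar>}"
    show "(D has_derivative (\<lambda>h. h *\<^sub>R D' s)) (at s within {-\<bar>t\<bar>..\<bar>t\<bar>})"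
      using D[of s] has_derivative_at_withinI unfolding has_vector_derivative_def by blast
    show "onorm (\<lambda>h. h *\<^sub>R D' s) \<le> 2 * \<bar>t\<bar> * V * exp (m * t\<^sup>2)"
    proof (rule onorm_le)
      fix h :: real
      have "\<bar>s\<bar> \<le> \<bar>t\<bar>" using s by auto
      then have "s\<^sup>2 \<le> t\<^sup>2" by (rule abs_le_square_iff[THEN iffD1])
      then have "exp (m * s\<^sup>2) \<le> exp (m * t\<^sup>2)" using m0 by (simp add: mult_left_mono)
      then have "norm (D' s) \<le> 2 * \<bar>t\<bar> * V * exp (m * t\<^sup>2)"
        unfolding D'_def norm_mult using \<open>\<bar>s\<bar> \<le> \<bar>t\<bar>\<close> bound[of s] T4
        by (intro mult_mono) (auto simp: V_def)
      then show "norm (h *\<^sub>R D' s) \<le> 2 * \<bar>t\<bar> * V * exp (m * t\<^sup>2) * norm h"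
        by (simp add: mult.commute mult_left_mono)
    qed
  qed auto
  then have "norm (D t - 1) \<le> 2 * t\<^sup>2 * V * exp (m * t\<^sup>2)"
    by (simp add: D_def \<phi>_def prob_space power2_eq_square mult_ac abs_mult_self_eq)
  moreover have "\<phi> t - exp (- (2 * m) * t\<^sup>2 / 2) = (D t - 1) * complex_of_real (exp (- m * t\<^sup>2))"
    unfolding D_def by (simp add: algebra_simps exp_minus flip: of_real_mult exp_add)
  ultimately have "norm (\<phi> t - exp (- (2 * m) * t\<^sup>2 / 2)) \<le> 2 * t\<^sup>2 * V * exp (m * t\<^sup>2) * exp (- m * t\<^sup>2)"
    by (simp add: norm_mult)
  also have "\<dots> = 2 * t\<^sup>2 * V" by (simp add: mult.assoc flip: exp_add)
  finally show ?thesis unfolding \<phi>_def Q_def m_def V_def .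
qed

end

section \<open>A Cauchy-Schwarz inequality for the fourth trace\<close>

context gauss_field begin

definition tr4 :: "'i set \<Rightarrow> ('i \<Rightarrow> real) \<Rightarrow> ('i \<Rightarrow> real) \<Rightarrow> ('i \<Rightarrow> real) \<Rightarrow> ('i \<Rightarrow> real) \<Rightarrow> real" where
  "tr4 I a b c d = (\<Sum>p\<in>I. \<Sum>q\<in>I. \<Sum>r\<in>I. \<Sum>s\<in>I. a p * b q * c r * d s * (K p q * K q r * K r s * K s p))"

text \<open>For matrices \<open>m\<close>, \<open>n\<close> this is tr(m K n' K), with n' the
  transpose: the Hilbert-Schmidt inner product after multiplying both matrices on both sides by the
  square root of \<open>K\<close>.\<close>

definition hs_form :: "'i set \<Rightarrow> ('i \<times> 'i \<Rightarrow> real) \<Rightarrow> ('i \<times> 'i \<Rightarrow> real) \<Rightarrow> real" where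
  "hs_form I m n = (\<Sum>x\<in>I \<times> I. \<Sum>y\<in>I \<times> I. m x * n y * (K (fst x) (fst y) * K (snd x) (snd y)))"

lemma hs_form_sum:
  "hs_form I m n = (\<Sum>p\<in>I. \<Sum>q\<in>I. \<Sum>s\<in>I. \<Sum>r\<in>I. m (p, q) * n (s, r) * (K p s * K q r))"
  unfolding hs_form_def by (simp add: sum.cartesian_product')

lemma tr4_eq_trace4: "tr4 I w w w w = trace4 I w"
  by (simp add: tr4_def trace4_def)

lemma tr4_hs_form:
  "tr4 I a b c d = hs_form I (\<lambda>(p, q). a p * b q * K p q) (\<lambda>(s, r). d s * c r * K s r)"
proof -
  have "tr4 I a b c d = (\<Sum>p\<in>I. \<Sum>q\<in>I. \<Sum>s\<in>I. \<Sum>r\<in>I. (a p * b q * K p q) * (d s * c r * K s r) * (K p s * K q r))"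
    unfolding tr4_def
  proof (rule sum.cong[OF refl], rule sum.cong[OF refl])
    fix p q
    have "(\<Sum>r\<in>I. \<Sum>s\<in>I. a p * b q * c r * d s * (K p q * K q r * K r s * K s p))
      = (\<Sum>s\<in>I. \<Sum>r\<in>I. a p * b q * c r * d s * (K p q * K q r * K r s * K s p))"
      by (rule sum.swap)
    also have "\<dots> = (\<Sum>s\<in>I. \<Sum>r\<in>I. (a p * b q * K p q) * (d s * c r * K s r) * (K p s * K q r))"
    proof (intro sum.cong refl)
      fix r s
      show "a p * b q * c r * d s * (K p q * K q r * K r s * K s p) = (a p * b q * K p q) * (d s * c r * K s r) * (K p s * K q r)"
        by (simp add: sym[of r s] sym[of s p])
    qed
    finally show "(\<Sum>r\<in>I. \<Sum>s\<in>I. a p * b q * c r * d s * (K p q * K q r * K r s * K s p))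
      = (\<Sum>s\<in>I. \<Sum>r\<in>I. (a p * b q * K p q) * (d s * c r * K s r) * (K p s * K q r))" .
  qed
  then show ?thesis
    unfolding hs_form_sum by simp
qed

lemma hs_form_commute: "hs_form I m n = hs_form I n m"
  unfolding hs_form_def
  apply (subst sum.swap)
  apply (intro sum.cong refl)
  subgoal for y x using sym[of "fst x" "fst y"] sym[of "snd x" "snd y"] by simp
  done

lemma tr4_cyclic: "tr4 I a b c d = tr4 I b c d a"
proof -
  have "tr4 I a b c d = (\<Sum>q\<in>I. \<Sum>p\<in>I. \<Sum>r\<in>I. \<Sum>s\<in>I. a p * b q * c r * d s * (K p q * K q r * K r s * K s p))"
    unfolding tr4_def by (rule sum.swap)
  also have "\<dots> = (\<Sum>q\<in>I. \<Sum>r\<in>I. \<Sum>p\<in>I. \<Sum>s\<in>I. a p * b q * c r * d s * (K p q * K q r * K r s * K s p))"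
    by (intro sum.cong refl sum.swap)
  also have "\<dots> = (\<Sum>q\<in>I. \<Sum>r\<in>I. \<Sum>s\<in>I. \<Sum>p\<in>I. a p * b q * c r * d s * (K p q * K q r * K r s * K s p))"
    by (intro sum.cong refl sum.swap)
  also have "\<dots> = tr4 I b c d a" unfolding tr4_def by (simp add: mult_ac)
  finally show ?thesis .
qed

lemma second_moment_bilinear:
  "(\<integral>\<omega>. (\<Sum>q\<in>I. a q * X q \<omega>) * (\<Sum>r\<in>I. b r * X r \<omega>) \<partial>M) = (\<Sum>q\<in>I. \<Sum>r\<in>I. a q * b r * K q r)"
proof -
  have i: "integrable M (\<lambda>\<omega>. c * (X q \<omega> * X r \<omega>))" for c q r
    by (intro has_moments_integrable has_moments_mult has_moments_const has_moments_X)
  have "(\<Sum>q\<in>I. a q * X q \<omega>) * (\<Sum>r\<in>I. b r * X r \<omega>) = (\<Sum>q\<in>I. \<Sum>r\<in>I. (a q * b r) * (X q \<omega> * X r \<omega>))" for \<omega>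
    unfolding sum_product by (intro sum.cong refl) (simp only: mult_ac)
  then show ?thesis
    by (simp only: Bochner_Integration.integral_sum Bochner_Integration.integrable_sum i integral_mult_right_zero second_moment)
qed

text \<open>The tensor square of a positive semidefinite matrix is positive semidefinite. Instead of
  taking a square root, one factor \<open>K q r\<close> is written as the expectation of
  \<open>X q * X r\<close>; the form becomes the expectation of the quadratic form of
  \<open>K\<close> at a random vector.\<close>

lemma hs_form_nonneg:
  assumes "finite I" shows "0 \<le> hs_form I m m"
proof -
  define c where "c = (\<lambda>p \<omega>. \<Sum>q\<in>I. m (p, q) * X q \<omega>)"
  have i: "integrable M (\<lambda>\<omega>. K p s * (c p \<omega> * c s \<omega>))" for p s
    unfolding c_def
    by (intro has_moments_integrable has_moments_mult has_moments_sum has_moments_const has_moments_X)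
  have "0 \<le> (\<integral>\<omega>. (\<Sum>p\<in>I. \<Sum>s\<in>I. K p s * (c p \<omega> * c s \<omega>)) \<partial>M)"
  proof (rule Bochner_Integration.integral_nonneg)
    fix \<omega>
    show "0 \<le> (\<Sum>p\<in>I. \<Sum>s\<in>I. K p s * (c p \<omega> * c s \<omega>))"
      using quadratic_form_nonneg[OF assms, of "\<lambda>p. c p \<omega>"] by (simp add: mult.commute)
  qed
  also have "\<dots> = (\<Sum>p\<in>I. \<Sum>s\<in>I. K p s * (\<integral>\<omega>. c p \<omega> * c s \<omega> \<partial>M))"
    by (simp only: Bochner_Integration.integral_sum Bochner_Integration.integrable_sum i integral_mult_right_zero)
  also have "\<dots> = (\<Sum>p\<in>I. \<Sum>s\<in>I. \<Sum>q\<in>I. \<Sum>r\<in>I. m (p, q) * m (s, r) * (K p s * K q r))"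
    unfolding c_def second_moment_bilinear unfolding sum_distrib_left by (intro sum.cong refl) (simp only: mult_ac)
  also have "\<dots> = (\<Sum>p\<in>I. \<Sum>q\<in>I. \<Sum>s\<in>I. \<Sum>r\<in>I. m (p, q) * m (s, r) * (K p s * K q r))"
    by (intro sum.cong refl sum.swap)
  also have "\<dots> = hs_form I m m"
    unfolding hs_form_sum by simp
  finally show ?thesis .
qed

lemma hs_form_bound:
  assumes "finite I" shows "\<bar>hs_form I m n\<bar> \<le> (hs_form I m m + hs_form I n n) / 2"
proof -
  have e: "hs_form I (\<lambda>x. m x + t * n x) (\<lambda>x. m x + t * n x) = hs_form I m m + t * (2 * hs_form I m n) + t\<^sup>2 * hs_form I n n" for t
  proof -
    have "hs_form I (\<lambda>x. m x + t * n x) (\<lambda>x. m x + t * n x) = hs_form I m m + t * hs_form I m n + t * hs_form I n m + t\<^sup>2 * hs_form I n n"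
      unfolding hs_form_def by (simp add: algebra_simps sum.distrib sum_distrib_left power2_eq_square)
    then show ?thesis using hs_form_commute[of I n m] by simp
  qed
  have "0 \<le> hs_form I m m + 1 * (2 * hs_form I m n) + 1\<^sup>2 * hs_form I n n"
    unfolding e[symmetric] by (rule hs_form_nonneg[OF assms])
  moreover have "0 \<le> hs_form I m m + (-1) * (2 * hs_form I m n) + (-1)\<^sup>2 * hs_form I n n"
    unfolding e[symmetric] by (rule hs_form_nonneg[OF assms])
  ultimately show ?thesis by simp
qed

text \<open>Cauchy-Schwarz, in its arithmetic mean form, pairs the weights as \<open>a b b a\<close>
  and \<open>d c c d\<close>. After a cyclic rotation to \<open>b b a a\<close> a second application
  leaves only pure traces.\<close>

lemma tr4_bound:
  assumes "finite I"
  shows "tr4 I a b c d \<le> (trace4 I a + trace4 I b + trace4 I c + trace4 I d) / 4"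
proof -
  have cs: "tr4 I a b c d \<le> (tr4 I a b b a + tr4 I d c c d) / 2" for a b c d
    unfolding tr4_hs_form[of I a b c d] tr4_hs_form[of I a b b a] tr4_hs_form[of I d c c d]
    using hs_form_bound[OF assms] abs_le_D1 by blast
  have "tr4 I a b b a \<le> (trace4 I a + trace4 I b) / 2" for a b
    unfolding tr4_cyclic[of I a b b a] using cs[of b b a a] by (simp add: tr4_eq_trace4)
  from this[of a b] this[of d c] cs[of a b c d] show ?thesis by simp
qed

lemma tr4_sum: "finite S \<Longrightarrow> tr4 I (\<lambda>p. \<Sum>a\<in>S. w a p) x y z = (\<Sum>a\<in>S. tr4 I (w a) x y z)"
proof (induction S rule: finite_induct)
  case empty then show ?case by (simp add: tr4_def)
next
  case (insert a S)
  have "tr4 I (\<lambda>p. w a p + (\<Sum>a\<in>S. w a p)) x y z = tr4 I (w a) x y z + tr4 I (\<lambda>p. \<Sum>a\<in>S. w a p) x y z"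
    unfolding tr4_def by (simp add: distrib_right sum.distrib)
  with insert show ?case by simp
qed

text \<open>Applied with one summand per segment, this reduces the trace of a whole family of
  segments to the traces of its members. The cube arises since the average over four free indices
  leaves three of them to be summed trivially.\<close>

lemma trace4_sum_bound:
  assumes I: "finite I" and S: "finite S"
  shows "trace4 I (\<lambda>p. \<Sum>a\<in>S. w a p) \<le> real (card S) ^ 3 * (\<Sum>a\<in>S. trace4 I (w a))"
proof -
  let ?W = "\<lambda>p. \<Sum>a\<in>S. w a p"
  have 1: "tr4 I x ?W y z = (\<Sum>a\<in>S. tr4 I x (w a) y z)" for x y z
    unfolding tr4_cyclic[of I x] tr4_sum[OF S] ..
  have 2: "tr4 I x y ?W z = (\<Sum>a\<in>S. tr4 I x y (w a) z)" for x y z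
    unfolding tr4_cyclic[of I x] 1 ..
  have 3: "tr4 I x y z ?W = (\<Sum>a\<in>S. tr4 I x y z (w a))" for x y z
    unfolding tr4_cyclic[of I x] 2 ..
  have "trace4 I ?W = (\<Sum>a\<in>S. \<Sum>b\<in>S. \<Sum>c\<in>S. \<Sum>d\<in>S. tr4 I (w a) (w b) (w c) (w d))"
    unfolding tr4_eq_trace4[symmetric] tr4_sum[OF S] 1 2 3 ..
  also have "\<dots> \<le> (\<Sum>a\<in>S. \<Sum>b\<in>S. \<Sum>c\<in>S. \<Sum>d\<in>S. (trace4 I (w a) + trace4 I (w b) + trace4 I (w c) + trace4 I (w d)) / 4)"
    by (intro sum_mono tr4_bound I)
  also have "\<dots> = real (card S) ^ 3 * (\<Sum>a\<in>S. trace4 I (w a))"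
    by (simp add: sum.distrib sum_distrib_left[symmetric] power3_eq_cube flip: sum_divide_distrib)
  finally show ?thesis .
qed

end

section \<open>Existence of Gaussian laws with given covariance\<close>

lemma normal_law_scaled_std_normal:
  assumes "0 \<le> s" shows "normal_law (distr std_normal_distribution borel (\<lambda>x. s * x))"
proof (cases "s = 0")
  case True
  interpret N: real_distribution std_normal_distribution by (rule real_dist_normal_dist)
  have "distr std_normal_distribution borel (\<lambda>x. s * x) = distr std_normal_distribution borel (\<lambda>_. 0)"
    using True by simp
  also have "\<dots> = return borel 0" by (rule N.distr_const) simp
  finally show ?thesis unfolding normal_law_def by blast
next
  case False
  interpret N: real_distribution std_normal_distribution by (rule real_dist_normal_dist)
  have "distributed std_normal_distribution lborel (\<lambda>x. x) (normal_density 0 1)"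
    unfolding distributed_def by (auto simp: distr_id2)
  from N.normal_density_affine[OF this, of s 0] False
  have "distr std_normal_distribution lborel (\<lambda>x. s * x) = density lborel (normal_density 0 \<bar>s\<bar>)"
    by (simp add: distributed_def)
  moreover have "distr std_normal_distribution lborel (\<lambda>x. s * x) = distr std_normal_distribution borel (\<lambda>x. s * x)"
    by (rule distr_cong) auto
  ultimately show ?thesis unfolding normal_law_def using False assms by (intro disjI2 exI[of _ 0] exI[of _ s]) auto
qed

lemma (in gauss_field) mean_zero: "(\<integral>\<omega>. X a \<omega> \<partial>M) = 0"
  using expectation_X_iexp[of "{a}" a "\<lambda>_. 0"] by simp

lemma (in gauss_field) centered_gaussian_family: "centered_gaussian_family M X K"
  unfolding centered_gaussian_family_def gaussian_family_def
proof (intro conjI allI impI)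
  show "prob_space M" by (rule prob_space_axioms)
  show "X i \<in> borel_measurable M" for i by measurable
  show "(\<integral>\<omega>. X i \<omega> \<partial>M) = 0" for i by (rule mean_zero)
  show "(\<integral>\<omega>. X i \<omega> * X j \<omega> \<partial>M) = K i j" for i j by (rule second_moment)
  fix I :: "'i set" and c :: "'i \<Rightarrow> real" assume "finite I"
  then show "normal_law (distr M borel (\<lambda>\<omega>. \<Sum>i\<in>I. c i * X i \<omega>))"
    using law quadratic_form_nonneg by (simp add: normal_law_scaled_std_normal)
qed

text \<open>The image of independent standard normal variables under the matrix \<open>L\<close>. A
  covariance presented as a Gram matrix may be singular, and its factor \<open>L\<close> is supplied
  and not extracted.\<close>

lemma gaussian_law_factorized:
  fixes L :: "'d::finite \<Rightarrow> 'a \<Rightarrow> real"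
  assumes A: "finite A"
  shows "\<exists>N :: (real^'d) measure. sets N = sets borel \<and> gauss_field N (\<lambda>i x. x $ i) (\<lambda>i j. \<Sum>a\<in>A. L i a * L j a)"
proof -
  interpret S: real_distribution std_normal_distribution by (rule real_dist_normal_dist)
  interpret P: product_prob_space "\<lambda>_. std_normal_distribution" A by standard
  let ?M = "PiM A (\<lambda>_. std_normal_distribution)"
  define X :: "('a \<Rightarrow> real) \<Rightarrow> real^'d" where "X \<omega> = (\<chi> i. \<Sum>a\<in>A. L i a * \<omega> a)" for \<omega>
  have cm [measurable]: "(\<lambda>\<omega>. \<omega> a) \<in> borel_measurable ?M" if "a \<in> A" for a
    using measurable_component_singleton[OF that, of "\<lambda>_. std_normal_distribution"] by simp
  have Xm [measurable]: "X \<in> borel_measurable ?M"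
  proof (subst borel_measurable_euclidean_space, rule ballI)
    fix b :: "real^'d" assume "b \<in> Basis"
    then obtain i where b: "b = axis i 1" by (auto simp: Basis_vec_def)
    have "(\<lambda>\<omega>. \<Sum>a\<in>A. L i a * \<omega> a) \<in> borel_measurable ?M"
      by (intro borel_measurable_sum borel_measurable_times borel_measurable_const cm)
    then show "(\<lambda>\<omega>. X \<omega> \<bullet> b) \<in> borel_measurable ?M" by (simp add: X_def b inner_axis)
  qed
  let ?N = "distr ?M borel X"
  have "gauss_field ?N (\<lambda>i x. x $ i) (\<lambda>i j. \<Sum>a\<in>A. L i a * L j a)"
  proof (intro gauss_field.intro gauss_field_axioms.intro)
    show "prob_space ?N" by (intro prob_space.prob_space_distr prob_space_PiM S.prob_space_axioms Xm)
    show "(\<Sum>a\<in>A. L i a * L j a) = (\<Sum>a\<in>A. L j a * L i a)" for i j by (simp add: mult.commute)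
    fix I :: "'d set" and c :: "'d \<Rightarrow> real"
    define d where "d a = (\<Sum>i\<in>I. c i * L i a)" for a
    have "(\<integral>x. iexp (\<Sum>i\<in>I. c i * x $ i) \<partial>?N) = (\<integral>\<omega>. iexp (\<Sum>i\<in>I. c i * X \<omega> $ i) \<partial>?M)"
      by (rule integral_distr) auto
    also have "\<dots> = (\<integral>\<omega>. (\<Prod>a\<in>A. iexp (d a * \<omega> a)) \<partial>?M)"
    proof (intro Bochner_Integration.integral_cong refl)
      fix \<omega>
      have "(\<Sum>i\<in>I. c i * X \<omega> $ i) = (\<Sum>i\<in>I. \<Sum>a\<in>A. c i * L i a * \<omega> a)"
        by (simp add: X_def sum_distrib_left mult.assoc)
      also have "\<dots> = (\<Sum>a\<in>A. d a * \<omega> a)"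
        by (subst sum.swap) (simp add: d_def sum_distrib_right)
      finally show "iexp (\<Sum>i\<in>I. c i * X \<omega> $ i) = (\<Prod>a\<in>A. iexp (d a * \<omega> a))"
        using A by (simp add: sum_distrib_left exp_sum)
    qed
    also have "\<dots> = (\<Prod>a\<in>A. \<integral>x. iexp (d a * x) \<partial>std_normal_distribution)"
      by (rule P.product_integral_prod[OF A]) (rule S.integrable_iexp, auto)
    also have "\<dots> = (\<Prod>a\<in>A. complex_of_real (exp (- (d a)\<^sup>2 / 2)))"
      by (simp only: std_normal_expectation_iexp)
    also have "\<dots> = complex_of_real (exp (\<Sum>a\<in>A. - (d a)\<^sup>2 / 2))"
      using A by (simp only: exp_sum of_real_prod)
    also have "(\<Sum>a\<in>A. - (d a)\<^sup>2 / 2) = - (\<Sum>i\<in>I. \<Sum>j\<in>I. c i * c j * (\<Sum>a\<in>A. L i a * L j a)) / 2"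
    proof -
      have "(\<Sum>a\<in>A. (d a)\<^sup>2) = (\<Sum>a\<in>A. \<Sum>i\<in>I. \<Sum>j\<in>I. c i * c j * (L i a * L j a))"
        by (simp add: d_def power2_eq_square sum_product mult_ac)
      also have "\<dots> = (\<Sum>i\<in>I. \<Sum>a\<in>A. \<Sum>j\<in>I. c i * c j * (L i a * L j a))" by (rule sum.swap)
      also have "\<dots> = (\<Sum>i\<in>I. \<Sum>j\<in>I. \<Sum>a\<in>A. c i * c j * (L i a * L j a))" by (intro sum.cong refl sum.swap)
      finally show ?thesis by (simp add: sum_negf sum_distrib_left flip: sum_divide_distrib)
    qed
    finally show "(\<integral>x. iexp (\<Sum>i\<in>I. c i * x $ i) \<partial>?N) =
       complex_of_real (exp (- (\<Sum>i\<in>I. \<Sum>j\<in>I. c i * c j * (\<Sum>a\<in>A. L i a * L j a)) / 2))" .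
  qed simp
  then show ?thesis by (intro exI[of _ ?N]) simp
qed

section \<open>Bessel functions\<close>

text \<open>The Bessel function of order m is (u/2)^m times \<open>bes m\<close> at u^2/4. Taking
  the squared argument as variable makes the covariance an entire function of the squared distance,
  so that nothing singular happens at coinciding points; differentiation merely raises the
  index.\<close>

definition bes :: "nat \<Rightarrow> real \<Rightarrow> real" where
  "bes m x = (\<Sum>n. (-1) ^ n / (fact n * fact (n + m)) * x ^ n)"

lemma summable_power_series_fact_bound:
  assumes "\<And>n. \<bar>c n\<bar> \<le> R ^ n / fact n" shows "summable (\<lambda>n. c n * (x::real) ^ n)"
proof (rule summable_comparison_test[OF _ summable_exp[of "R * \<bar>x\<bar>"]], intro exI[of _ 0] allI impI)
  fix n :: nat
  have "\<bar>c n\<bar> * \<bar>x\<bar> ^ n \<le> R ^ n / fact n * \<bar>x\<bar> ^ n" using assms by (intro mult_right_mono) auto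
  then show "norm (c n * x ^ n) \<le> inverse (fact n) * (R * \<bar>x\<bar>) ^ n"
    by (simp add: abs_mult power_abs power_mult_distrib field_simps)
qed

lemma bes_coeff_bound: "\<bar>(-1) ^ n / (fact n * fact (n + m))\<bar> \<le> 1 / (fact n :: real)"
proof -
  have "fact n * 1 \<le> (fact n * fact (n + m) :: real)" by (intro mult_left_mono) auto
  then show ?thesis by (simp add: abs_divide abs_mult frac_le)
qed

lemma bes_summable: "summable (\<lambda>n. (-1) ^ n / (fact n * fact (n + m)) * (x::real) ^ n)"
  by (rule summable_power_series_fact_bound[of _ 1]) (use bes_coeff_bound in simp)

lemma bes_has_derivative: "(bes m has_real_derivative - bes (Suc m) x) (at x)"
proof -
  let ?c = "\<lambda>n. (-1) ^ n / (fact n * fact (n + m)) :: real"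
  have "((\<lambda>x. \<Sum>n. ?c n * x ^ n) has_real_derivative (\<Sum>n. diffs ?c n * x ^ n)) (at x)"
    by (rule termdiffs_strong_converges_everywhere) (rule bes_summable)
  moreover have "(\<lambda>n. diffs ?c n * x ^ n) = (\<lambda>n. - ((-1) ^ n / (fact n * fact (n + Suc m)) * x ^ n))"
    by (intro ext) (simp add: diffs_def divide_simps)
  then have "(\<Sum>n. diffs ?c n * x ^ n) = - bes (Suc m) x"
    unfolding bes_def by (simp only: suminf_minus[OF bes_summable])
  ultimately show ?thesis unfolding bes_def by simp
qed

lemma bes_deriv [derivative_intros]:
  assumes "(f has_real_derivative f') (at x within S)"
  shows "((\<lambda>x. bes m (f x)) has_real_derivative - bes (Suc m) (f x) * f') (at x within S)"
  by (rule DERIV_chain2[OF bes_has_derivative assms])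

lemma continuous_on_bes [continuous_intros]: "continuous_on S f \<Longrightarrow> continuous_on S (\<lambda>x. bes m (f x))"
proof -
  have "continuous_on UNIV (bes m)"
    by (intro continuous_at_imp_continuous_on ballI DERIV_isCont[OF bes_has_derivative])
  then show "continuous_on S f \<Longrightarrow> continuous_on S (\<lambda>x. bes m (f x))"
    by (rule continuous_on_compose2) auto
qed

lemma bes_at_0: "bes m 0 = 1 / fact m"
  unfolding bes_def by (subst powser_zero) simp

text \<open>The Bessel recurrence \<open>(2 \<nu> / u) J\<^sub>\<nu> = J\<^sub>\<nu>\<^sub>-\<^sub>1 + J\<^sub>\<nu>\<^sub>+\<^sub>1\<close> for
  \<open>\<nu> = 1\<close>, in the variable \<open>x = u\<^sup>2 / 4\<close>.\<close>

lemma bes_recurrence: "x * bes 2 x = bes 1 x - bes 0 x"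
proof -
  let ?a = "\<lambda>m n. (-1) ^ n / (fact n * fact (n + m)) * x ^ n :: real"
  have "bes 1 x - bes 0 x = (\<Sum>n. ?a 1 n - ?a 0 n)"
    unfolding bes_def by (rule suminf_diff) (rule bes_summable)+
  also have "\<dots> = (\<Sum>n. ?a 1 (Suc n) - ?a 0 (Suc n)) + (?a 1 0 - ?a 0 0)"
    by (subst suminf_split_head) (intro summable_diff bes_summable, simp)
  also have "(\<lambda>n. ?a 1 (Suc n) - ?a 0 (Suc n)) = (\<lambda>n. x * ?a 2 n)"
  proof
    fix n
    have *: "1 / ((y + 1) * F * ((y + 2) * ((y + 1) * F))) - 1 / ((y + 1) * F * ((y + 1) * F)) = - (1 / (F * ((y + 2) * ((y + 1) * F))))"
      if "F > 0" "y \<ge> 0" for F y :: real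
    proof -
      have "(y + 1) * F \<noteq> 0" "(y + 2) * ((y + 1) * F) \<noteq> 0" "F \<noteq> 0" "y + 1 \<noteq> 0" "y + 2 \<noteq> 0" using that by auto
      then show ?thesis by (simp add: divide_simps)
    qed
    have "?a 1 (Suc n) - ?a 0 (Suc n) = (-1) ^ Suc n * x ^ Suc n * (1 / ((real n + 1) * fact n * ((real n + 2) * ((real n + 1) * fact n))) - 1 / ((real n + 1) * fact n * ((real n + 1) * fact n)))"
      by (simp add: algebra_simps)
    also have "\<dots> = x * ?a 2 n"
      unfolding *[of "fact n" "real n", OF fact_gt_zero of_nat_0_le_iff] by (simp add: algebra_simps)
    finally show "?a 1 (Suc n) - ?a 0 (Suc n) = x * ?a 2 n" .
  qed
  also have "(\<Sum>n. x * ?a 2 n) = x * bes 2 x"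
    unfolding bes_def by (rule suminf_mult) (rule bes_summable)
  finally show ?thesis by simp
qed

lemma bessel_J0_bes: "bessel_J0 u = bes 0 (u\<^sup>2 / 4)"
  unfolding bessel_J0_def bes_def
  by (intro suminf_cong) (simp add: power_divide power_mult power2_eq_square[of "fact _"])

definition J1 :: "real \<Rightarrow> real" where "J1 u = u / 2 * bes 1 (u\<^sup>2 / 4)"
text \<open>J1(u)/u with the removable singularity at 0 filled in.\<close>

definition J1_over :: "real \<Rightarrow> real" where "J1_over u = bes 1 (u\<^sup>2 / 4) / 2"

lemma J1_eq: "J1 u = u * J1_over u" by (simp add: J1_def J1_over_def)

lemma J0_deriv [derivative_intros]:
  assumes "(f has_real_derivative f') (at x within S)"
  shows "((\<lambda>x. bessel_J0 (f x)) has_real_derivative - J1 (f x) * f') (at x within S)"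
  unfolding bessel_J0_bes J1_def
  by (rule derivative_eq_intros refl assms | simp)+

lemma J1_deriv [derivative_intros]:
  assumes "(f has_real_derivative f') (at x within S)"
  shows "((\<lambda>x. J1 (f x)) has_real_derivative (bessel_J0 (f x) - J1_over (f x)) * f') (at x within S)"
proof -
  have "((\<lambda>x. J1 (f x)) has_real_derivative (bes 1 ((f x)\<^sup>2 / 4) / 2 - ((f x)\<^sup>2 / 4) * bes 2 ((f x)\<^sup>2 / 4)) * f') (at x within S)"
    unfolding J1_def
    by (rule derivative_eq_intros refl assms | simp add: numeral_2_eq_2 field_simps)+
  then show ?thesis unfolding bes_recurrence bessel_J0_bes J1_over_def by simp
qed

lemma continuous_on_J0 [continuous_intros]: "continuous_on S f \<Longrightarrow> continuous_on S (\<lambda>x. bessel_J0 (f x))"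
  unfolding bessel_J0_bes by (intro continuous_intros) auto
lemma continuous_on_J1 [continuous_intros]: "continuous_on S f \<Longrightarrow> continuous_on S (\<lambda>x. J1 (f x))"
  unfolding J1_def by (intro continuous_intros) auto
lemma continuous_on_J1_over [continuous_intros]: "continuous_on S f \<Longrightarrow> continuous_on S (\<lambda>x. J1_over (f x))"
  unfolding J1_over_def by (intro continuous_intros) auto

lemma J0_minus [simp]: "bessel_J0 (- u) = bessel_J0 u" by (simp add: bessel_J0_bes)
lemma J1_minus [simp]: "J1 (- u) = - J1 u" by (simp add: J1_def)
lemma J0_0 [simp]: "bessel_J0 0 = 1" by (simp add: bessel_J0_bes bes_at_0)
lemma J1_0 [simp]: "J1 0 = 0" by (simp add: J1_def)

text \<open>For positive u the derivative of the sum of squares is -2 J1(u)^2 / u, so the sum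
  decreases from its value 1 at 0.\<close>

lemma J_sum_squares_le_1: "(bessel_J0 u)\<^sup>2 + (J1 u)\<^sup>2 \<le> 1"
proof -
  have "(bessel_J0 v)\<^sup>2 + (J1 v)\<^sup>2 \<le> (bessel_J0 0)\<^sup>2 + (J1 0)\<^sup>2" if "v \<ge> 0" for v
  proof (rule DERIV_nonpos_imp_nonincreasing[OF that])
    fix x :: real assume "0 \<le> x"
    have "((\<lambda>u. (bessel_J0 u)\<^sup>2 + (J1 u)\<^sup>2) has_real_derivative - 2 * J1 x * J1_over x) (at x)"
      by (rule derivative_eq_intros refl | simp add: algebra_simps)+
    moreover have "- 2 * J1 x * J1_over x \<le> 0" using \<open>0 \<le> x\<close> by (simp add: J1_eq mult_nonneg_nonneg flip: power2_eq_square mult.assoc)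
    ultimately show "\<exists>y. ((\<lambda>u. (bessel_J0 u)\<^sup>2 + (J1 u)\<^sup>2) has_real_derivative y) (at x) \<and> y \<le> 0" by blast
  qed
  moreover have "(bessel_J0 \<bar>u\<bar>)\<^sup>2 = (bessel_J0 u)\<^sup>2" "(J1 \<bar>u\<bar>)\<^sup>2 = (J1 u)\<^sup>2" by (auto simp: abs_if)
  ultimately show ?thesis by (metis J0_0 J1_0 abs_ge_zero add.right_neutral one_power2 zero_power2)
qed

lemma J0_abs_le_1: "\<bar>bessel_J0 u\<bar> \<le> 1"
  using J_sum_squares_le_1[of u] zero_le_power2[of "J1 u"] by (simp only: abs_square_le_1[symmetric])

lemma J1_abs_le_1: "\<bar>J1 u\<bar> \<le> 1"
  using J_sum_squares_le_1[of u] zero_le_power2[of "bessel_J0 u"] by (simp only: abs_square_le_1[symmetric])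

section \<open>The primitive of \<open>besh\<close>: boundedness and convergence at infinity\<close>

definition besP :: "real \<Rightarrow> real" where "besP u = u * ((bessel_J0 u)\<^sup>2 + (J1 u)\<^sup>2)"
definition besh :: "real \<Rightarrow> real" where "besh u = (bessel_J0 u)\<^sup>2 - (J1 u)\<^sup>2"

lemma besP_deriv [derivative_intros]:
  assumes "(f has_real_derivative f') (at x within S)"
  shows "((\<lambda>x. besP (f x)) has_real_derivative besh (f x) * f') (at x within S)"
  unfolding besP_def besh_def
  by (rule derivative_eq_intros refl assms | simp add: algebra_simps power2_eq_square J1_eq)+

lemma besP_minus [simp]: "besP (- u) = - besP u" by (simp add: besP_def)
lemma besh_minus [simp]: "besh (- u) = besh u" by (simp add: besh_def)

lemma continuous_on_besh [continuous_intros]: "continuous_on S f \<Longrightarrow> continuous_on S (\<lambda>x. besh (f x))"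
  unfolding besh_def by (intro continuous_intros) auto
lemma continuous_on_besP [continuous_intros]: "continuous_on S f \<Longrightarrow> continuous_on S (\<lambda>x. besP (f x))"
  unfolding besP_def by (intro continuous_intros) auto
lemma besP_measurable [measurable]: "besP \<in> borel_measurable borel" "besh \<in> borel_measurable borel"
  by (auto intro!: borel_measurable_continuous_onI continuous_intros)

text \<open>\<open>besW u\<close> is the energy \<open>v'\<^sup>2 + (1 + 1 / (4 u\<^sup>2)) v\<^sup>2\<close> of \<open>v = \<surd>u J\<^sub>0\<close>, a solution
  of \<open>v'' + (1 + 1 / (4 u\<^sup>2)) v = 0\<close>.\<close>

definition besW :: "real \<Rightarrow> real" where
  "besW u = besP u - bessel_J0 u * J1 u + (bessel_J0 u)\<^sup>2 / (2 * u)"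

lemma besW_deriv:
  assumes "u > 0" shows "(besW has_real_derivative - ((bessel_J0 u)\<^sup>2 / (2 * u\<^sup>2))) (at u)"
proof -
  have "(besW has_real_derivative (besh u - (- J1 u * J1 u + bessel_J0 u * (bessel_J0 u - J1_over u)) +
     (2 * bessel_J0 u * (- J1 u) * (2 * u) - (bessel_J0 u)\<^sup>2 * 2) / (2 * u)\<^sup>2)) (at u)"
    unfolding besW_def
    by (rule derivative_eq_intros refl | use assms in \<open>simp add: algebra_simps power2_eq_square\<close>)+
  also have "(besh u - (- J1 u * J1 u + bessel_J0 u * (bessel_J0 u - J1_over u)) +
     (2 * bessel_J0 u * (- J1 u) * (2 * u) - (bessel_J0 u)\<^sup>2 * 2) / (2 * u)\<^sup>2) = - ((bessel_J0 u)\<^sup>2 / (2 * u\<^sup>2))"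
    using assms by (simp add: besh_def J1_eq field_simps power2_eq_square)
  finally show ?thesis .
qed

lemma besW_nonneg: assumes "u > 0" shows "0 \<le> besW u"
proof -
  have "besW u = u * (J1 u - bessel_J0 u / (2 * u))\<^sup>2 + u * (bessel_J0 u)\<^sup>2 + (bessel_J0 u)\<^sup>2 / (4 * u)"
    using assms by (simp add: besW_def besP_def field_simps power2_eq_square)
  then show ?thesis using assms by simp
qed

lemma besW_antimono: assumes "0 < u" "u \<le> v" shows "besW v \<le> besW u"
proof (rule DERIV_nonpos_imp_nonincreasing[OF assms(2)])
  fix x assume "u \<le> x"
  then have "x > 0" using assms(1) by simp
  then show "\<exists>y. (besW has_real_derivative y) (at x) \<and> y \<le> 0"
    by (intro exI[of _ "- ((bessel_J0 x)\<^sup>2 / (2 * x\<^sup>2))"] conjI besW_deriv) auto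
qed

lemma besP_bounded: obtains C where "C \<ge> 1" "\<And>u. \<bar>besP u\<bar> \<le> C"
proof -
  \<comment> \<open>Beyond 1 the energy is at most \<open>besW 1\<close>, and \<open>besP\<close>
    exceeds the energy by at most the product of the two Bessel functions, which is bounded by
    1.\<close>
  let ?C = "max 1 (besW 1 + 1)"
  have "besP v \<le> ?C" if "v \<ge> 0" for v
  proof (cases "v \<le> 1")
    case True
    then have "besP v \<le> 1 * 1" unfolding besP_def using J_sum_squares_le_1[of v] that by (intro mult_mono) auto
    then show ?thesis by simp
  next
    case False
    then have "besW v \<le> besW 1" by (intro besW_antimono) auto
    moreover have "bessel_J0 v * J1 v \<le> 1"
      using mult_mono[OF J0_abs_le_1[of v] J1_abs_le_1[of v]] abs_ge_self[of "bessel_J0 v * J1 v"] by (simp add: abs_mult)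
    moreover have "0 \<le> (bessel_J0 v)\<^sup>2 / (2 * v)" using False by simp
    ultimately show ?thesis unfolding besW_def by simp
  qed
  moreover have "0 \<le> besP v" if "v \<ge> 0" for v using that by (simp add: besP_def)
  ultimately have "\<bar>besP u\<bar> \<le> ?C" for u
    by (cases "u \<ge> 0") (smt (verit) besP_minus)+
  then show ?thesis by (intro that[of ?C]) auto
qed

lemma J_decay: obtains C where "C \<ge> 1" "\<And>u. \<bar>u\<bar> * ((bessel_J0 u)\<^sup>2 + (J1 u)\<^sup>2) \<le> C"
proof -
  obtain C where C: "C \<ge> 1" "\<And>u. \<bar>besP u\<bar> \<le> C" by (rule besP_bounded) blast
  have "\<bar>u\<bar> * ((bessel_J0 u)\<^sup>2 + (J1 u)\<^sup>2) = \<bar>besP u\<bar>" for u by (simp add: besP_def abs_mult)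
  with C that show ?thesis by metis
qed

lemma J_at_top: "((\<lambda>u. (bessel_J0 u)\<^sup>2 + (J1 u)\<^sup>2) \<longlongrightarrow> 0) at_top"
proof -
  obtain C where C: "C \<ge> 1" "\<And>u. \<bar>u\<bar> * ((bessel_J0 u)\<^sup>2 + (J1 u)\<^sup>2) \<le> C" by (rule J_decay) blast
  show ?thesis
  proof (rule tendsto_sandwich[OF _ _ tendsto_const])
    show "((\<lambda>u::real. C / u) \<longlongrightarrow> 0) at_top" by (intro tendsto_divide_0[OF tendsto_const] filterlim_at_top_imp_at_infinity filterlim_ident)
    show "\<forall>\<^sub>F u in at_top. (bessel_J0 u)\<^sup>2 + (J1 u)\<^sup>2 \<le> C / u"
      using eventually_gt_at_top[of 0]
    proof eventually_elim
      case (elim u)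
      then show ?case using C(2)[of u] by (simp add: pos_le_divide_eq mult.commute)
    qed
  qed auto
qed

lemma J0_at_top: "(bessel_J0 \<longlongrightarrow> 0) at_top"
proof -
  have "((\<lambda>u. (bessel_J0 u)\<^sup>2) \<longlongrightarrow> 0) at_top"
    by (rule tendsto_sandwich[OF _ _ tendsto_const J_at_top]) auto
  then show ?thesis by (simp add: tendsto_null_power)
qed

lemma J1_at_top: "(J1 \<longlongrightarrow> 0) at_top"
proof -
  have "((\<lambda>u. (J1 u)\<^sup>2) \<longlongrightarrow> 0) at_top"
    by (rule tendsto_sandwich[OF _ _ tendsto_const J_at_top]) auto
  then show ?thesis by (simp add: tendsto_null_power)
qed

text \<open>The energy decreases and is nonnegative, hence converges, and it differs from
  \<open>besP\<close> by terms that tend to 0. The value of the limit is identified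
  separately.\<close>

lemma besP_converges: obtains A where "(besP \<longlongrightarrow> A) at_top"
proof -
  \<comment> \<open>Frozen left of 1, where the energy blows up, and negated, so that the function
    is increasing on the whole line and bounded above.\<close>
  define g where "g = (\<lambda>u. - besW (max 1 u))"
  have "mono g" unfolding mono_def g_def
    by (intro allI impI le_imp_neg_le besW_antimono) (auto simp: max_def)
  have "bdd_above (range g)" by (intro bdd_aboveI[of _ 0]) (auto simp: g_def intro!: besW_nonneg)
  have g: "(g \<longlongrightarrow> (SUP u. g u)) at_top"
  proof (rule increasing_tendsto)
    show "\<forall>\<^sub>F u in at_top. g u \<le> (SUP u. g u)"
      by (intro always_eventually allI cSUP_upper \<open>bdd_above (range g)\<close>) auto
    fix x assume "x < (SUP u. g u)"
    then obtain u where "x < g u" using less_cSUP_iff[OF _ \<open>bdd_above (range g)\<close>] by auto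
    show "\<forall>\<^sub>F u in at_top. x < g u"
      using eventually_ge_at_top[of u]
    proof eventually_elim
      case (elim v)
      then show ?case using \<open>x < g u\<close> monoD[OF \<open>mono g\<close>, of u v] by simp
    qed
  qed
  have "(besP \<longlongrightarrow> - (SUP u. g u) + 0 * 0 - 0) at_top"
  proof (rule Lim_transform_eventually)
    show "((\<lambda>u. - g u + bessel_J0 u * J1 u - (bessel_J0 u)\<^sup>2 / (2 * u)) \<longlongrightarrow> - (SUP u. g u) + 0 * 0 - 0) at_top"
    proof (intro tendsto_intros g J0_at_top J1_at_top tendsto_divide_0)
      show "((\<lambda>u. (bessel_J0 u)\<^sup>2) \<longlongrightarrow> 0\<^sup>2) at_top" by (intro tendsto_intros J0_at_top)
      show "filterlim (\<lambda>u::real. 2 * u) at_infinity at_top"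
        by (intro filterlim_at_top_imp_at_infinity filterlim_tendsto_pos_mult_at_top[OF tendsto_const] filterlim_ident) auto
    qed
    show "\<forall>\<^sub>F u in at_top. - g u + bessel_J0 u * J1 u - (bessel_J0 u)\<^sup>2 / (2 * u) = besP u"
      using eventually_ge_at_top[of 1] by eventually_elim (auto simp: g_def besW_def max_def)
  qed
  then show ?thesis by (rule that)
qed

section \<open>The limit of \<open>besP\<close>, through Catalan numbers (\<open>cat\<close>) and
  the quarter circle\<close>

definition cat :: "nat \<Rightarrow> real" where "cat j = fact (2 * j) / (fact j * fact (Suc j))"

lemma cat_nonneg: "0 \<le> cat j" by (simp add: cat_def)

lemma cat_le: "cat j \<le> 4 ^ j"
proof -
  have "cat j = real (2 * j choose j) / (real j + 1)"
    unfolding cat_def by (subst binomial_fact) (auto simp: field_simps)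
  also have "\<dots> \<le> real (2 * j choose j) / 1" by (intro divide_left_mono) auto
  also have "\<dots> \<le> real (2 ^ (2 * j))" by (simp only: div_by_1 of_nat_le_iff binomial_le_pow2)
  finally show ?thesis by (simp add: power_mult)
qed

lemma cat_Suc: "cat (Suc j) * (2 * real j + 4) = cat j * (4 * (2 * real j + 1))"
proof -
  have "(2 * Suc j) = Suc (Suc (2 * j))" by simp
  then have f: "fact (2 * Suc j) = (2 * real j + 2) * (2 * real j + 1) * (fact (2 * j) :: real)"
    by (simp add: algebra_simps)
  have "(real j + 1) * fact j \<noteq> (0::real)" "(real j + 2) * ((real j + 1) * fact j) \<noteq> (0::real)" "real j + 1 \<noteq> 0" "real j + 2 \<noteq> 0" by auto
  moreover have "fact (Suc j) = (real j + 1) * (fact j :: real)" "fact (Suc (Suc j)) = (real j + 2) * ((real j + 1) * (fact j :: real))"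
    by (simp_all add: algebra_simps)
  ultimately show ?thesis
    unfolding cat_def f by (simp add: divide_simps) (simp add: algebra_simps)
qed

text \<open>Cauchy product; after extracting the factorials of \<open>Suc k\<close> its coefficients
  are Vandermonde sums.\<close>

lemma bes_1_squared:
  "(bes 1 x)\<^sup>2 = (\<Sum>j. (-1) ^ j * real ((2 * j + 2) choose j) / (fact (Suc j))\<^sup>2 * x ^ j)"
proof -
  let ?a = "\<lambda>n. (-1) ^ n / (fact n * fact (n + 1)) * x ^ n"
  have s: "summable (\<lambda>n. norm (?a n))"
    using summable_power_series_fact_bound[of "\<lambda>n. \<bar>(-1) ^ n / (fact n * fact (n + 1))\<bar>" 1 "\<bar>x\<bar>"] bes_coeff_bound[of _ 1]
    by (simp add: abs_mult power_abs)
  have "(bes 1 x)\<^sup>2 = (\<Sum>k. \<Sum>i\<le>k. ?a i * ?a (k - i))"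
    unfolding power2_eq_square bes_def by (rule Cauchy_product[OF s s])
  also have "\<dots> = (\<Sum>j. (-1) ^ j * real ((2 * j + 2) choose j) / (fact (Suc j))\<^sup>2 * x ^ j)"
  proof (rule suminf_cong)
    fix k
    have "(\<Sum>i\<le>k. ?a i * ?a (k - i)) = (\<Sum>i\<le>k. (-1) ^ k * x ^ k / (fact (Suc k))\<^sup>2 * real ((Suc k choose i) * (Suc k choose (k - i))))"
    proof (intro sum.cong refl)
      fix i assume "i \<in> {..k}"
      then have i: "i \<le> k" by simp
      have 1: "real (Suc k choose i) = fact (Suc k) / (fact i * fact (k - i + 1))"
        using i by (subst binomial_fact) (auto simp: Suc_diff_le)
      have 2: "real (Suc k choose (k - i)) = fact (Suc k) / (fact (k - i) * fact (i + 1))"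
        using i by (subst binomial_fact) auto
      have "(-1) ^ i * (-1) ^ (k - i) = ((-1) ^ k :: real)" "x ^ i * x ^ (k - i) = x ^ k"
        using i by (simp_all flip: power_add)
      then have "?a i * ?a (k - i) = (-1) ^ k * x ^ k / ((fact i * fact (k - i + 1)) * (fact (k - i) * fact (i + 1)))"
        by (simp add: mult_ac)
      also have "\<dots> = (-1) ^ k * x ^ k / (fact (Suc k))\<^sup>2 * real ((Suc k choose i) * (Suc k choose (k - i)))"
        unfolding of_nat_mult 1 2 power2_eq_square by (simp del: fact_Suc)
      finally show "?a i * ?a (k - i) = (-1) ^ k * x ^ k / (fact (Suc k))\<^sup>2 * real ((Suc k choose i) * (Suc k choose (k - i)))" .
    qed
    also have "\<dots> = (-1) ^ k * x ^ k / (fact (Suc k))\<^sup>2 * real ((Suc k + Suc k) choose k)"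
      by (simp only: sum_distrib_left[symmetric] of_nat_sum[symmetric] vandermonde)
    also have "Suc k + Suc k = 2 * k + 2" by simp
    finally show "(\<Sum>i\<le>k. ?a i * ?a (k - i)) = (-1) ^ k * real ((2 * k + 2) choose k) / (fact (Suc k))\<^sup>2 * x ^ k"
      by (simp add: mult_ac)
  qed
  finally show ?thesis .
qed

text \<open>At x = u^2/4 the left side is J0(u)^2 + J1(u)^2. By the recurrence its derivative in x
  is minus the square of \<open>bes 1\<close>, and the series on the right has the same derivative;
  both sides equal 1 at 0.\<close>

lemma J_squares_series:
  "(bes 0 x)\<^sup>2 + x * (bes 1 x)\<^sup>2 = (\<Sum>j. (-1) ^ j * cat j / (fact j)\<^sup>2 * x ^ j)"
proof -
  let ?c = "\<lambda>j. (-1) ^ j * cat j / (fact j)\<^sup>2 :: real"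
  define f where "f = (\<lambda>x. (bes 0 x)\<^sup>2 + x * (bes 1 x)\<^sup>2)"
  define g where "g = (\<lambda>x. \<Sum>j. ?c j * x ^ j)"
  have s: "summable (\<lambda>j. ?c j * x ^ j)" for x
  proof (rule summable_power_series_fact_bound)
    fix n
    have "cat n \<le> 4 ^ n * fact n" using cat_le[of n] by (rule order_trans) simp
    then show "\<bar>?c n\<bar> \<le> 4 ^ n / fact n"
      using cat_nonneg[of n] by (simp add: abs_mult power2_eq_square field_simps)
  qed
  have f': "(f has_real_derivative - (bes 1 x)\<^sup>2) (at x)" for x
  proof -
    have "(f has_real_derivative (2 * bes 0 x * (- bes 1 x) + ((bes 1 x)\<^sup>2 + 2 * bes 1 x * (- (x * bes 2 x))))) (at x)"
      unfolding f_def by (rule derivative_eq_intros refl | simp add: algebra_simps numeral_2_eq_2)+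
    then show ?thesis unfolding bes_recurrence by (simp add: algebra_simps power2_eq_square)
  qed
  have g': "(g has_real_derivative - (bes 1 x)\<^sup>2) (at x)" for x
  proof -
    have "(g has_real_derivative (\<Sum>n. diffs ?c n * x ^ n)) (at x)"
      unfolding g_def by (rule termdiffs_strong_converges_everywhere) (rule s)
    moreover have "diffs ?c n = - ((-1) ^ n * real ((2 * n + 2) choose n) / (fact (Suc n))\<^sup>2)" for n
    proof -
      have 1: "real ((2 * n + 2) choose n) = fact (2 * n + 2) / (fact n * fact (n + 2))"
        by (subst binomial_fact) (auto simp: numeral_2_eq_2)
      have 2: "cat (Suc n) = fact (2 * n + 2) / (fact (Suc n) * fact (n + 2))"
        by (simp add: cat_def del: fact_Suc)
      have 3: "real (Suc n) / fact (Suc n) = 1 / (fact n :: real)" by simp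
      have "diffs ?c n = - ((-1) ^ n * fact (2 * n + 2) / fact (n + 2) / (fact (Suc n))\<^sup>2 * (real (Suc n) / fact (Suc n)))"
        unfolding diffs_def 2 by (simp add: mult_ac del: fact_Suc)
      then show ?thesis unfolding 3 1 by (simp add: mult_ac del: fact_Suc)
    qed
    moreover have "summable (\<lambda>n. (-1) ^ n * real ((2 * n + 2) choose n) / (fact (Suc n))\<^sup>2 * x ^ n)"
    proof -
      have "summable (\<lambda>n. - (diffs ?c n * x ^ n))"
        by (intro summable_minus termdiff_converges_all s)
      then show ?thesis unfolding \<open>\<And>n. diffs ?c n = _ n\<close> by simp
    qed
    ultimately show ?thesis unfolding bes_1_squared by (simp add: suminf_minus)
  qed
  have "((\<lambda>x. f x - g x) has_real_derivative 0) (at x)" for x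
    using DERIV_diff[OF f' g'] by simp
  then have "f x - g x = f 0 - g 0" for x
    using DERIV_isconst_all[of "\<lambda>x. f x - g x"] by blast
  moreover have "f 0 = 1" by (simp add: f_def bes_at_0)
  moreover have "g 0 = 1" unfolding g_def by (subst powser_zero) (simp add: cat_def)
  ultimately have "f x = g x" by simp
  then show ?thesis by (simp add: f_def g_def)
qed

text \<open>The even moments of the quarter circle are Catalan numbers up to powers of 4. The
  induction is the two-term recursion \<open>cat_Suc\<close>, which integration by parts
  reproduces.\<close>

lemma semicircle_moment: "((\<lambda>x. x ^ (2 * j) * sqrt (1 - x\<^sup>2)) has_integral (pi / 4 * cat j / 4 ^ j)) {0..1::real}"
proof (induction j)
  case 0
  have "((\<lambda>x. sqrt (1 - x\<^sup>2)) has_integral ((1 * sqrt (1 - 1\<^sup>2) + arcsin 1) / 2 - (0 * sqrt (1 - 0\<^sup>2) + arcsin 0) / 2)) {0..1::real}"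
  proof (rule fundamental_theorem_of_calculus_interior)
    fix x :: real assume x: "x \<in> {0<..<1}"
    then have "x\<^sup>2 < 1" by (simp add: abs_square_less_1)
    then have p: "1 - x\<^sup>2 > 0" by simp
    have "((\<lambda>x. (x * sqrt (1 - x\<^sup>2) + arcsin x) / 2) has_real_derivative
        (sqrt (1 - x\<^sup>2) + x * (- (2 * x) * (inverse (sqrt (1 - x\<^sup>2)) / 2)) + inverse (sqrt (1 - x\<^sup>2))) / 2) (at x)"
      using x p by (auto intro!: derivative_eq_intros)
    also have "(sqrt (1 - x\<^sup>2) + x * (- (2 * x) * (inverse (sqrt (1 - x\<^sup>2)) / 2)) + inverse (sqrt (1 - x\<^sup>2))) / 2
       = (sqrt (1 - x\<^sup>2) + (1 - x\<^sup>2) / sqrt (1 - x\<^sup>2)) / 2"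
      by (simp add: diff_divide_distrib inverse_eq_divide power2_eq_square)
    also have "\<dots> = sqrt (1 - x\<^sup>2)" using p by (simp add: real_div_sqrt)
    finally show "((\<lambda>x. (x * sqrt (1 - x\<^sup>2) + arcsin x) / 2) has_vector_derivative sqrt (1 - x\<^sup>2)) (at x)"
      by (simp add: has_real_derivative_iff_has_vector_derivative)
  qed (auto intro!: continuous_intros)
  then show ?case by (simp add: cat_def)
next
  case (Suc j)
  \<comment> \<open>The primitive is x^(2j+1) (1 - x^2)^(3/2). It vanishes at both ends, which
    relates the moments of orders 2j and 2j + 2.\<close>
  have "((\<lambda>x. (2 * real j + 1) * (x ^ (2 * j) * sqrt (1 - x\<^sup>2)) - (2 * real j + 4) * (x ^ (2 * Suc j) * sqrt (1 - x\<^sup>2))) has_integral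
     (1 ^ (2 * j + 1) * (1 - 1\<^sup>2) * sqrt (1 - 1\<^sup>2) - 0 ^ (2 * j + 1) * (1 - 0\<^sup>2) * sqrt (1 - 0\<^sup>2))) {0..1::real}"
  proof (rule fundamental_theorem_of_calculus_interior)
    fix x :: real assume x: "x \<in> {0<..<1}"
    then have "x\<^sup>2 < 1" by (simp add: abs_square_less_1)
    then have p: "1 - x\<^sup>2 > 0" by simp
    have D1: "((\<lambda>x. x ^ (2 * j + 1)) has_real_derivative (2 * real j + 1) * x ^ (2 * j)) (at x)"
      using DERIV_pow[of "2 * j + 1" x UNIV] by (simp add: mult_ac add_ac)
    have D2: "((\<lambda>x. 1 - x\<^sup>2) has_real_derivative - (2 * x)) (at x)"
      by (auto intro!: derivative_eq_intros)
    have D3: "((\<lambda>x. sqrt (1 - x\<^sup>2)) has_real_derivative - (2 * x) * (inverse (sqrt (1 - x\<^sup>2)) / 2)) (at x)"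
      using p by (auto intro!: derivative_eq_intros)
    have "((\<lambda>x. x ^ (2 * j + 1) * (1 - x\<^sup>2) * sqrt (1 - x\<^sup>2)) has_real_derivative
        (((2 * real j + 1) * x ^ (2 * j)) * (1 - x\<^sup>2) + x ^ (2 * j + 1) * (- (2 * x))) * sqrt (1 - x\<^sup>2)
          + x ^ (2 * j + 1) * (1 - x\<^sup>2) * (- (2 * x) * (inverse (sqrt (1 - x\<^sup>2)) / 2))) (at x)"
      using DERIV_mult[OF DERIV_mult[OF D1 D2] D3] by (simp add: mult_ac add_ac)
    also have "x ^ (2 * j + 1) * (1 - x\<^sup>2) * (- (2 * x) * (inverse (sqrt (1 - x\<^sup>2)) / 2))
       = - (x ^ (2 * Suc j) * ((1 - x\<^sup>2) / sqrt (1 - x\<^sup>2)))"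
      by (simp add: field_simps)
    also have "(1 - x\<^sup>2) / sqrt (1 - x\<^sup>2) = sqrt (1 - x\<^sup>2)" using p by (simp add: real_div_sqrt)
    also have "(((2 * real j + 1) * x ^ (2 * j)) * (1 - x\<^sup>2) + x ^ (2 * j + 1) * (- (2 * x))) * sqrt (1 - x\<^sup>2) + - (x ^ (2 * Suc j) * sqrt (1 - x\<^sup>2))
      = (2 * real j + 1) * (x ^ (2 * j) * sqrt (1 - x\<^sup>2)) - (2 * real j + 4) * (x ^ (2 * Suc j) * sqrt (1 - x\<^sup>2))"
      by (simp add: algebra_simps power2_eq_square)
    finally show "((\<lambda>x. x ^ (2 * j + 1) * (1 - x\<^sup>2) * sqrt (1 - x\<^sup>2)) has_vector_derivative
      ((2 * real j + 1) * (x ^ (2 * j) * sqrt (1 - x\<^sup>2)) - (2 * real j + 4) * (x ^ (2 * Suc j) * sqrt (1 - x\<^sup>2)))) (at x)"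
      by (simp add: has_real_derivative_iff_has_vector_derivative)
  qed (auto intro!: continuous_intros)
  then have "((\<lambda>x. (2 * real j + 1) * (x ^ (2 * j) * sqrt (1 - x\<^sup>2)) - ((2 * real j + 1) * (x ^ (2 * j) * sqrt (1 - x\<^sup>2)) - (2 * real j + 4) * (x ^ (2 * Suc j) * sqrt (1 - x\<^sup>2))))
     has_integral ((2 * real j + 1) * (pi / 4 * cat j / 4 ^ j) - 0)) {0..1::real}"
    by (intro has_integral_diff has_integral_mult_right Suc) simp
  then have "((\<lambda>x. (2 * real j + 4) * (x ^ (2 * Suc j) * sqrt (1 - x\<^sup>2))) has_integral ((2 * real j + 1) * (pi / 4 * cat j / 4 ^ j))) {0..1}"
    by simp
  then have "((\<lambda>x. (1 / (2 * real j + 4)) * ((2 * real j + 4) * (x ^ (2 * Suc j) * sqrt (1 - x\<^sup>2)))) has_integral (1 / (2 * real j + 4)) * ((2 * real j + 1) * (pi / 4 * cat j / 4 ^ j))) {0..1}"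
    by (rule has_integral_mult_right)
  moreover have "(1 / (2 * real j + 4)) * ((2 * real j + 1) * (pi / 4 * cat j / 4 ^ j)) = pi / 4 * cat (Suc j) / 4 ^ Suc j"
  proof -
    have "2 * real j + 4 \<noteq> 0" by simp
    then show ?thesis using cat_Suc[of j] by (simp add: divide_simps) (simp add: algebra_simps)
  qed
  moreover have "2 * real j + 4 \<noteq> 0" by simp
  ultimately show ?case by simp
qed

lemma gaussian_odd_moment:
  "has_bochner_integral lborel (\<lambda>x::real. indicator {0..} x *\<^sub>R (exp (- x\<^sup>2) * x ^ (2 * k + 1))) (fact k / 2)"
  using gaussian_moment_odd_pos[of k] by simp

text \<open>Termwise integration: the Gaussian moment j!/2 cancels one of the two factorials in the
  coefficient of J0^2 + J1^2. The factor w is chosen so that the integrand contains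
  \<open>besP (2 * m * w)\<close>; the integral is a Gaussian average of \<open>besP\<close> at
  scale m.\<close>

lemma weber_series:
  fixes m :: real
  shows "(\<integral>w. indicator {0..} w * (2 * w * exp (- w\<^sup>2) * ((bessel_J0 (2 * m * w))\<^sup>2 + (J1 (2 * m * w))\<^sup>2)) \<partial>lborel)
     = (\<Sum>j. (- 1) ^ j * cat j * (m\<^sup>2) ^ j / fact j)"
proof -
  define f where "f = (\<lambda>j w. ((- 1) ^ j * cat j / (fact j)\<^sup>2 * (m\<^sup>2) ^ j * 2) * (indicator {0..} w * (exp (- w\<^sup>2) * w ^ (2 * j + 1))) :: real)"
  have f: "has_bochner_integral lborel (f j) ((- 1) ^ j * cat j * (m\<^sup>2) ^ j / fact j)" for j
  proof -
    have "has_bochner_integral lborel (f j) (((- 1) ^ j * cat j / (fact j)\<^sup>2 * (m\<^sup>2) ^ j * 2) * (fact j / 2))"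
      unfolding f_def using gaussian_odd_moment[of j] by (intro has_bochner_integral_mult_right) simp
    then show ?thesis by (simp add: power2_eq_square mult_ac)
  qed
  have nf: "has_bochner_integral lborel (\<lambda>w. norm (f j w)) (cat j * (m\<^sup>2) ^ j / fact j)" for j
  proof -
    have "(\<lambda>w. norm (f j w)) = (\<lambda>w. (cat j / (fact j)\<^sup>2 * (m\<^sup>2) ^ j * 2) * (indicator {0..} w * (exp (- w\<^sup>2) * w ^ (2 * j + 1))))"
      unfolding f_def by (intro ext) (auto simp: abs_mult cat_nonneg power_abs indicator_def)
    moreover have "has_bochner_integral lborel (\<lambda>w. (cat j / (fact j)\<^sup>2 * (m\<^sup>2) ^ j * 2) * (indicator {0..} w * (exp (- w\<^sup>2) * w ^ (2 * j + 1)))) ((cat j / (fact j)\<^sup>2 * (m\<^sup>2) ^ j * 2) * (fact j / 2))"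
      using gaussian_odd_moment[of j] by (intro has_bochner_integral_mult_right) simp
    ultimately show ?thesis by (simp add: power2_eq_square mult_ac)
  qed
  have cs: "summable (\<lambda>j. cat j / (fact j)\<^sup>2 * x ^ j)" for x
  proof (rule summable_power_series_fact_bound)
    fix n
    have "cat n \<le> 4 ^ n * fact n" using cat_le[of n] by (rule order_trans) simp
    then show "\<bar>cat n / (fact n)\<^sup>2\<bar> \<le> 4 ^ n / fact n"
      using cat_nonneg[of n] by (simp add: abs_mult power2_eq_square field_simps)
  qed
  have sum_f: "(\<Sum>j. f j w) = indicator {0..} w * (2 * w * exp (- w\<^sup>2) * ((bessel_J0 (2 * m * w))\<^sup>2 + (J1 (2 * m * w))\<^sup>2))" for w
  proof -
    let ?x = "m\<^sup>2 * w\<^sup>2"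
    have s: "summable (\<lambda>j. (- 1) ^ j * cat j / (fact j)\<^sup>2 * ?x ^ j)"
      by (rule summable_norm_cancel) (use cs[of ?x] in \<open>simp add: abs_mult cat_nonneg power_abs\<close>)
    have e: "w ^ (2 * j + 1) = w * (w\<^sup>2) ^ j" for j by (simp add: power_mult)
    have "f j w = (indicator {0..} w * (2 * w * exp (- w\<^sup>2))) * ((- 1) ^ j * cat j / (fact j)\<^sup>2 * ?x ^ j)" for j
      unfolding f_def e by (simp add: power_mult_distrib mult_ac)
    then have "(\<Sum>j. f j w) = (indicator {0..} w * (2 * w * exp (- w\<^sup>2))) * ((bes 0 ?x)\<^sup>2 + ?x * (bes 1 ?x)\<^sup>2)"
      unfolding J_squares_series using suminf_mult[OF s] by simp
    moreover have "(2 * m * w)\<^sup>2 / 4 = ?x" by (simp add: power_mult_distrib)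
    ultimately show ?thesis
      unfolding bessel_J0_bes J1_def by (simp add: power_mult_distrib mult_ac)
  qed
  have "(\<integral>w. (\<Sum>j. f j w) \<partial>lborel) = (\<Sum>j. \<integral>w. f j w \<partial>lborel)"
  proof (rule integral_suminf)
    show "AE w in lborel. summable (\<lambda>j. norm (f j w))"
    proof (rule AE_I2)
      fix w :: real
      have e: "w ^ (2 * j + 1) = w * (w\<^sup>2) ^ j" for j by (simp add: power_mult)
      have "norm (f j w) = (indicator {0..} w * (2 * w * exp (- w\<^sup>2))) * (cat j / (fact j)\<^sup>2 * (m\<^sup>2 * w\<^sup>2) ^ j)" for j
        unfolding f_def e by (auto simp: power_mult_distrib abs_mult cat_nonneg power_abs indicator_def)
      then show "summable (\<lambda>j. norm (f j w))" using summable_mult[OF cs] by simp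
    qed
    have "summable (\<lambda>j. cat j / fact j * (m\<^sup>2) ^ j)"
      by (rule summable_power_series_fact_bound[of _ 4]) (use cat_le cat_nonneg in \<open>auto intro!: divide_right_mono\<close>)
    moreover have "(\<lambda>j. \<integral>w. norm (f j w) \<partial>lborel) = (\<lambda>j. cat j * (m\<^sup>2) ^ j / fact j)"
      by (intro ext has_bochner_integral_integral_eq nf)
    ultimately show "summable (\<lambda>j. \<integral>w. norm (f j w) \<partial>lborel)" by simp
  qed (use f in \<open>auto simp: has_bochner_integral_iff\<close>)
  also have "(\<lambda>j. \<integral>w. f j w \<partial>lborel) = (\<lambda>j. (- 1) ^ j * cat j * (m\<^sup>2) ^ j / fact j)"
    by (intro ext has_bochner_integral_integral_eq f)
  finally show ?thesis unfolding sum_f .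
qed

text \<open>Expanding the exponential and inserting the quarter circle moments yields the series of
  the Weber integral again. So the Gaussian average of \<open>besP\<close> is a Laplace integral
  whose behaviour for large m is elementary.\<close>

lemma semicircle_series:
  fixes m :: real
  shows "4 / pi * (\<integral>x. indicator {0..1} x * (sqrt (1 - x\<^sup>2) * exp (- (2 * m * x)\<^sup>2)) \<partial>lborel) = (\<Sum>j. (- 1) ^ j * cat j * (m\<^sup>2) ^ j / fact j)"
proof -
  define f where "f = (\<lambda>j x. ((- 4 * m\<^sup>2) ^ j / fact j) * (indicator {0..1} x * (x ^ (2 * j) * sqrt (1 - x\<^sup>2))) :: real)"
  have base: "has_bochner_integral lborel (\<lambda>x::real. indicator {0..1} x * (x ^ (2 * j) * sqrt (1 - x\<^sup>2))) (pi / 4 * cat j / 4 ^ j)" for j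
  proof -
    have "set_integrable lborel {0..1} (\<lambda>x::real. x ^ (2 * j) * sqrt (1 - x\<^sup>2))"
      by (rule borel_integrable_atLeastAtMost') (auto intro!: continuous_intros)
    then show ?thesis
      using set_borel_integral_eq_integral(2)[OF \<open>set_integrable _ _ _\<close>] integral_unique[OF semicircle_moment[of j]]
      by (simp add: has_bochner_integral_iff set_integrable_def set_lebesgue_integral_def)
  qed
  have f: "has_bochner_integral lborel (f j) ((- 4 * m\<^sup>2) ^ j / fact j * (pi / 4 * cat j / 4 ^ j))" for j
    unfolding f_def by (intro has_bochner_integral_mult_right base)
  have nf: "has_bochner_integral lborel (\<lambda>w. norm (f j w)) ((4 * m\<^sup>2) ^ j / fact j * (pi / 4 * cat j / 4 ^ j))" for j
  proof -
    have eq: "(\<lambda>w. norm (f j w)) = (\<lambda>x. ((4 * m\<^sup>2) ^ j / fact j) * (indicator {0..1} x * (x ^ (2 * j) * sqrt (1 - x\<^sup>2))))"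
      unfolding f_def by (intro ext) (auto simp: abs_mult power_abs indicator_def abs_square_le_1)
    show ?thesis unfolding eq by (rule has_bochner_integral_mult_right[OF base])
  qed
  have sum_f: "(\<Sum>j. f j x) = indicator {0..1} x * (sqrt (1 - x\<^sup>2) * exp (- (2 * m * x)\<^sup>2))" for x
  proof -
    have s: "summable (\<lambda>j. inverse (fact j) * (- (2 * m * x)\<^sup>2) ^ j)" by (rule summable_exp)
    have "f j x = (indicator {0..1} x * sqrt (1 - x\<^sup>2)) * (inverse (fact j) * (- (2 * m * x)\<^sup>2) ^ j)" for j
    proof -
      have "- (2 * m * x)\<^sup>2 = (- 4 * m\<^sup>2) * x\<^sup>2" by (simp add: power_mult_distrib)
      then have "(- (2 * m * x)\<^sup>2) ^ j = (- 4 * m\<^sup>2) ^ j * x ^ (2 * j)"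
        by (simp only: power_mult_distrib power_mult)
      then show ?thesis by (simp add: f_def divide_inverse mult_ac)
    qed
    then show ?thesis unfolding exp_def using suminf_mult[OF s] by (simp add: divideR_right scaleR_conv_of_real)
  qed
  have "(\<integral>w. (\<Sum>j. f j w) \<partial>lborel) = (\<Sum>j. \<integral>w. f j w \<partial>lborel)"
  proof (rule integral_suminf)
    show "AE x in lborel. summable (\<lambda>j. norm (f j x))"
    proof (rule AE_I2)
      fix x :: real
      have e: "x ^ (2 * j) = (x\<^sup>2) ^ j" for j by (simp add: power_mult)
      have e': "norm (f j x) = \<bar>indicator {0..1} x * sqrt (1 - x\<^sup>2)\<bar> * (inverse (fact j) * (4 * m\<^sup>2 * x\<^sup>2) ^ j)" for j
        unfolding f_def e by (simp add: divide_inverse abs_mult power_abs power_mult_distrib mult_ac)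
      show "summable (\<lambda>j. norm (f j x))" unfolding e' by (intro summable_mult summable_exp)
    qed
    have "summable (\<lambda>j. pi / 4 * (cat j / fact j * (m\<^sup>2) ^ j))"
      by (intro summable_mult summable_power_series_fact_bound[of _ 4]) (use cat_le cat_nonneg in \<open>auto intro!: divide_right_mono\<close>)
    moreover have "(\<lambda>j. \<integral>w. norm (f j w) \<partial>lborel) = (\<lambda>j. (4 * m\<^sup>2) ^ j / fact j * (pi / 4 * cat j / 4 ^ j))"
      by (intro ext has_bochner_integral_integral_eq nf)
    ultimately show "summable (\<lambda>j. \<integral>w. norm (f j w) \<partial>lborel)" by (simp add: power_mult_distrib mult_ac)
  qed (use f in \<open>auto simp: has_bochner_integral_iff\<close>)
  then have "(\<integral>x. indicator {0..1} x * (sqrt (1 - x\<^sup>2) * exp (- (2 * m * x)\<^sup>2)) \<partial>lborel) = (\<Sum>j. pi / 4 * ((- 1) ^ j * cat j * (m\<^sup>2) ^ j / fact j))"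
  proof -
    have "(- 4 * m\<^sup>2) ^ j / fact j * (pi / 4 * cat j / 4 ^ j) = pi / 4 * ((- 1) ^ j * cat j * (m\<^sup>2) ^ j / fact j)" for j
    proof -
      have "(- 4 * m\<^sup>2) ^ j = (- 1) ^ j * 4 ^ j * (m\<^sup>2) ^ j" by (simp flip: power_mult_distrib)
      then show ?thesis by (simp add: mult_ac)
    qed
    moreover have "(\<lambda>j. \<integral>w. f j w \<partial>lborel) = (\<lambda>j. (- 4 * m\<^sup>2) ^ j / fact j * (pi / 4 * cat j / 4 ^ j))"
      by (intro ext has_bochner_integral_integral_eq f)
    ultimately show ?thesis using \<open>(\<integral>w. (\<Sum>j. f j w) \<partial>lborel) = _\<close> unfolding sum_f by (simp only:)
  qed
  moreover have s: "summable (\<lambda>j. (- 1) ^ j * cat j * (m\<^sup>2) ^ j / fact j)"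
  proof (rule summable_norm_cancel)
    have "summable (\<lambda>j. cat j / fact j * (m\<^sup>2) ^ j)"
      by (rule summable_power_series_fact_bound[of _ 4]) (use cat_le cat_nonneg in \<open>auto intro!: divide_right_mono\<close>)
    then show "summable (\<lambda>j. norm ((- 1) ^ j * cat j * (m\<^sup>2) ^ j / fact j))"
      by (simp add: abs_mult cat_nonneg power_abs)
  qed
  ultimately have "(\<integral>x. indicator {0..1} x * (sqrt (1 - x\<^sup>2) * exp (- (2 * m * x)\<^sup>2)) \<partial>lborel) = pi / 4 * (\<Sum>j. (- 1) ^ j * cat j * (m\<^sup>2) ^ j / fact j)"
    by (simp only: suminf_mult[OF s])
  moreover have "4 / pi * (pi / 4 * x) = x" for x :: real by simp
  ultimately show ?thesis by (simp only:)
qed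

lemma gaussian_average_besP:
  assumes "(besP \<longlongrightarrow> A) at_top"
  shows "(\<lambda>n. \<integral>w. indicator {0..} w * (exp (- w\<^sup>2) * besP (2 * real n * w)) \<partial>lborel) \<longlonglongrightarrow> A * (sqrt pi / 2)"
proof -
  obtain C where C: "C \<ge> 1" "\<And>u. \<bar>besP u\<bar> \<le> C" by (rule besP_bounded) blast
  have g: "has_bochner_integral lborel (\<lambda>x::real. indicator {0..} x * exp (- x\<^sup>2)) (sqrt pi / 2)"
    using gaussian_moment_0 by simp
  have "(\<lambda>n. \<integral>w. indicator {0..} w * (exp (- w\<^sup>2) * besP (2 * real n * w)) \<partial>lborel) \<longlonglongrightarrow> (\<integral>w. A * (indicator {0..} w * exp (- w\<^sup>2)) \<partial>lborel)"
  proof (rule integral_dominated_convergence[where w = "\<lambda>w. C * (indicator {0..} w * exp (- w\<^sup>2))"])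
    show "integrable lborel (\<lambda>w::real. C * (indicator {0..} w * exp (- w\<^sup>2)))"
      using g by (auto simp: has_bochner_integral_iff)
    have "(\<lambda>n. besP (2 * real n * w)) \<longlonglongrightarrow> A" if "w > 0" for w :: real
    proof (rule filterlim_compose[OF assms])
      have "filterlim (\<lambda>n. (2 * w) * real n) at_top sequentially"
        by (rule filterlim_tendsto_pos_mult_at_top[OF tendsto_const]) (use that filterlim_real_sequentially in auto)
      then show "filterlim (\<lambda>n. 2 * real n * w) at_top sequentially" by (simp add: mult_ac)
    qed
    then have "(\<lambda>n. indicator {0..} w * (exp (- w\<^sup>2) * besP (2 * real n * w))) \<longlonglongrightarrow> A * (indicator {0..} w * exp (- w\<^sup>2))" if "w \<noteq> 0" for w :: real
    proof (cases "w > 0")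
      case True
      then show ?thesis using \<open>w > 0 \<Longrightarrow> _\<close>[OF True]
        by (auto intro!: tendsto_eq_intros)
    qed (use that in auto)
    then show "AE w in lborel. (\<lambda>n. indicator {0..} w * (exp (- w\<^sup>2) * besP (2 * real n * w))) \<longlonglongrightarrow> A * (indicator {0..} w * exp (- w\<^sup>2))"
      using AE_lborel_singleton[of "0::real"] by (auto elim: eventually_mono)
    show "AE w in lborel. norm (indicator {0..} w * (exp (- w\<^sup>2) * besP (2 * real n * w))) \<le> C * (indicator {0..} w * exp (- w\<^sup>2))" for n
    proof (rule AE_I2)
      fix w :: real
      have "indicator {0..} w * (exp (- w\<^sup>2) * \<bar>besP (2 * real n * w)\<bar>) \<le> indicator {0..} w * (exp (- w\<^sup>2) * C)"
        using C(2) by (intro mult_left_mono) auto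
      then show "norm (indicator {0..} w * (exp (- w\<^sup>2) * besP (2 * real n * w))) \<le> C * (indicator {0..} w * exp (- w\<^sup>2))"
        by (simp add: abs_mult mult_ac)
    qed
  qed measurable
  then show ?thesis by (simp add: has_bochner_integral_integral_eq[OF g])
qed

text \<open>The substitution w = 2 n x spreads the quarter circle over the half line, where its
  density tends to 1 and the Gaussian dominates.\<close>

lemma gaussian_average_semicircle:
  "(\<lambda>n. 2 * real n * (\<integral>x. indicator {0..1} x * (sqrt (1 - x\<^sup>2) * exp (- (2 * real n * x)\<^sup>2)) \<partial>lborel)) \<longlonglongrightarrow> sqrt pi / 2"
proof -
  have g: "has_bochner_integral lborel (\<lambda>x::real. indicator {0..} x * exp (- x\<^sup>2)) (sqrt pi / 2)"
    using gaussian_moment_0 by simp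
  let ?f = "\<lambda>n w. indicator {0..2 * real n} w * (sqrt (1 - (w / (2 * real n))\<^sup>2) * exp (- w\<^sup>2)) :: real"
  have "(\<lambda>n. \<integral>w. ?f n w \<partial>lborel) \<longlonglongrightarrow> (\<integral>w. indicator {0..} w * exp (- w\<^sup>2) \<partial>lborel)"
  proof (rule integral_dominated_convergence[where w = "\<lambda>w. indicator {0..} w * exp (- w\<^sup>2)"])
    show "integrable lborel (\<lambda>w::real. indicator {0..} w * exp (- w\<^sup>2))"
      using g by (auto simp: has_bochner_integral_iff)
    show "AE w in lborel. (\<lambda>n. ?f n w) \<longlonglongrightarrow> indicator {0..} w * exp (- w\<^sup>2)"
    proof (rule AE_I2)
      fix w :: real
      have l: "(\<lambda>n. indicator {0..} w * (sqrt (1 - (w / (2 * real n))\<^sup>2) * exp (- w\<^sup>2))) \<longlonglongrightarrow> indicator {0..} w * (sqrt (1 - 0\<^sup>2) * exp (- w\<^sup>2))"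
      proof (intro tendsto_intros)
        have "filterlim (\<lambda>n. 2 * real n) at_top sequentially"
          by (rule filterlim_tendsto_pos_mult_at_top[OF tendsto_const]) (use filterlim_real_sequentially in auto)
        then show "(\<lambda>n. w / (2 * real n)) \<longlonglongrightarrow> 0"
          by (intro tendsto_divide_0[OF tendsto_const] filterlim_at_top_imp_at_infinity)
      qed
      have "\<forall>\<^sub>F n in sequentially. indicator {0..} w * (sqrt (1 - (w / (2 * real n))\<^sup>2) * exp (- w\<^sup>2)) = ?f n w"
        using eventually_ge_at_top[of "nat \<lceil>w\<rceil>"]
      proof eventually_elim
        case (elim n)
        then have "w \<le> 2 * real n" by linarith
        then show ?case by (auto simp: indicator_def)
      qed
      from Lim_transform_eventually[OF l this] show "(\<lambda>n. ?f n w) \<longlonglongrightarrow> indicator {0..} w * exp (- w\<^sup>2)" by simp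
    qed
    show "AE w in lborel. norm (?f n w) \<le> indicator {0..} w * exp (- w\<^sup>2)" for n
    proof (rule AE_I2)
      fix w :: real
      show "norm (?f n w) \<le> indicator {0..} w * exp (- w\<^sup>2)"
      proof (cases "w \<in> {0..2 * real n}")
        case True
        have "w / (2 * real n) \<le> 1" using True by (cases "n = 0") (auto simp: divide_le_eq_1)
        then have "(w / (2 * real n))\<^sup>2 \<le> 1" using True by (simp add: power_le_one)
        then have "\<bar>sqrt (1 - (w / (2 * real n))\<^sup>2)\<bar> \<le> 1" by simp
        then have "\<bar>sqrt (1 - (w / (2 * real n))\<^sup>2)\<bar> * exp (- w\<^sup>2) \<le> 1 * exp (- w\<^sup>2)" by (intro mult_right_mono) auto
        then show ?thesis using True by (simp add: abs_mult)
      qed auto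
    qed
  qed measurable
  moreover have "\<forall>\<^sub>F n in sequentially. (\<integral>w. ?f n w \<partial>lborel) = 2 * real n * (\<integral>x. indicator {0..1} x * (sqrt (1 - x\<^sup>2) * exp (- (2 * real n * x)\<^sup>2)) \<partial>lborel)"
    using eventually_gt_at_top[of 0]
  proof eventually_elim
    case (elim n)
    then have n: "2 * real n \<noteq> 0" by simp
    have eq: "(\<lambda>x. ?f n (0 + 2 * real n * x)) = (\<lambda>x. indicator {0..1} x * (sqrt (1 - x\<^sup>2) * exp (- (2 * real n * x)\<^sup>2)))"
      using elim by (intro ext) (auto simp: indicator_def mult_le_cancel_left1 zero_le_mult_iff)
    show ?case unfolding lborel_integral_real_affine[OF n, of "?f n" 0] eq by simp
  qed
  ultimately show ?thesis by (simp add: has_bochner_integral_integral_eq[OF g] tendsto_cong)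
qed

text \<open>If \<open>A\<close> is the limit, the Gaussian averages tend to A sqrt(pi)/2. On the
  quarter circle side they tend to (2/pi) sqrt(pi)/2.\<close>

lemma besP_limit: "(besP \<longlongrightarrow> 2 / pi) at_top"
proof -
  obtain A where A: "(besP \<longlongrightarrow> A) at_top" by (rule besP_converges)
  have "(\<integral>w. indicator {0..} w * (exp (- w\<^sup>2) * besP (2 * real n * w)) \<partial>lborel)
     = 2 / pi * (2 * real n * (\<integral>x. indicator {0..1} x * (sqrt (1 - x\<^sup>2) * exp (- (2 * real n * x)\<^sup>2)) \<partial>lborel))" for n
  proof -
    have "(\<integral>w. indicator {0..} w * (exp (- w\<^sup>2) * besP (2 * real n * w)) \<partial>lborel) =
       (\<integral>w. real n * (indicator {0..} w * (2 * w * exp (- w\<^sup>2) * ((bessel_J0 (2 * real n * w))\<^sup>2 + (J1 (2 * real n * w))\<^sup>2))) \<partial>lborel)"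
      by (intro Bochner_Integration.integral_cong) (auto simp: besP_def)
    then show ?thesis unfolding integral_mult_right_zero weber_series semicircle_series[symmetric] by simp
  qed
  then have "(\<lambda>n. 2 / pi * (2 * real n * (\<integral>x. indicator {0..1} x * (sqrt (1 - x\<^sup>2) * exp (- (2 * real n * x)\<^sup>2)) \<partial>lborel))) \<longlonglongrightarrow> A * (sqrt pi / 2)"
    using gaussian_average_besP[OF A] by simp
  moreover have "(\<lambda>n. 2 / pi * (2 * real n * (\<integral>x. indicator {0..1} x * (sqrt (1 - x\<^sup>2) * exp (- (2 * real n * x)\<^sup>2)) \<partial>lborel))) \<longlonglongrightarrow> 2 / pi * (sqrt pi / 2)"
    by (intro tendsto_intros gaussian_average_semicircle)
  ultimately have "A * (sqrt pi / 2) = 2 / pi * (sqrt pi / 2)" by (rule LIMSEQ_unique)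
  then have "A = 2 / pi" by (subst (asm) mult_right_cancel) auto
  with A show ?thesis by simp
qed

section \<open>Integrals along polygonal chains\<close>

lemma hausdorff1_pre_le:
  "A \<subseteq> (\<Union>i. U i) \<Longrightarrow> (\<And>i. bounded (U i)) \<Longrightarrow> (\<And>i. diameter (U i) \<le> \<delta>) \<Longrightarrow> hausdorff1_pre \<delta> A \<le> (\<Sum>i. ennreal (diameter (U i)))"
  unfolding hausdorff1_pre_def by (rule INF_lower) auto

lemma le_hausdorff1_pre:
  assumes "\<And>U. A \<subseteq> (\<Union>i. U i) \<Longrightarrow> (\<And>i. bounded (U i)) \<Longrightarrow> (\<And>i. diameter (U i) \<le> \<delta>) \<Longrightarrow> c \<le> (\<Sum>i. ennreal (diameter (U i)))"
  shows "c \<le> hausdorff1_pre \<delta> A"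
  unfolding hausdorff1_pre_def by (rule INF_greatest) (use assms in auto)

lemma hausdorff1_pre_le_outer: "\<delta> > 0 \<Longrightarrow> hausdorff1_pre \<delta> A \<le> hausdorff1_outer A"
  unfolding hausdorff1_outer_def by (rule SUP_upper) auto

lemma hausdorff1_outer_least:
  "(\<And>\<delta>. \<delta> > 0 \<Longrightarrow> hausdorff1_pre \<delta> A \<le> c) \<Longrightarrow> hausdorff1_outer A \<le> c"
  unfolding hausdorff1_outer_def by (rule SUP_least) auto

lemma hausdorff1_pre_mono: "A \<subseteq> B \<Longrightarrow> hausdorff1_pre \<delta> A \<le> hausdorff1_pre \<delta> B"
  by (rule le_hausdorff1_pre, rule hausdorff1_pre_le) auto

lemma hausdorff1_pre_antimono: "\<delta> \<le> \<delta>' \<Longrightarrow> hausdorff1_pre \<delta>' A \<le> hausdorff1_pre \<delta> A"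
  by (rule le_hausdorff1_pre, rule hausdorff1_pre_le) (auto intro: order_trans)

lemma hausdorff1_outer_mono: "A \<subseteq> B \<Longrightarrow> hausdorff1_outer A \<le> hausdorff1_outer B"
  by (intro hausdorff1_outer_least order_trans[OF hausdorff1_pre_mono hausdorff1_pre_le_outer])

lemma hausdorff1_outer_empty: "hausdorff1_outer {} = 0"
proof -
  have "hausdorff1_outer ({}::'a set) \<le> 0"
  proof (rule hausdorff1_outer_least)
    fix \<delta> :: real assume "\<delta> > 0"
    then have "hausdorff1_pre \<delta> ({}::'a set) \<le> (\<Sum>i::nat. ennreal (diameter ({}::'a set)))"
      by (intro hausdorff1_pre_le) auto
    then show "hausdorff1_pre \<delta> ({}::'a set) \<le> 0" by simp
  qed
  then show ?thesis by simp
qed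

lemma hausdorff1_pre_UN:
  fixes A :: "nat \<Rightarrow> 'a::metric_space set"
  shows "hausdorff1_pre \<delta> (\<Union>n. A n) \<le> (\<Sum>n. hausdorff1_pre \<delta> (A n))"
proof (cases "(\<Sum>n. hausdorff1_pre \<delta> (A n)) = \<infinity>")
  case False
  show ?thesis
  proof (rule ennreal_le_epsilon)
    fix e :: real assume "e > 0"
    have "\<exists>U. A n \<subseteq> (\<Union>i::nat. U i) \<and> (\<forall>i. bounded (U i) \<and> diameter (U i) \<le> \<delta>) \<and>
        (\<Sum>i. ennreal (diameter (U i))) \<le> hausdorff1_pre \<delta> (A n) + ennreal (e * (1/2) ^ Suc n)" for n
    proof -
      have fin: "hausdorff1_pre \<delta> (A n) \<noteq> \<infinity>"
        using False ennreal_suminf_lessD[of "\<lambda>n. hausdorff1_pre \<delta> (A n)" \<infinity> n] by (auto simp: less_top)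
      have "hausdorff1_pre \<delta> (A n) < hausdorff1_pre \<delta> (A n) + ennreal (e * (1/2) ^ Suc n)"
      proof (cases "hausdorff1_pre \<delta> (A n)")
        case (real r)
        have "e * (1/2) ^ Suc n > 0" using \<open>e > 0\<close> by simp
        then have "ennreal r < ennreal (r + e * (1/2) ^ Suc n)" using real by (intro ennreal_lessI) linarith+
        moreover have "ennreal (r + e * (1/2) ^ Suc n) = ennreal r + ennreal (e * (1/2) ^ Suc n)"
          using real \<open>e > 0\<close> by (intro ennreal_plus) auto
        ultimately show ?thesis using real by simp
      qed (use fin in auto)
      then show ?thesis
        unfolding hausdorff1_pre_def INF_less_iff using less_imp_le by blast
    qed
    then obtain U where U: "\<And>n. A n \<subseteq> (\<Union>i::nat. U n i)" "\<And>n i. bounded (U n i)" "\<And>n i. diameter (U n i) \<le> \<delta>"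
      "\<And>n. (\<Sum>i. ennreal (diameter (U n i))) \<le> hausdorff1_pre \<delta> (A n) + ennreal (e * (1/2) ^ Suc n)"
      by metis
    define V where "V k = (case prod_decode k of (n, i) \<Rightarrow> U n i)" for k
    have "hausdorff1_pre \<delta> (\<Union>n. A n) \<le> (\<Sum>k. ennreal (diameter (V k)))"
    proof (rule hausdorff1_pre_le)
      show "(\<Union>n. A n) \<subseteq> (\<Union>k. V k)"
      proof
        fix x assume "x \<in> (\<Union>n. A n)"
        then obtain n where "x \<in> A n" by auto
        then obtain i where "x \<in> U n i" using U(1)[of n] by auto
        then have "x \<in> V (prod_encode (n, i))" by (simp add: V_def)
        then show "x \<in> (\<Union>k. V k)" by blast
      qed
    qed (auto simp: V_def U split: prod.split)
    also have "\<dots> = (\<Sum>k. (\<lambda>(n, i). ennreal (diameter (U n i))) (prod_decode k))"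
      by (simp add: V_def split_def)
    also have "\<dots> = (\<Sum>n. \<Sum>i. ennreal (diameter (U n i)))"
      by (rule suminf_ennreal_2dimen) simp
    also have "\<dots> \<le> (\<Sum>n. hausdorff1_pre \<delta> (A n) + ennreal (e * (1/2) ^ Suc n))"
      by (intro suminf_le U) auto
    also have "\<dots> = (\<Sum>n. hausdorff1_pre \<delta> (A n)) + (\<Sum>n. ennreal (e * (1/2) ^ Suc n))"
      by (intro suminf_add[symmetric]) auto
    also have "(\<Sum>n. ennreal (e * (1/2) ^ Suc n)) = ennreal e"
    proof -
      have "(\<lambda>n. e * (1/2) ^ Suc n) sums (e * 1)"
        using power_half_series by (intro sums_mult) simp
      then show ?thesis using \<open>e > 0\<close> by (intro suminf_ennreal_eq) auto
    qed
    finally show "hausdorff1_pre \<delta> (\<Union>n. A n) \<le> (\<Sum>n. hausdorff1_pre \<delta> (A n)) + ennreal e" .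
  qed
qed simp

lemma hausdorff1_outer_UN:
  fixes A :: "nat \<Rightarrow> 'a::metric_space set"
  shows "hausdorff1_outer (\<Union>n. A n) \<le> (\<Sum>n. hausdorff1_outer (A n))"
proof (rule hausdorff1_outer_least)
  fix \<delta> :: real assume "\<delta> > 0"
  have "hausdorff1_pre \<delta> (\<Union>n. A n) \<le> (\<Sum>n. hausdorff1_pre \<delta> (A n))" by (rule hausdorff1_pre_UN)
  also have "\<dots> \<le> (\<Sum>n. hausdorff1_outer (A n))"
    using \<open>\<delta> > 0\<close> by (intro suminf_le hausdorff1_pre_le_outer) auto
  finally show "hausdorff1_pre \<delta> (\<Union>n. A n) \<le> (\<Sum>n. hausdorff1_outer (A n))" .
qed

lemma hausdorff1_outer_Un:
  fixes A B :: "'a::metric_space set"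
  shows "hausdorff1_outer (A \<union> B) \<le> hausdorff1_outer A + hausdorff1_outer B"
proof -
  have "hausdorff1_outer (\<Union>n. binaryset A B n) \<le> (\<Sum>n. hausdorff1_outer (binaryset A B n))"
    by (rule hausdorff1_outer_UN)
  also have "\<dots> = hausdorff1_outer A + hausdorff1_outer B"
    by (rule suminf_binaryset_eq) (rule hausdorff1_outer_empty)
  finally show ?thesis by (simp add: UN_binaryset_eq)
qed

lemma outer_measure_space_hausdorff1: "outer_measure_space UNIV (hausdorff1_outer :: 'a::metric_space set \<Rightarrow> ennreal)"
  by (auto simp: outer_measure_space_def positive_def increasing_def countably_subadditive_def
      hausdorff1_outer_empty hausdorff1_outer_mono hausdorff1_outer_UN)

text \<open>A covering set of diameter below \<open>d\<close> cannot meet both \<open>A\<close> and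
  \<open>B\<close>, so a cover of the union splits into a cover of each. Sets that meet neither are
  replaced by the empty set, of diameter 0.\<close>

lemma hausdorff1_pre_separated:
  fixes A B :: "'a::metric_space set"
  assumes sep: "\<And>x y. x \<in> A \<Longrightarrow> y \<in> B \<Longrightarrow> d \<le> dist x y" and "\<delta> < d" "0 \<le> \<delta>"
  shows "hausdorff1_pre \<delta> A + hausdorff1_pre \<delta> B \<le> hausdorff1_pre \<delta> (A \<union> B)"
proof (rule le_hausdorff1_pre)
  fix U :: "nat \<Rightarrow> 'a set"
  assume U: "A \<union> B \<subseteq> (\<Union>i. U i)" "\<And>i. bounded (U i)" "\<And>i. diameter (U i) \<le> \<delta>"
  define V where "V i = (if U i \<inter> A = {} then {} else U i)" for i
  define W where "W i = (if U i \<inter> B = {} then {} else U i)" for i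
  have "x \<in> (\<Union>i. V i)" if x: "x \<in> A" for x
  proof -
    obtain i where "x \<in> U i" using U(1) x by blast
    with x have "x \<in> V i" by (auto simp: V_def)
    then show ?thesis by blast
  qed
  then have "hausdorff1_pre \<delta> A \<le> (\<Sum>i. ennreal (diameter (V i)))"
    by (intro hausdorff1_pre_le) (use U(2,3) \<open>0 \<le> \<delta>\<close> in \<open>auto simp: V_def\<close>)
  moreover have "x \<in> (\<Union>i. W i)" if x: "x \<in> B" for x
  proof -
    obtain i where "x \<in> U i" using U(1) x by blast
    with x have "x \<in> W i" by (auto simp: W_def)
    then show ?thesis by blast
  qed
  then have "hausdorff1_pre \<delta> B \<le> (\<Sum>i. ennreal (diameter (W i)))"
    by (intro hausdorff1_pre_le) (use U(2,3) \<open>0 \<le> \<delta>\<close> in \<open>auto simp: W_def\<close>)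
  moreover have "(\<Sum>i. ennreal (diameter (V i))) + (\<Sum>i. ennreal (diameter (W i))) \<le> (\<Sum>i. ennreal (diameter (U i)))"
  proof -
    have "ennreal (diameter (V i)) + ennreal (diameter (W i)) \<le> ennreal (diameter (U i))" for i
    proof (cases "U i \<inter> A = {} \<or> U i \<inter> B = {}")
      case False
      then obtain x y where "x \<in> U i" "x \<in> A" "y \<in> U i" "y \<in> B" by auto
      have "d \<le> dist x y" by (rule sep) fact+
      moreover have "dist x y \<le> diameter (U i)" by (rule diameter_bounded_bound[OF U(2)]) fact+
      ultimately show ?thesis using U(3)[of i] \<open>\<delta> < d\<close> by simp
    qed (auto simp: V_def W_def)
    then have "(\<Sum>i. ennreal (diameter (V i)) + ennreal (diameter (W i))) \<le> (\<Sum>i. ennreal (diameter (U i)))"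
      by (intro suminf_le) auto
    then show ?thesis by (simp add: suminf_add)
  qed
  ultimately show "hausdorff1_pre \<delta> A + hausdorff1_pre \<delta> B \<le> (\<Sum>i. ennreal (diameter (U i)))"
    using add_mono order_trans by meson
qed

lemma hausdorff1_outer_separated:
  fixes A B :: "'a::metric_space set"
  assumes sep: "\<And>x y. x \<in> A \<Longrightarrow> y \<in> B \<Longrightarrow> d \<le> dist x y" and "d > 0"
  shows "hausdorff1_outer A + hausdorff1_outer B \<le> hausdorff1_outer (A \<union> B)"
proof -
  have *: "hausdorff1_pre \<delta>1 A + hausdorff1_pre \<delta>2 B \<le> hausdorff1_outer (A \<union> B)" if "\<delta>1 > 0" "\<delta>2 > 0" for \<delta>1 \<delta>2
  proof -
    define \<delta> where "\<delta> = min (min \<delta>1 \<delta>2) (d / 2)"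
    have \<delta>: "\<delta> > 0" "\<delta> < d" "\<delta> \<le> \<delta>1" "\<delta> \<le> \<delta>2" using that \<open>d > 0\<close> by (auto simp: \<delta>_def)
    have "hausdorff1_pre \<delta>1 A + hausdorff1_pre \<delta>2 B \<le> hausdorff1_pre \<delta> A + hausdorff1_pre \<delta> B"
      by (intro add_mono hausdorff1_pre_antimono \<delta>)
    also have "\<dots> \<le> hausdorff1_pre \<delta> (A \<union> B)"
      by (rule hausdorff1_pre_separated[OF sep \<delta>(2)]) (use \<delta> in auto)
    also have "\<dots> \<le> hausdorff1_outer (A \<union> B)" by (rule hausdorff1_pre_le_outer[OF \<delta>(1)])
    finally show ?thesis .
  qed
  have ne: "{0<..} \<noteq> ({} :: real set)" by auto
  have "hausdorff1_outer A + hausdorff1_pre \<delta>2 B \<le> hausdorff1_outer (A \<union> B)" if "\<delta>2 > 0" for \<delta>2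
    unfolding hausdorff1_outer_def[of A] ennreal_SUP_add_left[OF ne, symmetric]
    using *[OF _ that] by (auto intro!: SUP_least)
  then show ?thesis
    unfolding hausdorff1_outer_def[of B] add.commute[of "hausdorff1_outer A"] ennreal_SUP_add_left[OF ne, symmetric]
    by (auto intro!: SUP_least simp: add.commute)
qed

lemma hausdorff1_outer_chain_separated:
  fixes D :: "nat \<Rightarrow> 'a::metric_space set"
  assumes "\<And>k j x y. k < j \<Longrightarrow> x \<in> D k \<Longrightarrow> y \<in> D j \<Longrightarrow> d j \<le> dist x y" "\<And>j. d j > 0"
  shows "(\<Sum>k<n. hausdorff1_outer (D k)) \<le> hausdorff1_outer (\<Union>k<n. D k)"
proof (induction n)
  case (Suc n)
  have "(\<Sum>k<Suc n. hausdorff1_outer (D k)) \<le> hausdorff1_outer (\<Union>k<n. D k) + hausdorff1_outer (D n)"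
    using Suc by (simp add: add_right_mono)
  also have "\<dots> \<le> hausdorff1_outer ((\<Union>k<n. D k) \<union> D n)"
    by (rule hausdorff1_outer_separated[of _ _ "d n"]) (use assms in auto)
  also have "(\<Union>k<n. D k) \<union> D n = (\<Union>k<Suc n. D k)" by (auto simp: less_Suc_eq)
  finally show ?case .
qed simp

text \<open>Caratheodory's criterion. The complement of \<open>C\<close> in \<open>A\<close> is
  exhausted by the sets \<open>B k\<close> of points at distance at least \<open>r k\<close> from
  \<open>C\<close>, on which additivity holds by separation. What remains is a tail of the shells
  \<open>D k\<close>; it vanishes because the total measure of the shells is finite.\<close>

lemma closed_in_lambda_system_hausdorff1:
  fixes C :: "'a::metric_space set"
  assumes "closed C"
  shows "C \<in> lambda_system UNIV UNIV hausdorff1_outer"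
proof (cases "C = {}")
  case True
  then show ?thesis by (auto simp: lambda_system_def hausdorff1_outer_empty)
next
  case False
  let ?h = "hausdorff1_outer :: 'a set \<Rightarrow> ennreal"
  have "?h (C \<inter> A) + ?h (A - C) \<le> ?h A" for A
  proof (cases "?h A = \<infinity>")
    case fin: False
    define r where "r k = 1 / (real k + 1)" for k
    have r: "r k > 0" "r (Suc k) < r k" for k by (auto simp: r_def divide_simps)
    have r_anti: "r j \<le> r k" if "k \<le> j" for k j using that by (simp add: r_def frac_le)
    define B where "B k = {x \<in> A. r k \<le> infdist x C}" for k
    define D where "D k = {x \<in> A. r (Suc k) \<le> infdist x C \<and> infdist x C < r k}" for k
    have dist_ge: "\<bar>infdist x C - infdist y C\<bar> \<le> dist x y" for x y :: 'a
      using infdist_triangle[of x C y] infdist_triangle[of y C x] by (simp add: dist_commute)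
    have B: "?h (C \<inter> A) + ?h (B k) \<le> ?h A" for k
    proof -
      have "?h (C \<inter> A) + ?h (B k) \<le> ?h ((C \<inter> A) \<union> B k)"
      proof (rule hausdorff1_outer_separated[of _ _ "r k"])
        fix x y assume "x \<in> C \<inter> A" "y \<in> B k"
        then have "r k \<le> infdist y C" "infdist y C \<le> dist y x" by (auto simp: B_def infdist_le)
        then show "r k \<le> dist x y" by (simp add: dist_commute)
      qed (rule r)
      also have "\<dots> \<le> ?h A" by (intro hausdorff1_outer_mono) (auto simp: B_def)
      finally show ?thesis .
    qed
    \<comment> \<open>Neighbouring shells may touch, but shells with indices of the same parity are
      separated. Hence the sum over each parity class, selected by \<open>p\<close>, is at most the
      measure of \<open>A\<close>.\<close>
    have half: "(\<Sum>k<n. ?h (D (2 * k + p))) \<le> ?h A" for n p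
    proof -
      have "(\<Sum>k<n. ?h (D (2 * k + p))) \<le> ?h (\<Union>k<n. D (2 * k + p))"
      \<comment> \<open>An earlier shell of the same parity keeps distance at least
        \<open>r (2 * j + p - 1)\<close> from \<open>C\<close>, which gives the gap. For
        \<open>j = 0\<close> there is no earlier shell, and the value 1 merely keeps the gap
        positive.\<close>
      proof (rule hausdorff1_outer_chain_separated[where d = "\<lambda>j. if j = 0 then 1 else r (2 * j + p - 1) - r (2 * j + p)"])
        fix k j x y assume kj: "k < (j::nat)" and x: "x \<in> D (2 * k + p)" and y: "y \<in> D (2 * j + p)"
        have "r (Suc (2 * k + p)) \<ge> r (2 * j + p - 1)" using kj by (intro r_anti) auto
        then have "r (2 * j + p - 1) - r (2 * j + p) \<le> infdist x C - infdist y C"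
          using x y by (auto simp: D_def)
        then show "(if j = 0 then 1 else r (2 * j + p - 1) - r (2 * j + p)) \<le> dist x y"
          using dist_ge[of x y] kj by auto
      next
        fix j
        show "(if j = 0 then 1 else r (2 * j + p - 1) - r (2 * j + p)) > 0"
        proof (cases "j = 0")
          case False
          then have "Suc (2 * j + p - 1) = 2 * j + p" by simp
          then show ?thesis using r(2)[of "2 * j + p - 1"] False by simp
        qed simp
      qed
      also have "\<dots> \<le> ?h A" by (intro hausdorff1_outer_mono) (auto simp: D_def)
      finally show ?thesis .
    qed
    have "(\<Sum>k<n. ?h (D k)) \<le> ?h A + ?h A" for n
    proof -
      have "(\<Sum>k<n. ?h (D k)) \<le> (\<Sum>k<2*n. ?h (D k))" by (intro sum_mono2) auto
      also have "(\<Sum>k<2*n. ?h (D k)) = (\<Sum>k<n. ?h (D (2 * k))) + (\<Sum>k<n. ?h (D (2 * k + 1)))"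
        by (induction n) (auto simp: algebra_simps)
      also have "\<dots> \<le> ?h A + ?h A" using half[of 0 n] half[of 1 n] by (intro add_mono) auto
      finally show ?thesis .
    qed
    then have sumD: "(\<Sum>k. ?h (D k)) \<le> ?h A + ?h A" by (intro suminf_le_const) auto
    have tail: "?h (A - C) \<le> ?h (B n) + (\<Sum>k. ?h (D (k + n)))" for n
    proof -
      have "A - C \<subseteq> B n \<union> (\<Union>k. D (k + n))"
      proof
        fix x assume x: "x \<in> A - C"
        then have pos: "infdist x C > 0"
          using \<open>closed C\<close> False in_closed_iff_infdist_zero[of C x] infdist_nonneg[of x C] by fastforce
        have "\<exists>k. r k \<le> infdist x C"
        proof -
          obtain k where "inverse (real (Suc k)) < infdist x C" using reals_Archimedean[OF pos] by auto
          then show ?thesis by (intro exI[of _ k]) (simp add: r_def inverse_eq_divide add.commute)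
        qed
        define m where "m = (LEAST k. r k \<le> infdist x C)"
        have m: "r m \<le> infdist x C" unfolding m_def by (rule LeastI_ex) fact
        show "x \<in> B n \<union> (\<Union>k. D (k + n))"
        proof (cases "m \<le> n")
          case True
          then show ?thesis using m r_anti[OF True] x by (auto simp: B_def)
        next
          case False
          then obtain k where k: "m = Suc (k + n)" by (metis add.commute less_iff_Suc_add not_le)
          have "infdist x C < r (k + n)" using not_less_Least[of "k + n" "\<lambda>k. r k \<le> infdist x C"] k by (simp add: m_def)
          then have "x \<in> D (k + n)" using m k x by (auto simp: D_def)
          then show ?thesis by blast
        qed
      qed
      then have "?h (A - C) \<le> ?h (B n \<union> (\<Union>k. D (k + n)))" by (rule hausdorff1_outer_mono)
      also have "\<dots> \<le> ?h (B n) + ?h (\<Union>k. D (k + n))" by (rule hausdorff1_outer_Un)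
      also have "\<dots> \<le> ?h (B n) + (\<Sum>k. ?h (D (k + n)))" by (intro add_left_mono hausdorff1_outer_UN)
      finally show ?thesis .
    qed
    have "(\<lambda>n. \<Sum>k. ?h (D (k + n))) \<longlonglongrightarrow> 0"
    proof -
      have fin': "(\<Sum>k. ?h (D k)) \<noteq> \<infinity>" using sumD fin by (auto simp: top_unique)
      then have fk: "?h (D k) \<noteq> \<infinity>" for k
        using ennreal_suminf_lessD[of "\<lambda>n. ?h (D n)" \<infinity> k] by (auto simp: less_top)
      define a where "a k = enn2real (?h (D k))" for k
      have a: "?h (D k) = ennreal (a k)" "a k \<ge> 0" for k using fk[of k] by (auto simp: a_def less_top)
      have sa: "summable a" using fin' a by (auto intro!: summable_suminf_not_top)
      have "(\<Sum>k. ?h (D (k + n))) = ennreal (\<Sum>k. a (k + n))" for n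
        unfolding a using sa a(2) by (intro suminf_ennreal2) (auto simp: summable_iff_shift)
      moreover have "(\<lambda>n. ennreal (\<Sum>k. a (k + n))) \<longlonglongrightarrow> ennreal 0"
        by (intro tendsto_ennrealI suminf_exist_split2 sa)
      ultimately show ?thesis by simp
    qed
    then have lim: "(\<lambda>n. ?h A + (\<Sum>k. ?h (D (k + n)))) \<longlonglongrightarrow> ?h A + 0"
      by (intro tendsto_intros)
    have "?h (C \<inter> A) + ?h (A - C) \<le> ?h A + (\<Sum>k. ?h (D (k + n)))" for n
    proof -
      have "?h (C \<inter> A) + ?h (A - C) \<le> ?h (C \<inter> A) + (?h (B n) + (\<Sum>k. ?h (D (k + n))))"
        by (intro add_left_mono tail)
      also have "\<dots> \<le> ?h A + (\<Sum>k. ?h (D (k + n)))" unfolding add.assoc[symmetric] by (intro add_right_mono B)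
      finally show ?thesis .
    qed
    then have "?h (C \<inter> A) + ?h (A - C) \<le> ?h A + 0"
      by (intro LIMSEQ_le_const[OF lim]) auto
    then show ?thesis by simp
  qed simp
  moreover have "?h A \<le> ?h (C \<inter> A) + ?h (A - C)" for A
  proof -
    have "(C \<inter> A) \<union> (A - C) = A" by blast
    then show ?thesis using hausdorff1_outer_Un[of "C \<inter> A" "A - C"] by simp
  qed
  ultimately have "?h (C \<inter> A) + ?h (A - C) = ?h A" for A by (intro antisym)
  moreover have "(UNIV - C) \<inter> A = A - C" for A by blast
  ultimately show ?thesis by (simp add: lambda_system_def)
qed

lemma measure_space_hausdorff1:
  "measure_space UNIV (sets (borel :: 'a::metric_space measure)) hausdorff1_outer"
proof -
  let ?L = "lambda_system UNIV UNIV (hausdorff1_outer :: 'a set \<Rightarrow> ennreal)"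
  interpret sigma_algebra UNIV "UNIV :: 'a set set" using sigma_algebra_Pow[of UNIV] by simp
  have ms: "measure_space UNIV ?L hausdorff1_outer"
    by (rule caratheodory_lemma) (rule outer_measure_space_hausdorff1)
  then have sa: "sigma_algebra UNIV ?L" by (simp add: measure_space_def)
  have "sets (borel :: 'a measure) = sigma_sets UNIV (Collect closed)"
    unfolding borel_eq_closed by (rule sets_measure_of) auto
  also have "\<dots> \<subseteq> ?L"
    by (rule sigma_algebra.sigma_sets_subset[OF sa]) (auto intro: closed_in_lambda_system_hausdorff1)
  finally show ?thesis
    using sets.sigma_algebra_axioms[of "borel :: 'a measure"] by (intro measure_down[OF ms]) simp_all
qed

lemma sets_hausdorff1 [simp, measurable_cong]: "sets (hausdorff1 :: 'a::metric_space measure) = sets borel"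
  unfolding hausdorff1_def using sets.sets_measure_of_eq[of borel] by simp

lemma space_hausdorff1 [simp]: "space hausdorff1 = UNIV"
  unfolding hausdorff1_def using sets.space_closed[of borel] by (simp add: space_measure_of)

lemma emeasure_hausdorff1:
  fixes A :: "'a::metric_space set"
  assumes "A \<in> sets borel" shows "emeasure hausdorff1 A = hausdorff1_outer A"
  using measure_space_hausdorff1[where 'a = 'a] assms unfolding hausdorff1_def
  by (intro emeasure_measure_of_sigma) (auto simp: measure_space_def)

section \<open>The Hausdorff measure of a segment is arc length\<close>

abbreviation seg_dir :: "oriented_segment \<Rightarrow> real^2" where
  "seg_dir S \<equiv> vector [cos (seg_angle S), sin (seg_angle S)]"

lemma inner_vector2: "(vector [a, b] :: real^2) \<bullet> vector [c, d] = a * c + b * d"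
  by (simp add: inner_vec_def sum_2)

lemma seg_dir_normal [simp]:
  "seg_dir S \<bullet> seg_dir S = 1" "seg_normal S \<bullet> seg_normal S = 1" "seg_dir S \<bullet> seg_normal S = 0" "seg_normal S \<bullet> seg_dir S = 0"
  by (simp_all add: seg_normal_def inner_vector2 flip: power2_eq_square)

lemma norm_seg_dir [simp]: "norm (seg_dir S) = 1" "norm (seg_normal S) = 1"
  by (simp_all add: norm_eq_sqrt_inner)

lemma seg_param_diff: "seg_param S s - seg_param S t = (s - t) *\<^sub>R seg_dir S"
  by (simp add: seg_param_def algebra_simps)

lemma dist_seg_param [simp]: "dist (seg_param S s) (seg_param S t) = \<bar>s - t\<bar>"
  by (simp add: dist_norm seg_param_diff)

lemma inj_seg_param: "inj (seg_param S)"
  by (intro injI) (metis abs_eq_0 diff_eq_diff_eq diff_self dist_eq_0_iff dist_seg_param eq_iff_diff_eq_0)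

lemma continuous_on_seg_param [continuous_intros]: "continuous_on A f \<Longrightarrow> continuous_on A (\<lambda>x. seg_param S (f x))"
  unfolding seg_param_def by (intro continuous_intros)

lemma seg_param_measurable [measurable]: "seg_param S \<in> borel_measurable borel"
  by (intro borel_measurable_continuous_onI continuous_intros)

text \<open>On the segment this inverts \<open>seg_param\<close>. Being the orthogonal projection,
  it is defined and Borel on the whole plane, so the measure on a segment can be transported as an
  image measure.\<close>

definition seg_coord :: "oriented_segment \<Rightarrow> real^2 \<Rightarrow> real" where
  "seg_coord S x = (x - seg_start S) \<bullet> seg_dir S"

lemma seg_coord_param [simp]: "seg_coord S (seg_param S t) = t"
  by (simp add: seg_coord_def seg_param_def)

lemma seg_coord_measurable [measurable]: "seg_coord S \<in> borel_measurable borel"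
  unfolding seg_coord_def by measurable

lemma closed_seg_image: "closed (seg_image S)"
  unfolding seg_image_def by (intro compact_imp_closed compact_continuous_image continuous_intros) auto

lemma seg_image_measurable [measurable]: "seg_image S \<in> sets borel"
  using closed_seg_image by (rule borel_closed)

text \<open>From above, the interval is cut into equal pieces shorter than the mesh. From below, the
  parameters falling into a covering set lie in an interval no longer than its diameter, and
  Lebesgue measure is countably subadditive.\<close>

lemma hausdorff1_outer_seg_interval:
  assumes "a \<le> b" shows "hausdorff1_outer (seg_param S ` {a..b}) = ennreal (b - a)"
proof (rule antisym)
  show "hausdorff1_outer (seg_param S ` {a..b}) \<le> ennreal (b - a)"
  proof (rule hausdorff1_outer_least)
    fix \<delta> :: real assume "\<delta> > 0"
    obtain n :: nat where n: "(b - a) / \<delta> < real n" using reals_Archimedean2 by blast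
    have "0 \<le> (b - a) / \<delta>" using assms \<open>\<delta> > 0\<close> by simp
    then have n0: "n > 0" using n by (cases n) auto
    define l where "l = (b - a) / real n"
    have l: "0 \<le> l" "l \<le> \<delta>" using n n0 assms \<open>\<delta> > 0\<close> by (auto simp: l_def field_simps)
    define U where "U i = (if i < n then seg_param S ` {a + real i * l..a + real i * l + l} else {})" for i
    have bdd: "bounded (U i)" for i
      unfolding U_def by (auto intro!: compact_imp_bounded compact_continuous_image continuous_intros)
    have diam: "diameter (U i) \<le> (if i < n then l else 0)" for i
      unfolding U_def using l by (auto intro!: diameter_le simp: dist_norm[symmetric])
    have "hausdorff1_pre \<delta> (seg_param S ` {a..b}) \<le> (\<Sum>i. ennreal (diameter (U i)))"
    proof (rule hausdorff1_pre_le[OF _ bdd])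
      show "seg_param S ` {a..b} \<subseteq> (\<Union>i. U i)"
      proof
        fix x assume "x \<in> seg_param S ` {a..b}"
        then obtain t where t: "a \<le> t" "t \<le> b" "x = seg_param S t" by auto
        show "x \<in> (\<Union>i. U i)"
        \<comment> \<open>The right end point belongs to the last piece; the floor used for the
          other points would give it the index \<open>n\<close>.\<close>
        proof (cases "t = b")
          case True
          have "b = a + real (n - 1) * l + l" using n0 by (simp add: l_def of_nat_diff field_simps)
          then have "x \<in> U (n - 1)" using n0 l t True by (auto simp: U_def)
          then show ?thesis by blast
        next
          case False
          then have l0: "l > 0" using t n0 by (auto simp: l_def)
          define i where "i = nat \<lfloor>(t - a) / l\<rfloor>"
          have i: "real i \<le> (t - a) / l" "(t - a) / l < real i + 1"
            using t l0 by (auto simp: i_def)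
          have "real i < real n"
          proof -
            have "(t - a) / l < (b - a) / l" using False t l0 by (intro divide_strict_right_mono) auto
            also have "\<dots> = real n" using l0 n0 by (auto simp: l_def)
            finally show ?thesis using i(1) by linarith
          qed
          moreover have "a + real i * l \<le> t" "t \<le> a + real i * l + l" using i l0 by (auto simp: field_simps)
          ultimately have "x \<in> U i" using t by (auto simp: U_def)
          then show ?thesis by blast
        qed
      qed
      show "diameter (U i) \<le> \<delta>" for i using diam[of i] l \<open>\<delta> > 0\<close> by (auto split: if_splits)
    qed
    also have "\<dots> \<le> (\<Sum>i. ennreal (if i < n then l else 0))"
      using diam by (intro suminf_le ennreal_leI) auto
    also have "\<dots> = (\<Sum>i<n. ennreal (if i < n then l else 0))"
      by (rule suminf_finite) auto
    also have "\<dots> = ennreal (b - a)"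
      using l n0 by (simp add: l_def ennreal_of_nat_eq_real_of_nat ennreal_mult[symmetric])
    finally show "hausdorff1_pre \<delta> (seg_param S ` {a..b}) \<le> ennreal (b - a)" .
  qed
  \<comment> \<open>The lower bound holds for covers of any mesh, so the single mesh 1 is enough:
    the outer measure dominates every premeasure.\<close>
  have "ennreal (b - a) \<le> hausdorff1_pre 1 (seg_param S ` {a..b})"
  proof (rule le_hausdorff1_pre)
    fix U :: "nat \<Rightarrow> (real^2) set"
    assume U: "seg_param S ` {a..b} \<subseteq> (\<Union>i. U i)" "\<And>i. bounded (U i)"
    define V where "V i = {t \<in> {a..b}. seg_param S t \<in> U i}" for i
    have V: "\<exists>c d. V i \<subseteq> {c..d} \<and> c \<le> d \<and> d - c \<le> diameter (U i)" for i
    proof (cases "V i = {}")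
      case True
      then show ?thesis using diameter_ge_0[OF U(2)] by (intro exI[of _ 0]) auto
    next
      case False
      have bb: "bdd_below (V i)" "bdd_above (V i)" by (auto simp: V_def intro: bdd_belowI[of _ a] bdd_aboveI[of _ b])
      have d: "x - y \<le> diameter (U i)" if "x \<in> V i" "y \<in> V i" for x y
        using diameter_bounded_bound[OF U(2), of "seg_param S x" i "seg_param S y"] that by (auto simp: V_def)
      have "x - diameter (U i) \<le> Inf (V i)" if "x \<in> V i" for x
        using d[OF that] False by (intro cInf_greatest) (auto simp: algebra_simps)
      then have "Sup (V i) \<le> Inf (V i) + diameter (U i)"
        using False by (intro cSup_least) (auto simp: algebra_simps)
      moreover have "Inf (V i) \<le> Sup (V i)" using False bb cInf_le_cSup by blast
      ultimately show ?thesis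
        using bb by (intro exI[of _ "Inf (V i)"] exI[of _ "Sup (V i)"]) (auto intro: cInf_lower cSup_upper)
    qed
    then obtain c d where cd: "\<And>i. V i \<subseteq> {c i..d i}" "\<And>i. c i \<le> d i" "\<And>i. d i - c i \<le> diameter (U i)"
      by metis
    have "{a..b} \<subseteq> (\<Union>i. {c i..d i})"
    proof
      fix t assume t: "t \<in> {a..b}"
      then have "seg_param S t \<in> (\<Union>i. U i)" using U(1) by blast
      then obtain i where "t \<in> V i" using t by (auto simp: V_def)
      then show "t \<in> (\<Union>i. {c i..d i})" using cd(1)[of i] by blast
    qed
    then have "emeasure lborel {a..b} \<le> emeasure lborel (\<Union>i. {c i..d i})"
      by (intro emeasure_mono) auto
    also have "\<dots> \<le> (\<Sum>i. emeasure lborel {c i..d i})"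
      by (intro emeasure_subadditive_countably) auto
    also have "\<dots> \<le> (\<Sum>i. ennreal (diameter (U i)))"
      using cd by (intro suminf_le) (auto intro: ennreal_leI)
    finally show "ennreal (b - a) \<le> (\<Sum>i. ennreal (diameter (U i)))" using assms by simp
  qed
  then show "ennreal (b - a) \<le> hausdorff1_outer (seg_param S ` {a..b})"
    using hausdorff1_pre_le_outer[of 1] order_trans by fastforce
qed

lemma seg_coord_distr:
  "distr (restrict_space hausdorff1 (seg_image S)) borel (seg_coord S) = density lborel (indicator {0..seg_length S})"
proof (rule measure_eqI_generator_eq[where E = "range (\<lambda>(a, b). {a..b::real})" and \<Omega> = UNIV and A = "\<lambda>n. {- real n..real n}"])
  let ?h = "hausdorff1 :: (real^2) measure"
  let ?M = "distr (restrict_space ?h (seg_image S)) borel (seg_coord S)"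
  have m: "seg_coord S \<in> measurable (restrict_space ?h (seg_image S)) borel"
    by (intro measurable_restrict_space1) simp
  have em: "emeasure ?M {a..b} = ennreal (if max a 0 \<le> min b (seg_length S) then min b (seg_length S) - max a 0 else 0)" for a b :: real
  proof -
    have "emeasure ?M {a..b} = emeasure (restrict_space ?h (seg_image S)) (seg_coord S -` {a..b} \<inter> seg_image S)"
      by (subst emeasure_distr[OF m]) (auto simp: space_restrict_space)
    also have "\<dots> = emeasure ?h (seg_coord S -` {a..b} \<inter> seg_image S)"
      by (intro emeasure_restrict_space) auto
    also have "seg_coord S -` {a..b} \<inter> seg_image S = seg_param S ` {max a 0..min b (seg_length S)}"
      by (auto simp: seg_image_def)
    also have "emeasure ?h \<dots> = hausdorff1_outer \<dots>"
      by (intro emeasure_hausdorff1 borel_closed compact_imp_closed compact_continuous_image continuous_intros) auto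
    also have "\<dots> = ennreal (if max a 0 \<le> min b (seg_length S) then min b (seg_length S) - max a 0 else 0)"
    proof (cases "max a 0 \<le> min b (seg_length S)")
      case True
      then show ?thesis using hausdorff1_outer_seg_interval[OF True] by simp
    next
      case False
      then have "{max a 0..min b (seg_length S)} = {}" by simp
      then show ?thesis using False by (simp only: image_empty hausdorff1_outer_empty if_False ennreal_0)
    qed
    finally show ?thesis .
  qed
  show "Int_stable (range (\<lambda>(a, b). {a..b::real}))"
  proof (rule Int_stableI)
    fix A B assume "A \<in> range (\<lambda>(a, b). {a..b::real})" "B \<in> range (\<lambda>(a, b). {a..b::real})"
    then obtain a b c d where "A = {a..b}" "B = {c..d}" by auto
    then have "A \<inter> B = (\<lambda>(a, b). {a..b}) (max a c, min b d)" by auto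
    then show "A \<inter> B \<in> range (\<lambda>(a, b). {a..b::real})" by blast
  qed
  show "sets ?M = sigma_sets UNIV (range (\<lambda>(a, b). {a..b::real}))"
    "sets (density lborel (indicator {0..seg_length S})) = sigma_sets UNIV (range (\<lambda>(a, b). {a..b::real}))"
    by (simp_all add: borel_eq_atLeastAtMost)
  show "(\<Union>n. {- real n..real n}) = UNIV"
  proof (intro equalityI subsetI UNIV_I)
    fix x :: real
    obtain n where "\<bar>x\<bar> \<le> real n" using real_arch_simple by blast
    then show "x \<in> (\<Union>n. {- real n..real n})" by (auto intro!: exI[of _ n])
  qed
  show "emeasure ?M {- real i..real i} \<noteq> \<infinity>" for i unfolding em by simp
  fix X assume "X \<in> range (\<lambda>(a, b). {a..b::real})"
  then obtain a b where X: "X = {a..b}" by auto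
  have "emeasure (density lborel (indicator {0..seg_length S})) X = (\<integral>\<^sup>+t. indicator {0..seg_length S} t * indicator {a..b} t \<partial>lborel)"
    unfolding X by (subst emeasure_density) auto
  also have "\<dots> = (\<integral>\<^sup>+t. indicator {max a 0..min b (seg_length S)} t \<partial>lborel)"
    by (intro nn_integral_cong) (auto simp: indicator_def)
  also have "\<dots> = emeasure lborel {max a 0..min b (seg_length S)}"
    by (rule nn_integral_indicator) simp
  also have "\<dots> = ennreal (if max a 0 \<le> min b (seg_length S) then min b (seg_length S) - max a 0 else 0)"
    by (rule emeasure_lborel_Icc_eq)
  finally show "emeasure ?M X = emeasure (density lborel (indicator {0..seg_length S})) X"
    unfolding em X by simp
qed auto

lemma integral_seg_image:
  fixes g :: "real^2 \<Rightarrow> real"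
  assumes [measurable]: "g \<in> borel_measurable borel"
  shows "(LINT x:seg_image S|hausdorff1. g x) = (LINT t:{0..seg_length S}|lborel. g (seg_param S t))" (is ?thesis1)
    and "set_integrable hausdorff1 (seg_image S) g \<longleftrightarrow> set_integrable lborel {0..seg_length S} (\<lambda>t. g (seg_param S t))"
proof -
  let ?h = "hausdorff1 :: (real^2) measure"
  let ?R = "restrict_space ?h (seg_image S)"
  have m: "seg_coord S \<in> measurable ?R borel"
    by (intro measurable_restrict_space1) simp
  have eq: "g (seg_param S (seg_coord S x)) = g x" if "x \<in> space ?R" for x
    using that by (auto simp: space_restrict_space seg_image_def)
  have "(LINT x:seg_image S|?h. g x) = (\<integral>x. g x \<partial>?R)"
    unfolding set_lebesgue_integral_def by (subst integral_restrict_space) auto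
  also have "\<dots> = (\<integral>x. g (seg_param S (seg_coord S x)) \<partial>?R)"
    using eq by (intro Bochner_Integration.integral_cong) auto
  also have "\<dots> = (\<integral>t. g (seg_param S t) \<partial>distr ?R borel (seg_coord S))"
    by (subst integral_distr[OF m]) auto
  also have "\<dots> = (LINT t:{0..seg_length S}|lborel. g (seg_param S t))"
    unfolding seg_coord_distr set_lebesgue_integral_def
    using integral_density[of "\<lambda>t. g (seg_param S t)" lborel "indicator {0..seg_length S}"] by (simp add: ennreal_indicator)
  finally show ?thesis1 .
  have "set_integrable ?h (seg_image S) g \<longleftrightarrow> integrable ?R g"
    unfolding set_integrable_def by (subst integrable_restrict_space) auto
  also have "\<dots> \<longleftrightarrow> integrable ?R (\<lambda>x. g (seg_param S (seg_coord S x)))"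
    using eq by (intro Bochner_Integration.integrable_cong) auto
  also have "\<dots> \<longleftrightarrow> integrable (distr ?R borel (seg_coord S)) (\<lambda>t. g (seg_param S t))"
    by (subst integrable_distr_eq[OF m]) auto
  also have "\<dots> \<longleftrightarrow> set_integrable lborel {0..seg_length S} (\<lambda>t. g (seg_param S t))"
    unfolding seg_coord_distr set_integrable_def
    using integrable_density[of "\<lambda>t. g (seg_param S t)" lborel "indicator {0..seg_length S}"] by (simp add: ennreal_indicator)
  finally show "set_integrable ?h (seg_image S) g \<longleftrightarrow> set_integrable lborel {0..seg_length S} (\<lambda>t. g (seg_param S t))" .
qed

lemma measure_seg_image_Int:
  assumes [measurable]: "Z \<in> sets borel"
  shows "measure hausdorff1 (Z \<inter> seg_image S) = measure lborel {t \<in> {0..seg_length S}. seg_param S t \<in> Z}"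
proof -
  have "measure hausdorff1 (Z \<inter> seg_image S) = (LINT x:seg_image S|hausdorff1. indicator Z x)"
    unfolding set_lebesgue_integral_def by (simp add: indicator_inter_arith[symmetric] Int_commute)
  also have "\<dots> = (LINT t:{0..seg_length S}|lborel. indicator Z (seg_param S t))"
    by (rule integral_seg_image) simp
  also have "\<dots> = (LINT t|lborel. indicator {t \<in> {0..seg_length S}. seg_param S t \<in> Z} t)"
    unfolding set_lebesgue_integral_def by (intro Bochner_Integration.integral_cong) (auto simp: indicator_def)
  also have "\<dots> = measure lborel {t \<in> {0..seg_length S}. seg_param S t \<in> Z}" by simp
  finally show ?thesis .
qed

lemma hausdorff1_finite_null:
  fixes F :: "(real^2) set"
  assumes "finite F" shows "F \<in> null_sets hausdorff1"
proof -
  have "{x} \<in> null_sets hausdorff1" for x :: "real^2"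
  proof -
    \<comment> \<open>A point is the degenerate interval \<open>{0..0}\<close> of an auxiliary
      segment starting there, so its measure is the length 0.\<close>
    define S where "S = \<lparr>seg_start = x, seg_length = 1, seg_angle = 0\<rparr>"
    have "{x} = seg_param S ` {0..0}" by (simp add: seg_param_def S_def)
    then have "hausdorff1_outer {x} = 0" using hausdorff1_outer_seg_interval[of 0 0 S] by simp
    then show ?thesis by (auto simp: null_sets_def emeasure_hausdorff1)
  qed
  then have "(\<Union>x\<in>F. {x}) \<in> null_sets hausdorff1"
    using assms by (intro null_sets_UN' countable_finite) auto
  then show ?thesis by simp
qed

section \<open>The segments of a chain meet in finitely many points\<close>

definition joined :: "chain \<Rightarrow> bool" where
  "joined C \<longleftrightarrow> (\<forall>k. Suc k < length C \<longrightarrow> seg_param (C ! k) (seg_length (C ! k)) = seg_param (C ! Suc k) 0)"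

lemma joined_Cons: "joined (S # T # C) \<Longrightarrow> seg_param S (seg_length S) = seg_param T 0 \<and> joined (T # C)"
  unfolding joined_def by (auto dest: spec[of _ 0] spec[of _ "Suc _"])

lemma pathstart_chain_path: "C \<noteq> [] \<Longrightarrow> pathstart (chain_path C) = seg_param (hd C) 0"
proof (induction C rule: chain_path.induct)
  case (3 S T C)
  have "pathstart (chain_path (S # T # C)) = pathstart (\<lambda>t. seg_param S (t * seg_length S))"
    by (simp only: chain_path.simps pathstart_join)
  then show ?case by (simp add: pathstart_def)
qed (auto simp: pathstart_def)

lemma path_image_seg: "seg_length S \<ge> 0 \<Longrightarrow> path_image (\<lambda>t. seg_param S (t * seg_length S)) = seg_image S"
proof -
  assume L: "seg_length S \<ge> 0"
  have "(\<lambda>t. t * seg_length S) ` {0..1} = {0..seg_length S}"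
  proof (cases "seg_length S = 0")
    case False
    then have "seg_length S > 0" using L by simp
    then show ?thesis
      by (auto simp: image_iff mult_left_le_one_le intro!: bexI[of _ "_ / seg_length S"])
  qed (auto intro!: image_eqI[of _ _ 0])
  then show ?thesis
    unfolding path_image_def seg_image_def by (metis image_image)
qed

lemma path_image_chain_path:
  assumes "C \<noteq> []" "joined C" "\<And>S. S \<in> set C \<Longrightarrow> seg_length S \<ge> 0"
  shows "path_image (chain_path C) = chain_image C"
  using assms
proof (induction C rule: chain_path.induct)
  case (2 S) then show ?case by (simp add: path_image_seg chain_image_def)
next
  case (3 S T C)
  have j: "seg_param S (seg_length S) = seg_param T 0" "joined (T # C)" using joined_Cons 3 by auto
  have "path_image (chain_path (S # T # C)) = path_image (\<lambda>t. seg_param S (t * seg_length S)) \<union> path_image (chain_path (T # C))"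
    unfolding chain_path.simps by (rule path_image_join) (simp add: pathstart_chain_path pathfinish_def j)
  with 3 j show ?case by (simp add: path_image_seg chain_image_def)
qed simp

text \<open>Splitting a simple path at its first joint shows that the first segment meets the rest
  at most in the joint and in its own starting point, the latter for closed chains. The rest is an
  arc, hence simple again, and the induction proceeds.\<close>

lemma finite_seg_Int:
  assumes "joined C" "simple_path (chain_path C)" "\<And>S. S \<in> set C \<Longrightarrow> seg_length S \<ge> 0" "i < j" "j < length C"
  shows "finite (seg_image (C ! i) \<inter> seg_image (C ! j))"
  using assms
proof (induction C arbitrary: i j rule: chain_path.induct)
  case (3 S T C)
  let ?g = "\<lambda>t. seg_param S (t * seg_length S)"
  have j: "seg_param S (seg_length S) = seg_param T 0" "joined (T # C)" using joined_Cons 3 by auto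
  have "pathfinish ?g = pathstart (chain_path (T # C))" by (simp add: pathstart_chain_path pathfinish_def j)
  then have s: "arc (chain_path (T # C))"
    "path_image ?g \<inter> path_image (chain_path (T # C)) \<subseteq> {pathstart ?g, pathstart (chain_path (T # C))}"
    using 3 by (auto elim!: simple_path_joinE)
  show ?case
  proof (cases i)
    case 0
    obtain j' where "j = Suc j'" using 3 0 by (cases j) auto
    then have "(S # T # C) ! j \<in> set (T # C)" using 3(6) nth_mem[of j' "T # C"] by simp
    then have "seg_image ((S # T # C) ! j) \<subseteq> path_image (chain_path (T # C))"
      using 3 j by (subst path_image_chain_path) (auto simp: chain_image_def)
    then have "seg_image ((S # T # C) ! i) \<inter> seg_image ((S # T # C) ! j) \<subseteq> {pathstart ?g, pathstart (chain_path (T # C))}"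
      using s(2) 0 3 by (auto simp: path_image_seg)
    then show ?thesis by (rule finite_subset) auto
  next
    case (Suc i')
    then obtain j' where "j = Suc j'" using 3 by (cases j) auto
    then show ?thesis
      using 3(1)[OF j(2) arc_imp_simple_path[OF s(1)], of i' j'] 3(4-6) Suc by simp
  qed
qed auto

lemma polygonal_chain_finite_Int:
  assumes "polygonal_chain C" "i < length C" "j < length C" "i \<noteq> j"
  shows "finite (seg_image (C ! i) \<inter> seg_image (C ! j))"
proof -
  have *: "joined C" "simple_path (chain_path C)" "\<And>S. S \<in> set C \<Longrightarrow> seg_length S \<ge> 0"
    using assms(1) by (auto simp: polygonal_chain_def joined_def oriented_segment_def)
  show ?thesis
    using finite_seg_Int[OF *, of i j] finite_seg_Int[OF *, of j i] assms by (cases "i < j") (auto simp: Int_commute)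
qed

section \<open>Gradients of smooth functions and integrals along a chain\<close>

lemma gradient_inner:
  fixes b :: "'a::euclidean_space \<Rightarrow> real"
  assumes "b differentiable (at x)"
  shows "gradient b x \<bullet> v = frechet_derivative b (at x) v"
proof -
  let ?f = "frechet_derivative b (at x)"
  have f: "(b has_derivative ?f) (at x)" using assms frechet_derivative_works by blast
  then have lin: "linear ?f" using has_derivative_linear by blast
  define D where "D = (\<Sum>i\<in>Basis. ?f i *\<^sub>R i)"
  have D: "?f h = h \<bullet> D" for h
  proof -
    have "?f h = ?f (\<Sum>i\<in>Basis. (h \<bullet> i) *\<^sub>R i)" by (simp add: euclidean_representation)
    also have "\<dots> = (\<Sum>i\<in>Basis. (h \<bullet> i) * ?f i)" by (simp add: linear_sum[OF lin] linear_cmul[OF lin])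
    finally show ?thesis by (simp add: D_def inner_sum_right mult.commute)
  qed
  have "GDERIV b x :> D" unfolding gderiv_def using f D by (simp add: ext[of ?f, OF D])
  moreover have "D' = D" if "GDERIV b x :> D'" for D'
  proof -
    have "(\<lambda>h. h \<bullet> D') = (\<lambda>h. h \<bullet> D)"
      using that \<open>GDERIV b x :> D\<close> unfolding gderiv_def by (rule has_derivative_unique)
    then show ?thesis by (metis inner_commute vector_eq_rdot)
  qed
  ultimately have "gradient b x = D" unfolding gradient_def by (rule the_equality)
  then show ?thesis by (simp add: D inner_commute)
qed

lemma smooth_differentiable: "smooth b \<Longrightarrow> b differentiable (at x)"
  unfolding smooth_def by (metis Ck.simps(2))

lemma smooth_continuous: "smooth b \<Longrightarrow> continuous_on UNIV b"
  unfolding smooth_def by (metis Ck.simps(1))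

lemma smooth_continuous_gradient:
  assumes "smooth b" shows "continuous_on UNIV (\<lambda>x. gradient b x \<bullet> v)"
proof -
  have "Ck (Suc 0) b" using assms by (simp add: smooth_def)
  then show ?thesis using gradient_inner[OF smooth_differentiable[OF assms]] by simp
qed

text \<open>\<open>chain_normal\<close> is given by a description, so measurability of the integrand
  is obtained from its agreement, off a finite set, with a sum over segments that is visibly
  Borel.\<close>

lemma borel_measurable_modify_finite:
  fixes f g :: "'a::t1_space \<Rightarrow> real"
  assumes "finite F" "g \<in> borel_measurable borel" "\<And>x. x \<notin> F \<Longrightarrow> f x = g x"
  shows "f \<in> borel_measurable borel"
proof -
  have "f x = indicator (- F) x * g x + (\<Sum>y\<in>F. f y * indicator {y} x)" for x
  proof (cases "x \<in> F")
    case True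
    then have "(\<Sum>y\<in>F. f y * indicator {y} x) = (\<Sum>y\<in>F. if y = x then f y else 0)"
      by (intro sum.cong) (auto simp: indicator_def)
    with True assms(1) show ?thesis by simp
  next
    case False
    then have "(\<Sum>y\<in>F. f y * indicator {y} x) = 0" by (intro sum.neutral) (auto simp: indicator_def)
    with False assms(3) show ?thesis by simp
  qed
  then have eq: "f = (\<lambda>x. indicator (- F) x * g x + (\<Sum>y\<in>F. f y * indicator {y} x))" by (rule ext)
  have [measurable]: "F \<in> sets borel" using assms(1) by (intro borel_closed finite_imp_closed)
  have "(\<lambda>x. indicator (- F) x * g x + (\<Sum>y\<in>F. f y * indicator {y} x)) \<in> borel_measurable borel"
    using assms(2) by measurable
  then show ?thesis by (subst eq)
qed

lemma rel_interior_seg_image: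
  assumes "seg_length S > 0"
  shows "rel_interior (seg_image S) = seg_image S - {seg_param S 0, seg_param S (seg_length S)}"
proof -
  have "seg_image S = closed_segment (seg_param S 0) (seg_param S (seg_length S))"
  proof (intro equalityI subsetI)
    fix x assume "x \<in> seg_image S"
    then obtain t where "x = seg_param S t" "0 \<le> t" "t \<le> seg_length S" by (auto simp: seg_image_def)
    then show "x \<in> closed_segment (seg_param S 0) (seg_param S (seg_length S))"
      using assms unfolding closed_segment_def
      by (auto simp: seg_param_def algebra_simps intro!: exI[of _ "t / seg_length S"])
  next
    fix x assume "x \<in> closed_segment (seg_param S 0) (seg_param S (seg_length S))"
    then obtain u where "0 \<le> u" "u \<le> 1" "x = (1 - u) *\<^sub>R seg_param S 0 + u *\<^sub>R seg_param S (seg_length S)"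
      unfolding closed_segment_def by auto
    then have "x = seg_param S (u * seg_length S)" "u * seg_length S \<in> {0..seg_length S}"
      using assms by (auto simp: seg_param_def algebra_simps mult_left_le_one_le)
    then show "x \<in> seg_image S" by (auto simp: seg_image_def)
  qed
  moreover have "seg_param S 0 \<noteq> seg_param S (seg_length S)" using inj_seg_param[of S] assms by (auto dest: injD)
  ultimately show ?thesis by (simp add: rel_interior_closed_segment open_segment_def)
qed

lemma integral_chain:
  fixes b :: "real^2 \<Rightarrow> real"
  assumes C: "polygonal_chain C" and b: "smooth b"
  shows "(LINT x:chain_image C|hausdorff1. b x * (gradient b x \<bullet> chain_normal C x))
    = (\<Sum>i<length C. LINT t:{0..seg_length (C ! i)}|lborel. b (seg_param (C ! i) t) * (gradient b (seg_param (C ! i) t) \<bullet> seg_normal (C ! i)))"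
proof -
  let ?h = "hausdorff1 :: (real^2) measure"
  define G where "G = (\<lambda>i x. b x * (gradient b x \<bullet> seg_normal (C ! i)))"
  have cG: "continuous_on UNIV (G i)" for i
    unfolding G_def by (intro continuous_intros smooth_continuous[OF b] smooth_continuous_gradient[OF b])
  then have mG [measurable]: "G i \<in> borel_measurable borel" for i by (rule borel_measurable_continuous_onI)
  have pos: "seg_length (C ! i) > 0" if "i < length C" for i
    using C that by (auto simp: polygonal_chain_def oriented_segment_def)
  \<comment> \<open>Off the end points and the pairwise intersections a point of the chain lies on
    exactly one segment, and in its relative interior. There the description operator selects that
    segment, and a single summand survives.\<close>
  define F where "F = (\<Union>i<length C. {seg_param (C ! i) 0, seg_param (C ! i) (seg_length (C ! i))})
    \<union> (\<Union>i<length C. \<Union>j\<in>{..<length C} - {i}. seg_image (C ! i) \<inter> seg_image (C ! j))"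
  have F: "finite F" unfolding F_def
    by (intro finite_UnI finite_UN_I) (auto intro: polygonal_chain_finite_Int[OF C])
  let ?H = "\<lambda>x. indicator (chain_image C) x *\<^sub>R (b x * (gradient b x \<bullet> chain_normal C x))"
  let ?S = "\<lambda>x. \<Sum>i<length C. indicator (seg_image (C ! i)) x *\<^sub>R G i x"
  have eq: "?H x = ?S x" if "x \<notin> F" for x
  proof (cases "x \<in> chain_image C")
    case True
    then obtain i where i: "i < length C" "x \<in> seg_image (C ! i)"
      by (auto simp: chain_image_def in_set_conv_nth)
    have uniq: "j = i" if "j < length C" "x \<in> seg_image (C ! j)" for j
      using \<open>x \<notin> F\<close> i that by (auto simp: F_def)
    have ri: "x \<in> rel_interior (seg_image (C ! i))"
      using \<open>x \<notin> F\<close> i by (auto simp: F_def rel_interior_seg_image[OF pos[OF i(1)]])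
    have "(THE S. S \<in> set C \<and> x \<in> rel_interior (seg_image S)) = C ! i"
    proof (rule the_equality)
      show "C ! i \<in> set C \<and> x \<in> rel_interior (seg_image (C ! i))" using i ri by simp
      fix S assume "S \<in> set C \<and> x \<in> rel_interior (seg_image S)"
      then obtain j where "j < length C" "S = C ! j" "x \<in> seg_image (C ! j)"
        using rel_interior_subset by (force simp: in_set_conv_nth)
      then show "S = C ! i" using uniq by blast
    qed
    moreover have "\<exists>S\<in>set C. x \<in> rel_interior (seg_image S)" using ri nth_mem[OF i(1)] by blast
    ultimately have "chain_normal C x = seg_normal (C ! i)"
      unfolding chain_normal_def by simp
    then have H: "?H x = G i x" using True by (simp add: G_def)
    have "?S x = indicator (seg_image (C ! i)) x *\<^sub>R G i x"
    proof (rule sum.remove[THEN trans])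
      show "i \<in> {..<length C}" using i by simp
      have "(\<Sum>j\<in>{..<length C} - {i}. indicator (seg_image (C ! j)) x *\<^sub>R G j x) = 0"
      proof (rule sum.neutral, rule ballI)
        fix j assume "j \<in> {..<length C} - {i}"
        then have "x \<notin> seg_image (C ! j)" using uniq by blast
        then show "indicator (seg_image (C ! j)) x *\<^sub>R G j x = 0" by simp
      qed
      then show "indicator (seg_image (C ! i)) x *\<^sub>R G i x + (\<Sum>j\<in>{..<length C} - {i}. indicator (seg_image (C ! j)) x *\<^sub>R G j x)
          = indicator (seg_image (C ! i)) x *\<^sub>R G i x" by simp
    qed simp
    also have "\<dots> = G i x" using i(2) by simp
    finally show ?thesis by (rule trans[OF H sym])
  next
    case False
    then have "x \<notin> seg_image (C ! i)" if "i < length C" for i using that by (auto simp: chain_image_def)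
    then have "?S x = 0" by (intro sum.neutral ballI) (simp add: indicator_def)
    then show ?thesis using False by (simp add: indicator_def)
  qed
  have Sm: "?S \<in> borel_measurable borel"
    by (intro borel_measurable_sum borel_measurable_scaleR borel_measurable_indicator seg_image_measurable mG)
  have Hm: "?H \<in> borel_measurable borel"
    by (rule borel_measurable_modify_finite[OF F Sm eq])
  have "(LINT x:chain_image C|?h. b x * (gradient b x \<bullet> chain_normal C x)) = (\<integral>x. ?S x \<partial>?h)"
    unfolding set_lebesgue_integral_def
  proof (rule integral_cong_AE)
    show "AE x in ?h. ?H x = ?S x"
      by (rule AE_I'[OF hausdorff1_finite_null[OF F]]) (use eq in blast)
  qed (use Hm Sm in \<open>simp_all cong: measurable_cong_sets\<close>)
  also have "\<dots> = (\<Sum>i<length C. LINT x:seg_image (C ! i)|?h. G i x)"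
    unfolding set_lebesgue_integral_def
  proof (rule Bochner_Integration.integral_sum)
    fix i
    have "set_integrable lborel {0..seg_length (C ! i)} (\<lambda>t. G i (seg_param (C ! i) t))"
      by (intro borel_integrable_atLeastAtMost' continuous_on_compose2[OF cG] continuous_intros) auto
    then show "integrable ?h (\<lambda>x. indicator (seg_image (C ! i)) x *\<^sub>R G i x)"
      using integral_seg_image(2)[of "G i" "C ! i"] by (simp add: set_integrable_def)
  qed
  also have "\<dots> = (\<Sum>i<length C. LINT t:{0..seg_length (C ! i)}|lborel. G i (seg_param (C ! i) t))"
    by (intro sum.cong refl integral_seg_image(1)) simp
  finally show ?thesis by (simp add: G_def)
qed

lemma signed_length_sum:
  "signed_length A C = (\<Sum>i<length A. \<Sum>j<length C. measure lborel {t \<in> {0..seg_length (C ! j)}. seg_param (C ! j) t \<in> seg_image (A ! i)} * (seg_normal (A ! i) \<bullet> seg_normal (C ! j)))"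
  unfolding signed_length_def seg_signed_length_def
  by (simp add: sum_list_sum_nth atLeast0LessThan measure_seg_image_Int)

section \<open>Convergence of characteristic functions\<close>

text \<open>The law of one coordinate after tilting \<open>M\<close> by the density
  \<open>w / Z\<close>. The lower bound 1 on \<open>w\<close> keeps \<open>Z\<close> away from 0 in
  the limit.\<close>

lemma weighted_marginal:
  fixes M :: "(real^'d) measure" and w :: "real^'d \<Rightarrow> real" and i :: 'd
  assumes "prob_space M" and sets: "sets M = sets borel"
    and w [measurable]: "w \<in> borel_measurable borel" and w1: "\<And>x. 1 \<le> w x" and wB: "\<And>x. w x \<le> B"
  defines "Z \<equiv> \<integral>x. w x \<partial>M"
  defines "D \<equiv> distr (density M (\<lambda>x. ennreal (w x / Z))) borel (\<lambda>x. x $ i)"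
  shows "real_distribution D" and "Z \<ge> 1"
    and "\<And>f :: real \<Rightarrow> 'b::{banach, second_countable_topology}. f \<in> borel_measurable borel \<Longrightarrow> (\<integral>t. f t \<partial>D) = (\<integral>x. w x *\<^sub>R f (x $ i) \<partial>M) /\<^sub>R Z"
proof -
  interpret prob_space M by fact
  note [measurable_cong] = sets
  have int: "integrable M w"
    by (rule integrable_const_bound[of _ B]) (use w1 wB in \<open>auto intro!: AE_I2 simp: abs_le_iff intro: order_trans[of _ 1]\<close>, smt (verit) w1)
  have "(\<integral>x. 1 \<partial>M) \<le> Z" unfolding Z_def using w1 int by (intro integral_mono) auto
  then show Z: "Z \<ge> 1" by (simp add: prob_space)
  have "emeasure (density M (\<lambda>x. ennreal (w x / Z))) (space M) = (\<integral>\<^sup>+x. ennreal (w x / Z) \<partial>M)"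
    by (subst emeasure_density) (auto intro!: nn_integral_cong)
  also have "\<dots> = ennreal (\<integral>x. w x / Z \<partial>M)"
    using int Z w1 by (intro nn_integral_eq_integral) (auto intro!: AE_I2 divide_nonneg_nonneg intro: order_trans[of _ 1])
  also have "(\<integral>x. w x / Z \<partial>M) = 1" using Z by (simp add: Z_def)
  finally have "prob_space (density M (\<lambda>x. ennreal (w x / Z)))" by (intro prob_spaceI) simp
  then show "real_distribution D"
    unfolding D_def by (rule prob_space.real_distribution_distr) measurable
  fix f :: "real \<Rightarrow> 'b" assume [measurable]: "f \<in> borel_measurable borel"
  have "(\<integral>t. f t \<partial>D) = (\<integral>x. f (x $ i) \<partial>density M (\<lambda>x. ennreal (w x / Z)))"
    unfolding D_def by (rule integral_distr) measurable
  also have "\<dots> = (\<integral>x. (w x / Z) *\<^sub>R f (x $ i) \<partial>M)"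
    using Z w1 by (intro integral_density) (auto intro!: AE_I2 divide_nonneg_nonneg intro: order_trans[of _ 1])
  also have "\<dots> = (\<integral>x. (w x *\<^sub>R f (x $ i)) /\<^sub>R Z \<partial>M)"
    by (intro Bochner_Integration.integral_cong refl) (simp add: divide_inverse mult.commute)
  also have "\<dots> = (\<integral>x. w x *\<^sub>R f (x $ i) \<partial>M) /\<^sub>R Z" by (rule integral_scaleR_right)
  finally show "(\<integral>t. f t \<partial>D) = (\<integral>x. w x *\<^sub>R f (x $ i) \<partial>M) /\<^sub>R Z" .
qed

section \<open>From characteristic functions to weak convergence of random vectors\<close>

locale chf_convergence =
  fixes \<mu> :: "nat \<Rightarrow> (real^'d) measure" and N :: "(real^'d) measure"
  assumes prob: "\<And>n. prob_space (\<mu> n)" "prob_space N"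
    and sets_eq [measurable_cong]: "\<And>n. sets (\<mu> n) = sets borel" "sets N = sets borel"
    and chf_tendsto: "\<And>u. (\<lambda>n. \<integral>x. iexp (u \<bullet> x) \<partial>\<mu> n) \<longlonglongrightarrow> (\<integral>x. iexp (u \<bullet> x) \<partial>N)"
begin

text \<open>Convergence is demanded against \<open>g\<close> times every character, and not merely
  against \<open>g\<close>, because this property is inherited by products with bounded continuous
  functions of one coordinate. Such products generate enough test functions.\<close>

definition good :: "(real^'d \<Rightarrow> real) \<Rightarrow> bool" where
  "good g \<longleftrightarrow> continuous_on UNIV g \<and> bounded (range g) \<and>
     (\<forall>u. (\<lambda>n. \<integral>x. g x * iexp (u \<bullet> x) \<partial>\<mu> n) \<longlonglongrightarrow> (\<integral>x. g x * iexp (u \<bullet> x) \<partial>N))"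

lemma bounded_integrable:
  fixes g :: "real^'d \<Rightarrow> 'b::{banach, second_countable_topology}"
  assumes "continuous_on UNIV g" "bounded (range g)"
  shows "integrable (\<mu> n) g" "integrable N g"
proof -
  obtain B where B: "\<And>x. norm (g x) \<le> B" using assms(2) by (auto simp: bounded_iff)
  have [measurable]: "g \<in> borel_measurable borel" using assms(1) by (rule borel_measurable_continuous_onI)
  interpret m: prob_space "\<mu> n" by (rule prob)
  interpret N: prob_space N by (rule prob)
  show "integrable (\<mu> n) g" by (rule m.integrable_const_bound[of _ B]) (use B in auto)
  show "integrable N g" by (rule N.integrable_const_bound[of _ B]) (use B in auto)
qed

lemma bounded_range_mult:
  fixes f g :: "'a \<Rightarrow> 'b::real_normed_algebra"
  assumes "bounded (range f)" "bounded (range g)" shows "bounded (range (\<lambda>x. f x * g x))"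
proof -
  obtain B C where "\<And>x. norm (f x) \<le> B" "\<And>x. norm (g x) \<le> C" using assms by (auto simp: bounded_iff)
  then have "norm (f x * g x) \<le> B * C" for x
    by (intro order_trans[OF norm_mult_ineq] mult_mono) (auto intro: order_trans[OF norm_ge_zero])
  then show ?thesis by (auto simp: bounded_iff)
qed

lemma bounded_iexp: "bounded (range (\<lambda>x. iexp (u \<bullet> x)))"
  by (auto simp: bounded_iff intro!: exI[of _ 1])

lemma bounded_of_real: "bounded (range g) \<Longrightarrow> bounded (range (\<lambda>x. complex_of_real (g x)))"
  by (auto simp: bounded_iff)

lemma integrable_char:
  assumes "continuous_on UNIV g" "bounded (range g)"
  shows "integrable (\<mu> n) (\<lambda>x. complex_of_real (g x) * iexp (u \<bullet> x))" "integrable N (\<lambda>x. complex_of_real (g x) * iexp (u \<bullet> x))"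
  by (intro bounded_integrable bounded_range_mult bounded_iexp bounded_of_real assms continuous_intros)+

lemma good_const: "good (\<lambda>_. c)"
  unfolding good_def using tendsto_mult[OF tendsto_const chf_tendsto, of "complex_of_real c"] by auto

lemma good_add: "good f \<Longrightarrow> good g \<Longrightarrow> good (\<lambda>x. f x + g x)"
  unfolding good_def
  by (auto intro!: continuous_intros bounded_plus_comp tendsto_add simp: distrib_right integrable_char)

lemma good_scale: "good f \<Longrightarrow> good (\<lambda>x. c * f x)"
  unfolding good_def
  by (auto intro!: continuous_intros bounded_range_mult tendsto_mult simp: mult.assoc image_constant_conv)

lemma good_tendsto: assumes "good g" shows "(\<lambda>n. \<integral>x. g x \<partial>\<mu> n) \<longlonglongrightarrow> (\<integral>x. g x \<partial>N)"
proof -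
  have "(\<lambda>n. \<integral>x. g x * iexp (0 \<bullet> x) \<partial>\<mu> n) \<longlonglongrightarrow> (\<integral>x. g x * iexp (0 \<bullet> x) \<partial>N)"
    using assms unfolding good_def by blast
  then show ?thesis by (simp flip: of_real_eq_iff add: tendsto_of_real_iff)
qed

text \<open>The continuity theorem on the line needs probability measures, so a complex character
  cannot serve as a weight. The factor \<open>2 + cos (u \<bullet> x - a)\<close> is at least 1 and
  still carries the frequency \<open>u\<close>; the phase \<open>a\<close> later recovers the real
  and the imaginary part.\<close>

lemma good_marginal_pos:
  assumes g: "good g" and g1: "\<And>x. 1 \<le> g x" and h: "continuous_on UNIV h" "bounded (range h)"
  shows "(\<lambda>n. \<integral>x. (g x * (2 + cos (u \<bullet> x - a))) * h (x $ i) \<partial>\<mu> n) \<longlonglongrightarrow> (\<integral>x. (g x * (2 + cos (u \<bullet> x - a))) * h (x $ i) \<partial>N)"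
proof -
  define w where "w x = g x * (2 + cos (u \<bullet> x - a))" for x
  have gc: "continuous_on UNIV g" and gb: "bounded (range g)" using g by (auto simp: good_def)
  have w: "continuous_on UNIV w" unfolding w_def by (intro continuous_intros gc)
  then have [measurable]: "w \<in> borel_measurable borel" by (rule borel_measurable_continuous_onI)
  have w1: "1 \<le> w x" for x
    using mult_mono[of 1 "g x" 1 "2 + cos (u \<bullet> x - a)"] g1[of x] cos_ge_minus_one[of "u \<bullet> x - a"] by (simp add: w_def)
  obtain C where C: "\<And>x. \<bar>g x\<bar> \<le> C" using gb by (auto simp: bounded_iff)
  have wB: "w x \<le> C * 3" for x
    unfolding w_def using C[of x] g1[of x] cos_le_one[of "u \<bullet> x - a"] cos_ge_minus_one[of "u \<bullet> x - a"] by (intro mult_mono) linarith+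
  have wbdd: "bounded (range w)" using w1 wB by (intro boundedI[of _ "C * 3"]) (auto simp: abs_le_iff intro: order_trans[of _ 1], smt (verit) w1 wB)
  have hm: "h \<in> borel_measurable borel" using h(1) by (rule borel_measurable_continuous_onI)
  define Z where "Z M = (\<integral>x. w x \<partial>M)" for M
  define D where "D M = distr (density M (\<lambda>x. ennreal (w x / Z M))) borel (\<lambda>x. x $ i)" for M
  note wm = weighted_marginal[OF prob(1) sets_eq(1) \<open>w \<in> borel_measurable borel\<close> w1 wB, folded Z_def]
    and wn = weighted_marginal[OF prob(2) sets_eq(2) \<open>w \<in> borel_measurable borel\<close> w1 wB, folded Z_def]
  note WM = wm(1)[where i = i, folded D_def] wm(2) wm(3)[where i = i, folded D_def]
    and WN = wn(1)[where i = i, folded D_def] wn(2) wn(3)[where i = i, folded D_def]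
  have key: "(\<lambda>n. \<integral>x. w x *\<^sub>R iexp (t * x $ i) \<partial>\<mu> n) \<longlonglongrightarrow> (\<integral>x. w x *\<^sub>R iexp (t * x $ i) \<partial>N)" for t
  proof -
    let ?v = "t *\<^sub>R axis i 1 :: real^'d"
    \<comment> \<open>Expanding the cosine writes the weighted character as a combination of three
      characters times \<open>g\<close>, at the frequencies \<open>?v\<close>, \<open>?v + u\<close>
      and \<open>?v - u\<close>. Goodness of \<open>g\<close> at all frequencies enters
      here.\<close>
    have e: "w x *\<^sub>R iexp (t * x $ i) = 2 * (g x * iexp (?v \<bullet> x)) + (exp (- \<i> * a) / 2) * (g x * iexp ((?v + u) \<bullet> x))
        + (exp (\<i> * a) / 2) * (g x * iexp ((?v - u) \<bullet> x))" for x
    proof -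
      have "complex_of_real (cos (u \<bullet> x - a)) = (exp (\<i> * (u \<bullet> x - a)) + exp (- \<i> * (u \<bullet> x - a))) / 2"
        by (simp add: cos_exp_eq cos_of_real[symmetric])
      then have wexp: "w x *\<^sub>R iexp (t * x $ i) = g x * (2 + (exp (\<i> * (u \<bullet> x - a)) + exp (- \<i> * (u \<bullet> x - a))) / 2) * iexp (t * x $ i)"
        by (simp add: w_def scaleR_conv_of_real)
      have vx: "?v \<bullet> x = t * x $ i" by (simp add: inner_axis')
      show ?thesis
        unfolding wexp inner_add_left inner_diff_left vx
        by (simp add: algebra_simps exp_add exp_diff exp_minus divide_simps)
    qed
    have lim: "(\<lambda>n. \<integral>x. g x * iexp (v \<bullet> x) \<partial>\<mu> n) \<longlonglongrightarrow> (\<integral>x. g x * iexp (v \<bullet> x) \<partial>N)" for v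
      using g unfolding good_def by blast
    have sp: "(\<integral>x. 2 * (complex_of_real (g x) * iexp (v1 \<bullet> x)) + c1 * (complex_of_real (g x) * iexp (v2 \<bullet> x)) + c2 * (complex_of_real (g x) * iexp (v3 \<bullet> x)) \<partial>M)
        = 2 * (\<integral>x. g x * iexp (v1 \<bullet> x) \<partial>M) + c1 * (\<integral>x. g x * iexp (v2 \<bullet> x) \<partial>M) + c2 * (\<integral>x. g x * iexp (v3 \<bullet> x) \<partial>M)"
      if "M \<in> insert N (range \<mu>)" for M v1 v2 v3 and c1 c2 :: complex
    proof -
      have i: "integrable M (\<lambda>x. complex_of_real (g x) * iexp (v \<bullet> x))" for v
        using integrable_char[OF gc gb] that by auto
      show ?thesis
        by (simp only: Bochner_Integration.integral_add Bochner_Integration.integrable_add integrable_mult_right i integral_mult_right_zero)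
    qed
    show ?thesis
      unfolding e sp[OF insertI2[OF rangeI]] sp[OF insertI1]
      by (intro tendsto_add tendsto_mult lim tendsto_const)
  qed
  have Zlim: "(\<lambda>n. Z (\<mu> n)) \<longlonglongrightarrow> Z N"
  proof -
    have "(\<lambda>n. \<integral>x. complex_of_real (w x) \<partial>\<mu> n) \<longlonglongrightarrow> (\<integral>x. complex_of_real (w x) \<partial>N)"
      using key[of 0] by (simp add: scaleR_conv_of_real)
    then show ?thesis unfolding Z_def integral_complex_of_real by (simp add: tendsto_of_real_iff)
  qed
  have "weak_conv_m (\<lambda>n. D (\<mu> n)) (D N)"
  proof (rule levy_continuity)
    fix t
    have "(\<lambda>n. (\<integral>x. w x *\<^sub>R iexp (t * x $ i) \<partial>\<mu> n) /\<^sub>R Z (\<mu> n)) \<longlonglongrightarrow> (\<integral>x. w x *\<^sub>R iexp (t * x $ i) \<partial>N) /\<^sub>R Z N"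
      using WN(2) by (intro tendsto_intros key Zlim) auto
    moreover have "char (D (\<mu> n)) t = (\<integral>x. w x *\<^sub>R iexp (t * x $ i) \<partial>\<mu> n) /\<^sub>R Z (\<mu> n)" for n
      unfolding char_def by (rule WM(3)) measurable
    moreover have "char (D N) t = (\<integral>x. w x *\<^sub>R iexp (t * x $ i) \<partial>N) /\<^sub>R Z N"
      unfolding char_def by (rule WN(3)) measurable
    ultimately show "(\<lambda>n. char (D (\<mu> n)) t) \<longlonglongrightarrow> char (D N) t" by (simp only:)
  qed (use WM(1) WN(1) in auto)
  moreover obtain B where "\<And>x. norm (h x) \<le> B" using h(2) by (auto simp: bounded_iff)
  ultimately have "(\<lambda>n. \<integral>t. h t \<partial>D (\<mu> n)) \<longlonglongrightarrow> (\<integral>t. h t \<partial>D N)"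
    using h(1) WM(1) WN(1) by (intro weak_conv_imp_integral_bdd_continuous_conv) (auto simp: continuous_on_eq_continuous_at)
  then have "(\<lambda>n. Z (\<mu> n) *\<^sub>R ((\<integral>x. w x *\<^sub>R h (x $ i) \<partial>\<mu> n) /\<^sub>R Z (\<mu> n))) \<longlonglongrightarrow> Z N *\<^sub>R ((\<integral>x. w x *\<^sub>R h (x $ i) \<partial>N) /\<^sub>R Z N)"
    unfolding WM(3)[OF hm] WN(3)[OF hm] by (rule tendsto_scaleR[OF Zlim])
  moreover have "Z (\<mu> n) \<noteq> 0" "Z N \<noteq> 0" for n using WM(2)[of n] WN(2) by auto
  ultimately show ?thesis by (simp add: w_def flip: mult.assoc)
qed

lemma good_marginal:
  assumes g: "good g" and h: "continuous_on UNIV h" "bounded (range h)"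
  shows "good (\<lambda>x. h (x $ i) * g x)"
proof -
  have pos: "good (\<lambda>x. h (x $ i) * g x)" if g: "good g" and g1: "\<And>x. 1 \<le> g x" for g
  proof -
    have gc: "continuous_on UNIV g" and gb: "bounded (range g)" using g by (auto simp: good_def)
    have hb: "bounded (range (\<lambda>x::real^'d. h (x $ i)))" using h(2) by (auto simp: bounded_iff)
    have hc: "continuous_on UNIV (\<lambda>x::real^'d. h (x $ i))"
      by (rule continuous_on_compose2[OF h(1)]) (auto intro!: continuous_intros)
    let ?f = "\<lambda>x. h (x $ i) * g x"
    have fc: "continuous_on UNIV ?f" and fb: "bounded (range ?f)"
      by (intro continuous_intros hc gc bounded_range_mult hb gb)+
    have i1: "integrable (\<mu> n) ?f" "integrable N ?f" for n using bounded_integrable[OF fc fb] by auto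
    have cb: "bounded (range (\<lambda>x. cos (u \<bullet> x - a)))" for u :: "real^'d" and a by (auto simp: bounded_iff intro!: exI[of _ 1])
    have i2: "integrable (\<mu> n) (\<lambda>x. ?f x * cos (u \<bullet> x - a))" "integrable N (\<lambda>x. ?f x * cos (u \<bullet> x - a))" for u a n
      by (intro bounded_integrable continuous_intros fc bounded_range_mult[OF fb cb])+
    have E: "(\<integral>x. (g x * (2 + cos (u \<bullet> x - a))) * h (x $ i) \<partial>M) = 2 * (\<integral>x. ?f x \<partial>M) + (\<integral>x. ?f x * cos (u \<bullet> x - a) \<partial>M)"
      if "M = N \<or> (\<exists>n. M = \<mu> n)" for M u a
    proof -
      have "(\<integral>x. (g x * (2 + cos (u \<bullet> x - a))) * h (x $ i) \<partial>M) = (\<integral>x. 2 * ?f x + ?f x * cos (u \<bullet> x - a) \<partial>M)"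
        by (intro Bochner_Integration.integral_cong refl) (simp add: algebra_simps)
      then show ?thesis using that i1 i2 by auto
    qed
    have L: "(\<lambda>n. 2 * (\<integral>x. ?f x \<partial>\<mu> n) + (\<integral>x. ?f x * cos (u \<bullet> x - a) \<partial>\<mu> n)) \<longlonglongrightarrow> 2 * (\<integral>x. ?f x \<partial>N) + (\<integral>x. ?f x * cos (u \<bullet> x - a) \<partial>N)" for u a
    proof -
      have "(\<lambda>n. \<integral>x. (g x * (2 + cos (u \<bullet> x - a))) * h (x $ i) \<partial>\<mu> n) = (\<lambda>n. 2 * (\<integral>x. ?f x \<partial>\<mu> n) + (\<integral>x. ?f x * cos (u \<bullet> x - a) \<partial>\<mu> n))"
        by (intro ext E) blast
      moreover have "(\<integral>x. (g x * (2 + cos (u \<bullet> x - a))) * h (x $ i) \<partial>N) = 2 * (\<integral>x. ?f x \<partial>N) + (\<integral>x. ?f x * cos (u \<bullet> x - a) \<partial>N)"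
        by (intro E) blast
      ultimately show ?thesis using good_marginal_pos[OF g g1 h, where u = u and a = a and i = i] by (simp only:)
    qed
    \<comment> \<open>For \<open>u = 0\<close> and \<open>a = 0\<close> the cosine factor is the
      constant 3.\<close>
    have L0: "(\<lambda>n. \<integral>x. ?f x \<partial>\<mu> n) \<longlonglongrightarrow> (\<integral>x. ?f x \<partial>N)"
      using tendsto_mult[OF tendsto_const[of "1/3"] L[of 0 0]] by simp
    have Lc: "(\<lambda>n. \<integral>x. ?f x * cos (u \<bullet> x - a) \<partial>\<mu> n) \<longlonglongrightarrow> (\<integral>x. ?f x * cos (u \<bullet> x - a) \<partial>N)" for u a
      using tendsto_diff[OF L[of u a] tendsto_mult[OF tendsto_const[of 2] L0]] by simp
    \<comment> \<open>The phases 0 and \<open>pi / 2\<close> give the real part and the imaginary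
      part of the character.\<close>
    have I: "(\<integral>x. ?f x * iexp (u \<bullet> x) \<partial>M) = complex_of_real (\<integral>x. ?f x * cos (u \<bullet> x - 0) \<partial>M) + \<i> * complex_of_real (\<integral>x. ?f x * cos (u \<bullet> x - pi / 2) \<partial>M)"
      if "M = N \<or> (\<exists>n. M = \<mu> n)" for M u
    proof -
      have "(\<integral>x. ?f x * iexp (u \<bullet> x) \<partial>M) = (\<integral>x. complex_of_real (?f x * cos (u \<bullet> x - 0)) + \<i> * complex_of_real (?f x * cos (u \<bullet> x - pi / 2)) \<partial>M)"
        by (intro Bochner_Integration.integral_cong refl)
           (simp add: cis_conv_exp[symmetric] complex_eq_iff cos_diff)
      also have "\<dots> = (\<integral>x. complex_of_real (?f x * cos (u \<bullet> x - 0)) \<partial>M) + (\<integral>x. \<i> * complex_of_real (?f x * cos (u \<bullet> x - pi / 2)) \<partial>M)"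
        using that i2[where u = u and a = 0] i2[where u = u and a = "pi/2"] by (intro Bochner_Integration.integral_add integrable_mult_right integrable_of_real) auto
      finally show ?thesis unfolding integral_mult_right_zero integral_complex_of_real .
    qed
    have "(\<lambda>n. \<integral>x. ?f x * iexp (u \<bullet> x) \<partial>\<mu> n) \<longlonglongrightarrow> (\<integral>x. ?f x * iexp (u \<bullet> x) \<partial>N)" for u
    proof -
      have "(\<lambda>n. complex_of_real (\<integral>x. ?f x * cos (u \<bullet> x - 0) \<partial>\<mu> n) + \<i> * complex_of_real (\<integral>x. ?f x * cos (u \<bullet> x - pi / 2) \<partial>\<mu> n))
         \<longlonglongrightarrow> complex_of_real (\<integral>x. ?f x * cos (u \<bullet> x - 0) \<partial>N) + \<i> * complex_of_real (\<integral>x. ?f x * cos (u \<bullet> x - pi / 2) \<partial>N)"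
        by (intro tendsto_intros Lc)
      moreover have "(\<lambda>n. \<integral>x. ?f x * iexp (u \<bullet> x) \<partial>\<mu> n) = (\<lambda>n. complex_of_real (\<integral>x. ?f x * cos (u \<bullet> x - 0) \<partial>\<mu> n) + \<i> * complex_of_real (\<integral>x. ?f x * cos (u \<bullet> x - pi / 2) \<partial>\<mu> n))"
        by (intro ext I) blast
      moreover have "(\<integral>x. ?f x * iexp (u \<bullet> x) \<partial>N) = complex_of_real (\<integral>x. ?f x * cos (u \<bullet> x - 0) \<partial>N) + \<i> * complex_of_real (\<integral>x. ?f x * cos (u \<bullet> x - pi / 2) \<partial>N)"
        by (intro I) blast
      ultimately show ?thesis by (simp only:)
    qed
    then show ?thesis using fc fb by (simp add: good_def)
  qed
  obtain c where c: "\<And>x. \<bar>g x\<bar> \<le> c" using g by (auto simp: good_def bounded_iff)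
  \<comment> \<open>A bounded \<open>g\<close> is raised by \<open>c + 1\<close>, hence to at least
    1; the correction is a multiple of the case of a constant weight.\<close>
  have "good (\<lambda>x. g x + (c + 1))" by (intro good_add g good_const)
  then have 1: "good (\<lambda>x. h (x $ i) * (g x + (c + 1)))" by (rule pos) (use c in \<open>smt (verit)\<close>)
  have 2: "good (\<lambda>x. h (x $ i) * 1)" by (rule pos[OF good_const]) simp
  have "good (\<lambda>x. h (x $ i) * (g x + (c + 1)) + (- (c + 1)) * (h (x $ i) * 1))"
    by (rule good_add[OF 1 good_scale[OF 2]])
  then show ?thesis by (simp add: algebra_simps)
qed

definition clip :: "real \<Rightarrow> real^'d \<Rightarrow> real^'d" where
  "clip R x = (\<chi> i. max (- R) (min R (x $ i)))"

text \<open>A polynomial is unbounded, but in the clipped coordinates each linear factor is a sum of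
  bounded continuous functions of one coordinate. The general good function \<open>g\<close> absorbs
  the factors already treated.\<close>

lemma good_polynomial_clip:
  assumes "real_polynomial_function p" "good g"
  shows "good (\<lambda>x. p (clip R x) * g x)"
  using assms
proof (induction p arbitrary: g rule: real_polynomial_function.induct)
  case (linear f)
  interpret bounded_linear f by fact
  have "f (clip R x) = (\<Sum>i\<in>UNIV. f (axis i 1) * max (- R) (min R (x $ i)))" for x
  proof -
    have "clip R x = (\<Sum>i\<in>UNIV. (max (- R) (min R (x $ i))) *\<^sub>R axis i 1)"
      by (simp add: vec_eq_iff clip_def axis_def if_distrib sum.delta cong: if_cong)
    then show ?thesis by (simp add: sum scaleR mult.commute)
  qed
  then have eq: "f (clip R x) * g x = (\<Sum>i\<in>UNIV. f (axis i 1) * (max (- R) (min R (x $ i)) * g x))" for x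
    by (simp add: sum_distrib_right mult.assoc)
  have gm: "good (\<lambda>x. max (- R) (min R (x $ i)) * g x)" for i
  proof (rule good_marginal[OF linear.prems])
    show "bounded (range (\<lambda>t::real. max (- R) (min R t)))"
      by (rule boundedI[of _ "\<bar>R\<bar>"]) auto
  qed (intro continuous_intros)
  have "good (\<lambda>x. \<Sum>i\<in>I. f (axis i 1) * (max (- R) (min R (x $ i)) * g x))" if "finite I" for I
    using that by (induction I rule: finite_induct) (simp_all add: good_const good_add good_scale gm)
  then show ?case unfolding eq by simp
next
  case (const c) then show ?case by (rule good_scale)
next
  case (add p q) then show ?case by (simp add: distrib_right good_add)
next
  case (mult p q) then show ?case by (simp add: mult.assoc)
qed

text \<open>On a large cube \<open>f\<close> is approximated by a polynomial, which after clipping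
  is a good function on the whole space. Outside the cube the error is at most twice the bound of
  \<open>f\<close>, and the mass there is controlled by another good function.\<close>

theorem weak_convergence:
  fixes f :: "real^'d \<Rightarrow> real"
  assumes f: "continuous_on UNIV f" "bounded (range f)"
  shows "(\<lambda>n. \<integral>x. f x \<partial>\<mu> n) \<longlonglongrightarrow> (\<integral>x. f x \<partial>N)"
proof -
  obtain B where B: "\<And>x. \<bar>f x\<bar> \<le> B" using f(2) by (auto simp: bounded_iff)
  have B0: "B \<ge> 0" using B[of 0] by auto
  \<comment> \<open>A continuous cutoff, 0 for \<open>\<bar>t\<bar> \<le> R - 1\<close> and 1 for
    \<open>\<bar>t\<bar> \<ge> R\<close>. Its sum over the coordinates dominates the indicator of
    leaving the cube; being good, it carries tightness from the limit law to the approximating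
    laws.\<close>
  define \<psi> where "\<psi> R t = min 1 (max 0 (\<bar>t\<bar> - R + 1))" for R t :: real
  define \<Psi> where "\<Psi> R x = (\<Sum>i\<in>UNIV. \<psi> R (x $ i) * 1)" for R and x :: "real^'d"
  have \<psi>c: "continuous_on UNIV (\<psi> R)" for R unfolding \<psi>_def by (intro continuous_intros)
  have \<psi>b: "bounded (range (\<psi> R))" for R by (rule boundedI[of _ 1]) (auto simp: \<psi>_def)
  have \<psi>0: "0 \<le> \<psi> R t" "\<psi> R t \<le> 1" for R t by (auto simp: \<psi>_def)
  have "good (\<lambda>x. \<Sum>i\<in>I. \<psi> R (x $ i) * 1)" if "finite I" for I R
    using that by (induction I rule: finite_induct) (auto intro!: good_const good_add good_marginal[OF good_const \<psi>c \<psi>b, of _ _ 1, simplified])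
  then have \<Psi>: "good (\<Psi> R)" for R unfolding \<Psi>_def by simp
  have \<Psi>i: "integrable N (\<Psi> R)" "integrable (\<mu> n) (\<Psi> R)" for R n
    using \<Psi>[of R] bounded_integrable[of "\<Psi> R"] by (auto simp: good_def)
  have tight: "(\<lambda>k. \<integral>x. \<Psi> (real k) x \<partial>N) \<longlonglongrightarrow> 0"
  proof -
    interpret N: prob_space N by (rule prob)
    have "(\<lambda>k. \<integral>x. \<Psi> (real k) x \<partial>N) \<longlonglongrightarrow> (\<integral>x. 0 \<partial>N)"
    proof (rule integral_dominated_convergence[where w = "\<lambda>_. real CARD('d)"])
      show "AE x in N. (\<lambda>k. \<Psi> (real k) x) \<longlonglongrightarrow> 0"
      proof (rule AE_I2)
        fix x :: "real^'d"
        have "(\<lambda>k. \<psi> (real k) (x $ i) * 1) \<longlonglongrightarrow> 0" for i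
        proof (rule tendsto_eventually)
          show "\<forall>\<^sub>F k in sequentially. \<psi> (real k) (x $ i) * 1 = 0"
            using eventually_ge_at_top[of "nat \<lceil>\<bar>x $ i\<bar> + 1\<rceil>"] by eventually_elim (simp add: \<psi>_def, linarith)
        qed
        then show "(\<lambda>k. \<Psi> (real k) x) \<longlonglongrightarrow> 0" unfolding \<Psi>_def by (rule tendsto_null_sum)
      qed
      show "AE x in N. norm (\<Psi> (real k) x) \<le> real CARD('d)" for k
      proof (rule AE_I2)
        fix x
        have "\<Psi> (real k) x \<le> (\<Sum>i\<in>(UNIV::'d set). 1)" unfolding \<Psi>_def using \<psi>0 by (intro sum_mono) auto
        moreover have "0 \<le> \<Psi> (real k) x" unfolding \<Psi>_def using \<psi>0 by (intro sum_nonneg) auto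
        ultimately show "norm (\<Psi> (real k) x) \<le> real CARD('d)" by simp
      qed
    qed (use \<Psi>i in auto)
    then show ?thesis by simp
  qed
  have clipc: "continuous_on UNIV (clip R)" for R
    unfolding clip_def by (intro continuous_intros)
  have fclip: "\<bar>f x - f (clip R x)\<bar> \<le> 2 * B * \<Psi> R x" if "R \<ge> 0" for R x
  proof (cases "\<forall>i. \<bar>x $ i\<bar> \<le> R")
    case True
    have "max (- R) (min R (x $ i)) = x $ i" for i using True[rule_format, of i] by (auto simp: max_def min_def abs_le_iff)
    then have "clip R x = x" by (simp add: clip_def)
    then show ?thesis using B0 \<psi>0 by (auto simp: \<Psi>_def intro!: mult_nonneg_nonneg sum_nonneg)
  next
    case False
    then obtain i where "\<bar>x $ i\<bar> > R" by (auto simp: not_le)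
    then have "1 \<le> \<psi> R (x $ i) * 1" by (simp add: \<psi>_def)
    also have "\<dots> \<le> \<Psi> R x" unfolding \<Psi>_def using \<psi>0 by (intro member_le_sum) auto
    finally have "2 * B * 1 \<le> 2 * B * \<Psi> R x" using B0 by (intro mult_left_mono) auto
    then show ?thesis using B[of x] B[of "clip R x"] by linarith
  qed
  have fi: "integrable (\<mu> n) f" "integrable N f" for n using bounded_integrable[OF f] by auto
  show ?thesis
  proof (rule LIMSEQ_I)
    fix r :: real assume "r > 0"
    \<comment> \<open>Mass outside the cube contributes at most 4Be + 2Be, that is 3r/8, and the
      polynomial errors contribute three times r/8; altogether less than r.\<close>
    define e where "e = r / (16 * (B + 1))"
    have e: "e > 0" using \<open>r > 0\<close> B0 by (simp add: e_def)
    obtain k where k: "\<bar>\<integral>x. \<Psi> (real k) x \<partial>N\<bar> < e"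
      using LIMSEQ_D[OF tight e] by auto
    define R where "R = real k"
    define K where "K = {x::real^'d. \<forall>i. x $ i \<in> {-R..R}}"
    have K: "compact K"
    proof -
      have "K = cbox (\<chi> i. - R) (\<chi> i. R)" by (auto simp: K_def mem_box_cart)
      then show ?thesis by simp
    qed
    have clipK: "clip R x \<in> K" for x by (auto simp: clip_def K_def R_def)
    obtain p where p: "real_polynomial_function p" "\<And>x. x \<in> K \<Longrightarrow> \<bar>f x - p x\<bar> < r / 8"
      using Stone_Weierstrass_real_polynomial_function[OF K continuous_on_subset[OF f(1)], of "r / 8"] \<open>r > 0\<close> by auto
    let ?p = "\<lambda>x. p (clip R x) * 1"
    have gp: "good ?p" by (rule good_polynomial_clip[OF p(1) good_const])
    have pi: "integrable (\<mu> n) ?p" "integrable N ?p" for n using gp bounded_integrable[of ?p] by (auto simp: good_def)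
    have bnd: "\<bar>f x - ?p x\<bar> \<le> 2 * B * \<Psi> R x + r / 8" for x
    proof -
      have "R \<ge> 0" by (simp add: R_def)
      then have "\<bar>f x - f (clip R x)\<bar> \<le> 2 * B * \<Psi> R x" "\<bar>f (clip R x) - p (clip R x)\<bar> < r / 8"
        using fclip p(2)[OF clipK] by auto
      then show ?thesis by linarith
    qed
    have near: "\<bar>(\<integral>x. f x \<partial>M) - (\<integral>x. ?p x \<partial>M)\<bar> \<le> 2 * B * (\<integral>x. \<Psi> R x \<partial>M) + r / 8" if "M = N \<or> (\<exists>n. M = \<mu> n)" for M
    proof -
      interpret M: prob_space M using that prob by auto
      have i: "integrable M f" "integrable M ?p" "integrable M (\<Psi> R)" using that fi pi \<Psi>i by auto
      have "\<bar>(\<integral>x. f x \<partial>M) - (\<integral>x. ?p x \<partial>M)\<bar> = \<bar>\<integral>x. f x - ?p x \<partial>M\<bar>" using i by simp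
      also have "\<dots> \<le> (\<integral>x. \<bar>f x - ?p x\<bar> \<partial>M)" by (rule integral_abs_bound)
      also have "\<dots> \<le> (\<integral>x. 2 * B * \<Psi> R x + r / 8 \<partial>M)" using i bnd by (intro integral_mono) auto
      also have "\<dots> = 2 * B * (\<integral>x. \<Psi> R x \<partial>M) + r / 8" using i by (simp add: M.prob_space)
      finally show ?thesis .
    qed
    obtain n1 where n1: "\<And>n. n \<ge> n1 \<Longrightarrow> \<bar>(\<integral>x. \<Psi> R x \<partial>\<mu> n) - (\<integral>x. \<Psi> R x \<partial>N)\<bar> < e"
      using LIMSEQ_D[OF good_tendsto[OF \<Psi>] e, of R] by auto
    obtain n2 where n2: "\<And>n. n \<ge> n2 \<Longrightarrow> \<bar>(\<integral>x. ?p x \<partial>\<mu> n) - (\<integral>x. ?p x \<partial>N)\<bar> < r / 8"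
      using LIMSEQ_D[OF good_tendsto[OF gp], of "r / 8"] \<open>r > 0\<close> by auto
    have "norm ((\<integral>x. f x \<partial>\<mu> n) - (\<integral>x. f x \<partial>N)) < r" if "n \<ge> max n1 n2" for n
    proof -
      have "(\<integral>x. \<Psi> R x \<partial>\<mu> n) \<le> 2 * e" "(\<integral>x. \<Psi> R x \<partial>N) \<le> e"
        using n1[of n] k that by (auto simp: R_def)
      then have "2 * B * (\<integral>x. \<Psi> R x \<partial>\<mu> n) \<le> 2 * B * (2 * e)" "2 * B * (\<integral>x. \<Psi> R x \<partial>N) \<le> 2 * B * e"
        using B0 by (intro mult_left_mono; simp)+
      moreover have "B * e \<le> r / 16" using B0 \<open>r > 0\<close> by (simp add: e_def field_simps)
      moreover have "\<bar>(\<integral>x. f x \<partial>\<mu> n) - (\<integral>x. ?p x \<partial>\<mu> n)\<bar> \<le> 2 * B * (\<integral>x. \<Psi> R x \<partial>\<mu> n) + r / 8"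
        by (rule near) blast
      moreover have "\<bar>(\<integral>x. f x \<partial>N) - (\<integral>x. ?p x \<partial>N)\<bar> \<le> 2 * B * (\<integral>x. \<Psi> R x \<partial>N) + r / 8"
        by (rule near) blast
      moreover have "\<bar>(\<integral>x. ?p x \<partial>\<mu> n) - (\<integral>x. ?p x \<partial>N)\<bar> < r / 8" using n2[of n] that by simp
      ultimately show ?thesis using \<open>r > 0\<close> unfolding real_norm_def by linarith
    qed
    then show "\<exists>no. \<forall>n\<ge>no. norm ((\<integral>x. f x \<partial>\<mu> n) - (\<integral>x. f x \<partial>N)) < r" by blast
  qed
qed

end

section \<open>The random wave and its gradient\<close>

lemma normal_law_centered:
  assumes "prob_space M" and [measurable]: "Y \<in> borel_measurable M" and N: "normal_law (distr M borel Y)"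
  shows "integrable M Y" "integrable M (\<lambda>\<omega>. (Y \<omega>)\<^sup>2)"
    and "(\<integral>\<omega>. Y \<omega> \<partial>M) = 0 \<Longrightarrow> (\<integral>\<omega>. iexp (Y \<omega>) \<partial>M) = complex_of_real (exp (- (\<integral>\<omega>. (Y \<omega>)\<^sup>2 \<partial>M) / 2))"
proof -
  interpret prob_space M by fact
  have tr: "integrable M (\<lambda>\<omega>. f (Y \<omega>)) \<longleftrightarrow> integrable (distr M borel Y) f" "(\<integral>\<omega>. f (Y \<omega>) \<partial>M) = (\<integral>x. f x \<partial>distr M borel Y)"
    if "f \<in> borel_measurable borel" for f :: "real \<Rightarrow> 'b::{banach, second_countable_topology}"
    using that by (auto simp: integrable_distr_eq integral_distr)
  from N consider m where "distr M borel Y = return borel m"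
    | m \<sigma> where "\<sigma> > 0" "distr M borel Y = density lborel (\<lambda>x. ennreal (normal_density m \<sigma> x))"
    unfolding normal_law_def by blast
  then have "integrable M Y \<and> integrable M (\<lambda>\<omega>. (Y \<omega>)\<^sup>2) \<and> ((\<integral>\<omega>. Y \<omega> \<partial>M) = 0 \<longrightarrow> (\<integral>\<omega>. iexp (Y \<omega>) \<partial>M) = complex_of_real (exp (- (\<integral>\<omega>. (Y \<omega>)\<^sup>2 \<partial>M) / 2)))"
  proof cases
    case 1
    interpret R: prob_space "return borel m" by (rule prob_space_return) simp
    have i: "integrable (return borel m) f" if "f \<in> borel_measurable borel" for f :: "real \<Rightarrow> real"
    proof (rule integrableI_bounded)
      show "f \<in> borel_measurable (return borel m)" using that by simp
      have "(\<integral>\<^sup>+x. ennreal (norm (f x)) \<partial>return borel m) = ennreal (norm (f m))"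
        using that by (intro nn_integral_return) auto
      then show "(\<integral>\<^sup>+x. ennreal (norm (f x)) \<partial>return borel m) < \<infinity>" by simp
    qed
    have ret: "(\<integral>\<omega>. f (Y \<omega>) \<partial>M) = f m" if "f \<in> borel_measurable borel" for f :: "real \<Rightarrow> 'b::{banach, second_countable_topology}"
      unfolding tr(2)[OF that] 1 by (rule integral_return) (use that in simp_all)
    have int: "integrable M (\<lambda>\<omega>. f (Y \<omega>))" if "f \<in> borel_measurable borel" for f :: "real \<Rightarrow> real"
      unfolding tr(1)[OF that] 1 by (rule i[OF that])
    have "integrable M Y" "integrable M (\<lambda>\<omega>. (Y \<omega>)\<^sup>2)" by (rule int, simp)+
    moreover have "(\<integral>\<omega>. Y \<omega> \<partial>M) = m" by (rule ret) simp
    moreover have "(\<integral>\<omega>. (Y \<omega>)\<^sup>2 \<partial>M) = m\<^sup>2" by (rule ret) simp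
    moreover have "(\<integral>\<omega>. iexp (Y \<omega>) \<partial>M) = iexp m" by (rule ret) simp
    ultimately show ?thesis by simp
  next
    case 2
    let ?D = "density lborel (\<lambda>x. ennreal (normal_density m \<sigma> x))"
    have int: "(\<integral>x. f x \<partial>?D) = (\<integral>x. normal_density m \<sigma> x *\<^sub>R f x \<partial>lborel)" if "f \<in> borel_measurable borel" for f :: "real \<Rightarrow> 'b::{banach, second_countable_topology}"
      using that by (intro integral_density) (auto simp: normal_density_nonneg)
    have ing: "integrable ?D f \<longleftrightarrow> integrable lborel (\<lambda>x. normal_density m \<sigma> x * f x)" if "f \<in> borel_measurable borel" for f :: "real \<Rightarrow> real"
      using that by (subst integrable_density) (auto simp: normal_density_nonneg)
    have mean: "(\<integral>\<omega>. Y \<omega> \<partial>M) = m"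
      using tr(2)[of "\<lambda>x. x"] int[of "\<lambda>x. x"] integral_normal_moment_nz_1[OF 2(1)] by (simp add: 2(2))
    have i1: "integrable M Y"
      using tr(1)[of "\<lambda>x. x"] ing[of "\<lambda>x. x"] integrable_normal_moment_nz_1[OF 2(1)] by (simp add: 2(2))
    have ic: "integrable M (\<lambda>\<omega>. (Y \<omega> - m)\<^sup>2)"
      using tr(1)[of "\<lambda>x. (x - m)\<^sup>2"] ing[of "\<lambda>x. (x - m)\<^sup>2"] integrable_normal_moment[OF 2(1), of m 2] by (simp add: 2(2))
    have i2: "integrable M (\<lambda>\<omega>. (Y \<omega>)\<^sup>2)"
    proof -
      have "integrable M (\<lambda>\<omega>. (Y \<omega> - m)\<^sup>2 + 2 * m * Y \<omega> - m\<^sup>2)" using ic i1 by simp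
      then show ?thesis by (simp add: power2_diff mult_ac)
    qed
    have "(\<integral>\<omega>. iexp (Y \<omega>) \<partial>M) = complex_of_real (exp (- (\<integral>\<omega>. (Y \<omega>)\<^sup>2 \<partial>M) / 2))" if "(\<integral>\<omega>. Y \<omega> \<partial>M) = 0"
    proof -
      have m: "m = 0" using mean that by simp
      have var: "(\<integral>\<omega>. (Y \<omega>)\<^sup>2 \<partial>M) = \<sigma>\<^sup>2"
        using tr(2)[of "\<lambda>x. x\<^sup>2"] int[of "\<lambda>x. x\<^sup>2"] integral_normal_moment_even[OF 2(1), of m 1] by (simp add: 2(2) m)
      have sd: "distributed M lborel Y (normal_density 0 \<sigma>)"
        unfolding distributed_def using 2(2) m by (auto intro: distr_cong trans[OF distr_cong[of M M lborel borel Y Y]])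
      have "distributed M lborel (\<lambda>x. (Y x - 0) / \<sigma>) std_normal_density"
        using normal_standard_normal_convert[OF 2(1), of Y 0] sd by simp
      then have "distr M lborel (\<lambda>x. Y x / \<sigma>) = std_normal_distribution" by (simp add: distributed_def)
      moreover have "distr M lborel (\<lambda>x. Y x / \<sigma>) = distr M borel (\<lambda>x. Y x / \<sigma>)" by (rule distr_cong) auto
      ultimately have d: "distr M borel (\<lambda>x. Y x / \<sigma>) = std_normal_distribution" by simp
      have "(\<integral>\<omega>. iexp (Y \<omega>) \<partial>M) = (\<integral>\<omega>. iexp (\<sigma> * (Y \<omega> / \<sigma>)) \<partial>M)" using 2(1) by simp
      also have "\<dots> = (\<integral>x. iexp (\<sigma> * x) \<partial>distr M borel (\<lambda>x. Y x / \<sigma>))" by (rule integral_distr[symmetric]) auto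
      also have "\<dots> = complex_of_real (exp (- \<sigma>\<^sup>2 / 2))" unfolding d by (rule std_normal_expectation_iexp)
      finally show ?thesis unfolding var .
    qed
    with i1 i2 show ?thesis by blast
  qed
  then show "integrable M Y" "integrable M (\<lambda>\<omega>. (Y \<omega>)\<^sup>2)"
    "(\<integral>\<omega>. Y \<omega> \<partial>M) = 0 \<Longrightarrow> (\<integral>\<omega>. iexp (Y \<omega>) \<partial>M) = complex_of_real (exp (- (\<integral>\<omega>. (Y \<omega>)\<^sup>2 \<partial>M) / 2))" by auto
qed

lemma centered_gaussian_family_gauss_field:
  assumes "centered_gaussian_family M X K" shows "gauss_field M X K"
proof -
  have ps: "prob_space M" and rv [measurable]: "\<And>i. X i \<in> borel_measurable M"
    and nl: "\<And>I c. finite I \<Longrightarrow> normal_law (distr M borel (\<lambda>\<omega>. \<Sum>i\<in>I. c i * X i \<omega>))"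
    and mean: "\<And>i. (\<integral>\<omega>. X i \<omega> \<partial>M) = 0" and cov: "\<And>i j. (\<integral>\<omega>. X i \<omega> * X j \<omega> \<partial>M) = K i j"
    using assms by (auto simp: centered_gaussian_family_def gaussian_family_def)
  interpret prob_space M by (rule ps)
  have nl1: "normal_law (distr M borel (X i))" for i using nl[of "{i}" "\<lambda>_. 1"] by simp
  have i1: "integrable M (X i)" and i2: "integrable M (\<lambda>\<omega>. (X i \<omega>)\<^sup>2)" for i
    using normal_law_centered[OF ps rv nl1] by auto
  have i11: "integrable M (\<lambda>\<omega>. X i \<omega> * X j \<omega>)" for i j
  proof (rule Bochner_Integration.integrable_bound)
    show "integrable M (\<lambda>\<omega>. (X i \<omega>)\<^sup>2 + (X j \<omega>)\<^sup>2)" using i2 by simp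
    show "AE \<omega> in M. norm (X i \<omega> * X j \<omega>) \<le> norm ((X i \<omega>)\<^sup>2 + (X j \<omega>)\<^sup>2)"
    proof (rule AE_I2)
      fix \<omega>
      have "0 \<le> (\<bar>X i \<omega>\<bar> - \<bar>X j \<omega>\<bar>)\<^sup>2" "0 \<le> \<bar>X i \<omega>\<bar> * \<bar>X j \<omega>\<bar>" by auto
      then have "\<bar>X i \<omega>\<bar> * \<bar>X j \<omega>\<bar> \<le> (X i \<omega>)\<^sup>2 + (X j \<omega>)\<^sup>2" unfolding power2_diff power2_abs by linarith
      then show "norm (X i \<omega> * X j \<omega>) \<le> norm ((X i \<omega>)\<^sup>2 + (X j \<omega>)\<^sup>2)" by (simp add: abs_mult)
    qed
  qed measurable
  show ?thesis
  proof
    show "K i j = K j i" for i j using cov[of i j] cov[of j i] by (simp add: mult.commute)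
    fix I :: "'b set" and c :: "'b \<Rightarrow> real" assume I: "finite I"
    let ?Y = "\<lambda>\<omega>. \<Sum>i\<in>I. c i * X i \<omega>"
    have "(\<integral>\<omega>. ?Y \<omega> \<partial>M) = 0" using i1 mean by (simp add: Bochner_Integration.integral_sum)
    moreover have "(\<integral>\<omega>. (?Y \<omega>)\<^sup>2 \<partial>M) = (\<Sum>i\<in>I. \<Sum>j\<in>I. c i * c j * K i j)"
    proof -
      have "(?Y \<omega>)\<^sup>2 = (\<Sum>i\<in>I. \<Sum>j\<in>I. (c i * c j) * (X i \<omega> * X j \<omega>))" for \<omega>
        unfolding power2_eq_square sum_product by (intro sum.cong refl) (simp only: mult_ac)
      then show ?thesis
        by (simp only: Bochner_Integration.integral_sum Bochner_Integration.integrable_sum integrable_mult_right i11 integral_mult_right_zero cov)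
    qed
    ultimately show "(\<integral>\<omega>. iexp (?Y \<omega>) \<partial>M) = complex_of_real (exp (- (\<Sum>i\<in>I. \<Sum>j\<in>I. c i * c j * K i j) / 2))"
      using normal_law_centered(3)[OF ps _ nl[OF I, of c]] by simp
  qed (rule rv)
qed

section \<open>Gaussian fields under reindexing, linear combinations and limits\<close>

lemma sum_regroup:
  fixes f :: "'b \<Rightarrow> real" and c :: "'a \<Rightarrow> real"
  assumes "finite J"
  shows "(\<Sum>i\<in>h ` J. (\<Sum>j\<in>{j \<in> J. h j = i}. c j) * f i) = (\<Sum>j\<in>J. c j * f (h j))"
proof -
  have "(\<Sum>j\<in>J. c j * f (h j)) = (\<Sum>i\<in>h ` J. \<Sum>j\<in>{j \<in> J. h j = i}. c j * f (h j))"
    using assms by (rule sum.image_gen)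
  then show ?thesis by (simp add: sum_distrib_right)
qed

text \<open>The map \<open>h\<close> may identify indices, as happens when sample points of
  different segments coincide; the coefficients are then collected over the fibres of
  \<open>h\<close>.\<close>

lemma (in gauss_field) reindex:
  fixes h :: "'j \<Rightarrow> 'i"
  shows "gauss_field M (\<lambda>j. X (h j)) (\<lambda>j k. K (h j) (h k))"
proof
  show "K (h j) (h k) = K (h k) (h j)" for j k by (rule sym)
  fix J :: "'j set" and c :: "'j \<Rightarrow> real" assume J: "finite J"
  define d where "d i = (\<Sum>j\<in>{j \<in> J. h j = i}. c j)" for i
  have "(\<Sum>j\<in>J. c j * X (h j) \<omega>) = (\<Sum>i\<in>h ` J. d i * X i \<omega>)" for \<omega>
    unfolding d_def using sum_regroup[OF J, of c h "\<lambda>i. X i \<omega>"] by simp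
  moreover have "(\<Sum>j\<in>J. \<Sum>k\<in>J. c j * c k * K (h j) (h k)) = (\<Sum>i\<in>h ` J. \<Sum>l\<in>h ` J. d i * d l * K i l)"
  proof -
    have "(\<Sum>i\<in>h ` J. \<Sum>l\<in>h ` J. d i * d l * K i l) = (\<Sum>i\<in>h ` J. d i * (\<Sum>l\<in>h ` J. d l * K i l))"
      by (simp add: sum_distrib_left mult.assoc)
    also have "\<dots> = (\<Sum>j\<in>J. c j * (\<Sum>l\<in>h ` J. d l * K (h j) l))"
      unfolding d_def using sum_regroup[OF J, of c h "\<lambda>i. \<Sum>l\<in>h ` J. (\<Sum>j\<in>{j \<in> J. h j = l}. c j) * K i l"] by simp
    also have "\<dots> = (\<Sum>j\<in>J. c j * (\<Sum>k\<in>J. c k * K (h j) (h k)))"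
      unfolding d_def using sum_regroup[OF J, of c h] by simp
    finally show ?thesis by (simp add: sum_distrib_left mult.assoc)
  qed
  ultimately show "(\<integral>\<omega>. iexp (\<Sum>j\<in>J. c j * X (h j) \<omega>) \<partial>M) = complex_of_real (exp (- (\<Sum>j\<in>J. \<Sum>k\<in>J. c j * c k * K (h j) (h k)) / 2))"
    using chf[of "h ` J" d] J by simp
qed measurable

lemma (in gauss_field) linear_pair:
  fixes f g :: "'p \<Rightarrow> 'i"
  shows "gauss_field M (\<lambda>p \<omega>. a * X (f p) \<omega> + b * X (g p) \<omega>)
    (\<lambda>p q. a * a * K (f p) (f q) + a * b * K (f p) (g q) + b * a * K (g p) (f q) + b * b * K (g p) (g q))"
proof
  show "a * a * K (f p) (f q) + a * b * K (f p) (g q) + b * a * K (g p) (f q) + b * b * K (g p) (g q) =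
     a * a * K (f q) (f p) + a * b * K (f q) (g p) + b * a * K (g q) (f p) + b * b * K (g q) (g p)" for p q
    using sym[of "f p" "f q"] sym[of "f p" "g q"] sym[of "g p" "f q"] sym[of "g p" "g q"] by simp
  fix I :: "'p set" and c :: "'p \<Rightarrow> real" assume I: "finite I"
  define h where "h = (\<lambda>(p, s). if s then f p else g p)"
  define d where "d = (\<lambda>(p, s). c p * (if s then a else b))"
  interpret H: gauss_field M "\<lambda>j. X (h j)" "\<lambda>j k. K (h j) (h k)" by (rule reindex)
  have two: "(\<Sum>s\<in>(UNIV::bool set). t s) = t True + t False" for t :: "bool \<Rightarrow> real" by (simp add: UNIV_bool)
  have e1: "(\<Sum>j\<in>I \<times> UNIV. d j * X (h j) \<omega>) = (\<Sum>p\<in>I. c p * (a * X (f p) \<omega> + b * X (g p) \<omega>))" for \<omega>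
    unfolding sum.cartesian_product'[symmetric] two by (simp add: sum.cartesian_product' two d_def h_def algebra_simps)
  have e2: "(\<Sum>j\<in>I \<times> UNIV. \<Sum>k\<in>I \<times> UNIV. d j * d k * K (h j) (h k)) =
     (\<Sum>p\<in>I. \<Sum>q\<in>I. c p * c q * (a * a * K (f p) (f q) + a * b * K (f p) (g q) + b * a * K (g p) (f q) + b * b * K (g p) (g q)))"
    by (simp add: sum.cartesian_product' two d_def h_def algebra_simps sum.distrib)
  show "(\<integral>\<omega>. iexp (\<Sum>p\<in>I. c p * (a * X (f p) \<omega> + b * X (g p) \<omega>)) \<partial>M) =
    complex_of_real (exp (- (\<Sum>p\<in>I. \<Sum>q\<in>I. c p * c q * (a * a * K (f p) (f q) + a * b * K (f p) (g q) + b * a * K (g p) (f q) + b * b * K (g p) (g q))) / 2))"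
    using H.chf[of "I \<times> UNIV" d] I unfolding e1 e2 by simp
qed measurable

text \<open>Characteristic functions pass to the limit by dominated convergence. This makes the wave
  and its gradient jointly Gaussian, since derivatives are pointwise limits of difference
  quotients.\<close>

lemma gauss_field_limit:
  fixes X :: "nat \<Rightarrow> 'j \<Rightarrow> 'w \<Rightarrow> real"
  assumes G: "\<And>n. gauss_field M (X n) (K n)"
    and X: "\<And>i \<omega>. \<omega> \<in> space M \<Longrightarrow> (\<lambda>n. X n i \<omega>) \<longlonglongrightarrow> Y i \<omega>"
    and K: "\<And>i j. (\<lambda>n. K n i j) \<longlonglongrightarrow> L i j"
  shows "gauss_field M Y L"
proof -
  interpret G0: gauss_field M "X 0" "K 0" by (rule G)
  have mX [measurable]: "X n i \<in> borel_measurable M" for n i by (rule gauss_field.rv[OF G])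
  have mY [measurable]: "Y i \<in> borel_measurable M" for i by (rule borel_measurable_LIMSEQ_real[OF X mX])
  show ?thesis
  proof
    show "L i j = L j i" for i j
      using K[of i j] K[of j i] gauss_field.sym[OF G, of _ i j] by (simp add: LIMSEQ_unique)
    fix I :: "'j set" and c :: "'j \<Rightarrow> real" assume I: "finite I"
    have "(\<lambda>n. \<integral>\<omega>. iexp (\<Sum>i\<in>I. c i * X n i \<omega>) \<partial>M) \<longlonglongrightarrow> (\<integral>\<omega>. iexp (\<Sum>i\<in>I. c i * Y i \<omega>) \<partial>M)"
    proof (rule integral_dominated_convergence[where w = "\<lambda>_. 1"])
      show "AE \<omega> in M. (\<lambda>n. iexp (\<Sum>i\<in>I. c i * X n i \<omega>)) \<longlonglongrightarrow> iexp (\<Sum>i\<in>I. c i * Y i \<omega>)"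
        by (intro AE_I2 tendsto_intros X)
    qed auto
    moreover have "(\<lambda>n. \<integral>\<omega>. iexp (\<Sum>i\<in>I. c i * X n i \<omega>) \<partial>M) \<longlonglongrightarrow> complex_of_real (exp (- (\<Sum>i\<in>I. \<Sum>j\<in>I. c i * c j * L i j) / 2))"
      unfolding gauss_field.chf[OF G I] by (intro tendsto_intros K) auto
    ultimately show "(\<integral>\<omega>. iexp (\<Sum>i\<in>I. c i * Y i \<omega>) \<partial>M) = complex_of_real (exp (- (\<Sum>i\<in>I. \<Sum>j\<in>I. c i * c j * L i j) / 2))"
      by (rule LIMSEQ_unique)
  qed measurable
qed

text \<open>The covariance \<open>J\<^sub>0(2 \<surd>\<kappa> |z|)\<close> of the wave, where \<open>\<kappa> = \<pi>\<^sup>2 E\<close>, and its first and second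
  directional derivatives.\<close>

definition k0 :: "real \<Rightarrow> real^2 \<Rightarrow> real" where
  "k0 \<kappa> z = bes 0 (\<kappa> * (z \<bullet> z))"
definition k1 :: "real \<Rightarrow> real^2 \<Rightarrow> real^2 \<Rightarrow> real" where
  "k1 \<kappa> z v = - (2 * \<kappa> * (z \<bullet> v) * bes 1 (\<kappa> * (z \<bullet> z)))"
definition k2 :: "real \<Rightarrow> real^2 \<Rightarrow> real^2 \<Rightarrow> real^2 \<Rightarrow> real" where
  "k2 \<kappa> z v w = - (2 * \<kappa> * (v \<bullet> w) * bes 1 (\<kappa> * (z \<bullet> z))) + 4 * \<kappa>\<^sup>2 * (z \<bullet> v) * (z \<bullet> w) * bes 2 (\<kappa> * (z \<bullet> z))"

lemma k0_line: "((\<lambda>h. k0 \<kappa> (z + h *\<^sub>R u)) has_real_derivative k1 \<kappa> (z + h *\<^sub>R u) u) (at h within S)"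
  unfolding k0_def k1_def inner_add_left inner_add_right inner_scaleR_left inner_scaleR_right
  by (rule derivative_eq_intros refl | simp add: algebra_simps inner_commute[of u z])+

lemma k1_line: "((\<lambda>h. k1 \<kappa> (z + h *\<^sub>R u) v) has_real_derivative k2 \<kappa> (z + h *\<^sub>R u) u v) (at h within S)"
  unfolding k1_def k2_def inner_add_left inner_add_right inner_scaleR_left inner_scaleR_right
  by (rule derivative_eq_intros refl | simp add: algebra_simps inner_commute[of u z] numeral_2_eq_2[symmetric] power2_eq_square)+

lemma continuous_on_k0 [continuous_intros]: "continuous_on S f \<Longrightarrow> continuous_on S (\<lambda>x. k0 \<kappa> (f x))"
  unfolding k0_def by (intro continuous_intros)
lemma continuous_on_k1 [continuous_intros]:
  "continuous_on S f \<Longrightarrow> continuous_on S g \<Longrightarrow> continuous_on S (\<lambda>x. k1 \<kappa> (f x) (g x))"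
  unfolding k1_def by (intro continuous_intros)
lemma continuous_on_k2 [continuous_intros]:
  "continuous_on S f \<Longrightarrow> continuous_on S g \<Longrightarrow> continuous_on S h \<Longrightarrow> continuous_on S (\<lambda>x. k2 \<kappa> (f x) (g x) (h x))"
  unfolding k2_def by (intro continuous_intros)

text \<open>Polarization: the covariance of two difference quotients involves second differences in
  the directions \<open>v - w\<close>, \<open>v\<close> and \<open>- w\<close>, and this combination
  isolates the mixed derivative.\<close>

lemma k2_diff: "k2 \<kappa> z (v - w) (v - w) - k2 \<kappa> z v v - k2 \<kappa> z (- w) (- w) = - 2 * k2 \<kappa> z v w"
  unfolding k2_def by (simp add: inner_diff_left inner_diff_right algebra_simps inner_commute[of w v])

lemma second_difference_limit:
  fixes f f' f'' :: "real \<Rightarrow> real"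
  assumes f: "\<And>h. (f has_real_derivative f' h) (at h)" and f': "\<And>h. (f' has_real_derivative f'' h) (at h)"
    and cont: "isCont f'' 0"
  shows "(\<lambda>n. real (Suc n) * (f (1 / real (Suc n)) - f 0)) \<longlonglongrightarrow> f' 0"
    and "(\<lambda>n. (real (Suc n))\<^sup>2 * (f (1 / real (Suc n)) - f 0 - f' 0 / real (Suc n))) \<longlonglongrightarrow> f'' 0 / 2"
proof -
  have "\<exists>t. 0 < t \<and> t < 1 / real (Suc n) \<and> (real (Suc n))\<^sup>2 * (f (1 / real (Suc n)) - f 0 - f' 0 / real (Suc n)) = f'' t / 2" for n
  proof -
    define h where "h = 1 / real (Suc n)"
    have h: "h > 0" by (simp add: h_def)
    define d where "d = (\<lambda>m::nat. if m = 0 then f else if m = 1 then f' else f'')"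
    have "\<exists>t>0. t < h \<and> f h = (\<Sum>m<2. d m 0 / fact m * h ^ m) + d 2 t / fact 2 * h ^ 2"
      by (rule Maclaurin[OF h]) (use f f' in \<open>auto simp: less_2_cases_iff d_def\<close>)
    then obtain t where t: "0 < t" "t < h" "f h = f 0 + f' 0 * h + f'' t / 2 * h\<^sup>2"
      by (auto simp: numeral_2_eq_2 lessThan_Suc d_def)
    have "(real (Suc n))\<^sup>2 * (f h - f 0 - f' 0 * h) = f'' t / 2"
      unfolding t(3) by (simp add: h_def power_divide del: of_nat_Suc)
    with t show ?thesis by (intro exI[of _ t]) (simp add: h_def)
  qed
  then obtain t where t: "\<And>n. 0 < t n" "\<And>n. t n < 1 / real (Suc n)"
    "\<And>n. (real (Suc n))\<^sup>2 * (f (1 / real (Suc n)) - f 0 - f' 0 / real (Suc n)) = f'' (t n) / 2" by metis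
  have "t \<longlonglongrightarrow> 0"
  proof (rule tendsto_sandwich[OF _ _ tendsto_const])
    show "(\<lambda>n. 1 / real (Suc n)) \<longlonglongrightarrow> 0" by (rule LIMSEQ_Suc[OF lim_1_over_n])
  qed (use t in \<open>auto intro!: always_eventually less_imp_le\<close>)
  then have "(\<lambda>n. f'' (t n)) \<longlonglongrightarrow> f'' 0" by (rule isCont_tendsto_compose[OF cont])
  then show lim2: "(\<lambda>n. (real (Suc n))\<^sup>2 * (f (1 / real (Suc n)) - f 0 - f' 0 / real (Suc n))) \<longlonglongrightarrow> f'' 0 / 2"
    unfolding t(3) by (intro tendsto_intros) auto
  have "(\<lambda>n. 1 / real (Suc n) * ((real (Suc n))\<^sup>2 * (f (1 / real (Suc n)) - f 0 - f' 0 / real (Suc n))) + f' 0) \<longlonglongrightarrow> 0 * (f'' 0 / 2) + f' 0"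
    by (intro tendsto_intros lim2 LIMSEQ_Suc[OF lim_1_over_n])
  moreover have "1 / real (Suc n) * ((real (Suc n))\<^sup>2 * (f (1 / real (Suc n)) - f 0 - f' 0 / real (Suc n))) + f' 0
     = real (Suc n) * (f (1 / real (Suc n)) - f 0)" for n
  proof -
    have "x \<noteq> 0 \<Longrightarrow> 1 / x * (x\<^sup>2 * (a - b - c / x)) + c = x * (a - b)" for x a b c :: real
      by (simp add: power2_eq_square field_simps)
    then show ?thesis by (simp del: of_nat_Suc)
  qed
  ultimately show "(\<lambda>n. real (Suc n) * (f (1 / real (Suc n)) - f 0)) \<longlonglongrightarrow> f' 0" by (simp only: mult_zero_left add_0)
qed

lemma k0_difference_limit:
  "(\<lambda>n. real (Suc n) * (k0 \<kappa> (z + (1 / real (Suc n)) *\<^sub>R u) - k0 \<kappa> z)) \<longlonglongrightarrow> k1 \<kappa> z u" (is ?A)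
  "(\<lambda>n. (real (Suc n))\<^sup>2 * (k0 \<kappa> (z + (1 / real (Suc n)) *\<^sub>R u) - k0 \<kappa> z - k1 \<kappa> z u / real (Suc n))) \<longlonglongrightarrow> k2 \<kappa> z u u / 2" (is ?B)
proof -
  have c: "isCont (\<lambda>h. k2 \<kappa> (z + h *\<^sub>R u) u u) 0"
  proof -
    have "continuous_on UNIV (\<lambda>h. k2 \<kappa> (z + h *\<^sub>R u) u u)" by (intro continuous_intros)
    then show ?thesis by (simp add: continuous_on_eq_continuous_at)
  qed
  show ?A using second_difference_limit(1)[OF k0_line k1_line c] by simp
  show ?B using second_difference_limit(2)[OF k0_line k1_line c] by simp
qed

text \<open>The covariance of the variables \<open>B(x) + \<langle>\<nabla>B(x), v\<rangle>\<close>, indexed by the pairs \<open>(x, v)\<close>.\<close>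

definition kz :: "real \<Rightarrow> (real^2) \<times> (real^2) \<Rightarrow> (real^2) \<times> (real^2) \<Rightarrow> real" where
  "kz \<kappa> p q = (let z = fst p - fst q in k0 \<kappa> z + k1 \<kappa> z (snd p) - k1 \<kappa> z (snd q) - k2 \<kappa> z (snd p) (snd q))"

lemma directional_difference_limit:
  fixes b :: "real^2 \<Rightarrow> real"
  assumes "b differentiable (at x)"
  shows "(\<lambda>n. real (Suc n) * (b (x + (1 / real (Suc n)) *\<^sub>R v) - b x)) \<longlonglongrightarrow> gradient b x \<bullet> v"
proof -
  have "(b has_derivative frechet_derivative b (at x)) (at x)" using assms frechet_derivative_works by blast
  then have "((\<lambda>h. b (x + h *\<^sub>R v)) has_derivative (\<lambda>h. frechet_derivative b (at x) (h *\<^sub>R v))) (at 0)"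
    by (intro has_derivative_compose[of "\<lambda>h. x + h *\<^sub>R v" _ 0 UNIV b, simplified]) (auto intro!: derivative_eq_intros)
  moreover have "(\<lambda>h. frechet_derivative b (at x) (h *\<^sub>R v)) = (\<lambda>h. (gradient b x \<bullet> v) * h)"
    using gradient_inner[OF assms] by (simp add: fun_eq_iff mult.commute flip: gradient_inner[OF assms])
  ultimately have "((\<lambda>h. b (x + h *\<^sub>R v)) has_real_derivative (gradient b x \<bullet> v)) (at 0)"
    by (simp add: has_field_derivative_def)
  then have "((\<lambda>h. (b (x + h *\<^sub>R v) - b x) / h) \<longlongrightarrow> gradient b x \<bullet> v) (at 0)"
    by (simp add: DERIV_def)
  moreover have "filterlim (\<lambda>n. 1 / real (Suc n)) (at 0) sequentially"
    by (rule filterlim_atI) (auto intro: LIMSEQ_Suc[OF lim_1_over_n] simp del: of_nat_Suc)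
  ultimately have "(\<lambda>n. (b (x + (1 / real (Suc n)) *\<^sub>R v) - b x) / (1 / real (Suc n))) \<longlonglongrightarrow> gradient b x \<bullet> v"
    by (rule filterlim_compose)
  then show ?thesis by (simp add: mult.commute del: of_nat_Suc)
qed

lemma berry_gauss_field:
  assumes B: "berry_random_wave E M B" and E: "E > 0"
  shows "gauss_field M (\<lambda>p \<omega>. B (fst p) \<omega> + gradient (\<lambda>x. B x \<omega>) (fst p) \<bullet> snd p) (kz (pi\<^sup>2 * E))"
proof -
  let ?\<kappa> = "pi\<^sup>2 * E"
  have cg: "centered_gaussian_family M B (\<lambda>x y. bessel_J0 (2 * pi * sqrt E * norm (x - y)))"
    and sm: "\<And>\<omega>. \<omega> \<in> space M \<Longrightarrow> smooth (\<lambda>x. B x \<omega>)"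
    using B by (auto simp: berry_random_wave_def)
  have kernel: "bessel_J0 (2 * pi * sqrt E * norm (x - y)) = k0 ?\<kappa> (x - y)" for x y :: "real^2"
    using E by (simp add: bessel_J0_bes k0_def power_mult_distrib power2_norm_eq_inner mult.assoc)
  interpret G: gauss_field M B "\<lambda>x y. k0 ?\<kappa> (x - y)"
    using centered_gaussian_family_gauss_field[OF cg] unfolding kernel .
  define s where "s n p = fst p + (1 / real (Suc n)) *\<^sub>R snd p" for n and p :: "(real^2) \<times> (real^2)"
  define N where "N n = real (Suc n)" for n
  show ?thesis
  proof (rule gauss_field_limit)
    show "gauss_field M (\<lambda>p \<omega>. (1 - N n) * B (fst p) \<omega> + N n * B (s n p) \<omega>)
      (\<lambda>p q. (1 - N n) * (1 - N n) * k0 ?\<kappa> (fst p - fst q) + (1 - N n) * N n * k0 ?\<kappa> (fst p - s n q)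
        + N n * (1 - N n) * k0 ?\<kappa> (s n p - fst q) + N n * N n * k0 ?\<kappa> (s n p - s n q))" for n
      by (rule G.linear_pair)
    fix p \<omega> assume "\<omega> \<in> space M"
    then have "(\<lambda>n. B (fst p) \<omega> + N n * (B (s n p) \<omega> - B (fst p) \<omega>)) \<longlonglongrightarrow> B (fst p) \<omega> + gradient (\<lambda>x. B x \<omega>) (fst p) \<bullet> snd p"
      unfolding s_def N_def by (intro tendsto_intros directional_difference_limit smooth_differentiable sm)
    then show "(\<lambda>n. (1 - N n) * B (fst p) \<omega> + N n * B (s n p) \<omega>) \<longlonglongrightarrow> B (fst p) \<omega> + gradient (\<lambda>x. B x \<omega>) (fst p) \<bullet> snd p"
      by (simp add: algebra_simps)
  next
    fix p q :: "(real^2) \<times> (real^2)"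
    define z where "z = fst p - fst q"
    define v where "v = snd p"
    define w where "w = snd q"
    \<comment> \<open>First and second order difference quotients of the covariance at
      \<open>z\<close>. Written in these terms the covariance of the quotients has no divergent
      part: the terms of order \<open>N n\<close> cancel because \<open>k1\<close> is linear in its
      direction.\<close>
    define A where "A u n = N n * (k0 ?\<kappa> (z + (1 / N n) *\<^sub>R u) - k0 ?\<kappa> z)" for u n
    define C where "C u n = (N n)\<^sup>2 * (k0 ?\<kappa> (z + (1 / N n) *\<^sub>R u) - k0 ?\<kappa> z - k1 ?\<kappa> z u / N n)" for u n
    have A: "A u \<longlonglongrightarrow> k1 ?\<kappa> z u" and C: "C u \<longlonglongrightarrow> k2 ?\<kappa> z u u / 2" for u
      unfolding A_def C_def N_def by (rule k0_difference_limit)+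
    have k1lin: "k1 ?\<kappa> z (v - w) = k1 ?\<kappa> z v + k1 ?\<kappa> z (- w)" "k1 ?\<kappa> z (- w) = - k1 ?\<kappa> z w"
      by (simp_all add: k1_def inner_diff_right algebra_simps)
    have lim: "(\<lambda>n. k0 ?\<kappa> z + A v n + A (- w) n + (C (v - w) n - C v n - C (- w) n))
       \<longlonglongrightarrow> k0 ?\<kappa> z + k1 ?\<kappa> z v + k1 ?\<kappa> z (- w) + (k2 ?\<kappa> z (v - w) (v - w) / 2 - k2 ?\<kappa> z v v / 2 - k2 ?\<kappa> z (- w) (- w) / 2)"
      by (intro tendsto_intros A C)
    have "k0 ?\<kappa> z + k1 ?\<kappa> z v + k1 ?\<kappa> z (- w) + (k2 ?\<kappa> z (v - w) (v - w) / 2 - k2 ?\<kappa> z v v / 2 - k2 ?\<kappa> z (- w) (- w) / 2) = kz ?\<kappa> p q"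
      using k2_diff[of ?\<kappa> z v w] k1lin by (simp add: kz_def z_def v_def w_def Let_def)
    moreover have "k0 ?\<kappa> z + A v n + A (- w) n + (C (v - w) n - C v n - C (- w) n) =
      (1 - N n) * (1 - N n) * k0 ?\<kappa> (fst p - fst q) + (1 - N n) * N n * k0 ?\<kappa> (fst p - s n q)
        + N n * (1 - N n) * k0 ?\<kappa> (s n p - fst q) + N n * N n * k0 ?\<kappa> (s n p - s n q)" for n
    proof -
      have e: "fst p - s n q = z + (1 / N n) *\<^sub>R (- w)" "s n p - fst q = z + (1 / N n) *\<^sub>R v"
        "s n p - s n q = z + (1 / N n) *\<^sub>R (v - w)" "fst p - fst q = z"
        by (simp_all add: s_def N_def z_def v_def w_def algebra_simps del: of_nat_Suc)
      have N0: "N n \<noteq> 0" by (simp add: N_def)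
      show ?thesis
        unfolding e A_def C_def k1lin(1)
        using N0 by (simp add: field_simps power2_eq_square)
    qed
    ultimately show "(\<lambda>n. (1 - N n) * (1 - N n) * k0 ?\<kappa> (fst p - fst q) + (1 - N n) * N n * k0 ?\<kappa> (fst p - s n q)
        + N n * (1 - N n) * k0 ?\<kappa> (s n p - fst q) + N n * N n * k0 ?\<kappa> (s n p - s n q)) \<longlonglongrightarrow> kz ?\<kappa> p q"
      using lim by (simp only:)
  qed
qed

section \<open>The limiting covariance\<close>

text \<open>\<open>h2 \<kappa> z v w\<close> is \<open>- 1 / 2\<close> times the second derivative of \<open>(k0 \<kappa>)\<^sup>2\<close> at \<open>z\<close> in the directions
  \<open>v\<close> and \<open>w\<close>, the covariance density of the functionals.\<close>

definition h2 :: "real \<Rightarrow> real^2 \<Rightarrow> real^2 \<Rightarrow> real^2 \<Rightarrow> real" where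
  "h2 \<kappa> z v w = - (k0 \<kappa> z * k2 \<kappa> z v w + k1 \<kappa> z v * k1 \<kappa> z w)"

lemma h2_line: "((\<lambda>s. - (k0 \<kappa> (z + s *\<^sub>R u) * k1 \<kappa> (z + s *\<^sub>R u) v)) has_real_derivative h2 \<kappa> (z + s *\<^sub>R u) u v) (at s within S)"
  unfolding h2_def by (rule derivative_eq_intros k0_line k1_line refl | simp add: algebra_simps)+

lemma continuous_on_h2 [continuous_intros]:
  "continuous_on S f \<Longrightarrow> continuous_on S g \<Longrightarrow> continuous_on S h \<Longrightarrow> continuous_on S (\<lambda>x. h2 \<kappa> (f x) (g x) (h x))"
  unfolding h2_def by (intro continuous_intros)

lemma h2_linear:
  "h2 \<kappa> z (a *\<^sub>R u + b *\<^sub>R v) w = a * h2 \<kappa> z u w + b * h2 \<kappa> z v w"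
  "h2 \<kappa> z w (a *\<^sub>R u + b *\<^sub>R v) = a * h2 \<kappa> z w u + b * h2 \<kappa> z w v"
  unfolding h2_def k2_def k1_def by (simp_all add: inner_add_left inner_add_right algebra_simps)

lemma h2_scale: "h2 \<kappa> z (a *\<^sub>R v) w = a * h2 \<kappa> z v w" "h2 \<kappa> z v (a *\<^sub>R w) = a * h2 \<kappa> z v w"
  unfolding h2_def k2_def k1_def by (simp_all add: algebra_simps)

lemma k0_bessel: "k0 (k\<^sup>2 / 4) z = bessel_J0 (k * norm z)"
  by (simp add: k0_def bessel_J0_bes power_mult_distrib power2_norm_eq_inner)

lemma k1_bound: assumes "k \<ge> 0" shows "\<bar>k1 (k\<^sup>2 / 4) z v\<bar> \<le> k * norm v * \<bar>J1 (k * norm z)\<bar>"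
proof -
  have "\<bar>k1 (k\<^sup>2 / 4) z v\<bar> = k\<^sup>2 / 2 * \<bar>z \<bullet> v\<bar> * \<bar>bes 1 (k\<^sup>2 / 4 * (z \<bullet> z))\<bar>"
    by (simp add: k1_def abs_mult)
  also have "\<dots> \<le> k\<^sup>2 / 2 * (norm z * norm v) * \<bar>bes 1 (k\<^sup>2 / 4 * (z \<bullet> z))\<bar>"
    by (intro mult_right_mono mult_left_mono Cauchy_Schwarz_ineq2) auto
  also have "\<dots> = k * norm v * \<bar>J1 (k * norm z)\<bar>"
    using assms by (simp add: J1_def abs_mult power_mult_distrib power2_norm_eq_inner power2_eq_square[of k])
  finally show ?thesis .
qed

lemma k0k1_bound: assumes "k \<ge> 0" shows "\<bar>k0 (k\<^sup>2 / 4) z * k1 (k\<^sup>2 / 4) z v\<bar> \<le> k * norm v * \<bar>J1 (k * norm z)\<bar>"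
proof -
  have "\<bar>k0 (k\<^sup>2 / 4) z\<bar> * \<bar>k1 (k\<^sup>2 / 4) z v\<bar> \<le> 1 * (k * norm v * \<bar>J1 (k * norm z)\<bar>)"
    using assms J0_abs_le_1 by (intro mult_mono k1_bound) (auto simp: k0_bessel)
  then show ?thesis by (simp add: abs_mult)
qed

text \<open>With f the function J0(k|z|), the left side is minus the sum of |grad f|^2 and f times
  its Laplacian. The recurrence supplies the Helmholtz equation: the Laplacian of f is -k^2
  f.\<close>

lemma h2_laplacian:
  assumes "v \<bullet> v = 1" "w \<bullet> w = 1" "(z \<bullet> v)\<^sup>2 + (z \<bullet> w)\<^sup>2 = z \<bullet> z"
  shows "h2 (k\<^sup>2 / 4) z v v + h2 (k\<^sup>2 / 4) z w w = k\<^sup>2 * besh (k * norm z)"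
proof -
  let ?x = "k\<^sup>2 / 4 * (z \<bullet> z)"
  have x: "(k * norm z)\<^sup>2 / 4 = ?x" by (simp add: power_mult_distrib power2_norm_eq_inner)
  have "h2 (k\<^sup>2 / 4) z v v + h2 (k\<^sup>2 / 4) z w w =
    k\<^sup>2 * (bes 0 ?x * bes 1 ?x) - bes 0 ?x * (k\<^sup>2 * k\<^sup>2 / 4 * ((z \<bullet> v)\<^sup>2 + (z \<bullet> w)\<^sup>2) * bes 2 ?x) - k\<^sup>2 * k\<^sup>2 / 4 * ((z \<bullet> v)\<^sup>2 + (z \<bullet> w)\<^sup>2) * (bes 1 ?x)\<^sup>2"
    unfolding h2_def k0_def k1_def k2_def by (simp add: assms(1,2) algebra_simps power2_eq_square)
  also have "\<dots> = k\<^sup>2 * (bes 0 ?x * bes 1 ?x - bes 0 ?x * (?x * bes 2 ?x) - ?x * (bes 1 ?x)\<^sup>2)"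
    unfolding assms(3) by (simp add: algebra_simps)
  also have "\<dots> = k\<^sup>2 * ((bes 0 ?x)\<^sup>2 - ?x * (bes 1 ?x)\<^sup>2)"
    unfolding bes_recurrence by (simp add: algebra_simps power2_eq_square)
  also have "\<dots> = k\<^sup>2 * besh (k * norm z)"
    unfolding besh_def bessel_J0_bes J1_def x by (simp add: power_mult_distrib power_divide power2_norm_eq_inner)
  finally show ?thesis .
qed

section \<open>Covariance integrals over pairs of segments, and tangential derivatives\<close>

lemma dominated_Icc:
  fixes f :: "nat \<Rightarrow> real \<Rightarrow> real"
  assumes f: "\<And>n. continuous_on {a..b} (f n)" and bd: "\<And>n t. t \<in> {a..b} \<Longrightarrow> \<bar>f n t\<bar> \<le> C"
    and F: "finite F" and lim: "\<And>t. t \<in> {a..b} \<Longrightarrow> t \<notin> F \<Longrightarrow> (\<lambda>n. f n t) \<longlonglongrightarrow> g t"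
    and g: "g \<in> borel_measurable borel"
  shows "(\<lambda>n. integral {a..b} (f n)) \<longlonglongrightarrow> (LINT t:{a..b}|lborel. g t)"
proof -
  have "(\<lambda>n. \<integral>t. indicator {a..b} t *\<^sub>R f n t \<partial>lborel) \<longlonglongrightarrow> (\<integral>t. indicator {a..b} t *\<^sub>R g t \<partial>lborel)"
  proof (rule integral_dominated_convergence[where w = "\<lambda>t. indicator {a..b} t * C"])
    show "(\<lambda>t. indicator {a..b} t *\<^sub>R g t) \<in> borel_measurable lborel" using g by measurable
    show "(\<lambda>t. indicator {a..b} t *\<^sub>R f n t) \<in> borel_measurable lborel" for n
      using borel_integrable_atLeastAtMost'[OF f[of n]] by (auto simp: set_integrable_def)
    show "integrable lborel (\<lambda>t. indicator {a..b} t * C)"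
      by (intro integrable_mult_left integrable_real_indicator) (auto simp: emeasure_lborel_Icc_eq)
    have "AE t in lborel. t \<notin> F"
      by (rule AE_not_in) (use F in \<open>auto intro: finite_imp_null_set_lborel\<close>)
    then show "AE t in lborel. (\<lambda>n. indicator {a..b} t *\<^sub>R f n t) \<longlonglongrightarrow> indicator {a..b} t *\<^sub>R g t"
      by eventually_elim (auto simp: indicator_def intro: lim)
    show "AE t in lborel. norm (indicator {a..b} t *\<^sub>R f n t) \<le> indicator {a..b} t * C" for n
      using bd by (intro AE_I2) (auto simp: indicator_def)
  qed
  moreover have "(\<integral>t. indicator {a..b} t *\<^sub>R f n t \<partial>lborel) = integral {a..b} (f n)" for n
    using set_borel_integral_eq_integral(2)[OF borel_integrable_atLeastAtMost'[OF f[of n]]] by (simp add: set_lebesgue_integral_def)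
  ultimately show ?thesis by (simp add: set_lebesgue_integral_def)
qed

lemma filterlim_scale_at_top:
  fixes K :: "nat \<Rightarrow> real"
  assumes "filterlim K at_top sequentially" "c > 0" shows "filterlim (\<lambda>n. K n * c) at_top sequentially"
  using filterlim_tendsto_pos_mult_at_top[OF tendsto_const assms(2,1)] by (simp add: mult.commute)

lemma endpoint_integral_null:
  assumes K: "filterlim K at_top sequentially"
  shows "(\<lambda>n. integral {0..L} (\<lambda>t. \<bar>J1 (K n * norm (p - seg_param T t))\<bar>)) \<longlonglongrightarrow> 0"
proof -
  define F where "F = {t. seg_param T t = p}"
  have F: "finite F"
  proof (cases "F = {}")
    case False
    then obtain t0 where "seg_param T t0 = p" by (auto simp: F_def)
    then have "F \<subseteq> {t0}" using inj_seg_param[of T] by (auto simp: F_def dest: injD)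
    then show ?thesis by (rule finite_subset) simp
  qed simp
  have "(\<lambda>n. integral {0..L} (\<lambda>t. \<bar>J1 (K n * norm (p - seg_param T t))\<bar>)) \<longlonglongrightarrow> (LINT t:{0..L}|lborel. 0)"
  proof (rule dominated_Icc[where C = 1, OF _ _ F])
    fix t assume "t \<notin> F"
    then have "norm (p - seg_param T t) > 0" by (auto simp: F_def)
    then have "(\<lambda>n. J1 (K n * norm (p - seg_param T t))) \<longlonglongrightarrow> 0"
      by (rule filterlim_compose[OF J1_at_top filterlim_scale_at_top[OF K]])
    then show "(\<lambda>n. \<bar>J1 (K n * norm (p - seg_param T t))\<bar>) \<longlonglongrightarrow> 0" by (rule tendsto_rabs_zero)
  qed (auto intro!: continuous_intros J1_abs_le_1)
  then show ?thesis by (simp add: set_lebesgue_integral_def)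
qed

text \<open>For a continuous kernel of the difference of two points both orders of integration are
  available; the direction to be integrated out by the fundamental theorem is always taken
  first.\<close>

definition seg_int :: "oriented_segment \<Rightarrow> oriented_segment \<Rightarrow> (real^2 \<Rightarrow> real) \<Rightarrow> real" where
  "seg_int S T f = integral (cbox (0, 0) (seg_length S, seg_length T)) (\<lambda>(s, t). f (seg_param S s - seg_param T t))"

lemma seg_int_iterated:
  assumes "continuous_on UNIV f"
  shows "seg_int S T f = integral {0..seg_length S} (\<lambda>s. integral {0..seg_length T} (\<lambda>t. f (seg_param S s - seg_param T t)))" (is ?A)
    "seg_int S T f = integral {0..seg_length T} (\<lambda>t. integral {0..seg_length S} (\<lambda>s. f (seg_param S s - seg_param T t)))" (is ?B)
    and seg_int_integrable: "(\<lambda>(s, t). f (seg_param S s - seg_param T t)) integrable_on cbox (0, 0) (seg_length S, seg_length T)" (is ?C)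
proof -
  have c: "continuous_on X (\<lambda>(s, t). f (seg_param S s - seg_param T t))" for X
    unfolding split_def by (intro continuous_on_compose2[OF assms] continuous_intros) auto
  show ?A using integral_prod_continuous[OF c, of 0 0 "seg_length S" "seg_length T"] by (simp add: seg_int_def cbox_interval)
  also have "\<dots> = integral {0..seg_length T} (\<lambda>t. integral {0..seg_length S} (\<lambda>s. f (seg_param S s - seg_param T t)))"
    unfolding cbox_interval[symmetric] by (rule integral_swap_continuous[OF c])
  finally show ?B .
  show ?C by (rule integrable_continuous[OF c])
qed

lemma seg_int_linear:
  assumes "continuous_on UNIV f" "continuous_on UNIV g"
  shows "seg_int S T (\<lambda>z. a * f z + b * g z) = a * seg_int S T f + b * seg_int S T g"
proof -
  have "seg_int S T (\<lambda>z. a * f z + b * g z) = integral (cbox (0, 0) (seg_length S, seg_length T))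
     (\<lambda>x. a * (case x of (s, t) \<Rightarrow> f (seg_param S s - seg_param T t)) + b * (case x of (s, t) \<Rightarrow> g (seg_param S s - seg_param T t)))"
    unfolding seg_int_def by (simp add: split_def)
  also have "\<dots> = a * seg_int S T f + b * seg_int S T g"
    unfolding seg_int_def using seg_int_integrable[OF assms(1), of S T] seg_int_integrable[OF assms(2), of S T]
    by (subst integral_add) (auto dest: integrable_on_cmult_left)
  finally show ?thesis .
qed

lemma continuous_h2: "continuous_on UNIV (\<lambda>z. h2 \<kappa> z v w)" by (intro continuous_intros)

text \<open>Integration along the tangent leaves \<open>k0 * k1\<close> at the end points, of size
  \<open>K n\<close> times |J1|, and the prefactor cancels \<open>K n\<close>. Since J1 tends to 0
  at infinity, what remains tends to 0. The prefactor \<open>pi / (4 * K n)\<close> is the squared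
  normalisation of the functionals when \<open>K n\<close> is the wave number.\<close>

lemma seg_int_tangent_null:
  assumes K: "filterlim K at_top sequentially" and pos: "\<And>n. K n > 0" and L: "seg_length S \<ge> 0" "seg_length T \<ge> 0"
  shows "(\<lambda>n. pi / (4 * K n) * seg_int S T (\<lambda>z. h2 ((K n)\<^sup>2 / 4) z (seg_dir S) v)) \<longlonglongrightarrow> 0"
    and "(\<lambda>n. pi / (4 * K n) * seg_int S T (\<lambda>z. h2 ((K n)\<^sup>2 / 4) z (seg_dir T) v)) \<longlonglongrightarrow> 0"
proof -
  have bound: "\<bar>pi / (4 * k) * integral {0..b} (\<lambda>t. g1 t - g2 t)\<bar>
     \<le> pi / 4 * norm v * (integral {0..b} (\<lambda>t. \<bar>J1 (k * norm (w1 t))\<bar>) + integral {0..b} (\<lambda>t. \<bar>J1 (k * norm (w2 t))\<bar>))"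
    if k: "k > 0" and c: "continuous_on {0..b} w1" "continuous_on {0..b} w2"
      and g: "\<And>t. g1 t = k0 (k\<^sup>2 / 4) (w1 t) * k1 (k\<^sup>2 / 4) (w1 t) v" "\<And>t. g2 t = k0 (k\<^sup>2 / 4) (w2 t) * k1 (k\<^sup>2 / 4) (w2 t) v"
    for k b :: real and w1 w2 :: "real \<Rightarrow> real^2" and g1 g2 :: "real \<Rightarrow> real"
  proof -
    let ?J = "\<lambda>w t. \<bar>J1 (k * norm (w t))\<bar>"
    have ci1: "?J w1 integrable_on {0..b}"
      by (rule integrable_continuous_real) (auto intro!: continuous_intros c)
    have ci2: "?J w2 integrable_on {0..b}"
      by (rule integrable_continuous_real) (auto intro!: continuous_intros c)
    have gi: "(\<lambda>t. g1 t - g2 t) integrable_on {0..b}"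
      unfolding g by (intro integrable_continuous_real continuous_intros c)
    have "norm (integral {0..b} (\<lambda>t. g1 t - g2 t)) \<le> integral {0..b} (\<lambda>t. k * norm v * (?J w1 t + ?J w2 t))"
    proof (rule integral_norm_bound_integral[OF gi])
      show "(\<lambda>t. k * norm v * (?J w1 t + ?J w2 t)) integrable_on {0..b}"
        by (intro integrable_continuous_real continuous_intros c)
      fix t
      show "norm (g1 t - g2 t) \<le> k * norm v * (?J w1 t + ?J w2 t)"
        using k0k1_bound[of k "w1 t" v] k0k1_bound[of k "w2 t" v] k unfolding g by (simp add: distrib_left)
    qed
    also have "\<dots> = k * norm v * (integral {0..b} (?J w1) + integral {0..b} (?J w2))"
      using ci1 ci2 by (simp add: integral_add)
    finally have "pi / (4 * k) * \<bar>integral {0..b} (\<lambda>t. g1 t - g2 t)\<bar> \<le> pi / (4 * k) * (k * norm v * (integral {0..b} (?J w1) + integral {0..b} (?J w2)))"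
      using k by (intro mult_left_mono) auto
    then show ?thesis using k by (simp add: abs_mult)
  qed
  have fS: "seg_int S T (\<lambda>z. h2 \<kappa> z (seg_dir S) v) = integral {0..seg_length T} (\<lambda>t.
      k0 \<kappa> (seg_param S 0 - seg_param T t) * k1 \<kappa> (seg_param S 0 - seg_param T t) v
      - k0 \<kappa> (seg_param S (seg_length S) - seg_param T t) * k1 \<kappa> (seg_param S (seg_length S) - seg_param T t) v)" for \<kappa>
    unfolding seg_int_iterated(2)[OF continuous_h2]
  proof (intro integral_cong integral_unique)
    fix t
    let ?z = "\<lambda>s. seg_param S s - seg_param T t"
    have z: "?z s = ?z 0 + s *\<^sub>R seg_dir S" for s by (simp add: seg_param_def algebra_simps)
    have "((\<lambda>s. h2 \<kappa> (?z 0 + s *\<^sub>R seg_dir S) (seg_dir S) v) has_integral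
       (- (k0 \<kappa> (?z 0 + seg_length S *\<^sub>R seg_dir S) * k1 \<kappa> (?z 0 + seg_length S *\<^sub>R seg_dir S) v)
        - - (k0 \<kappa> (?z 0 + 0 *\<^sub>R seg_dir S) * k1 \<kappa> (?z 0 + 0 *\<^sub>R seg_dir S) v))) {0..seg_length S}"
      by (rule fundamental_theorem_of_calculus[OF L(1)]) (use h2_line in \<open>simp add: has_real_derivative_iff_has_vector_derivative\<close>)
    then show "((\<lambda>s. h2 \<kappa> (?z s) (seg_dir S) v) has_integral (k0 \<kappa> (?z 0) * k1 \<kappa> (?z 0) v - k0 \<kappa> (?z (seg_length S)) * k1 \<kappa> (?z (seg_length S)) v)) {0..seg_length S}"
      unfolding z[symmetric] by simp
  qed
  have fT: "seg_int S T (\<lambda>z. h2 \<kappa> z (seg_dir T) v) = integral {0..seg_length S} (\<lambda>s.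
      k0 \<kappa> (seg_param S s - seg_param T (seg_length T)) * k1 \<kappa> (seg_param S s - seg_param T (seg_length T)) v
      - k0 \<kappa> (seg_param S s - seg_param T 0) * k1 \<kappa> (seg_param S s - seg_param T 0) v)" for \<kappa>
    unfolding seg_int_iterated(1)[OF continuous_h2]
  proof (intro integral_cong integral_unique)
    fix s
    let ?z = "\<lambda>t. seg_param S s - seg_param T t"
    \<comment> \<open>The difference moves against the direction of \<open>T\<close> as
      \<open>t\<close> grows; the sign is undone at the end by linearity of
      \<open>h2\<close>.\<close>
    have z: "?z t = ?z 0 + t *\<^sub>R (- seg_dir T)" for t by (simp add: seg_param_def algebra_simps)
    have "((\<lambda>t. h2 \<kappa> (?z 0 + t *\<^sub>R (- seg_dir T)) (- seg_dir T) v) has_integral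
       (- (k0 \<kappa> (?z 0 + seg_length T *\<^sub>R (- seg_dir T)) * k1 \<kappa> (?z 0 + seg_length T *\<^sub>R (- seg_dir T)) v)
        - - (k0 \<kappa> (?z 0 + 0 *\<^sub>R (- seg_dir T)) * k1 \<kappa> (?z 0 + 0 *\<^sub>R (- seg_dir T)) v))) {0..seg_length T}"
      by (rule fundamental_theorem_of_calculus[OF L(2)]) (rule h2_line[unfolded has_real_derivative_iff_has_vector_derivative])
    then have "((\<lambda>t. h2 \<kappa> (?z t) (- seg_dir T) v) has_integral (k0 \<kappa> (?z 0) * k1 \<kappa> (?z 0) v - k0 \<kappa> (?z (seg_length T)) * k1 \<kappa> (?z (seg_length T)) v)) {0..seg_length T}"
      unfolding z[symmetric] by simp
    from has_integral_neg[OF this]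
    show "((\<lambda>t. h2 \<kappa> (?z t) (seg_dir T) v) has_integral (k0 \<kappa> (?z (seg_length T)) * k1 \<kappa> (?z (seg_length T)) v - k0 \<kappa> (?z 0) * k1 \<kappa> (?z 0) v)) {0..seg_length T}"
      using h2_scale(1)[of \<kappa> _ "-1" "seg_dir T" v] by simp
  qed
  have null: "(\<lambda>n. pi / 4 * norm v * (integral {0..b} (\<lambda>t. \<bar>J1 (K n * norm (p - seg_param R t))\<bar>) + integral {0..b} (\<lambda>t. \<bar>J1 (K n * norm (q - seg_param R t))\<bar>))) \<longlonglongrightarrow> 0" for b p q R
  proof -
    have "(\<lambda>n. pi / 4 * norm v * (integral {0..b} (\<lambda>t. \<bar>J1 (K n * norm (p - seg_param R t))\<bar>) + integral {0..b} (\<lambda>t. \<bar>J1 (K n * norm (q - seg_param R t))\<bar>))) \<longlonglongrightarrow> pi / 4 * norm v * (0 + 0)"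
      by (intro tendsto_intros endpoint_integral_null K)
    then show ?thesis by simp
  qed
  show "(\<lambda>n. pi / (4 * K n) * seg_int S T (\<lambda>z. h2 ((K n)\<^sup>2 / 4) z (seg_dir S) v)) \<longlonglongrightarrow> 0"
    unfolding fS
    by (rule Lim_null_comparison[OF always_eventually null[where R = T and b = "seg_length T" and p = "seg_param S 0" and q = "seg_param S (seg_length S)"]])
       (intro allI, unfold real_norm_def, intro bound pos continuous_intros refl)
  show "(\<lambda>n. pi / (4 * K n) * seg_int S T (\<lambda>z. h2 ((K n)\<^sup>2 / 4) z (seg_dir T) v)) \<longlonglongrightarrow> 0"
    unfolding fT norm_minus_commute[of "seg_param T _"]
    by (rule Lim_null_comparison[OF always_eventually null[where R = S and b = "seg_length S" and p = "seg_param T (seg_length T)" and q = "seg_param T 0"]])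
       (intro allI, unfold real_norm_def norm_minus_commute[of "seg_param T _"], intro bound pos continuous_intros refl)
qed

section \<open>Parallel segments\<close>

lemma besP_scaled_integral:
  assumes "L \<ge> 0"
  shows "integral {0..L} (\<lambda>s. k * besh (k * \<bar>s - x\<bar>)) = besP (k * (L - x)) + besP (k * x)"
proof -
  have hi: "((\<lambda>s. k * besh (k * (s - x))) has_integral (besP (k * (L - x)) - besP (k * (0 - x)))) {0..L}"
  proof (rule fundamental_theorem_of_calculus[OF assms])
    fix s
    have "((\<lambda>s. besP (k * (s - x))) has_real_derivative k * besh (k * (s - x))) (at s within {0..L})"
      by (rule derivative_eq_intros refl | simp)+
    then show "((\<lambda>s. besP (k * (s - x))) has_vector_derivative k * besh (k * (s - x))) (at s within {0..L})"
      by (simp add: has_real_derivative_iff_has_vector_derivative)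
  qed
  have e: "besh (k * \<bar>s - x\<bar>) = besh (k * (s - x))" for s
    using besh_minus[of "k * (s - x)"] by (cases "s \<ge> x") (simp_all add: algebra_simps)
  have "besP (k * (0 - x)) = - besP (k * x)" using besP_minus[of "k * x"] by simp
  then show ?thesis unfolding e integral_unique[OF hi] by simp
qed

lemma besP_scaled_limit:
  fixes K :: "nat \<Rightarrow> real"
  assumes "filterlim K at_top sequentially"
  shows "y > 0 \<Longrightarrow> (\<lambda>n. besP (K n * y)) \<longlonglongrightarrow> 2 / pi"
    and "y < 0 \<Longrightarrow> (\<lambda>n. besP (K n * y)) \<longlonglongrightarrow> - (2 / pi)"
proof -
  show *: "(\<lambda>n. besP (K n * y)) \<longlonglongrightarrow> 2 / pi" if "y > 0" for y
    by (rule filterlim_compose[OF besP_limit filterlim_scale_at_top[OF assms that]])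
  show "(\<lambda>n. besP (K n * y)) \<longlonglongrightarrow> - (2 / pi)" if "y < 0"
    using tendsto_minus[OF *[of "- y"]] that besP_minus[of "K _ * - y"] by simp
qed

lemma besh_decay: obtains C where "C \<ge> 1" "\<And>k r. k > 0 \<Longrightarrow> r > 0 \<Longrightarrow> \<bar>k * besh (k * r)\<bar> \<le> C / r"
proof -
  obtain C where C: "C \<ge> 1" "\<And>u. \<bar>u\<bar> * ((bessel_J0 u)\<^sup>2 + (J1 u)\<^sup>2) \<le> C" by (rule J_decay) blast
  have "\<bar>k * besh (k * r)\<bar> \<le> C / r" if "k > 0" "r > 0" for k r
  proof -
    have "\<bar>besh (k * r)\<bar> \<le> (bessel_J0 (k * r))\<^sup>2 + (J1 (k * r))\<^sup>2" unfolding besh_def by (simp add: abs_le_iff)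
    then have "\<bar>k * r\<bar> * \<bar>besh (k * r)\<bar> \<le> C" using C(2)[of "k * r"] by (meson abs_ge_zero mult_left_mono order_trans)
    then show ?thesis using that by (simp add: abs_mult field_simps)
  qed
  with C that show thesis by blast
qed

text \<open>The weight \<open>(s - x)\<^sup>2 / ((s - x)\<^sup>2 + \<epsilon>)\<close> removes the stationary point of the distance;
  away from it the integrand is the derivative of \<open>besP (k r) - 2 / pi\<close> up to a smooth factor.\<close>

lemma besh_offset_null:
  fixes K :: "nat \<Rightarrow> real"
  assumes K: "filterlim K at_top sequentially" and pos: "\<And>n. K n > 0" and L: "L \<ge> 0" and \<delta>: "\<delta> \<noteq> 0"
  shows "(\<lambda>n. integral {0..L} (\<lambda>s. K n * besh (K n * sqrt ((s - x)\<^sup>2 + \<delta>\<^sup>2)))) \<longlonglongrightarrow> 0"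
proof -
  define r where "r s = sqrt ((s - x)\<^sup>2 + \<delta>\<^sup>2)" for s
  have r\<delta>: "r s \<ge> \<bar>\<delta>\<bar>" for s unfolding r_def by (rule real_le_rsqrt) simp
  have r0: "r s > 0" for s using r\<delta>[of s] \<delta> by linarith
  have rpos: "(s - x)\<^sup>2 + \<delta>\<^sup>2 > 0" for s using \<delta> by (simp add: add_nonneg_pos)
  have rd: "(r has_real_derivative (s - x) / r s) (at s within S)" for s S
    unfolding r_def using rpos[of s] by (auto intro!: derivative_eq_intros simp: divide_simps)
  have rc: "continuous_on S r" for S unfolding r_def by (intro continuous_intros)
  obtain C where C: "C \<ge> 1" "\<And>u. \<bar>besP u\<bar> \<le> C" by (rule besP_bounded) blast
  obtain C' where C': "C' \<ge> 1" "\<And>k r. k > 0 \<Longrightarrow> r > 0 \<Longrightarrow> \<bar>k * besh (k * r)\<bar> \<le> C' / r" by (rule besh_decay) blast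
  \<comment> \<open>The distance is at least \<open>\<bar>\<delta>\<bar>\<close>, so the decay of
    \<open>besh\<close> bounds the scaled integrand uniformly in \<open>n\<close> and
    \<open>s\<close>.\<close>
  define D where "D = C' / \<bar>\<delta>\<bar>"
  have D0: "D > 0" using C' \<delta> by (simp add: D_def)
  have D: "\<bar>K n * besh (K n * r s)\<bar> \<le> D" for n s
  proof -
    have "C' / r s \<le> D" unfolding D_def using r\<delta>[of s] \<delta> C'(1) by (intro divide_left_mono mult_pos_pos r0) auto
    then show ?thesis using C'(2)[OF pos[of n] r0[of s]] by simp
  qed
  define h where "h n s = K n * besh (K n * r s)" for n s
  have hc: "continuous_on S (h n)" for S n unfolding h_def by (intro continuous_intros rc)
  \<comment> \<open>Subtracting the limit gives a primitive that tends to 0 pointwise, so that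
    boundary terms and the remaining integral disappear.\<close>
  define P where "P n s = besP (K n * r s) - 2 / pi" for n s
  have Pc: "continuous_on S (P n)" for S n unfolding P_def by (intro continuous_intros rc)
  have Plim: "(\<lambda>n. P n s) \<longlonglongrightarrow> 0" for s
    using tendsto_diff[OF besP_scaled_limit(1)[OF K r0] tendsto_const[of "2 / pi"]] by (simp add: P_def)
  have Pb: "\<bar>P n s\<bar> \<le> C + 2 / pi" for n s
  proof -
    have "2 / pi > 0" by simp
    then show ?thesis using C(2)[of "K n * r s"] unfolding P_def by linarith
  qed
  \<comment> \<open>First \<open>n\<close> grows with the regularisation fixed, and
    \<open>\<eta>\<close> absorbs the integrated part. Since \<open>D\<close> does not depend on the
    regularisation, the latter may tend to 0 afterwards.\<close>
  have split: "eventually (\<lambda>n. \<bar>integral {0..L} (h n)\<bar> \<le> D * integral {0..L} (\<lambda>s. \<epsilon> / ((s - x)\<^sup>2 + \<epsilon>)) + \<eta>) sequentially"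
    if \<epsilon>: "\<epsilon> > 0" and \<eta>: "\<eta> > 0" for \<epsilon> \<eta>
  proof -
    define q where "q s = (s - x)\<^sup>2 + \<epsilon>" for s
    have q: "q s > 0" for s unfolding q_def using \<epsilon> by (simp add: add_nonneg_pos)
    have qc: "continuous_on S q" for S unfolding q_def by (intro continuous_intros)
    have qd: "(q has_real_derivative 2 * (s - x)) (at s within S)" for s S
      unfolding q_def by (rule derivative_eq_intros refl | simp)+
    \<comment> \<open>Chosen so that the derivative of \<open>P n\<close> times \<open>f\<close> is
      the weighted integrand: differentiating the distance yields
      \<open>(s - x) / r s\<close>.\<close>
    define f where "f s = r s * (s - x) / q s" for s
    define f' where "f' s = (((s - x) / r s * (s - x) + r s) * q s - r s * (s - x) * (2 * (s - x))) / (q s * q s)" for s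
    have fd: "(f has_real_derivative f' s) (at s within S)" for s S
      unfolding f_def f'_def using q[of s] by (auto intro!: derivative_eq_intros rd qd)
    have rn: "r s \<noteq> 0" "q s \<noteq> 0" for s using r0[of s] q[of s] by auto
    have f'c: "continuous_on S f'" for S unfolding f'_def by (intro continuous_intros rc qc) (auto simp: rn)
    have eq: "integral {0..L} (h n) = (P n L * f L - P n 0 * f 0) - integral {0..L} (\<lambda>s. P n s * f' s) + integral {0..L} (\<lambda>s. h n s * (\<epsilon> / q s))" for n
    proof -
      have "((\<lambda>s. h n s * ((s - x)\<^sup>2 / q s) + P n s * f' s) has_integral (P n L * f L - P n 0 * f 0)) {0..L}"
      proof (rule fundamental_theorem_of_calculus[OF L])
        fix s
        have "((\<lambda>s. P n s * f s) has_real_derivative (besh (K n * r s) * (K n * ((s - x) / r s))) * f s + P n s * f' s) (at s within {0..L})"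
          unfolding P_def by (auto intro!: derivative_eq_intros rd fd)
        moreover have "(besh (K n * r s) * (K n * ((s - x) / r s))) * f s = h n s * ((s - x)\<^sup>2 / q s)"
          using rn(1)[of s] by (simp add: h_def f_def power2_eq_square)
        ultimately show "((\<lambda>s. P n s * f s) has_vector_derivative h n s * ((s - x)\<^sup>2 / q s) + P n s * f' s) (at s within {0..L})"
          by (simp add: has_real_derivative_iff_has_vector_derivative)
      qed
      moreover have "((\<lambda>s. P n s * f' s) has_integral integral {0..L} (\<lambda>s. P n s * f' s)) {0..L}"
        by (intro integrable_integral integrable_continuous_real continuous_intros Pc f'c)
      moreover have "((\<lambda>s. h n s * (\<epsilon> / q s)) has_integral integral {0..L} (\<lambda>s. h n s * (\<epsilon> / q s))) {0..L}"
        by (intro integrable_integral integrable_continuous_real continuous_intros hc qc) (auto simp: rn)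
      ultimately have "((\<lambda>s. (h n s * ((s - x)\<^sup>2 / q s) + P n s * f' s) - P n s * f' s + h n s * (\<epsilon> / q s)) has_integral
         (P n L * f L - P n 0 * f 0) - integral {0..L} (\<lambda>s. P n s * f' s) + integral {0..L} (\<lambda>s. h n s * (\<epsilon> / q s))) {0..L}"
        by (intro has_integral_add has_integral_diff)
      moreover have "(h n s * ((s - x)\<^sup>2 / q s) + P n s * f' s) - P n s * f' s + h n s * (\<epsilon> / q s) = h n s" for s
      proof -
        have "(s - x)\<^sup>2 / q s + \<epsilon> / q s = 1" using rn(2)[of s] by (simp add: q_def flip: add_divide_distrib)
        then have "h n s * ((s - x)\<^sup>2 / q s + \<epsilon> / q s) = h n s" by simp
        then show ?thesis by (simp add: distrib_left)
      qed
      ultimately show ?thesis by (simp add: integral_unique)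
    qed
    have b: "\<bar>integral {0..L} (\<lambda>s. h n s * (\<epsilon> / q s))\<bar> \<le> D * integral {0..L} (\<lambda>s. \<epsilon> / q s)" for n
    proof -
      have "norm (integral {0..L} (\<lambda>s. h n s * (\<epsilon> / q s))) \<le> integral {0..L} (\<lambda>s. D * (\<epsilon> / q s))"
      proof (rule integral_norm_bound_integral)
        show "(\<lambda>s. h n s * (\<epsilon> / q s)) integrable_on {0..L}" "(\<lambda>s. D * (\<epsilon> / q s)) integrable_on {0..L}"
          by (rule integrable_continuous_real; auto intro!: continuous_intros hc qc simp: rn)+
        show "norm (h n s * (\<epsilon> / q s)) \<le> D * (\<epsilon> / q s)" for s
        proof -
          have "\<bar>h n s\<bar> * (\<epsilon> / q s) \<le> D * (\<epsilon> / q s)" using D[of n s] \<epsilon> q[of s] unfolding h_def by (intro mult_right_mono) auto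
          then show ?thesis using \<epsilon> q[of s] by (simp add: abs_mult)
        qed
      qed
      then show ?thesis by (simp only: real_norm_def integral_mult_right)
    qed
    obtain B where B: "\<And>s. s \<in> {0..L} \<Longrightarrow> \<bar>f' s\<bar> \<le> B"
    proof -
      have "bounded (f' ` {0..L})" by (intro compact_imp_bounded compact_continuous_image f'c) auto
      then obtain B where "\<forall>y\<in>f' ` {0..L}. norm y \<le> B" by (auto simp: bounded_iff)
      then show thesis by (intro that[of B]) auto
    qed
    have "(\<lambda>n. integral {0..L} (\<lambda>s. P n s * f' s)) \<longlonglongrightarrow> (LINT s:{0..L}|lborel. 0)"
    proof (rule dominated_Icc[where F = "{}" and C = "(C + 2 / pi) * B"])
      show "continuous_on {0..L} (\<lambda>s. P n s * f' s)" for n by (intro continuous_intros Pc f'c)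
      show "\<bar>P n s * f' s\<bar> \<le> (C + 2 / pi) * B" if "s \<in> {0..L}" for n s
        unfolding abs_mult using Pb[of n s] B[OF that] C(1) by (intro mult_mono) auto
      show "(\<lambda>n. P n s * f' s) \<longlonglongrightarrow> 0" for s by (rule tendsto_mult_left_zero[OF Plim])
    qed auto
    then have i0: "(\<lambda>n. integral {0..L} (\<lambda>s. P n s * f' s)) \<longlonglongrightarrow> 0" by (simp add: set_lebesgue_integral_def)
    have "(\<lambda>n. (P n L * f L - P n 0 * f 0) - integral {0..L} (\<lambda>s. P n s * f' s)) \<longlonglongrightarrow> (0 * f L - 0 * f 0) - 0"
      by (intro tendsto_intros Plim i0)
    then have "(\<lambda>n. (P n L * f L - P n 0 * f 0) - integral {0..L} (\<lambda>s. P n s * f' s)) \<longlonglongrightarrow> 0" by simp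
    from tendstoD[OF this \<eta>] show ?thesis
    proof eventually_elim
      case (elim n)
      then show ?case using b[of n] unfolding eq[of n] q_def[symmetric] dist_real_def by linarith
    qed
  qed
  have "(\<lambda>m. integral {0..L} (\<lambda>s. (1 / real (Suc m)) / ((s - x)\<^sup>2 + 1 / real (Suc m)))) \<longlonglongrightarrow> (LINT s:{0..L}|lborel. 0)"
  proof (rule dominated_Icc[where F = "{x}" and C = 1])
    have p: "(s - x)\<^sup>2 + 1 / real (Suc m) > 0" for s m by (intro add_nonneg_pos) (auto simp del: of_nat_Suc)
    show "continuous_on {0..L} (\<lambda>s. (1 / real (Suc m)) / ((s - x)\<^sup>2 + 1 / real (Suc m)))" for m
      using p[of _ m] by (intro continuous_intros) (metis less_irrefl)
    have frac: "\<bar>e / (a + e)\<bar> \<le> 1" if "a \<ge> 0" "e > 0" for a e :: real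
      using that by (simp add: pos_divide_le_eq)
    show "\<bar>(1 / real (Suc m)) / ((s - x)\<^sup>2 + 1 / real (Suc m))\<bar> \<le> 1" for s m
      by (rule frac) (auto simp del: of_nat_Suc)
    fix s assume "s \<notin> {x}"
    then have "(\<lambda>m. (1 / real (Suc m)) / ((s - x)\<^sup>2 + 1 / real (Suc m))) \<longlonglongrightarrow> 0 / ((s - x)\<^sup>2 + 0)"
      by (intro tendsto_intros LIMSEQ_Suc[OF lim_1_over_n]) auto
    then show "(\<lambda>m. (1 / real (Suc m)) / ((s - x)\<^sup>2 + 1 / real (Suc m))) \<longlonglongrightarrow> 0" by simp
  qed auto
  then have small: "(\<lambda>m. D * integral {0..L} (\<lambda>s. (1 / real (Suc m)) / ((s - x)\<^sup>2 + 1 / real (Suc m)))) \<longlonglongrightarrow> D * 0"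
    by (intro tendsto_intros) (simp add: set_lebesgue_integral_def)
  show ?thesis
  proof (rule LIMSEQ_I)
    fix e :: real assume e: "e > 0"
    then have "\<forall>\<^sub>F m in sequentially. D * integral {0..L} (\<lambda>s. (1 / real (Suc m)) / ((s - x)\<^sup>2 + 1 / real (Suc m))) < e / 2"
      using order_tendstoD(2)[OF small, of "e / 2"] by simp
    then obtain m where m: "D * integral {0..L} (\<lambda>s. (1 / real (Suc m)) / ((s - x)\<^sup>2 + 1 / real (Suc m))) < e / 2"
      by (auto simp: eventually_sequentially)
    have "eventually (\<lambda>n. norm (integral {0..L} (h n) - 0) < e) sequentially"
      using split[of "1 / real (Suc m)" "e / 2"] e
    proof (simp del: of_nat_Suc, elim eventually_mono)
      fix n assume "\<bar>integral {0..L} (h n)\<bar> \<le> D * integral {0..L} (\<lambda>s. 1 / (real (Suc m) * ((s - x)\<^sup>2 + 1 / real (Suc m)))) + e / 2"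
      with m show "\<bar>integral {0..L} (h n)\<bar> < e" by simp
    qed
    moreover have "h n = (\<lambda>s. K n * besh (K n * sqrt ((s - x)\<^sup>2 + \<delta>\<^sup>2)))" for n by (rule ext) (simp add: h_def r_def)
    ultimately show "\<exists>no. \<forall>n\<ge>no. norm (integral {0..L} (\<lambda>s. K n * besh (K n * sqrt ((s - x)\<^sup>2 + \<delta>\<^sup>2))) - 0) < e"
      by (simp only: eventually_sequentially)
  qed
qed

lemma vector_frame:
  fixes v :: "real^2" shows "v = (v \<bullet> seg_dir S) *\<^sub>R seg_dir S + (v \<bullet> seg_normal S) *\<^sub>R seg_normal S"
    and "(v \<bullet> seg_dir S)\<^sup>2 + (v \<bullet> seg_normal S)\<^sup>2 = v \<bullet> v"
proof -
  have cs: "sin a * sin a = 1 - cos a * cos a" for a :: real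
    using sin_cos_squared_add[of a] by (simp add: power2_eq_square)
  define x y c s where "x = v $ 1" and "y = v $ 2" and "c = cos (seg_angle S)" and "s = sin (seg_angle S)"
  have css: "s * s = 1 - c * c" unfolding c_def s_def by (rule cs)
  have d: "v \<bullet> seg_dir S = x * c + y * s" "v \<bullet> seg_normal S = y * c - x * s" "v \<bullet> v = x * x + y * y"
    by (simp_all add: inner_vec_def sum_2 seg_normal_def x_def y_def c_def s_def)
  have "x = (x * c + y * s) * c - (y * c - x * s) * s" "y = (x * c + y * s) * s + (y * c - x * s) * c"
    using css by algebra+
  then show "v = (v \<bullet> seg_dir S) *\<^sub>R seg_dir S + (v \<bullet> seg_normal S) *\<^sub>R seg_normal S"
    unfolding d by (simp add: vec_eq_iff forall_2 seg_normal_def x_def[symmetric] y_def[symmetric] c_def[symmetric] s_def[symmetric])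
  show "(v \<bullet> seg_dir S)\<^sup>2 + (v \<bullet> seg_normal S)\<^sup>2 = v \<bullet> v"
    unfolding d using css by algebra
qed

lemma seg_normal_inner:
  "seg_normal S \<bullet> seg_normal T = seg_dir S \<bullet> seg_dir T" "seg_dir S \<bullet> seg_normal T = - (seg_normal S \<bullet> seg_dir T)"
  by (simp_all add: seg_normal_def inner_vector2 algebra_simps)

text \<open>Transversal and parallel segments are separated by whether \<open>d\<close> vanishes. In
  the first case the overlap has at most one point; in the second the lines may still be distinct,
  and only collinear segments contribute.\<close>

lemma seg_int_normal_limit:
  fixes K :: "nat \<Rightarrow> real"
  assumes K: "filterlim K at_top sequentially" and pos: "\<And>n. K n > 0" and L: "seg_length S > 0" "seg_length T > 0"
  shows "(\<lambda>n. pi / (4 * K n) * seg_int S T (\<lambda>z. h2 ((K n)\<^sup>2 / 4) z (seg_normal S) (seg_normal T))) \<longlonglongrightarrow>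
    measure lborel {t \<in> {0..seg_length T}. seg_param T t \<in> seg_image S} * (seg_normal S \<bullet> seg_normal T)"
proof -
  let ?A = "{t \<in> {0..seg_length T}. seg_param T t \<in> seg_image S}"
  define d where "d = seg_dir S \<bullet> seg_normal T"
  have nd: "seg_normal S \<bullet> seg_dir T = - d" using seg_normal_inner(2)[of S T] by (simp add: d_def)
  have L': "seg_length S \<ge> 0" "seg_length T \<ge> 0" using L by auto
  show ?thesis
  proof (cases "d = 0")
    case False
    \<comment> \<open>For transversal segments the two tangents span the plane, so the normal of
      \<open>S\<close> is a combination of them. Both tangential contributions are already known to
      vanish.\<close>
    define a where "a = (seg_normal S \<bullet> seg_normal T) / d"
    have n: "seg_normal S = a *\<^sub>R seg_dir S + (- (1 / d)) *\<^sub>R seg_dir T"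
    proof -
      have T: "seg_dir T = (seg_normal S \<bullet> seg_normal T) *\<^sub>R seg_dir S + (- d) *\<^sub>R seg_normal S"
        using vector_frame(1)[of "seg_dir T" S] nd seg_normal_inner(1)[of S T] by (simp add: inner_commute)
      show ?thesis unfolding T a_def using False by (simp add: algebra_simps)
    qed
    have one: "?A \<subseteq> {t}" if t: "t \<in> ?A" for t
    proof
      fix t' assume "t' \<in> ?A"
      with t obtain s s' where s: "seg_param T t = seg_param S s" "seg_param T t' = seg_param S s'" by (auto simp: seg_image_def)
      have "(t - t') *\<^sub>R seg_dir T = (s - s') *\<^sub>R seg_dir S"
        using seg_param_diff[of T t t'] seg_param_diff[of S s s'] s by simp
      then have "seg_normal S \<bullet> ((t - t') *\<^sub>R seg_dir T) = seg_normal S \<bullet> ((s - s') *\<^sub>R seg_dir S)" by simp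
      then have "(t - t') * - d = 0" using nd by simp
      then show "t' \<in> {t}" using False by simp
    qed
    have "finite ?A"
    proof (cases "?A = {}")
      case True
      then show ?thesis by (simp only: finite.emptyI)
    next
      case False
      then obtain t where "t \<in> ?A" by blast
      then show ?thesis using one[of t] finite_subset[of ?A "{t}"] by blast
    qed
    then have m0: "measure lborel ?A = 0" by (intro measure_eq_0_null_sets finite_imp_null_set_lborel)
    have "(\<lambda>n. a * (pi / (4 * K n) * seg_int S T (\<lambda>z. h2 ((K n)\<^sup>2 / 4) z (seg_dir S) (seg_normal T))) +
       - (1 / d) * (pi / (4 * K n) * seg_int S T (\<lambda>z. h2 ((K n)\<^sup>2 / 4) z (seg_dir T) (seg_normal T)))) \<longlonglongrightarrow> a * 0 + - (1 / d) * 0"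
      by (intro tendsto_intros seg_int_tangent_null[OF K pos L'])
    moreover have "pi / (4 * K n) * seg_int S T (\<lambda>z. h2 ((K n)\<^sup>2 / 4) z (seg_normal S) (seg_normal T)) =
      a * (pi / (4 * K n) * seg_int S T (\<lambda>z. h2 ((K n)\<^sup>2 / 4) z (seg_dir S) (seg_normal T))) +
       - (1 / d) * (pi / (4 * K n) * seg_int S T (\<lambda>z. h2 ((K n)\<^sup>2 / 4) z (seg_dir T) (seg_normal T)))" for n
      by (subst n, subst h2_linear, subst seg_int_linear[OF continuous_h2 continuous_h2]) (simp only: algebra_simps)
    ultimately show ?thesis using m0 by simp
  next
    case True
    define e where "e = seg_normal S \<bullet> seg_normal T"
    have nT: "seg_normal T = e *\<^sub>R seg_normal S" and dT: "seg_dir T = e *\<^sub>R seg_dir S"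
      using vector_frame(1)[of "seg_normal T" S] vector_frame(1)[of "seg_dir T" S] True nd seg_normal_inner(1)[of S T]
      by (simp_all add: d_def e_def inner_commute)
    have e2: "e * e = 1" using seg_dir_normal(2)[of T] unfolding nT by simp
    \<comment> \<open>Coordinates relative to \<open>S\<close>: \<open>x t\<close> is the position
      of the foot of the point \<open>t\<close> of \<open>T\<close> on the line of \<open>S\<close>,
      and \<open>\<delta>\<close> the constant offset between the lines.\<close>
    define c0 where "c0 = (seg_param T 0 - seg_param S 0) \<bullet> seg_dir S"
    define \<delta> where "\<delta> = (seg_param T 0 - seg_param S 0) \<bullet> seg_normal S"
    define x where "x t = c0 + e * t" for t
    have z: "seg_param S s - seg_param T t = (s - x t) *\<^sub>R seg_dir S - \<delta> *\<^sub>R seg_normal S" for s t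
    proof -
      have "seg_param T 0 - seg_param S 0 = c0 *\<^sub>R seg_dir S + \<delta> *\<^sub>R seg_normal S"
        unfolding c0_def \<delta>_def by (rule vector_frame(1))
      moreover have "seg_param S s - seg_param T t = (seg_param S s - seg_param S 0) - (seg_param T 0 - seg_param S 0) - (seg_param T t - seg_param T 0)" by simp
      ultimately show ?thesis unfolding seg_param_diff dT x_def by (simp add: algebra_simps)
    qed
    have nz: "norm (seg_param S s - seg_param T t) = sqrt ((s - x t)\<^sup>2 + \<delta>\<^sup>2)" for s t
      unfolding z norm_eq_sqrt_inner by (simp add: inner_diff_left inner_diff_right power2_eq_square)
    let ?G = "\<lambda>n t. integral {0..seg_length S} (\<lambda>s. K n * besh (K n * sqrt ((s - x t)\<^sup>2 + \<delta>\<^sup>2)))"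
    have cb: "continuous_on UNIV (\<lambda>z::real^2. k * besh (k * norm z))" for k by (intro continuous_intros)
    have it: "seg_int S T (\<lambda>z. K n * besh (K n * norm z)) = integral {0..seg_length T} (?G n)" for n
      unfolding seg_int_iterated(2)[OF cb] nz ..
    have xinj: "finite {t. x t = y}" for y
    proof (rule finite_subset[of _ "{(y - c0) * e}"])
      show "{t. x t = y} \<subseteq> {(y - c0) * e}"
        unfolding x_def using e2 by auto
    qed simp
    have Gc: "continuous_on {0..seg_length T} (?G n)" for n
      unfolding cbox_interval[symmetric] x_def by (rule integral_continuous_on_param) (auto simp: split_def intro!: continuous_intros)
    have Ameas: "?A \<in> sets borel"
    proof -
      have "seg_param T \<in> borel_measurable borel" by (intro borel_measurable_continuous_onI continuous_intros)
      then have "{t. seg_param T t \<in> seg_image S} \<in> sets borel" using measurable_sets_borel[OF _ seg_image_measurable] by (auto simp: vimage_def)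
      then have "{0..seg_length T} \<inter> {t. seg_param T t \<in> seg_image S} \<in> sets borel" by auto
      then show ?thesis by (simp add: Int_def)
    qed
    have inA: "seg_param T t \<in> seg_image S \<longleftrightarrow> \<delta> = 0 \<and> 0 \<le> x t \<and> x t \<le> seg_length S" for t
    proof -
      have "seg_param T t \<in> seg_image S \<longleftrightarrow> (\<exists>s\<in>{0..seg_length S}. norm (seg_param S s - seg_param T t) = 0)"
        unfolding seg_image_def by (simp add: image_iff) metis
      also have "\<dots> \<longleftrightarrow> (\<exists>s\<in>{0..seg_length S}. s = x t \<and> \<delta> = 0)"
        unfolding nz by (simp add: add_nonneg_eq_0_iff)
      finally show ?thesis by auto
    qed
    have main: "(\<lambda>n. integral {0..seg_length T} (?G n)) \<longlonglongrightarrow> 4 / pi * measure lborel ?A"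
    proof (cases "\<delta> = 0")
      case \<delta>: False
      obtain C where C: "C \<ge> 1" "\<And>k r. k > 0 \<Longrightarrow> r > 0 \<Longrightarrow> \<bar>k * besh (k * r)\<bar> \<le> C / r" by (rule besh_decay) blast
      have "(\<lambda>n. integral {0..seg_length T} (?G n)) \<longlonglongrightarrow> (LINT t:{0..seg_length T}|lborel. 0)"
      proof (rule dominated_Icc[OF Gc, where F = "{}" and C = "C / \<bar>\<delta>\<bar> * seg_length S"])
        fix n t
        have "norm (?G n t) \<le> integral {0..seg_length S} (\<lambda>s. C / \<bar>\<delta>\<bar>)"
        proof (rule integral_norm_bound_integral)
          fix s
          have r: "\<bar>\<delta>\<bar> \<le> sqrt ((s - x t)\<^sup>2 + \<delta>\<^sup>2)" by (rule real_le_rsqrt) simp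
          then have r0: "sqrt ((s - x t)\<^sup>2 + \<delta>\<^sup>2) > 0" using \<delta> by linarith
          have "\<bar>K n * besh (K n * sqrt ((s - x t)\<^sup>2 + \<delta>\<^sup>2))\<bar> \<le> C / sqrt ((s - x t)\<^sup>2 + \<delta>\<^sup>2)"
            by (rule C(2)[OF pos r0])
          also have "\<dots> \<le> C / \<bar>\<delta>\<bar>" using r r0 \<delta> C(1) by (intro divide_left_mono mult_pos_pos) auto
          finally show "norm (K n * besh (K n * sqrt ((s - x t)\<^sup>2 + \<delta>\<^sup>2))) \<le> C / \<bar>\<delta>\<bar>" by simp
        qed (auto intro!: integrable_continuous_real continuous_intros)
        then show "\<bar>?G n t\<bar> \<le> C / \<bar>\<delta>\<bar> * seg_length S" using L' by (simp add: mult.commute)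
      next
        show "(\<lambda>n. ?G n t) \<longlonglongrightarrow> 0" for t by (rule besh_offset_null[OF K pos L'(1) \<delta>])
      qed auto
      moreover have m0: "measure lborel ?A = 0" unfolding inA using \<delta> by simp
      ultimately show ?thesis unfolding m0 by (simp add: set_lebesgue_integral_def)
    next
      case \<delta>: True
      have G: "?G n t = besP (K n * (seg_length S - x t)) + besP (K n * x t)" for n t
        using besP_scaled_integral[OF L'(1), of "K n" "x t"] \<delta> by simp
      obtain C where C: "C \<ge> 1" "\<And>u. \<bar>besP u\<bar> \<le> C" by (rule besP_bounded) blast
      \<comment> \<open>The two terms tend to \<open>2 / pi\<close> with the signs of
        \<open>seg_length S - x t\<close> and \<open>x t\<close>. They add up to
        \<open>4 / pi\<close> inside \<open>S\<close> and cancel outside; the end points of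
        \<open>S\<close> are hit for finitely many \<open>t\<close> only.\<close>
      have "(\<lambda>n. integral {0..seg_length T} (?G n)) \<longlonglongrightarrow> (LINT t:{0..seg_length T}|lborel. 4 / pi * indicator ?A t)"
      proof (rule dominated_Icc[OF Gc, where F = "{t. x t = 0} \<union> {t. x t = seg_length S}" and C = "2 * C"])
        show "\<bar>?G n t\<bar> \<le> 2 * C" for n t
          unfolding G using C(2)[of "K n * (seg_length S - x t)"] C(2)[of "K n * x t"] by linarith
        fix t assume t: "t \<in> {0..seg_length T}" "t \<notin> {t. x t = 0} \<union> {t. x t = seg_length S}"
        consider "x t < 0" | "0 < x t" "x t < seg_length S" | "seg_length S < x t" using t(2) by fastforce
        then show "(\<lambda>n. ?G n t) \<longlonglongrightarrow> 4 / pi * indicator ?A t"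
        proof cases
          case 1
          then have "(\<lambda>n. ?G n t) \<longlonglongrightarrow> 2 / pi + - (2 / pi)"
            unfolding G using L by (intro tendsto_intros besP_scaled_limit[OF K]) auto
          moreover have "t \<notin> ?A" using 1 inA by auto
          ultimately show ?thesis by simp
        next
          case 2
          then have "(\<lambda>n. ?G n t) \<longlonglongrightarrow> 2 / pi + 2 / pi"
            unfolding G by (intro tendsto_intros besP_scaled_limit[OF K]) auto
          moreover have "t \<in> ?A" using 2 inA \<delta> t by auto
          ultimately show ?thesis by simp
        next
          case 3
          then have "(\<lambda>n. ?G n t) \<longlonglongrightarrow> - (2 / pi) + 2 / pi"
            unfolding G using L by (intro tendsto_intros besP_scaled_limit[OF K]) auto
          moreover have "t \<notin> ?A" using 3 inA by auto
          ultimately show ?thesis by simp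
        qed
      qed (use xinj Ameas in auto)
      moreover have "(LINT t:{0..seg_length T}|lborel. 4 / pi * indicator ?A t) = 4 / pi * measure lborel ?A"
      proof -
        have "(LINT t:{0..seg_length T}|lborel. 4 / pi * indicator ?A t) = (\<integral>t. 4 / pi * indicator ?A t \<partial>lborel)"
          unfolding set_lebesgue_integral_def by (intro Bochner_Integration.integral_cong) (auto simp: indicator_def)
        then show ?thesis by simp
      qed
      ultimately show ?thesis by simp
    qed
    have "(\<lambda>n. e * (pi / 4 * integral {0..seg_length T} (?G n)) + - e * (pi / (4 * K n) * seg_int S T (\<lambda>z. h2 ((K n)\<^sup>2 / 4) z (seg_dir S) (seg_dir S))))
       \<longlonglongrightarrow> e * (pi / 4 * (4 / pi * measure lborel ?A)) + - e * 0"
      by (intro tendsto_intros main seg_int_tangent_null[OF K pos L'])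
    moreover have "e * (pi / 4 * (4 / pi * measure lborel ?A)) + - e * 0 = measure lborel ?A * e" by simp
    moreover have "pi / (4 * K n) * seg_int S T (\<lambda>z. h2 ((K n)\<^sup>2 / 4) z (seg_normal S) (seg_normal T)) =
      e * (pi / 4 * integral {0..seg_length T} (?G n)) + - e * (pi / (4 * K n) * seg_int S T (\<lambda>z. h2 ((K n)\<^sup>2 / 4) z (seg_dir S) (seg_dir S)))" for n
    proof -
      \<comment> \<open>The normal part is the Laplacian minus the tangential part; \<open>e\<close>
        is 1 or -1 according to the relative orientation.\<close>
      have h: "h2 ((K n)\<^sup>2 / 4) z (seg_normal S) (seg_normal T) = e * K n * (K n * besh (K n * norm z)) + - e * h2 ((K n)\<^sup>2 / 4) z (seg_dir S) (seg_dir S)" for z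
      proof -
        have "h2 ((K n)\<^sup>2 / 4) z (seg_dir S) (seg_dir S) + h2 ((K n)\<^sup>2 / 4) z (seg_normal S) (seg_normal S) = (K n)\<^sup>2 * besh (K n * norm z)"
          by (rule h2_laplacian) (simp_all add: vector_frame(2))
        then have X: "h2 ((K n)\<^sup>2 / 4) z (seg_normal S) (seg_normal S) = (K n)\<^sup>2 * besh (K n * norm z) - h2 ((K n)\<^sup>2 / 4) z (seg_dir S) (seg_dir S)" by linarith
        show ?thesis unfolding nT h2_scale X by (simp add: power2_eq_square algebra_simps)
      qed
      have "K n \<noteq> 0" using pos[of n] by simp
      then show ?thesis unfolding h seg_int_linear[OF cb continuous_h2] it by (simp add: field_simps)
    qed
    ultimately show ?thesis by (simp only: e_def[symmetric])
  qed
qed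

section \<open>Approximation by quadratic forms\<close>

lemma riemann_error:
  fixes f :: "real \<Rightarrow> real"
  assumes f: "continuous_on {0..L} f" and L: "L \<ge> 0" and n: "n > 0"
    and u: "\<And>x y. x \<in> {0..L} \<Longrightarrow> y \<in> {0..L} \<Longrightarrow> \<bar>x - y\<bar> \<le> L / real n \<Longrightarrow> \<bar>f x - f y\<bar> \<le> \<epsilon>"
  shows "\<bar>L / real n * (\<Sum>i<n. f (L * real i / real n)) - integral {0..L} f\<bar> \<le> L * \<epsilon>"
proof -
  define p where "p i = L * real i / real n" for i
  have p: "p i \<le> p (Suc i)" "0 \<le> p i" for i using L n by (auto simp: p_def divide_right_mono mult_left_mono)
  have pn: "p i \<le> L" if "i \<le> n" for i
  proof -
    have "L * real i \<le> L * real n" using L that by (intro mult_left_mono) auto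
    then show ?thesis using n by (simp add: p_def pos_divide_le_eq)
  qed
  have len: "p (Suc i) - p i = L / real n" for i using n by (simp add: p_def field_simps)
  have fi: "f integrable_on {p i..p j}" if "j \<le> n" for i j
    using pn[OF that] p(2)[of i] by (intro integrable_continuous_real continuous_on_subset[OF f]) auto
  have step: "\<bar>L / real n * f (p i) - integral {p i..p (Suc i)} f\<bar> \<le> L / real n * \<epsilon>" if i: "i < n" for i
  proof -
    have f1: "f integrable_on {p i..p (Suc i)}" using i by (intro fi) auto
    have "norm (integral {p i..p (Suc i)} (\<lambda>x. f (p i) - f x)) \<le> integral {p i..p (Suc i)} (\<lambda>x. \<epsilon>)"
    proof (rule integral_norm_bound_integral)
      show "(\<lambda>x. f (p i) - f x) integrable_on {p i..p (Suc i)}" using f1 by (intro integrable_diff) auto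
      fix x assume x: "x \<in> {p i..p (Suc i)}"
      show "norm (f (p i) - f x) \<le> \<epsilon>"
        unfolding real_norm_def by (rule u) (use x p(2)[of i] pn[of "Suc i"] len[of i] i in auto)
    qed auto
    moreover have "integral {p i..p (Suc i)} (\<lambda>x. f (p i) - f x) = (p (Suc i) - p i) * f (p i) - integral {p i..p (Suc i)} f"
      using f1 p(1)[of i] by (subst integral_diff) auto
    ultimately show ?thesis using p(1)[of i] unfolding len by (simp add: len mult.commute)
  qed
  have "m \<le> n \<Longrightarrow> integral {0..p m} f = (\<Sum>i<m. integral {p i..p (Suc i)} f)" for m
  proof (induction m)
    case 0
    then show ?case by (simp add: p_def)
  next
    case (Suc m)
    have "f integrable_on {0..p (Suc m)}" using fi[of "Suc m" 0] Suc.prems by (simp add: p_def)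
    then have "integral {0..p m} f + integral {p m..p (Suc m)} f = integral {0..p (Suc m)} f"
      using p by (intro Henstock_Kurzweil_Integration.integral_combine) auto
    with Suc show ?case by simp
  qed
  from this[of n] have "integral {0..L} f = (\<Sum>i<n. integral {p i..p (Suc i)} f)"
    using n by (simp add: p_def)
  then have "\<bar>L / real n * (\<Sum>i<n. f (p i)) - integral {0..L} f\<bar> = \<bar>\<Sum>i<n. L / real n * f (p i) - integral {p i..p (Suc i)} f\<bar>"
    by (simp add: sum_subtractf sum_distrib_left)
  also have "\<dots> \<le> (\<Sum>i<n. L / real n * \<epsilon>)"
    by (rule order_trans[OF sum_abs sum_mono]) (use step in auto)
  also have "\<dots> = L * \<epsilon>" using n by simp
  finally show ?thesis unfolding p_def .
qed

text \<open>Uniform in \<open>x\<close>, because the inner sums are evaluated at nodes that move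
  with the mesh.\<close>

lemma riemann_uniform:
  fixes g :: "real \<Rightarrow> real \<Rightarrow> real"
  assumes c: "continuous_on ({0..L} \<times> {0..L'}) (\<lambda>(x, y). g x y)" and L: "L' \<ge> 0" and e: "\<epsilon> > 0"
  shows "\<forall>\<^sub>F n in sequentially. n > 0 \<and> (\<forall>x\<in>{0..L}. \<bar>L' / real n * (\<Sum>j<n. g x (L' * real j / real n)) - integral {0..L'} (g x)\<bar> \<le> L' * \<epsilon>)"
proof -
  have "uniformly_continuous_on ({0..L} \<times> {0..L'}) (\<lambda>(x, y). g x y)"
    by (intro compact_uniformly_continuous c compact_Times) auto
  then obtain d where d: "d > 0" "\<And>p q. p \<in> {0..L} \<times> {0..L'} \<Longrightarrow> q \<in> {0..L} \<times> {0..L'} \<Longrightarrow> dist q p < d \<Longrightarrow>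
      dist (case q of (x, y) \<Rightarrow> g x y) (case p of (x, y) \<Rightarrow> g x y) < \<epsilon>"
    using e unfolding uniformly_continuous_on_def by metis
  have "(\<lambda>n. L' * (1 / real n)) \<longlonglongrightarrow> L' * 0" by (intro tendsto_intros lim_1_over_n)
  then have "\<forall>\<^sub>F n in sequentially. L' * (1 / real n) < d" using d(1) by (intro order_tendstoD) auto
  with eventually_gt_at_top[of "0::nat"] show ?thesis
  proof eventually_elim
    case (elim n)
    have "\<bar>L' / real n * (\<Sum>j<n. g x (L' * real j / real n)) - integral {0..L'} (g x)\<bar> \<le> L' * \<epsilon>" if x: "x \<in> {0..L}" for x
    proof (rule riemann_error[OF _ L elim(1)])
      have "continuous_on {0..L'} (\<lambda>y. case (x, y) of (x, y) \<Rightarrow> g x y)"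
        by (rule continuous_on_compose2[OF c]) (use x in \<open>auto intro!: continuous_intros\<close>)
      then show "continuous_on {0..L'} (g x)" by simp
      fix y z assume "y \<in> {0..L'}" "z \<in> {0..L'}" "\<bar>y - z\<bar> \<le> L' / real n"
      then show "\<bar>g x y - g x z\<bar> \<le> \<epsilon>"
        using d(2)[of "(x, z)" "(x, y)"] x elim(2) by (simp add: dist_Pair_Pair dist_real_def)
    qed
    with elim show ?case by auto
  qed
qed

lemma riemann_sum:
  fixes f :: "real \<Rightarrow> real"
  assumes f: "continuous_on {0..L} f" and L: "L \<ge> 0"
  shows "(\<lambda>n. L / real n * (\<Sum>i<n. f (L * real i / real n))) \<longlonglongrightarrow> integral {0..L} f"
proof (rule LIMSEQ_I)
  fix e :: real assume e: "e > 0"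
  have e': "e / (L + 1) > 0" using e L by simp
  have "L * (e / (L + 1)) < e" using e L by (simp add: field_simps)
  \<comment> \<open>The parameter interval is degenerated to a point to obtain the case without a
    parameter.\<close>
  moreover have "continuous_on ({0..0} \<times> {0..L}) (\<lambda>(x::real, y). f y)"
    unfolding split_def by (intro continuous_on_compose2[OF f]) (auto intro!: continuous_intros)
  from riemann_uniform[OF this L e'] have "\<forall>\<^sub>F n in sequentially. \<bar>L / real n * (\<Sum>i<n. f (L * real i / real n)) - integral {0..L} f\<bar> \<le> L * (e / (L + 1))"
    by (rule eventually_mono) auto
  ultimately have "\<forall>\<^sub>F n in sequentially. norm (L / real n * (\<Sum>i<n. f (L * real i / real n)) - integral {0..L} f) < e"
    by (auto elim!: eventually_mono)
  then show "\<exists>no. \<forall>n\<ge>no. norm (L / real n * (\<Sum>i<n. f (L * real i / real n)) - integral {0..L} f) < e"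
    by (simp only: eventually_sequentially)
qed

lemma node_le: "i < n \<Longrightarrow> L \<ge> 0 \<Longrightarrow> L * real i / real n \<in> {0..L}" for L :: real
proof -
  assume "i < n" "L \<ge> 0"
  then have "L * real i \<le> L * real n" "0 < real n" by (auto intro!: mult_left_mono)
  then show ?thesis using \<open>L \<ge> 0\<close> by (simp add: pos_divide_le_eq)
qed

lemma riemann_sum_average_bound:
  fixes f :: "nat \<Rightarrow> real"
  assumes "\<And>i. i < n \<Longrightarrow> \<bar>f i\<bar> \<le> B" "L \<ge> 0" "n > 0"
  shows "\<bar>L / real n * (\<Sum>i<n. f i)\<bar> \<le> L * B"
proof -
  have "\<bar>\<Sum>i<n. f i\<bar> \<le> (\<Sum>i<n. B)" by (rule order_trans[OF sum_abs sum_mono]) (use assms in auto)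
  then have "L / real n * \<bar>\<Sum>i<n. f i\<bar> \<le> L / real n * (real n * B)" using assms by (intro mult_left_mono) auto
  then show ?thesis using assms by (simp add: abs_mult)
qed

lemma riemann_sum2:
  fixes g :: "real \<Rightarrow> real \<Rightarrow> real"
  assumes c: "continuous_on ({0..L} \<times> {0..L'}) (\<lambda>(x, y). g x y)" and L: "L \<ge> 0" "L' \<ge> 0"
  shows "(\<lambda>n. L / real n * (\<Sum>i<n. L' / real n * (\<Sum>j<n. g (L * real i / real n) (L' * real j / real n))))
    \<longlonglongrightarrow> integral {0..L} (\<lambda>x. integral {0..L'} (g x))"
proof -
  let ?G = "\<lambda>x. integral {0..L'} (g x)"
  let ?R = "\<lambda>n. L / real n * (\<Sum>i<n. L' / real n * (\<Sum>j<n. g (L * real i / real n) (L' * real j / real n)))"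
  have G: "continuous_on {0..L} ?G"
    unfolding cbox_interval[symmetric] by (rule integral_continuous_on_param) (use c in \<open>simp add: cbox_interval\<close>)
  have "(\<lambda>n. ?R n - L / real n * (\<Sum>i<n. ?G (L * real i / real n))) \<longlonglongrightarrow> 0"
  proof (rule LIMSEQ_I)
    fix e :: real assume e: "e > 0"
    have e': "e / (L * L' + 1) > 0" using e L by (simp add: add_nonneg_pos)
    have lt: "L * (L' * (e / (L * L' + 1))) < e"
    proof -
      have "L * L' / (L * L' + 1) < 1" using L by (simp add: add_nonneg_pos)
      from mult_strict_right_mono[OF this e] show ?thesis by (simp add: mult_ac)
    qed
    have "\<forall>\<^sub>F n in sequentially. norm (?R n - L / real n * (\<Sum>i<n. ?G (L * real i / real n)) - 0) < e"
      using riemann_uniform[OF c L(2) e']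
    proof (rule eventually_mono)
      fix n assume n: "n > 0 \<and> (\<forall>x\<in>{0..L}. \<bar>L' / real n * (\<Sum>j<n. g x (L' * real j / real n)) - ?G x\<bar> \<le> L' * (e / (L * L' + 1)))"
      have "\<bar>L / real n * (\<Sum>i<n. L' / real n * (\<Sum>j<n. g (L * real i / real n) (L' * real j / real n)) - ?G (L * real i / real n))\<bar> \<le> L * (L' * (e / (L * L' + 1)))"
        by (rule riemann_sum_average_bound) (use n L node_le in auto)
      with lt show "norm (?R n - L / real n * (\<Sum>i<n. ?G (L * real i / real n)) - 0) < e"
        by (simp add: sum_subtractf right_diff_distrib)
    qed
    then show "\<exists>no. \<forall>n\<ge>no. norm (?R n - L / real n * (\<Sum>i<n. ?G (L * real i / real n)) - 0) < e"
      by (simp only: eventually_sequentially)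
  qed
  from tendsto_add[OF this riemann_sum[OF G L(1)]] show ?thesis by simp
qed

section \<open>Sampling the wave along the segments\<close>

definition node :: "oriented_segment \<Rightarrow> nat \<Rightarrow> nat \<Rightarrow> real^2" where
  "node S n i = seg_param S (seg_length S * real i / real n)"

lemma riemann_seg_int:
  assumes f: "continuous_on UNIV f" and L: "seg_length S \<ge> 0" "seg_length T \<ge> 0"
  shows "(\<lambda>n. seg_length S / real n * (\<Sum>i<n. seg_length T / real n * (\<Sum>j<n. f (node S n i - node T n j)))) \<longlonglongrightarrow> seg_int S T f"
  unfolding node_def seg_int_iterated(1)[OF f]
  by (rule riemann_sum2[OF _ L]) (auto simp: split_def intro!: continuous_on_compose2[OF f] continuous_intros)

text \<open>An index names a segment, a node and a sign; the sign distinguishes the sum from the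
  difference of value and normal derivative. As a real number it can enter both the direction and
  the weight as a factor.\<close>

definition sample_index :: "'a set \<Rightarrow> nat \<Rightarrow> ('a \<times> nat \<times> real) set" where
  "sample_index A n = A \<times> {..<n} \<times> {1, -1}"

definition sample_point :: "('a \<Rightarrow> oriented_segment) \<Rightarrow> nat \<Rightarrow> 'a \<times> nat \<times> real \<Rightarrow> (real^2) \<times> (real^2)" where
  "sample_point S n = (\<lambda>(a, i, s). (node (S a) n i, s *\<^sub>R seg_normal (S a)))"

text \<open>The mesh width times the coefficient of the segment; the 4 comes from expressing a
  product by two squares.\<close>

definition sample_weight :: "('a \<Rightarrow> oriented_segment) \<Rightarrow> ('a \<Rightarrow> real) \<Rightarrow> nat \<Rightarrow> 'a \<times> nat \<times> real \<Rightarrow> real" where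
  "sample_weight S \<alpha> n = (\<lambda>(a, i, s). s * (\<alpha> a * (seg_length (S a) / real n) / 4))"

lemma finite_sample_index [simp]: "finite A \<Longrightarrow> finite (sample_index A n)" by (simp add: sample_index_def)

lemma sum_signs: "(\<Sum>s\<in>{1, -1::real}. f s) = f 1 + f (-1)" by simp

lemma sum_sample_index:
  "(\<Sum>p\<in>sample_index A n. f p) = (\<Sum>a\<in>A. \<Sum>i<n. f (a, i, 1) + f (a, i, -1))"
  unfolding sample_index_def by (simp only: sum.cartesian_product' sum_signs)

lemma kz_signs:
  fixes s t :: real
  shows "kz \<kappa> (x, s *\<^sub>R v) (y, t *\<^sub>R w) = k0 \<kappa> (x - y) + s * k1 \<kappa> (x - y) v - t * k1 \<kappa> (x - y) w - s * t * k2 \<kappa> (x - y) v w"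
  unfolding kz_def k1_def k2_def by (simp add: Let_def algebra_simps)

lemma sign_sum:
  fixes a b c d :: real
  shows "(a + b - c - d)\<^sup>2 - (a + b + c + d)\<^sup>2 - (a - b - c + d)\<^sup>2 + (a - b + c - d)\<^sup>2 = - 8 * (a * d + b * c)"
  by (simp add: power2_eq_square algebra_simps)

text \<open>At one point value and gradient are uncorrelated, so the two signs give equal variances,
  and their weights are opposite.\<close>

lemma sample_trace: "(\<Sum>p\<in>sample_index A n. sample_weight S \<alpha> n p * kz \<kappa> (sample_point S n p) (sample_point S n p)) = 0"
proof -
  have "kz \<kappa> (x, - v) (x, - v) = kz \<kappa> (x, v) (x, v)" for x v
    by (simp add: kz_def k1_def k2_def)
  then show ?thesis unfolding sum_sample_index by (simp add: sample_weight_def sample_point_def)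
qed

text \<open>Summing over the four sign pairs keeps only the products of \<open>k0\<close> with
  \<open>k2\<close> and of the two \<open>k1\<close>; their factor -8 turns them into 8 times
  \<open>h2\<close>, which meets 2/16 from the front factor and the weights.\<close>

lemma sample_variance:
  fixes S :: "'a \<Rightarrow> oriented_segment"
  shows "2 * (\<Sum>p\<in>sample_index A n. \<Sum>q\<in>sample_index A n. sample_weight S \<alpha> n p * sample_weight S \<alpha> n q * (kz \<kappa> (sample_point S n p) (sample_point S n q))\<^sup>2)
    = (\<Sum>a\<in>A. \<Sum>b\<in>A. \<alpha> a * \<alpha> b * (seg_length (S a) / real n * (\<Sum>i<n. seg_length (S b) / real n *
        (\<Sum>j<n. h2 \<kappa> (node (S a) n i - node (S b) n j) (seg_normal (S a)) (seg_normal (S b))))))"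
proof -
  let ?c = "\<lambda>a. \<alpha> a * (seg_length (S a) / real n)"
  let ?H = "\<lambda>a i b j. h2 \<kappa> (node (S a) n i - node (S b) n j) (seg_normal (S a)) (seg_normal (S b))"
  let ?F = "\<lambda>p q. sample_weight S \<alpha> n p * sample_weight S \<alpha> n q * (kz \<kappa> (sample_point S n p) (sample_point S n q))\<^sup>2"
  have pt: "?F (a, i, 1) (b, j, 1) + ?F (a, i, 1) (b, j, -1) + (?F (a, i, -1) (b, j, 1) + ?F (a, i, -1) (b, j, -1)) = ?c a * ?c b * ?H a i b j / 2" for a i b j
  proof -
    let ?z = "node (S a) n i - node (S b) n j"
    let ?v = "seg_normal (S a)" and ?w = "seg_normal (S b)"
    have F: "?F (a, i, s) (b, j, t) = s * t * (?c a * ?c b / 16) * (k0 \<kappa> ?z + s * k1 \<kappa> ?z ?v - t * k1 \<kappa> ?z ?w - s * t * k2 \<kappa> ?z ?v ?w)\<^sup>2" for s t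
      by (simp add: sample_weight_def sample_point_def kz_signs mult_ac)
    have "?F (a, i, 1) (b, j, 1) + ?F (a, i, 1) (b, j, -1) + (?F (a, i, -1) (b, j, 1) + ?F (a, i, -1) (b, j, -1)) =
      (?c a * ?c b / 16) * ((k0 \<kappa> ?z + k1 \<kappa> ?z ?v - k1 \<kappa> ?z ?w - k2 \<kappa> ?z ?v ?w)\<^sup>2 - (k0 \<kappa> ?z + k1 \<kappa> ?z ?v + k1 \<kappa> ?z ?w + k2 \<kappa> ?z ?v ?w)\<^sup>2
       - (k0 \<kappa> ?z - k1 \<kappa> ?z ?v - k1 \<kappa> ?z ?w + k2 \<kappa> ?z ?v ?w)\<^sup>2 + (k0 \<kappa> ?z - k1 \<kappa> ?z ?v + k1 \<kappa> ?z ?w - k2 \<kappa> ?z ?v ?w)\<^sup>2)"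
      unfolding F by (simp add: algebra_simps)
    also have "\<dots> = ?c a * ?c b * ?H a i b j / 2" unfolding sign_sum h2_def by (simp add: algebra_simps)
    finally show ?thesis .
  qed
  have "(\<Sum>p\<in>sample_index A n. \<Sum>q\<in>sample_index A n. ?F p q) = (\<Sum>a\<in>A. \<Sum>i<n. \<Sum>b\<in>A. \<Sum>j<n. ?F (a, i, 1) (b, j, 1) + ?F (a, i, 1) (b, j, -1) + (?F (a, i, -1) (b, j, 1) + ?F (a, i, -1) (b, j, -1)))"
    unfolding sum_sample_index by (simp only: sum.distrib)
  also have "\<dots> = (\<Sum>a\<in>A. \<Sum>b\<in>A. \<Sum>i<n. \<Sum>j<n. ?c a * ?c b * ?H a i b j / 2)"
    unfolding pt by (intro sum.cong refl sum.swap)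
  also have "\<dots> = (\<Sum>a\<in>A. \<Sum>b\<in>A. \<alpha> a * \<alpha> b * (seg_length (S a) / real n * (\<Sum>i<n. seg_length (S b) / real n * (\<Sum>j<n. ?H a i b j)))) / 2"
    by (simp add: sum_distrib_left sum_divide_distrib mult_ac)
  finally show ?thesis by simp
qed

lemma sample_form:
  "(\<Sum>p\<in>sample_index A n. sample_weight S \<alpha> n p * (b (fst (sample_point S n p)) + gradient b (fst (sample_point S n p)) \<bullet> snd (sample_point S n p))\<^sup>2)
   = (\<Sum>a\<in>A. \<alpha> a * (seg_length (S a) / real n * (\<Sum>i<n. b (node (S a) n i) * (gradient b (node (S a) n i) \<bullet> seg_normal (S a)))))"
proof -
  have sq: "c * (x + y)\<^sup>2 - c * (x - y)\<^sup>2 = 4 * c * (x * y)" for c x y :: real by (simp add: power2_eq_square algebra_simps)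
  have "sample_weight S \<alpha> n (a, i, 1) * (b (fst (sample_point S n (a, i, 1))) + gradient b (fst (sample_point S n (a, i, 1))) \<bullet> snd (sample_point S n (a, i, 1)))\<^sup>2 +
    sample_weight S \<alpha> n (a, i, -1) * (b (fst (sample_point S n (a, i, -1))) + gradient b (fst (sample_point S n (a, i, -1))) \<bullet> snd (sample_point S n (a, i, -1)))\<^sup>2
    = \<alpha> a * (seg_length (S a) / real n) * (b (node (S a) n i) * (gradient b (node (S a) n i) \<bullet> seg_normal (S a)))" for a i
    using sq[of "\<alpha> a * (seg_length (S a) / real n) / 4" "b (node (S a) n i)" "gradient b (node (S a) n i) \<bullet> seg_normal (S a)"]
    by (simp add: sample_weight_def sample_point_def)
  then show ?thesis unfolding sum_sample_index by (simp add: sum_distrib_left mult_ac)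
qed

lemma sample_form_limit:
  assumes b: "smooth b" and L: "\<And>a. a \<in> A \<Longrightarrow> seg_length (S a) \<ge> 0"
  shows "(\<lambda>n. \<Sum>p\<in>sample_index A n. sample_weight S \<alpha> n p * (b (fst (sample_point S n p)) + gradient b (fst (sample_point S n p)) \<bullet> snd (sample_point S n p))\<^sup>2)
   \<longlonglongrightarrow> (\<Sum>a\<in>A. \<alpha> a * integral {0..seg_length (S a)} (\<lambda>t. b (seg_param (S a) t) * (gradient b (seg_param (S a) t) \<bullet> seg_normal (S a))))"
  unfolding sample_form node_def
proof (intro tendsto_intros)
  fix a assume a: "a \<in> A"
  let ?f = "\<lambda>t. b (seg_param (S a) t) * (gradient b (seg_param (S a) t) \<bullet> seg_normal (S a))"
  have "continuous_on {0..seg_length (S a)} ?f"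
    by (intro continuous_intros continuous_on_compose2[OF smooth_continuous[OF b]] continuous_on_compose2[OF smooth_continuous_gradient[OF b]]) auto
  from riemann_sum[OF this L[OF a]]
  show "(\<lambda>n. seg_length (S a) / real n * (\<Sum>i<n. ?f (seg_length (S a) * real i / real n))) \<longlonglongrightarrow> integral {0..seg_length (S a)} ?f" .
qed

section \<open>The fourth trace on a single segment\<close>

lemma inverse_sqrt_deriv:
  assumes "(Y has_real_derivative Y') (at x within S)" "Y x > 0"
  shows "((\<lambda>x. 1 / sqrt (Y x)) has_real_derivative - Y' / (2 * (Y x * sqrt (Y x)))) (at x within S)"
proof -
  have "((\<lambda>x. 1 / sqrt (Y x)) has_real_derivative (0 * sqrt (Y x) - 1 * (inverse (sqrt (Y x)) / 2 * Y')) / (sqrt (Y x) * sqrt (Y x))) (at x within S)"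
    using assms(2) by (intro DERIV_divide DERIV_const DERIV_chain2[where f = sqrt] DERIV_real_sqrt assms(1)) auto
  moreover have "(0 * sqrt (Y x) - 1 * (inverse (sqrt (Y x)) / 2 * Y')) / (sqrt (Y x) * sqrt (Y x)) = - Y' / (2 * (Y x * sqrt (Y x)))"
  proof -
    have "sqrt (Y x) * sqrt (Y x) = Y x" using assms(2) by simp
    then show ?thesis using assms(2) by (simp add: field_simps)
  qed
  ultimately show ?thesis by (simp only:)
qed

text \<open>J1 is of order u^(-1/2), so J1(u)/u is of order u^(-3/2) and absolutely integrable. Near
  0 compactness bounds it, and 1 + |u| removes the singularity of the majorant.\<close>

lemma J1_over_decay:
  obtains C where "C \<ge> 0" "\<And>u. \<bar>J1_over u\<bar> \<le> C / ((1 + \<bar>u\<bar>) * sqrt (1 + \<bar>u\<bar>))"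
proof -
  obtain C where C: "C \<ge> 1" "\<And>u. \<bar>u\<bar> * ((bessel_J0 u)\<^sup>2 + (J1 u)\<^sup>2) \<le> C" by (rule J_decay) blast
  have "bounded (J1_over ` {-1..1})" by (intro compact_imp_bounded compact_continuous_image continuous_intros) auto
  then obtain D where "\<forall>y\<in>J1_over ` {-1..1}. norm y \<le> D" by (auto simp: bounded_iff)
  then have D: "\<bar>J1_over u\<bar> \<le> D" if "\<bar>u\<bar> \<le> 1" for u
  proof -
    have "u \<in> {-1..1}" using that by auto
    then show ?thesis using \<open>\<forall>y\<in>J1_over ` {-1..1}. norm y \<le> D\<close> by auto
  qed
  define Q where "Q = 8 * (C + D\<^sup>2)"
  have Q0: "Q \<ge> 0" using C(1) by (simp add: Q_def)
  have Q: "(1 + \<bar>u\<bar>) ^ 3 * (J1_over u)\<^sup>2 \<le> Q" for u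
  proof (cases "\<bar>u\<bar> \<le> 1")
    case True
    have "(1 + \<bar>u\<bar>) ^ 3 \<le> 2 ^ 3" using True by (intro power_mono) auto
    moreover have "(J1_over u)\<^sup>2 \<le> D\<^sup>2" using D[OF True] by (metis abs_ge_zero power2_abs power_mono)
    ultimately have "(1 + \<bar>u\<bar>) ^ 3 * (J1_over u)\<^sup>2 \<le> 2 ^ 3 * D\<^sup>2" by (intro mult_mono) auto
    also have "\<dots> \<le> Q" using C(1) by (simp add: Q_def)
    finally show ?thesis .
  next
    case False
    have "(1 + \<bar>u\<bar>) ^ 3 \<le> (2 * \<bar>u\<bar>) ^ 3" using False by (intro power_mono) auto
    then have "(1 + \<bar>u\<bar>) ^ 3 * (J1_over u)\<^sup>2 \<le> (2 * \<bar>u\<bar>) ^ 3 * (J1_over u)\<^sup>2" by (rule mult_right_mono) simp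
    also have "(2 * \<bar>u\<bar>) ^ 3 * (J1_over u)\<^sup>2 = 8 * (\<bar>u\<bar> * (J1 u)\<^sup>2)"
    proof -
      have "\<bar>u\<bar> ^ 3 = \<bar>u\<bar> * u\<^sup>2" by (simp add: power3_eq_cube power2_eq_square)
      then show ?thesis by (simp add: power_mult_distrib J1_eq)
    qed
    also have "\<dots> \<le> 8 * C"
    proof -
      have "\<bar>u\<bar> * (J1 u)\<^sup>2 \<le> \<bar>u\<bar> * ((bessel_J0 u)\<^sup>2 + (J1 u)\<^sup>2)" by (intro mult_left_mono) auto
      with C(2)[of u] show ?thesis by simp
    qed
    also have "\<dots> \<le> Q" by (simp add: Q_def)
    finally show ?thesis .
  qed
  have "\<bar>J1_over u\<bar> \<le> sqrt Q / ((1 + \<bar>u\<bar>) * sqrt (1 + \<bar>u\<bar>))" for u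
  proof -
    define y where "y = 1 + \<bar>u\<bar>"
    have y: "y > 0" by (simp add: y_def)
    have "(\<bar>J1_over u\<bar> * (y * sqrt y))\<^sup>2 = (J1_over u)\<^sup>2 * (y\<^sup>2 * (sqrt y)\<^sup>2)"
      by (simp only: power_mult_distrib power2_abs)
    also have "\<dots> = y ^ 3 * (J1_over u)\<^sup>2"
      using y by (simp add: power3_eq_cube power2_eq_square[of y])
    finally have "\<bar>J1_over u\<bar> * (y * sqrt y) \<le> sqrt Q" using Q[of u] by (intro real_le_rsqrt) (simp add: y_def)
    moreover have "y * sqrt y > 0" using y by simp
    ultimately show ?thesis unfolding y_def[symmetric] by (subst pos_le_divide_eq)
  qed
  with Q0 that[of "sqrt Q"] show thesis by auto
qed

text \<open>The majorant has the primitive 2 / sqrt(1 + k|x - y|) up to sign on either side of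
  \<open>x\<close>. Each side contributes at most 2, whatever the scale \<open>k\<close>, the
  position \<open>x\<close> and the length.\<close>

lemma J1_over_mass:
  obtains C where "C \<ge> 0" "\<And>k x L. k > 0 \<Longrightarrow> x \<in> {0..L} \<Longrightarrow> integral {0..L} (\<lambda>y. k * \<bar>J1_over (k * \<bar>x - y\<bar>)\<bar>) \<le> C"
proof -
  obtain C where C: "C \<ge> 0" "\<And>u. \<bar>J1_over u\<bar> \<le> C / ((1 + \<bar>u\<bar>) * sqrt (1 + \<bar>u\<bar>))" by (rule J1_over_decay) blast
  have "integral {0..L} (\<lambda>y. k * \<bar>J1_over (k * \<bar>x - y\<bar>)\<bar>) \<le> 4 * C" if k: "k > 0" and x: "x \<in> {0..L}" for k x L
  proof -
    let ?h = "\<lambda>y. k / ((1 + k * \<bar>x - y\<bar>) * sqrt (1 + k * \<bar>x - y\<bar>))"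
    have pos: "1 + k * \<bar>x - y\<bar> > 0" for y using k by (intro add_pos_nonneg) auto
    have l: "(?h has_integral (2 * (1 / sqrt (1 + k * (x - x))) - 2 * (1 / sqrt (1 + k * (x - 0))))) {0..x}"
    proof (rule fundamental_theorem_of_calculus)
      show "0 \<le> x" using x by auto
      fix y assume y: "y \<in> {0..x}"
      then have p: "1 + k * (x - y) > 0" "\<bar>x - y\<bar> = x - y" using pos[of y] by auto
      have "((\<lambda>y. 1 + k * (x - y)) has_real_derivative - k) (at y within {0..x})"
        by (rule derivative_eq_intros refl | simp)+
      from DERIV_cmult[OF inverse_sqrt_deriv[OF this p(1)], of 2]
      show "((\<lambda>y. 2 * (1 / sqrt (1 + k * (x - y)))) has_vector_derivative ?h y) (at y within {0..x})"
        unfolding p(2) by (simp add: has_real_derivative_iff_has_vector_derivative)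
    qed
    have r: "(?h has_integral (-2 * (1 / sqrt (1 + k * (L - x))) - -2 * (1 / sqrt (1 + k * (x - x))))) {x..L}"
    proof (rule fundamental_theorem_of_calculus)
      show "x \<le> L" using x by auto
      fix y assume y: "y \<in> {x..L}"
      then have p: "1 + k * (y - x) > 0" "\<bar>x - y\<bar> = y - x" using pos[of y] by auto
      have "((\<lambda>y. 1 + k * (y - x)) has_real_derivative k) (at y within {x..L})"
        by (rule derivative_eq_intros refl | simp)+
      from DERIV_cmult[OF inverse_sqrt_deriv[OF this p(1)], of "-2"]
      show "((\<lambda>y. -2 * (1 / sqrt (1 + k * (y - x)))) has_vector_derivative ?h y) (at y within {x..L})"
        unfolding p(2) by (simp add: has_real_derivative_iff_has_vector_derivative)
    qed
    have H: "(?h has_integral (2 * (1 / sqrt (1 + k * (x - x))) - 2 * (1 / sqrt (1 + k * (x - 0)))) + (-2 * (1 / sqrt (1 + k * (L - x))) - -2 * (1 / sqrt (1 + k * (x - x))))) {0..L}"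
      by (rule has_integral_combine[OF _ _ l r]) (use x in auto)
    have aux: "i = (2 * c - 2 * b) + (- 2 * a - - 2 * c) \<Longrightarrow> 0 \<le> a \<Longrightarrow> 0 \<le> b \<Longrightarrow> c = 1 \<Longrightarrow> i \<le> 4" for i a b c :: real by linarith
    have h4: "integral {0..L} ?h \<le> 4"
    proof (rule aux[OF integral_unique[OF H]])
      show "1 / sqrt (1 + k * (L - x)) \<ge> 0" "1 / sqrt (1 + k * (x - 0)) \<ge> 0"
        using x k by (auto intro!: divide_nonneg_nonneg add_nonneg_nonneg mult_nonneg_nonneg)
    qed simp
    have "integral {0..L} (\<lambda>y. k * \<bar>J1_over (k * \<bar>x - y\<bar>)\<bar>) \<le> integral {0..L} (\<lambda>y. C * ?h y)"
    proof (rule integral_le)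
      show "(\<lambda>y. k * \<bar>J1_over (k * \<bar>x - y\<bar>)\<bar>) integrable_on {0..L}"
        by (intro integrable_continuous_real continuous_intros)
      show "(\<lambda>y. C * ?h y) integrable_on {0..L}" using has_integral_mult_right[OF H, of C] by (rule has_integral_integrable)
      show "k * \<bar>J1_over (k * \<bar>x - y\<bar>)\<bar> \<le> C * ?h y" for y
        using mult_left_mono[OF C(2)[of "k * \<bar>x - y\<bar>"], of k] k by (simp add: abs_mult mult.commute)
    qed
    also have "\<dots> = C * integral {0..L} ?h" by (rule integral_mult_right)
    also have "\<dots> \<le> C * 4" using h4 C(1) by (rule mult_left_mono)
    finally show ?thesis by simp
  qed
  with C(1) that[of "4 * C"] show thesis by auto
qed

text \<open>The covariance of the normal derivatives at two points of one segment: their difference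
  is orthogonal to the normal, so the second term of \<open>k2\<close> vanishes.\<close>

definition km :: "real \<Rightarrow> real^2 \<Rightarrow> real" where "km \<kappa> z = 2 * \<kappa> * bes 1 (\<kappa> * (z \<bullet> z))"

lemma km_J1_over: "km (k\<^sup>2 / 4) z = k\<^sup>2 * J1_over (k * norm z)"
  by (simp add: km_def J1_over_def power_mult_distrib power2_norm_eq_inner)

lemma continuous_on_km [continuous_intros]: "continuous_on S f \<Longrightarrow> continuous_on S (\<lambda>x. km \<kappa> (f x))"
  unfolding km_def by (intro continuous_intros)

lemma norm_seg_param_diff: "norm (seg_param S s - seg_param S t) = \<bar>s - t\<bar>"
  by (simp add: seg_param_diff)

lemma km_mass:
  obtains C where "C \<ge> 0" "\<And>k S x. k > 0 \<Longrightarrow> x \<in> {0..seg_length S} \<Longrightarrow>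
    integral {0..seg_length S} (\<lambda>y. \<bar>km (k\<^sup>2 / 4) (seg_param S x - seg_param S y)\<bar>) \<le> C * k"
proof -
  obtain C where C: "C \<ge> 0" "\<And>k x L. k > 0 \<Longrightarrow> x \<in> {0..L} \<Longrightarrow> integral {0..L} (\<lambda>y. k * \<bar>J1_over (k * \<bar>x - y\<bar>)\<bar>) \<le> C"
    by (rule J1_over_mass) blast
  have "integral {0..seg_length S} (\<lambda>y. \<bar>km (k\<^sup>2 / 4) (seg_param S x - seg_param S y)\<bar>) \<le> C * k"
    if "k > 0" "x \<in> {0..seg_length S}" for k S x
  proof -
    have "(\<lambda>y. \<bar>km (k\<^sup>2 / 4) (seg_param S x - seg_param S y)\<bar>) = (\<lambda>y. k * (k * \<bar>J1_over (k * \<bar>x - y\<bar>)\<bar>))"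
      unfolding km_J1_over norm_seg_param_diff using that(1) by (simp add: abs_mult power2_eq_square mult.assoc)
    then have "integral {0..seg_length S} (\<lambda>y. \<bar>km (k\<^sup>2 / 4) (seg_param S x - seg_param S y)\<bar>) = k * integral {0..seg_length S} (\<lambda>y. k * \<bar>J1_over (k * \<bar>x - y\<bar>)\<bar>)"
      by (simp only: integral_mult_right)
    also have "\<dots> \<le> k * C" using C(2)[OF that] that(1) by (intro mult_left_mono) auto
    finally show ?thesis by (simp add: mult.commute)
  qed
  with C(1) that show thesis by blast
qed

lemma seg_int_k0_null:
  fixes K :: "nat \<Rightarrow> real"
  assumes K: "filterlim K at_top sequentially" and L: "seg_length S \<ge> 0"
  shows "(\<lambda>n. seg_int S S (\<lambda>z. \<bar>k0 ((K n)\<^sup>2 / 4) z\<bar>)) \<longlonglongrightarrow> 0"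
proof -
  let ?L = "seg_length S"
  have it: "seg_int S S (\<lambda>z. \<bar>k0 ((K n)\<^sup>2 / 4) z\<bar>) = integral {0..?L} (\<lambda>s. integral {0..?L} (\<lambda>t. \<bar>bessel_J0 (K n * \<bar>s - t\<bar>)\<bar>))" for n
  proof -
    have "continuous_on UNIV (\<lambda>z. \<bar>k0 ((K n)\<^sup>2 / 4) z\<bar>)" by (intro continuous_intros)
    from seg_int_iterated(1)[OF this, of S S] show ?thesis unfolding k0_bessel norm_seg_param_diff .
  qed
  have c: "continuous_on X (\<lambda>(s, t). \<bar>bessel_J0 (K n * \<bar>s - t\<bar>)\<bar>)" for X n
    unfolding split_def by (intro continuous_intros)
  have inner: "(\<lambda>n. integral {0..?L} (\<lambda>t. \<bar>bessel_J0 (K n * \<bar>s - t\<bar>)\<bar>)) \<longlonglongrightarrow> 0" for s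
  proof -
    have "(\<lambda>n. integral {0..?L} (\<lambda>t. \<bar>bessel_J0 (K n * \<bar>s - t\<bar>)\<bar>)) \<longlonglongrightarrow> (LINT t:{0..?L}|lborel. 0)"
    proof (rule dominated_Icc[where C = 1 and F = "{s}"])
      fix t assume "t \<notin> {s}"
      then have "\<bar>s - t\<bar> > 0" by auto
      then have "(\<lambda>n. bessel_J0 (K n * \<bar>s - t\<bar>)) \<longlonglongrightarrow> 0"
        by (rule filterlim_compose[OF J0_at_top filterlim_scale_at_top[OF K]])
      then show "(\<lambda>n. \<bar>bessel_J0 (K n * \<bar>s - t\<bar>)\<bar>) \<longlonglongrightarrow> 0" by (rule tendsto_rabs_zero)
    qed (auto intro!: continuous_intros J0_abs_le_1)
    then show ?thesis by (simp add: set_lebesgue_integral_def)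
  qed
  have "(\<lambda>n. integral {0..?L} (\<lambda>s. integral {0..?L} (\<lambda>t. \<bar>bessel_J0 (K n * \<bar>s - t\<bar>)\<bar>))) \<longlonglongrightarrow> (LINT t:{0..?L}|lborel. 0)"
  proof (rule dominated_Icc[where C = ?L and F = "{}"])
    show "continuous_on {0..?L} (\<lambda>s. integral {0..?L} (\<lambda>t. \<bar>bessel_J0 (K n * \<bar>s - t\<bar>)\<bar>))" for n
      unfolding cbox_interval[symmetric] by (rule integral_continuous_on_param[OF c])
    fix n s
    have "norm (integral {0..?L} (\<lambda>t. \<bar>bessel_J0 (K n * \<bar>s - t\<bar>)\<bar>)) \<le> integral {0..?L} (\<lambda>t. 1)"
      by (rule integral_norm_bound_integral) (auto intro!: integrable_continuous_real continuous_intros J0_abs_le_1)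
    then show "\<bar>integral {0..?L} (\<lambda>t. \<bar>bessel_J0 (K n * \<bar>s - t\<bar>)\<bar>)\<bar> \<le> ?L" using L by simp
  qed (use inner in auto)
  then show ?thesis unfolding it by (simp add: set_lebesgue_integral_def)
qed

context gauss_field begin

lemma trace4_restrict:
  assumes "finite I" "J \<subseteq> I" "\<And>p. p \<in> I - J \<Longrightarrow> w p = 0" "\<And>p. p \<in> J \<Longrightarrow> w p = v p"
  shows "trace4 I w = trace4 J v"
  unfolding trace4_def using assms
  by (intro sum.mono_neutral_cong_right ballI) auto

text \<open>Cutting the cycle at opposite indices exhibits the square of an entry of K W K, W being
  the diagonal matrix of the weights; the sum over signs can then be carried out inside the
  square.\<close>

lemma trace4_square: "trace4 I w = (\<Sum>p\<in>I. \<Sum>r\<in>I. w p * w r * (\<Sum>q\<in>I. w q * (K p q * K q r))\<^sup>2)"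
proof -
  have "trace4 I w = (\<Sum>p\<in>I. \<Sum>r\<in>I. \<Sum>q\<in>I. \<Sum>s\<in>I. w p * w q * w r * w s * (K p q * K q r * K r s * K s p))"
    unfolding trace4_def by (intro sum.cong refl sum.swap)
  also have "\<dots> = (\<Sum>p\<in>I. \<Sum>r\<in>I. w p * w r * ((\<Sum>q\<in>I. w q * (K p q * K q r)) * (\<Sum>s\<in>I. w s * (K p s * K s r))))"
    unfolding sum_product unfolding sum_distrib_left
  proof (intro sum.cong refl)
    fix p r q s
    show "w p * w q * w r * w s * (K p q * K q r * K r s * K s p) = w p * w r * (w q * (K p q * K q r) * (w s * (K p s * K s r)))"
      by (simp add: sym[of r s] sym[of s p])
  qed
  finally show ?thesis by (simp add: power2_eq_square)
qed

end

text \<open>On one segment the covariance is \<open>kk + s * t * mm\<close>, without mixed terms,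
  and the signs in the weights keep only products of one factor \<open>kk\<close> and one
  \<open>mm\<close>, collected in \<open>P\<close>. One \<open>P\<close> is bounded by
  \<open>R\<close> through \<open>\<bar>kk i l\<bar> \<le> 1\<close>; the other is summed
  completely, which costs a second \<open>R\<close> and leaves the sum of
  \<open>\<bar>kk i j\<bar>\<close>.\<close>

lemma segment_trace_bound:
  assumes gf: "gauss_field M X (\<lambda>p q. kz (k\<^sup>2 / 4) (sample_point S n p) (sample_point S n q))"
    and mass: "\<And>i. i < n \<Longrightarrow> (\<Sum>j<n. \<bar>km (k\<^sup>2 / 4) (node (S a) n i - node (S a) n j)\<bar>) \<le> R"
  shows "gauss_field.trace4 (\<lambda>p q. kz (k\<^sup>2 / 4) (sample_point S n p) (sample_point S n q)) (sample_index {a} n) (sample_weight S \<alpha> n)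
    \<le> 32 * (\<alpha> a * (seg_length (S a) / real n) / 4) ^ 4 * (R\<^sup>2 * (\<Sum>i<n. \<Sum>j<n. \<bar>k0 (k\<^sup>2 / 4) (node (S a) n i - node (S a) n j)\<bar>))"
proof -
  interpret gauss_field M X "\<lambda>p q. kz (k\<^sup>2 / 4) (sample_point S n p) (sample_point S n q)" by (rule gf)
  let ?K = "\<lambda>p q. kz (k\<^sup>2 / 4) (sample_point S n p) (sample_point S n q)"
  define c where "c = \<alpha> a * (seg_length (S a) / real n) / 4"
  define kk where "kk i j = k0 (k\<^sup>2 / 4) (node (S a) n i - node (S a) n j)" for i j
  define mm where "mm i j = km (k\<^sup>2 / 4) (node (S a) n i - node (S a) n j)" for i j
  have symm: "kk i j = kk j i" "mm i j = mm j i" for i j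
    unfolding kk_def mm_def k0_bessel km_J1_over by (simp_all add: norm_minus_commute)
  have kk1: "\<bar>kk i j\<bar> \<le> 1" for i j unfolding kk_def k0_bessel by (rule J0_abs_le_1)
  have mR: "i < n \<Longrightarrow> (\<Sum>j<n. \<bar>mm i j\<bar>) \<le> R" for i unfolding mm_def by (rule mass)
  \<comment> \<open>Differences of points on the segment are orthogonal to the normal, so the
    correlations \<open>k1\<close> between value and normal derivative vanish.\<close>
  have KK: "?K (a, i, s) (a, j, t) = kk i j + s * t * mm i j" for i j s t
  proof -
    have "(node (S a) n i - node (S a) n j) \<bullet> seg_normal (S a) = 0" by (simp add: node_def seg_param_diff)
    then show ?thesis unfolding kk_def mm_def by (simp add: sample_point_def kz_signs k1_def k2_def km_def)
  qed
  have W: "sample_weight S \<alpha> n (a, i, s) = s * c" for i s by (simp add: sample_weight_def c_def)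
  define P where "P i j = (\<Sum>l<n. kk i l * mm l j)" for i j
  have inner: "(\<Sum>q\<in>sample_index {a} n. sample_weight S \<alpha> n q * (?K (a, i, s) q * ?K q (a, j, u))) = 2 * c * (u * P i j + s * P j i)" for i j s u
  proof -
    have "(\<Sum>q\<in>sample_index {a} n. sample_weight S \<alpha> n q * (?K (a, i, s) q * ?K q (a, j, u)))
       = (\<Sum>l<n. 2 * c * (u * (kk i l * mm l j) + s * (kk j l * mm l i)))"
      unfolding sum_sample_index by (simp add: W KK symm[of i] symm[of _ j] algebra_simps)
    also have "\<dots> = 2 * c * (u * P i j + s * P j i)"
      unfolding P_def by (simp add: sum_distrib_left sum.distrib distrib_left)
    finally show ?thesis .
  qed
  have "trace4 (sample_index {a} n) (sample_weight S \<alpha> n) = (\<Sum>i<n. \<Sum>j<n. 32 * c ^ 4 * (P i j * P j i))"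
  proof -
    let ?I = "sample_index {a} n"
    define G where "G p r = sample_weight S \<alpha> n p * sample_weight S \<alpha> n r * (\<Sum>q\<in>?I. sample_weight S \<alpha> n q * (?K p q * ?K q r))\<^sup>2" for p r
    have G: "G (a, i, s) (a, j, u) = (s * c) * (u * c) * (2 * c * (u * P i j + s * P j i))\<^sup>2" for i j s u
      unfolding G_def inner W ..
    have e: "G (a, i, 1) (a, j, 1) + G (a, i, 1) (a, j, -1) + (G (a, i, -1) (a, j, 1) + G (a, i, -1) (a, j, -1)) = 32 * c ^ 4 * (P i j * P j i)" for i j
      unfolding G by (simp add: power2_eq_square power4_eq_xxxx algebra_simps)
    have "trace4 ?I (sample_weight S \<alpha> n) = (\<Sum>p\<in>?I. \<Sum>r\<in>?I. G p r)"
      unfolding trace4_square G_def ..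
    also have "\<dots> = (\<Sum>i<n. \<Sum>j<n. G (a, i, 1) (a, j, 1) + G (a, i, 1) (a, j, -1) + (G (a, i, -1) (a, j, 1) + G (a, i, -1) (a, j, -1)))"
      unfolding sum_sample_index by (simp add: sum.distrib)
    finally show ?thesis unfolding e .
  qed
  also have "\<dots> \<le> (\<Sum>i<n. \<Sum>j<n. 32 * c ^ 4 * (R * \<bar>P j i\<bar>))"
  proof (intro sum_mono mult_left_mono)
    fix i j assume ij: "i \<in> {..<n}" "j \<in> {..<n}"
    have "\<bar>P i j\<bar> \<le> (\<Sum>l<n. \<bar>mm j l\<bar>)" unfolding P_def
    proof (rule order_trans[OF sum_abs sum_mono])
      fix l
      have "\<bar>kk i l\<bar> * \<bar>mm l j\<bar> \<le> 1 * \<bar>mm l j\<bar>" by (intro mult_right_mono kk1) auto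
      then show "\<bar>kk i l * mm l j\<bar> \<le> \<bar>mm j l\<bar>" using symm(2)[of l j] by (simp add: abs_mult)
    qed
    also have "\<dots> \<le> R" using ij by (intro mR) auto
    finally have "\<bar>P i j\<bar> * \<bar>P j i\<bar> \<le> R * \<bar>P j i\<bar>" by (rule mult_right_mono) simp
    then show "P i j * P j i \<le> R * \<bar>P j i\<bar>" using abs_ge_self[of "P i j * P j i"] by (simp add: abs_mult)
  qed simp
  also have "\<dots> = 32 * c ^ 4 * (R * (\<Sum>i<n. \<Sum>j<n. \<bar>P j i\<bar>))" by (simp add: sum_distrib_left)
  also have "\<dots> \<le> 32 * c ^ 4 * (R\<^sup>2 * (\<Sum>i<n. \<Sum>j<n. \<bar>kk i j\<bar>))"
  proof (cases "n = 0")
    case False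
    have R0: "R \<ge> 0" using order_trans[OF sum_nonneg mR[of 0]] False by simp
    \<comment> \<open>In the complete sum it is the row sum over the free index of \<open>mm\<close>
      that is bounded by \<open>R\<close>.\<close>
    have "(\<Sum>i<n. \<Sum>j<n. \<bar>P j i\<bar>) \<le> (\<Sum>i<n. \<Sum>j<n. \<Sum>l<n. \<bar>kk j l\<bar> * \<bar>mm l i\<bar>)"
      unfolding P_def by (intro sum_mono order_trans[OF sum_abs]) (simp add: abs_mult)
    also have "\<dots> = (\<Sum>j<n. \<Sum>i<n. \<Sum>l<n. \<bar>kk j l\<bar> * \<bar>mm l i\<bar>)" by (rule sum.swap)
    also have "\<dots> = (\<Sum>j<n. \<Sum>l<n. \<Sum>i<n. \<bar>kk j l\<bar> * \<bar>mm l i\<bar>)" by (intro sum.cong refl sum.swap)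
    also have "\<dots> \<le> (\<Sum>j<n. \<Sum>l<n. \<bar>kk j l\<bar> * R)"
      unfolding sum_distrib_left[symmetric] by (intro sum_mono mult_left_mono mR) auto
    also have "\<dots> = R * (\<Sum>i<n. \<Sum>j<n. \<bar>kk i j\<bar>)" by (simp add: sum_distrib_left mult.commute)
    finally have "R * (\<Sum>i<n. \<Sum>j<n. \<bar>P j i\<bar>) \<le> R * (R * (\<Sum>i<n. \<Sum>j<n. \<bar>kk i j\<bar>))" using R0 by (rule mult_left_mono)
    then show ?thesis by (intro mult_left_mono) (auto simp: power2_eq_square mult.assoc)
  qed simp
  finally show ?thesis unfolding c_def kk_def .
qed

text \<open>Energy is fixed and only the mesh tends to 0: the error bound for the sampled quadratic
  forms passes to the limit together with its Riemann sums. The characteristic function is taken at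
  1, its argument being carried by \<open>\<alpha>\<close>.\<close>

lemma berry_chf_bound:
  fixes S :: "'a \<Rightarrow> oriented_segment" and B :: "real^2 \<Rightarrow> 'w \<Rightarrow> real" and \<alpha> :: "'a \<Rightarrow> real" and k R :: real
  assumes gf: "gauss_field M (\<lambda>p \<omega>. B (fst p) \<omega> + gradient (\<lambda>x. B x \<omega>) (fst p) \<bullet> snd p) (kz (k\<^sup>2 / 4))"
    and sm: "\<And>\<omega>. \<omega> \<in> space M \<Longrightarrow> smooth (\<lambda>x. B x \<omega>)"
    and A: "finite A" and L: "\<And>a. a \<in> A \<Longrightarrow> seg_length (S a) > 0"
    and mass: "\<And>a x. a \<in> A \<Longrightarrow> x \<in> {0..seg_length (S a)} \<Longrightarrow>
      integral {0..seg_length (S a)} (\<lambda>y. \<bar>km (k\<^sup>2 / 4) (seg_param (S a) x - seg_param (S a) y)\<bar>) \<le> R"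
  defines "F \<equiv> \<lambda>\<omega>. \<Sum>a\<in>A. \<alpha> a * integral {0..seg_length (S a)} (\<lambda>t. B (seg_param (S a) t) \<omega> * (gradient (\<lambda>x. B x \<omega>) (seg_param (S a) t) \<bullet> seg_normal (S a)))"
    and "V \<equiv> \<Sum>a\<in>A. \<Sum>b\<in>A. \<alpha> a * \<alpha> b * seg_int (S a) (S b) (\<lambda>z. h2 (k\<^sup>2 / 4) z (seg_normal (S a)) (seg_normal (S b)))"
    and "T \<equiv> real (card A) ^ 3 * (\<Sum>a\<in>A. (\<alpha> a) ^ 4 / 8 * ((R + 1)\<^sup>2 * seg_int (S a) (S a) (\<lambda>z. \<bar>k0 (k\<^sup>2 / 4) z\<bar>)))"
  shows "F \<in> borel_measurable M"
    and "norm ((\<integral>\<omega>. iexp (F \<omega>) \<partial>M) - complex_of_real (exp (- V / 2))) \<le> 2 * sqrt (2 * T)"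
proof -
  interpret Z: gauss_field M "\<lambda>p \<omega>. B (fst p) \<omega> + gradient (\<lambda>x. B x \<omega>) (fst p) \<bullet> snd p" "kz (k\<^sup>2 / 4)" by (rule gf)
  define Q where "Q n \<omega> = (\<Sum>p\<in>sample_index A n. sample_weight S \<alpha> n p *
     (B (fst (sample_point S n p)) \<omega> + gradient (\<lambda>x. B x \<omega>) (fst (sample_point S n p)) \<bullet> snd (sample_point S n p))\<^sup>2)" for n \<omega>
  have Qm [measurable]: "Q n \<in> borel_measurable M" for n
    unfolding Q_def by (intro borel_measurable_sum borel_measurable_times borel_measurable_power borel_measurable_const Z.rv)
  have QF: "(\<lambda>n. Q n \<omega>) \<longlonglongrightarrow> F \<omega>" if "\<omega> \<in> space M" for \<omega>
    unfolding Q_def F_def by (rule sample_form_limit[OF sm[OF that]]) (use L in \<open>auto intro: less_imp_le\<close>)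
  show Fm [measurable]: "F \<in> borel_measurable M" by (rule borel_measurable_LIMSEQ_real[OF QF Qm])
  let ?K = "\<lambda>n p q. kz (k\<^sup>2 / 4) (sample_point S n p) (sample_point S n q)"
  define Vn where "Vn n = 2 * (\<Sum>p\<in>sample_index A n. \<Sum>q\<in>sample_index A n. sample_weight S \<alpha> n p * sample_weight S \<alpha> n q * (?K n p q)\<^sup>2)" for n
  have VV: "Vn \<longlonglongrightarrow> V"
    unfolding Vn_def V_def sample_variance
    by (intro tendsto_intros riemann_seg_int continuous_h2 less_imp_le L)
  define D where "D n a = (\<alpha> a) ^ 4 / 8 * ((R + 1)\<^sup>2 * (seg_length (S a) / real n * (\<Sum>i<n. seg_length (S a) / real n *
      (\<Sum>j<n. \<bar>k0 (k\<^sup>2 / 4) (node (S a) n i - node (S a) n j)\<bar>))))" for n a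
  define Tn where "Tn n = real (card A) ^ 3 * (\<Sum>a\<in>A. D n a)" for n
  have TT: "Tn \<longlonglongrightarrow> T"
    unfolding Tn_def T_def D_def
    by (intro tendsto_intros riemann_seg_int continuous_intros less_imp_le L)
  \<comment> \<open>Four mesh widths come from the weights, and two are lost since row sums are
    integrals divided by the mesh width; the remaining two make up the double Riemann sum.\<close>
  have scale: "32 * (x * h / 4) ^ 4 * ((r / h)\<^sup>2 * s) = x ^ 4 / 8 * (r\<^sup>2 * (h * (h * s)))" if "h \<noteq> 0" for x h r s :: real
    using that by (simp add: power_divide power_mult_distrib field_simps power2_eq_square power4_eq_xxxx)
  \<comment> \<open>The tolerance is the inverse of the length, so the Riemann error of a row sum is
    at most 1; this is the 1 in \<open>R + 1\<close>.\<close>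
  define W where "W n a \<longleftrightarrow> n > 0 \<and> (\<forall>x\<in>{0..seg_length (S a)}. \<bar>seg_length (S a) / real n * (\<Sum>j<n. \<bar>km (k\<^sup>2 / 4) (seg_param (S a) x - seg_param (S a) (seg_length (S a) * real j / real n))\<bar>)
      - integral {0..seg_length (S a)} (\<lambda>y. \<bar>km (k\<^sup>2 / 4) (seg_param (S a) x - seg_param (S a) y)\<bar>)\<bar> \<le> seg_length (S a) * (1 / seg_length (S a)))" for n a
  have "\<forall>\<^sub>F n in sequentially. W n a" if "a \<in> A" for a
    unfolding W_def by (rule riemann_uniform) (use L[OF that] in \<open>auto simp: split_def intro!: continuous_intros\<close>)
  then have "\<forall>\<^sub>F n in sequentially. \<forall>a\<in>A. W n a" by (intro eventually_ball_finite[OF A] ballI)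
  then have trace: "\<forall>\<^sub>F n in sequentially. gauss_field.trace4 (?K n) (sample_index A n) (sample_weight S \<alpha> n) \<le> Tn n"
  proof (rule eventually_mono)
    fix n assume "\<forall>a\<in>A. W n a"
    note n = this[unfolded W_def]
    let ?w = "sample_weight S \<alpha> n" and ?I = "sample_index A n"
    interpret G: gauss_field M "\<lambda>p \<omega>. B (fst (sample_point S n p)) \<omega> + gradient (\<lambda>x. B x \<omega>) (fst (sample_point S n p)) \<bullet> snd (sample_point S n p)" "?K n"
      by (rule Z.reindex)
    have fI: "finite ?I" using A by simp
    \<comment> \<open>The weight is split into its restrictions to the single segments.\<close>
    have "G.trace4 ?I ?w = G.trace4 ?I (\<lambda>p. \<Sum>a\<in>A. if fst p = a then ?w p else 0)"
      by (rule G.trace4_restrict[OF fI]) (use A in \<open>auto simp: sample_index_def sum.delta\<close>)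
    also have "\<dots> \<le> real (card A) ^ 3 * (\<Sum>a\<in>A. G.trace4 ?I (\<lambda>p. if fst p = a then ?w p else 0))"
      by (rule G.trace4_sum_bound[OF fI A])
    also have "\<dots> \<le> Tn n" unfolding Tn_def
    proof (intro mult_left_mono sum_mono)
      fix a assume a: "a \<in> A"
      let ?h = "seg_length (S a) / real n"
      have n0: "n > 0" using n a by blast
      have h: "?h > 0" using L[OF a] n0 by simp
      have "G.trace4 ?I (\<lambda>p. if fst p = a then ?w p else 0) = G.trace4 (sample_index {a} n) ?w"
        by (rule G.trace4_restrict[OF fI]) (use a in \<open>auto simp: sample_index_def\<close>)
      also have "\<dots> \<le> 32 * (\<alpha> a * ?h / 4) ^ 4 * (((R + 1) / ?h)\<^sup>2 * (\<Sum>i<n. \<Sum>j<n. \<bar>k0 (k\<^sup>2 / 4) (node (S a) n i - node (S a) n j)\<bar>))"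
      proof (rule segment_trace_bound[OF G.gauss_field_axioms])
        fix i assume i: "i < n"
        let ?x = "seg_length (S a) * real i / real n"
        have x: "?x \<in> {0..seg_length (S a)}" using node_le[OF i] L[OF a] by simp
        have "?h * (\<Sum>j<n. \<bar>km (k\<^sup>2 / 4) (node (S a) n i - node (S a) n j)\<bar>) \<le> R + 1"
        proof -
          have "\<bar>?h * (\<Sum>j<n. \<bar>km (k\<^sup>2 / 4) (seg_param (S a) ?x - seg_param (S a) (seg_length (S a) * real j / real n))\<bar>)
            - integral {0..seg_length (S a)} (\<lambda>y. \<bar>km (k\<^sup>2 / 4) (seg_param (S a) ?x - seg_param (S a) y)\<bar>)\<bar> \<le> 1"
            using n a x L[OF a] by fastforce
          with mass[OF a x] show ?thesis unfolding node_def by linarith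
        qed
        then show "(\<Sum>j<n. \<bar>km (k\<^sup>2 / 4) (node (S a) n i - node (S a) n j)\<bar>) \<le> (R + 1) / ?h"
          using h by (subst pos_le_divide_eq) (simp_all only: mult.commute)
      qed
      also have "\<dots> = D n a"
        unfolding D_def sum_distrib_left[symmetric] by (rule scale) (use n0 L[OF a] in auto)
      finally show "G.trace4 ?I (\<lambda>p. if fst p = a then ?w p else 0) \<le> D n a" .
    qed simp
    finally show "G.trace4 ?I ?w \<le> Tn n" .
  qed
  have bound: "\<forall>\<^sub>F n in sequentially. norm ((\<integral>\<omega>. iexp (Q n \<omega>) \<partial>M) - complex_of_real (exp (- Vn n / 2))) \<le> 2 * sqrt (2 * Tn n)"
    using trace
  proof eventually_elim
    case (elim n)
    interpret G: gauss_field M "\<lambda>p \<omega>. B (fst (sample_point S n p)) \<omega> + gradient (\<lambda>x. B x \<omega>) (fst (sample_point S n p)) \<bullet> snd (sample_point S n p)" "?K n"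
      by (rule Z.reindex)
    have "norm ((\<integral>\<omega>. iexp (1 * Q n \<omega>) \<partial>M) - complex_of_real (exp (- Vn n * 1\<^sup>2 / 2))) \<le> 2 * 1\<^sup>2 * sqrt (2 * G.trace4 (sample_index A n) (sample_weight S \<alpha> n))"
      unfolding Q_def Vn_def by (rule G.chf_quadratic_bound[OF finite_sample_index[OF A] sample_trace])
    also have "\<dots> \<le> 2 * sqrt (2 * Tn n)" using elim by simp
    finally show ?case by simp
  qed
  have "(\<lambda>n. \<integral>\<omega>. iexp (Q n \<omega>) \<partial>M) \<longlonglongrightarrow> (\<integral>\<omega>. iexp (F \<omega>) \<partial>M)"
  proof (rule integral_dominated_convergence[where w = "\<lambda>_. 1"])
    show "AE \<omega> in M. (\<lambda>n. iexp (Q n \<omega>)) \<longlonglongrightarrow> iexp (F \<omega>)"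
      by (intro AE_I2 tendsto_intros QF)
  qed auto
  moreover have "(\<lambda>n. complex_of_real (exp (- Vn n / 2))) \<longlonglongrightarrow> complex_of_real (exp (- V / 2))"
    by (intro tendsto_intros VV) auto
  ultimately have "(\<lambda>n. norm ((\<integral>\<omega>. iexp (Q n \<omega>) \<partial>M) - complex_of_real (exp (- Vn n / 2)))) \<longlonglongrightarrow> norm ((\<integral>\<omega>. iexp (F \<omega>) \<partial>M) - complex_of_real (exp (- V / 2)))"
    by (intro tendsto_norm tendsto_diff)
  moreover have "(\<lambda>n. 2 * sqrt (2 * Tn n)) \<longlonglongrightarrow> 2 * sqrt (2 * T)" by (intro tendsto_intros TT)
  ultimately show "norm ((\<integral>\<omega>. iexp (F \<omega>) \<partial>M) - complex_of_real (exp (- V / 2))) \<le> 2 * sqrt (2 * T)"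
    by (rule LIMSEQ_le) (use bound in \<open>simp add: eventually_sequentially\<close>)
qed

text \<open>The error term combines (c n)^4, of order K^(-2), with the square of a row mass of order
  K. The product stays bounded, so the vanishing mean of |J0| forces the error to 0.\<close>

lemma berry_chf_limit:
  fixes S :: "'a \<Rightarrow> oriented_segment" and B :: "nat \<Rightarrow> real^2 \<Rightarrow> 'w \<Rightarrow> real" and E c :: "nat \<Rightarrow> real"
  assumes E: "filterlim E at_top sequentially" "\<And>n. E n > 0"
    and B: "\<And>n. berry_random_wave (E n) (M n) (B n)"
    and A: "finite A" and L: "\<And>a. a \<in> A \<Longrightarrow> seg_length (S a) > 0"
    and c: "\<And>n. (c n)\<^sup>2 = 1 / (8 * sqrt (E n))"
  shows "(\<lambda>n. \<integral>\<omega>. iexp (\<Sum>a\<in>A. (c n * \<beta> a) * integral {0..seg_length (S a)} (\<lambda>t. B n (seg_param (S a) t) \<omega> * (gradient (\<lambda>x. B n x \<omega>) (seg_param (S a) t) \<bullet> seg_normal (S a)))) \<partial>M n)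
    \<longlonglongrightarrow> complex_of_real (exp (- (\<Sum>a\<in>A. \<Sum>b\<in>A. \<beta> a * \<beta> b * (measure lborel {t \<in> {0..seg_length (S b)}. seg_param (S b) t \<in> seg_image (S a)} * (seg_normal (S a) \<bullet> seg_normal (S b)))) / 2))"
proof -
  define K where "K n = 2 * pi * sqrt (E n)" for n
  have Kpos: "K n > 0" for n using E(2)[of n] by (simp add: K_def)
  have K2: "(K n)\<^sup>2 / 4 = pi\<^sup>2 * E n" for n using E(2)[of n] by (simp add: K_def power_mult_distrib)
  have K: "filterlim K at_top sequentially"
    unfolding K_def by (rule filterlim_tendsto_pos_mult_at_top[OF tendsto_const _ filterlim_compose[OF sqrt_at_top E(1)]]) simp
  have c2: "(c n)\<^sup>2 = pi / (4 * K n)" for n unfolding c K_def using E(2)[of n] by (simp add: field_simps)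
  obtain C where C: "C \<ge> 0" "\<And>k S x. k > 0 \<Longrightarrow> x \<in> {0..seg_length S} \<Longrightarrow>
    integral {0..seg_length S} (\<lambda>y. \<bar>km (k\<^sup>2 / 4) (seg_param S x - seg_param S y)\<bar>) \<le> C * k" by (rule km_mass) blast
  define V where "V n = (\<Sum>a\<in>A. \<Sum>b\<in>A. (c n * \<beta> a) * (c n * \<beta> b) * seg_int (S a) (S b) (\<lambda>z. h2 ((K n)\<^sup>2 / 4) z (seg_normal (S a)) (seg_normal (S b))))" for n
  define T where "T n = real (card A) ^ 3 * (\<Sum>a\<in>A. (c n * \<beta> a) ^ 4 / 8 * ((C * K n + 1)\<^sup>2 * seg_int (S a) (S a) (\<lambda>z. \<bar>k0 ((K n)\<^sup>2 / 4) z\<bar>)))" for n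
  define I where "I n = (\<integral>\<omega>. iexp (\<Sum>a\<in>A. (c n * \<beta> a) * integral {0..seg_length (S a)} (\<lambda>t. B n (seg_param (S a) t) \<omega> * (gradient (\<lambda>x. B n x \<omega>) (seg_param (S a) t) \<bullet> seg_normal (S a)))) \<partial>M n)" for n
  have bound: "norm (I n - complex_of_real (exp (- V n / 2))) \<le> 2 * sqrt (2 * T n)" for n
    unfolding I_def V_def T_def
  proof (rule berry_chf_bound(2)[OF _ _ A L])
    show "gauss_field (M n) (\<lambda>p \<omega>. B n (fst p) \<omega> + gradient (\<lambda>x. B n x \<omega>) (fst p) \<bullet> snd p) (kz ((K n)\<^sup>2 / 4))"
      unfolding K2 by (rule berry_gauss_field[OF B E(2)])
    show "\<omega> \<in> space (M n) \<Longrightarrow> smooth (\<lambda>x. B n x \<omega>)" for \<omega> using B[of n] by (simp add: berry_random_wave_def)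
  qed (use C(2)[OF Kpos] in auto)
  have Veq: "V n = (\<Sum>a\<in>A. \<Sum>b\<in>A. \<beta> a * \<beta> b * (pi / (4 * K n) * seg_int (S a) (S b) (\<lambda>z. h2 ((K n)\<^sup>2 / 4) z (seg_normal (S a)) (seg_normal (S b)))))" for n
    unfolding V_def c2[symmetric] by (intro sum.cong refl) (simp add: power2_eq_square mult_ac)
  have Vlim: "V \<longlonglongrightarrow> (\<Sum>a\<in>A. \<Sum>b\<in>A. \<beta> a * \<beta> b * (measure lborel {t \<in> {0..seg_length (S b)}. seg_param (S b) t \<in> seg_image (S a)} * (seg_normal (S a) \<bullet> seg_normal (S b))))"
    unfolding Veq by (intro tendsto_intros seg_int_normal_limit K Kpos L)
  have Teq: "T n = real (card A) ^ 3 * (\<Sum>a\<in>A. (\<beta> a) ^ 4 / 8 * ((pi / 4)\<^sup>2 * (C + 1 / K n)\<^sup>2 * seg_int (S a) (S a) (\<lambda>z. \<bar>k0 ((K n)\<^sup>2 / 4) z\<bar>)))" for n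
  proof -
    have "(c n) ^ 4 * (C * K n + 1)\<^sup>2 = (pi / 4)\<^sup>2 * (C + 1 / K n)\<^sup>2"
    proof -
      have "(c n) ^ 4 = (pi / (4 * K n))\<^sup>2" unfolding c2[symmetric] by simp
      then have "(c n) ^ 4 * (C * K n + 1)\<^sup>2 = (pi / (4 * K n) * (C * K n + 1))\<^sup>2" by (simp only: power_mult_distrib)
      also have "pi / (4 * K n) * (C * K n + 1) = pi / 4 * (C + 1 / K n)" using Kpos[of n] by (simp add: field_simps)
      finally show ?thesis by (simp only: power_mult_distrib)
    qed
    then have "(pi / 4)\<^sup>2 * (C + 1 / K n)\<^sup>2 * (b ^ 4 / 8 * s) = ((c n) ^ 4 * (C * K n + 1)\<^sup>2) * (b ^ 4 / 8 * s)" for b s by (simp only:)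
    then have "(c n * b) ^ 4 / 8 * ((C * K n + 1)\<^sup>2 * s) = b ^ 4 / 8 * ((pi / 4)\<^sup>2 * (C + 1 / K n)\<^sup>2 * s)" for b s
      by (simp only: power_mult_distrib mult_ac times_divide_eq_left times_divide_eq_right)
    then show ?thesis unfolding T_def by (simp only:)
  qed
  have "(\<lambda>n. 1 / K n) \<longlonglongrightarrow> 0" by (rule tendsto_divide_0[OF tendsto_const filterlim_at_top_imp_at_infinity[OF K]])
  then have "T \<longlonglongrightarrow> real (card A) ^ 3 * (\<Sum>a\<in>A. (\<beta> a) ^ 4 / 8 * ((pi / 4)\<^sup>2 * (C + 0)\<^sup>2 * 0))"
    unfolding Teq by (intro tendsto_intros seg_int_k0_null K less_imp_le L)
  then have "(\<lambda>n. 2 * sqrt (2 * T n)) \<longlonglongrightarrow> 2 * sqrt (2 * 0)" by (intro tendsto_intros) simp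
  then have "(\<lambda>n. 2 * sqrt (2 * T n)) \<longlonglongrightarrow> 0" by simp
  then have "(\<lambda>n. I n - complex_of_real (exp (- V n / 2))) \<longlonglongrightarrow> 0"
    by (rule Lim_null_comparison[rotated]) (use bound in auto)
  moreover have "(\<lambda>n. complex_of_real (exp (- V n / 2))) \<longlonglongrightarrow> complex_of_real (exp (- (\<Sum>a\<in>A. \<Sum>b\<in>A. \<beta> a * \<beta> b * (measure lborel {t \<in> {0..seg_length (S b)}. seg_param (S b) t \<in> seg_image (S a)} * (seg_normal (S a) \<bullet> seg_normal (S b)))) / 2))"
    by (intro tendsto_intros Vlim) auto
  ultimately show ?thesis unfolding I_def[symmetric] by (rule Lim_transform[rotated])
qed

section \<open>Convergence of the functionals\<close>

text \<open>The signed length is the inner product of the fields equal to the normal on a segment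
  and 0 elsewhere, in the square integrable fields for Hausdorff measure. The atoms of the finite
  family reduce this space to finite dimension, so that the covariance becomes a finite Gram
  matrix.\<close>

definition venn_atom :: "oriented_segment set \<Rightarrow> oriented_segment set \<Rightarrow> (real^2) set" where
  "venn_atom \<S> U = {x. \<forall>S\<in>\<S>. x \<in> seg_image S \<longleftrightarrow> S \<in> U}"

lemma venn_atom_measurable: assumes "finite \<S>" shows "venn_atom \<S> U \<in> sets borel"
proof -
  have "venn_atom \<S> U = (\<Inter>S\<in>\<S>. if S \<in> U then seg_image S else - seg_image S) \<inter> UNIV" by (auto simp: venn_atom_def)
  moreover have "(\<Inter>S\<in>\<S>. if S \<in> U then seg_image S else - seg_image S) \<in> sets borel" if "\<S> \<noteq> {}"
    by (intro sets.finite_INT assms that) auto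
  ultimately show ?thesis by (cases "\<S> = {}") auto
qed

lemma measure_seg_image_Int_venn:
  assumes \<S>: "finite \<S>" "S \<in> \<S>" "T \<in> \<S>"
  shows "measure hausdorff1 (seg_image S \<inter> seg_image T) = (\<Sum>U\<in>Pow \<S>. measure hausdorff1 (venn_atom \<S> U) * (of_bool (S \<in> U) * of_bool (T \<in> U)))"
proof -
  let ?P = "{U \<in> Pow \<S>. S \<in> U \<and> T \<in> U}"
  let ?E = "\<lambda>U. {t \<in> {0..seg_length T}. seg_param T t \<in> venn_atom \<S> U}"
  have fin: "finite ?P" using \<S>(1) by simp
  have E: "?E U \<in> sets lborel" for U
  proof -
    have "seg_param T -` venn_atom \<S> U \<inter> space borel \<in> sets borel"
      by (rule measurable_sets[OF seg_param_measurable venn_atom_measurable[OF \<S>(1)]])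
    then have "{0..seg_length T} \<inter> (seg_param T -` venn_atom \<S> U) \<in> sets lborel" by auto
    then show ?thesis by (simp add: Int_def vimage_def)
  qed
  \<comment> \<open>The sum over atoms is formed in the parameter interval of \<open>T\<close>,
    where every piece has finite measure; the atom outside all segments does not meet
    \<open>T\<close>.\<close>
  have "measure hausdorff1 (seg_image S \<inter> seg_image T) = measure lborel {t \<in> {0..seg_length T}. seg_param T t \<in> seg_image S}"
    by (rule measure_seg_image_Int) simp
  also have "{t \<in> {0..seg_length T}. seg_param T t \<in> seg_image S} = (\<Union>U\<in>?P. ?E U)"
  proof (intro set_eqI iffI)
    fix t assume t: "t \<in> {t \<in> {0..seg_length T}. seg_param T t \<in> seg_image S}"
    let ?U = "{V \<in> \<S>. seg_param T t \<in> seg_image V}"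
    have "seg_param T t \<in> seg_image T" using t by (auto simp: seg_image_def)
    then have "?U \<in> ?P" "t \<in> ?E ?U" using t \<S> by (auto simp: venn_atom_def)
    then show "t \<in> (\<Union>U\<in>?P. ?E U)" by blast
  next
    fix t assume "t \<in> (\<Union>U\<in>?P. ?E U)"
    then show "t \<in> {t \<in> {0..seg_length T}. seg_param T t \<in> seg_image S}" using \<S> by (auto simp: venn_atom_def)
  qed
  also have "measure lborel (\<Union>U\<in>?P. ?E U) = (\<Sum>U\<in>?P. measure lborel (?E U))"
  proof (rule measure_finite_Union[OF fin])
    show "disjoint_family_on ?E ?P"
      unfolding disjoint_family_on_def venn_atom_def by (auto 0 4 simp: set_eq_iff)
    show "?E ` ?P \<subseteq> sets lborel" using E by auto
    fix U
    have "emeasure lborel (?E U) \<le> emeasure lborel {0..seg_length T}" by (intro emeasure_mono) auto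
    also have "\<dots> < \<infinity>" by (simp add: emeasure_lborel_Icc_eq)
    finally show "emeasure lborel (?E U) \<noteq> \<infinity>" by simp
  qed
  also have "\<dots> = (\<Sum>U\<in>?P. measure hausdorff1 (venn_atom \<S> U))"
  proof (rule sum.cong[OF refl])
    fix U assume "U \<in> ?P"
    then have "venn_atom \<S> U \<inter> seg_image T = venn_atom \<S> U" using \<S>(3) by (auto simp: venn_atom_def)
    then show "measure lborel (?E U) = measure hausdorff1 (venn_atom \<S> U)"
      using measure_seg_image_Int[OF venn_atom_measurable[OF \<S>(1)], of U T] by simp
  qed
  also have "\<dots> = (\<Sum>U\<in>Pow \<S>. measure hausdorff1 (venn_atom \<S> U) * (of_bool (S \<in> U) * of_bool (T \<in> U)))"
    by (rule sum.mono_neutral_cong_left) (use \<S>(1) in auto)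
  finally show ?thesis .
qed

lemma seg_signed_length_venn:
  assumes \<S>: "finite \<S>" "S \<in> \<S>" "T \<in> \<S>"
  shows "seg_signed_length S T = (\<Sum>(U, e)\<in>Pow \<S> \<times> (Basis :: (real^2) set).
     (sqrt (measure hausdorff1 (venn_atom \<S> U)) * of_bool (S \<in> U) * (seg_normal S \<bullet> e)) *
     (sqrt (measure hausdorff1 (venn_atom \<S> U)) * of_bool (T \<in> U) * (seg_normal T \<bullet> e)))"
proof -
  let ?m = "\<lambda>U. measure hausdorff1 (venn_atom \<S> U)"
  have "seg_signed_length S T = (\<Sum>U\<in>Pow \<S>. \<Sum>e\<in>Basis. ?m U * (of_bool (S \<in> U) * of_bool (T \<in> U)) * ((seg_normal S \<bullet> e) * (seg_normal T \<bullet> e)))"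
    unfolding seg_signed_length_def measure_seg_image_Int_venn[OF assms]
    by (subst euclidean_inner) (rule sum_product)
  also have "\<dots> = (\<Sum>(U, e)\<in>Pow \<S> \<times> (Basis :: (real^2) set).
     (sqrt (?m U) * of_bool (S \<in> U) * (seg_normal S \<bullet> e)) * (sqrt (?m U) * of_bool (T \<in> U) * (seg_normal T \<bullet> e)))"
    unfolding sum.cartesian_product
  proof (intro sum.cong refl, clarify)
    fix U e
    have q: "sqrt (?m U) * sqrt (?m U) = ?m U" by simp
    have "(sqrt (?m U) * of_bool (S \<in> U) * (seg_normal S \<bullet> e)) * (sqrt (?m U) * of_bool (T \<in> U) * (seg_normal T \<bullet> e)) =
      (sqrt (?m U) * sqrt (?m U)) * (of_bool (S \<in> U) * of_bool (T \<in> U)) * ((seg_normal S \<bullet> e) * (seg_normal T \<bullet> e))"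
      by (simp only: mult_ac)
    then show "?m U * (of_bool (S \<in> U) * of_bool (T \<in> U)) * ((seg_normal S \<bullet> e) * (seg_normal T \<bullet> e)) =
      (sqrt (?m U) * of_bool (S \<in> U) * (seg_normal S \<bullet> e)) * (sqrt (?m U) * of_bool (T \<in> U) * (seg_normal T \<bullet> e))" unfolding q by simp
  qed
  finally show ?thesis .
qed

lemma sum_list_map_nth: "(\<Sum>x\<leftarrow>xs. f x) = (\<Sum>k<length xs. f (xs ! k))"
  by (simp add: sum_list_sum_nth atLeast0LessThan)

lemma signed_length_nth: "signed_length A C = (\<Sum>k<length A. \<Sum>l<length C. seg_signed_length (A ! k) (C ! l))"
  unfolding signed_length_def sum_list_map_nth ..

text \<open>The Gram vectors of the segments add up along a chain, so the matrix of signed lengths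
  is again a Gram matrix and hence the covariance of a Gaussian law.\<close>

lemma signed_length_gaussian:
  fixes C :: "'d::finite \<Rightarrow> chain"
  shows "\<exists>N :: (real^'d) measure. sets N = sets borel \<and> gauss_field N (\<lambda>i x. x $ i) (\<lambda>i j. signed_length (C i) (C j))"
proof -
  define \<S> where "\<S> = (\<Union>i. set (C i))"
  have fin: "finite \<S>" by (simp add: \<S>_def)
  define L where "L i = (\<lambda>(U, e :: real^2). \<Sum>k<length (C i). sqrt (measure hausdorff1 (venn_atom \<S> U)) * of_bool (C i ! k \<in> U) * (seg_normal (C i ! k) \<bullet> e))" for i
  have "signed_length (C i) (C j) = (\<Sum>a\<in>Pow \<S> \<times> Basis. L i a * L j a)" for i j
  proof -
    have mem: "C i ! k \<in> \<S>" if "k < length (C i)" for i k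
      unfolding \<S>_def using nth_mem[OF that] by blast
    have "signed_length (C i) (C j) = (\<Sum>k<length (C i). \<Sum>l<length (C j). \<Sum>(U, e)\<in>Pow \<S> \<times> (Basis :: (real^2) set).
     (sqrt (measure hausdorff1 (venn_atom \<S> U)) * of_bool (C i ! k \<in> U) * (seg_normal (C i ! k) \<bullet> e)) *
     (sqrt (measure hausdorff1 (venn_atom \<S> U)) * of_bool (C j ! l \<in> U) * (seg_normal (C j ! l) \<bullet> e)))"
      unfolding signed_length_nth by (intro sum.cong refl seg_signed_length_venn[OF fin]) (auto intro: mem)
    also have "\<dots> = (\<Sum>k<length (C i). \<Sum>a\<in>Pow \<S> \<times> (Basis :: (real^2) set). \<Sum>l<length (C j). case a of (U, e) \<Rightarrow>
     (sqrt (measure hausdorff1 (venn_atom \<S> U)) * of_bool (C i ! k \<in> U) * (seg_normal (C i ! k) \<bullet> e)) *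
     (sqrt (measure hausdorff1 (venn_atom \<S> U)) * of_bool (C j ! l \<in> U) * (seg_normal (C j ! l) \<bullet> e)))"
      by (intro sum.cong refl sum.swap)
    also have "\<dots> = (\<Sum>a\<in>Pow \<S> \<times> (Basis :: (real^2) set). \<Sum>k<length (C i). \<Sum>l<length (C j). case a of (U, e) \<Rightarrow>
     (sqrt (measure hausdorff1 (venn_atom \<S> U)) * of_bool (C i ! k \<in> U) * (seg_normal (C i ! k) \<bullet> e)) *
     (sqrt (measure hausdorff1 (venn_atom \<S> U)) * of_bool (C j ! l \<in> U) * (seg_normal (C j ! l) \<bullet> e)))"
      by (rule sum.swap)
    also have "\<dots> = (\<Sum>a\<in>Pow \<S> \<times> Basis. L i a * L j a)"
      unfolding L_def by (intro sum.cong refl) (auto simp: sum_product)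
    finally show ?thesis .
  qed
  then show ?thesis using gaussian_law_factorized[of "Pow \<S> \<times> (Basis :: (real^2) set)" L] fin by (simp add: finite_Basis)
qed

section \<open>The normalised functionals and the limit theorem\<close>

definition phi_scale :: "real \<Rightarrow> real" where
  "phi_scale E = 4 * pi * E powr (1/4) * (1 / (8 * pi * sqrt (2 * E)))"

lemma phi_scale_square:
  assumes "E > 0" shows "(phi_scale E)\<^sup>2 = 1 / (8 * sqrt E)"
proof -
  have p: "(E powr (1/4))\<^sup>2 = sqrt E"
    using assms by (simp add: power2_eq_square powr_half_sqrt flip: powr_add)
  have "phi_scale E = E powr (1/4) * (1 / (2 * sqrt (2 * E)))" by (simp add: phi_scale_def)
  then have "(phi_scale E)\<^sup>2 = sqrt E * (1 / (2 * sqrt (2 * E)))\<^sup>2" by (simp only: power_mult_distrib p)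
  also have "(1 / (2 * sqrt (2 * E)))\<^sup>2 = 1 / (8 * E)" using assms by (simp add: power_divide power_mult_distrib)
  also have "sqrt E * (1 / (8 * E)) = 1 / (8 * sqrt E)"
    using assms real_sqrt_mult_self[of E] by (simp add: field_simps)
  finally show ?thesis .
qed

lemma phi_tilde_segments:
  assumes C: "polygonal_chain C" and b: "smooth b"
  shows "phi_tilde E b C = (\<Sum>k<length C. phi_scale E * integral {0..seg_length (C ! k)}
    (\<lambda>t. b (seg_param (C ! k) t) * (gradient b (seg_param (C ! k) t) \<bullet> seg_normal (C ! k))))"
proof -
  have "(LINT t:{0..seg_length S}|lborel. b (seg_param S t) * (gradient b (seg_param S t) \<bullet> seg_normal S))
     = integral {0..seg_length S} (\<lambda>t. b (seg_param S t) * (gradient b (seg_param S t) \<bullet> seg_normal S))" for S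
  proof (rule set_borel_integral_eq_integral(2)[OF borel_integrable_atLeastAtMost'])
    show "continuous_on {0..seg_length S} (\<lambda>t. b (seg_param S t) * (gradient b (seg_param S t) \<bullet> seg_normal S))"
      by (intro continuous_intros continuous_on_compose2[OF smooth_continuous[OF b]] continuous_on_compose2[OF smooth_continuous_gradient[OF b]]) auto
  qed
  then show ?thesis
    unfolding phi_tilde_def phi_def integral_chain[OF assms] phi_scale_def by (simp add: sum_distrib_left)
qed

lemma polygonal_chain_seg_length: "polygonal_chain C \<Longrightarrow> k < length C \<Longrightarrow> seg_length (C ! k) > 0"
  by (auto simp: polygonal_chain_def oriented_segment_def)

text \<open>The functional is a pointwise limit of quadratic forms in the sampled wave; the bound
  for characteristic functions already delivers this for sums over segments.\<close>

lemma phi_tilde_measurable: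
  assumes B: "berry_random_wave E M B" and E: "E > 0" and C: "polygonal_chain C"
  shows "(\<lambda>\<omega>. phi_tilde E (\<lambda>x. B x \<omega>) C) \<in> borel_measurable M"
proof -
  define k where "k = 2 * pi * sqrt E"
  have k: "k > 0" "k\<^sup>2 / 4 = pi\<^sup>2 * E" using E by (simp_all add: k_def power_mult_distrib)
  obtain R where R: "\<And>k S x. k > 0 \<Longrightarrow> x \<in> {0..seg_length S} \<Longrightarrow>
    integral {0..seg_length S} (\<lambda>y. \<bar>km (k\<^sup>2 / 4) (seg_param S x - seg_param S y)\<bar>) \<le> R * k" by (rule km_mass) blast
  have sm: "smooth (\<lambda>x. B x \<omega>)" if "\<omega> \<in> space M" for \<omega> using B that by (simp add: berry_random_wave_def)
  have "(\<lambda>\<omega>. \<Sum>i\<in>{..<length C}. phi_scale E * integral {0..seg_length (C ! i)}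
    (\<lambda>t. B (seg_param (C ! i) t) \<omega> * (gradient (\<lambda>x. B x \<omega>) (seg_param (C ! i) t) \<bullet> seg_normal (C ! i)))) \<in> borel_measurable M"
  proof (rule berry_chf_bound(1))
    show "gauss_field M (\<lambda>p \<omega>. B (fst p) \<omega> + gradient (\<lambda>x. B x \<omega>) (fst p) \<bullet> snd p) (kz (k\<^sup>2 / 4))"
      unfolding k(2) by (rule berry_gauss_field[OF B E])
  qed (use sm C R[OF k(1)] polygonal_chain_seg_length in auto)
  then show ?thesis
    by (rule measurable_cong[THEN iffD1, rotated]) (simp add: phi_tilde_segments[OF C sm])
qed

lemma measurable_vec_lambda:
  fixes f :: "'d::finite \<Rightarrow> 'w \<Rightarrow> real"
  assumes "\<And>i. f i \<in> borel_measurable M"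
  shows "(\<lambda>\<omega>. \<chi> i. f i \<omega>) \<in> borel_measurable M"
  unfolding borel_measurable_euclidean_space[where f = "\<lambda>\<omega>. \<chi> i. f i \<omega>"]
  using assms by (auto simp: Basis_vec_def inner_axis)

lemma signed_length_form:
  fixes C :: "'d::finite \<Rightarrow> chain" and u :: "'d \<Rightarrow> real"
  defines "A \<equiv> Sigma UNIV (\<lambda>i. {..<length (C i)})"
  shows "(\<Sum>a\<in>A. \<Sum>b\<in>A. u (fst a) * u (fst b) *
     (measure lborel {t \<in> {0..seg_length (C (fst b) ! snd b)}. seg_param (C (fst b) ! snd b) t \<in> seg_image (C (fst a) ! snd a)} *
      (seg_normal (C (fst a) ! snd a) \<bullet> seg_normal (C (fst b) ! snd b))))
   = (\<Sum>i\<in>UNIV. \<Sum>j\<in>UNIV. u i * u j * signed_length (C i) (C j))"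
proof -
  let ?m = "\<lambda>i k j l. measure lborel {t \<in> {0..seg_length (C j ! l)}. seg_param (C j ! l) t \<in> seg_image (C i ! k)} *
      (seg_normal (C i ! k) \<bullet> seg_normal (C j ! l))"
  have S: "(\<Sum>a\<in>A. f a) = (\<Sum>i\<in>UNIV. \<Sum>k<length (C i). f (i, k))" for f :: "'d \<times> nat \<Rightarrow> real"
    unfolding A_def by (subst sum.Sigma) auto
  have "(\<Sum>i\<in>UNIV. \<Sum>k<length (C i). \<Sum>j\<in>UNIV. \<Sum>l<length (C j). u i * u j * ?m i k j l)
     = (\<Sum>i\<in>UNIV. \<Sum>j\<in>UNIV. \<Sum>k<length (C i). \<Sum>l<length (C j). u i * u j * ?m i k j l)"
    by (intro sum.cong refl sum.swap)
  also have "\<dots> = (\<Sum>i\<in>UNIV. \<Sum>j\<in>UNIV. u i * u j * signed_length (C i) (C j))"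
    unfolding signed_length_sum sum_distrib_left ..
  finally show ?thesis unfolding S fst_conv snd_conv .
qed

theorem theorem2p4:
  fixes M :: "real \<Rightarrow> 'w measure"
    and B :: "real \<Rightarrow> real^2 \<Rightarrow> 'w \<Rightarrow> real"
    and C :: "'d::finite \<Rightarrow> chain"
  assumes "\<And>E. E > 0 \<Longrightarrow> berry_random_wave E (M E) (B E)"
    and "\<And>i. polygonal_chain (C i)"
  shows "\<exists>N :: (real^'d) measure.
           centered_gaussian_law (\<chi> i j. signed_length (C i) (C j)) N \<and>
           converges_in_distribution M
             (\<lambda>E \<omega>. \<chi> i. phi_tilde E (\<lambda>x. B E x \<omega>) (C i)) N at_top"
proof -
  note B = assms(1) and C = assms(2)
  define X where "X E \<omega> = (\<chi> i. phi_tilde E (\<lambda>x. B E x \<omega>) (C i))" for E \<omega>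
  obtain N :: "(real^'d) measure" where sN: "sets N = sets borel"
    and gN: "gauss_field N (\<lambda>i (x :: real^'d). x $ i) (\<lambda>i j. signed_length (C i) (C j))"
    using signed_length_gaussian[of C] by blast
  interpret N: gauss_field N "\<lambda>i (x :: real^'d). x $ i" "\<lambda>i j. signed_length (C i) (C j)" by (rule gN)
  have prob: "prob_space (M E)" if "E > 0" for E
    using B[OF that] by (simp add: berry_random_wave_def centered_gaussian_family_def gaussian_family_def)
  have Xm: "X E \<in> borel_measurable (M E)" if "E > 0" for E
    unfolding X_def by (intro measurable_vec_lambda phi_tilde_measurable B C that)
  have lim: "(\<lambda>n. \<integral>\<omega>. f (X (E n) \<omega>) \<partial>M (E n)) \<longlonglongrightarrow> (\<integral>x. f x \<partial>N)"
    if E: "filterlim E at_top sequentially" "\<And>n. E n > 0"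
      and f: "continuous_on UNIV f" "bounded (range f)"
    for E :: "nat \<Rightarrow> real" and f :: "real^'d \<Rightarrow> real"
  proof -
    note Xn [measurable] = Xm[OF E(2)]
    interpret chf_convergence "\<lambda>n. distr (M (E n)) borel (X (E n))" N
    proof (rule chf_convergence.intro)
      show "prob_space (distr (M (E n)) borel (X (E n)))" for n
        by (rule prob_space.prob_space_distr[OF prob[OF E(2)] Xn])
      show "prob_space N" by (rule N.prob_space_axioms)
      show "sets N = sets borel" by (rule sN)
      fix u :: "real^'d"
      let ?A = "Sigma UNIV (\<lambda>i. {..<length (C i)})"
      let ?S = "\<lambda>a. C (fst a) ! snd a"
      let ?I = "\<lambda>n \<omega> S. integral {0..seg_length S} (\<lambda>t. B (E n) (seg_param S t) \<omega> * (gradient (\<lambda>x. B (E n) x \<omega>) (seg_param S t) \<bullet> seg_normal S))"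
      \<comment> \<open>A linear combination of the functionals is one sum over the segments of all
        chains, so the limit of a single characteristic function treats the whole vector.\<close>
      have form: "u \<bullet> X (E n) \<omega> = (\<Sum>a\<in>?A. (phi_scale (E n) * u $ fst a) * ?I n \<omega> (?S a))" if "\<omega> \<in> space (M (E n))" for n \<omega>
      proof -
        have sm: "smooth (\<lambda>x. B (E n) x \<omega>)" using B[OF E(2)] that by (simp add: berry_random_wave_def)
        have "u \<bullet> X (E n) \<omega> = (\<Sum>i\<in>UNIV. u $ i * phi_tilde (E n) (\<lambda>x. B (E n) x \<omega>) (C i))"
          by (simp add: inner_vec_def X_def)
        also have "\<dots> = (\<Sum>i\<in>UNIV. \<Sum>k<length (C i). u $ i * (phi_scale (E n) * ?I n \<omega> (C i ! k)))"
          unfolding phi_tilde_segments[OF C sm] sum_distrib_left ..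
        also have "\<dots> = (\<Sum>i\<in>UNIV. \<Sum>k<length (C i). (phi_scale (E n) * u $ i) * ?I n \<omega> (C i ! k))"
          by (intro sum.cong refl) (simp only: mult_ac)
        also have "\<dots> = (\<Sum>a\<in>?A. (phi_scale (E n) * u $ fst a) * ?I n \<omega> (?S a))"
          by (subst sum.Sigma) (auto simp: split_def)
        finally show ?thesis .
      qed
      have "(\<lambda>n. \<integral>\<omega>. iexp (\<Sum>a\<in>?A. (phi_scale (E n) * u $ fst a) * ?I n \<omega> (?S a)) \<partial>M (E n))
        \<longlonglongrightarrow> complex_of_real (exp (- (\<Sum>i\<in>UNIV. \<Sum>j\<in>UNIV. u $ i * u $ j * signed_length (C i) (C j)) / 2))"
        unfolding signed_length_form[of "\<lambda>i. u $ i" C, symmetric]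
        by (rule berry_chf_limit[OF E B[OF E(2)] _ _ phi_scale_square[OF E(2)]])
          (auto intro: polygonal_chain_seg_length[OF C])
      moreover have "(\<integral>\<omega>. iexp (\<Sum>a\<in>?A. (phi_scale (E n) * u $ fst a) * ?I n \<omega> (?S a)) \<partial>M (E n)) = (\<integral>x. iexp (u \<bullet> x) \<partial>distr (M (E n)) borel (X (E n)))" for n
      proof -
        have "(\<integral>\<omega>. iexp (\<Sum>a\<in>?A. (phi_scale (E n) * u $ fst a) * ?I n \<omega> (?S a)) \<partial>M (E n)) = (\<integral>\<omega>. iexp (u \<bullet> X (E n) \<omega>) \<partial>M (E n))"
          by (intro Bochner_Integration.integral_cong refl) (simp only: form)
        also have "\<dots> = (\<integral>x. iexp (u \<bullet> x) \<partial>distr (M (E n)) borel (X (E n)))"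
          by (rule integral_distr[symmetric]) measurable
        finally show ?thesis .
      qed
      moreover have "(\<integral>x. iexp (u \<bullet> x) \<partial>N) = complex_of_real (exp (- (\<Sum>i\<in>UNIV. \<Sum>j\<in>UNIV. u $ i * u $ j * signed_length (C i) (C j)) / 2))"
        using N.chf[of UNIV "\<lambda>i. u $ i"] by (simp add: inner_vec_def)
      ultimately show "(\<lambda>n. \<integral>x. iexp (u \<bullet> x) \<partial>distr (M (E n)) borel (X (E n))) \<longlonglongrightarrow> (\<integral>x. iexp (u \<bullet> x) \<partial>N)"
        by (simp only:)
    qed simp_all
    have "(\<integral>x. f x \<partial>distr (M (E n)) borel (X (E n))) = (\<integral>\<omega>. f (X (E n) \<omega>) \<partial>M (E n))" for n
      by (rule integral_distr[OF Xn borel_measurable_continuous_onI[OF f(1)]])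
    with weak_convergence[OF f] show ?thesis by (simp only:)
  qed
  have "((\<lambda>E. \<integral>\<omega>. f (X E \<omega>) \<partial>M E) \<longlongrightarrow> (\<integral>x. f x \<partial>N)) at_top"
    if f: "continuous_on UNIV f" "bounded (range f)" for f :: "real^'d \<Rightarrow> real"
  proof (rule tendsto_at_topI_sequentially)
    fix E :: "nat \<Rightarrow> real" assume E: "filterlim E at_top sequentially"
    \<comment> \<open>The hypotheses speak of positive energies only. Raising the sequence to at
      least 1 makes every term admissible and changes only finitely many of them.\<close>
    define E' where "E' n = max (E n) 1" for n
    have "filterlim E' at_top sequentially"
      by (rule filterlim_at_top_mono[OF E]) (simp add: E'_def)
    then have "(\<lambda>n. \<integral>\<omega>. f (X (E' n) \<omega>) \<partial>M (E' n)) \<longlonglongrightarrow> (\<integral>x. f x \<partial>N)"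
      by (rule lim[OF _ _ f]) (simp add: E'_def)
    moreover have "\<forall>\<^sub>F n in sequentially. (\<integral>\<omega>. f (X (E' n) \<omega>) \<partial>M (E' n)) = (\<integral>\<omega>. f (X (E n) \<omega>) \<partial>M (E n))"
      using filterlim_at_top[THEN iffD1, OF E, rule_format, of 1] by eventually_elim (simp add: E'_def max_absorb1)
    ultimately show "(\<lambda>n. \<integral>\<omega>. f (X (E n) \<omega>) \<partial>M (E n)) \<longlonglongrightarrow> (\<integral>x. f x \<partial>N)"
      by (rule Lim_transform_eventually)
  qed
  moreover have "\<forall>\<^sub>F E in at_top. prob_space (M E) \<and> X E \<in> borel_measurable (M E)"
    by (rule eventually_mono[OF eventually_gt_at_top[of 0]]) (use prob Xm in auto)
  ultimately have "converges_in_distribution M X N at_top"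
    unfolding converges_in_distribution_def using N.prob_space_axioms sN by auto
  moreover have "(\<lambda>i j. (\<chi> i j. signed_length (C i) (C j)) $ i $ j) = (\<lambda>i j. signed_length (C i) (C j))"
    by (simp add: fun_eq_iff)
  then have "centered_gaussian_law (\<chi> i j. signed_length (C i) (C j)) N"
    unfolding centered_gaussian_law_def using sN N.centered_gaussian_family by (simp only: simp_thms)
  ultimately show ?thesis unfolding X_def by blast
qed

end
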